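(* Let $X$ be an $\alpha$-determinantal process on $\mathbb{R}^d$ with Hermitian kernel $K$ and background measure $\mu$ such that: (i) $K$ is a bounded symmetric integral operator on $L^2(\mu)$ which is locally trace class and positive semi-definite; (ii) $\alpha\in\{2/m: m\in\mathbb{N}_+\}\cup\{-1/m: m\in\mathbb{N}_+\}$, and if $\alpha<0$ then moreover $I+\alpha K$ is positive semi-definite, i.e. $\mathrm{Spec}(K)\subset[0,-1/\alpha]$; (iii) there is $C>0$ with $\mathbb{E}[X(B)]\le C\,\mathrm{Vol}(B)$ for every compact $B\subset\mathbb{R}^d$, where $X(B)$ is the number of points of $X$ in $B$. Let $\varphi:\mathbb{R}^d\to\mathbb{R}$ be a bounded, compactly supported (measurable) function, $\varphi_L(\cdot)=\varphi(\cdot/L)$ for $L>0$, and $\Lambda(\varphi_L)=\sum_{x\in X}\varphi_L(x)$. If $$\frac{\mathrm{Var}[\Lambda(\varphi_L)]^{1/2}}{\log L}\to\infty\quad\text{as }L\to\infty,$$ then $(\Lambda(\varphi_L)-\mathbb{E}[\Lambda(\varphi_L)])/\mathrm{Var}[\Lambda(\varphi_L)]^{1/2}$ converges in law to $N(0,1)$ as $L\to\infty$, and its Kolmogorov–Smirnov distance to $N(0,1)$ is $O\big(\log L\cdot \mathrm{Var}[\Lambda(\varphi_L)]^{-1/2}\big)$ as $L\to\infty$.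
   Context: For an $n\times n$ complex matrix $A$, $\mathrm{Det}_\alpha[A]=\sum_{\sigma\in S_n}\alpha^{n-\nu(\sigma)}\prod_{i=1}^nA_{i\sigma(i)}$, where $\nu(\sigma)$ is the number of cycles of $\sigma$. The $\alpha$-determinantal process with kernel $K:\mathbb{R}^d\times\mathbb{R}^d\to\mathbb{C}$ and background (non-negative Borel) measure $\mu$ is the random locally finite point set $X\subset\mathbb{R}^d$ whose $n$-point correlation functions with respect to $\mu^{\otimes n}$ are $\rho_n(x_1,\dots,x_n)=\mathrm{Det}_\alpha[(K(x_i,x_j))_{1\le i,j\le n}]$ for all $n\ge1$. The same letter $K$ denotes the integral operator $f\mapsto\int K(\cdot,y)f(y)\,d\mu(y)$ on $L^2(\mu)$. Locally trace class means that $\mathbf 1_BK\mathbf 1_B$ is trace class for every compact $B$; the kernel is normalized on the diagonal so that $\mathrm{Tr}[\mathbf 1_BK\mathbf 1_B]=\int_BK(x,x)\,d\mu(x)$. $\mathrm{Vol}$ is Lebesgue measure. The Kolmogorov–Smirnov distance is the supremum distance between cumulative distribution functions. *)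

theory Defs
  imports
    "HOL-Probability.Probability"
    "HOL-Combinatorics.Orbits"
    "HOL-Library.Landau_Symbols"
begin

section \<open>The alpha-determinant\<close>

definition num_cycles :: "nat \<Rightarrow> (nat \<Rightarrow> nat) \<Rightarrow> nat" where
  \<comment> \<open>Cycles are the orbits on \<open>{..<n}\<close>; fixed points count as cycles of length one.\<close>
  "num_cycles n \<sigma> = card (orbit \<sigma> ` {..<n})"

definition alpha_det :: "real \<Rightarrow> nat \<Rightarrow> (nat \<Rightarrow> nat \<Rightarrow> complex) \<Rightarrow> complex" where
  "alpha_det \<alpha> n A =
     (\<Sum>\<sigma> | \<sigma> permutes {..<n}.
        complex_of_real \<alpha> ^ (n - num_cycles n \<sigma>) * (\<Prod>i<n. A i (\<sigma> i)))"


section \<open>Operators on \<open>L\<^sup>2(\<mu>)\<close>\<close>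

text \<open>
  Elements of \<open>L\<^sup>2(\<mu>)\<close> are represented by square integrable functions, and operators by maps between
  such functions; equality of elements of \<open>L\<^sup>2(\<mu>)\<close> is equality \<open>\<mu>\<close>-almost everywhere.
\<close>

definition L2 :: "'a measure \<Rightarrow> ('a \<Rightarrow> complex) set" where
  "L2 \<mu> = {f \<in> borel_measurable \<mu>. integrable \<mu> (\<lambda>x. (cmod (f x))\<^sup>2)}"

definition l2_inner :: "'a measure \<Rightarrow> ('a \<Rightarrow> complex) \<Rightarrow> ('a \<Rightarrow> complex) \<Rightarrow> complex" where
  "l2_inner \<mu> f g = (LINT x|\<mu>. cnj (f x) * g x)"

definition l2_norm :: "'a measure \<Rightarrow> ('a \<Rightarrow> complex) \<Rightarrow> real" where
  "l2_norm \<mu> f = sqrt (LINT x|\<mu>. (cmod (f x))\<^sup>2)"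

text \<open>
  Linearity and boundedness together imply that almost everywhere equal functions have almost
  everywhere equal images.
\<close>

definition bounded_l2_operator ::
    "'a measure \<Rightarrow> (('a \<Rightarrow> complex) \<Rightarrow> ('a \<Rightarrow> complex)) \<Rightarrow> bool" where
  "bounded_l2_operator \<mu> T \<longleftrightarrow>
     (\<forall>f\<in>L2 \<mu>. T f \<in> L2 \<mu>) \<and>
     (\<forall>f\<in>L2 \<mu>. \<forall>g\<in>L2 \<mu>. \<forall>a b.
        AE x in \<mu>. T (\<lambda>y. a * f y + b * g y) x = a * T f x + b * T g x) \<and>
     (\<exists>c. \<forall>f\<in>L2 \<mu>. l2_norm \<mu> (T f) \<le> c * l2_norm \<mu> f)"

definition l2_adjoint ::
    "'a measure \<Rightarrow> (('a \<Rightarrow> complex) \<Rightarrow> ('a \<Rightarrow> complex)) \<Rightarrow> (('a \<Rightarrow> complex) \<Rightarrow> ('a \<Rightarrow> complex)) \<Rightarrow> bool" where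
  "l2_adjoint \<mu> T S \<longleftrightarrow>
     bounded_l2_operator \<mu> S \<and> (\<forall>f\<in>L2 \<mu>. \<forall>g\<in>L2 \<mu>. l2_inner \<mu> (T f) g = l2_inner \<mu> f (S g))"

definition l2_symmetric :: "'a measure \<Rightarrow> (('a \<Rightarrow> complex) \<Rightarrow> ('a \<Rightarrow> complex)) \<Rightarrow> bool" where
  "l2_symmetric \<mu> T \<longleftrightarrow> (\<forall>f\<in>L2 \<mu>. \<forall>g\<in>L2 \<mu>. l2_inner \<mu> (T f) g = l2_inner \<mu> f (T g))"

definition l2_psd :: "'a measure \<Rightarrow> (('a \<Rightarrow> complex) \<Rightarrow> ('a \<Rightarrow> complex)) \<Rightarrow> bool" where
  "l2_psd \<mu> T \<longleftrightarrow> (\<forall>f\<in>L2 \<mu>. l2_inner \<mu> f (T f) \<in> \<real>\<^sub>\<ge>\<^sub>0)"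

text \<open>\<open>P = |T|\<close>, the positive semi-definite square root of \<open>T\<^sup>*T\<close>.\<close>

definition l2_abs ::
    "'a measure \<Rightarrow> (('a \<Rightarrow> complex) \<Rightarrow> ('a \<Rightarrow> complex)) \<Rightarrow> (('a \<Rightarrow> complex) \<Rightarrow> ('a \<Rightarrow> complex)) \<Rightarrow> bool" where
  "l2_abs \<mu> T P \<longleftrightarrow>
     bounded_l2_operator \<mu> P \<and> l2_psd \<mu> P \<and>
     (\<exists>S. l2_adjoint \<mu> T S \<and> (\<forall>f\<in>L2 \<mu>. AE x in \<mu>. P (P f) x = S (T f) x))"

text \<open>
  For a \<open>\<sigma>\<close>-finite Borel measure on a Euclidean space, \<open>L\<^sup>2(\<mu>)\<close> is separable, so every orthonormal
  basis can be indexed by a (possibly finite) set \<open>I\<close> of natural numbers.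
\<close>

definition orthonormal_basis :: "'a measure \<Rightarrow> nat set \<Rightarrow> (nat \<Rightarrow> 'a \<Rightarrow> complex) \<Rightarrow> bool" where
  "orthonormal_basis \<mu> I e \<longleftrightarrow>
     (\<forall>i\<in>I. e i \<in> L2 \<mu>) \<and>
     (\<forall>i\<in>I. \<forall>j\<in>I. l2_inner \<mu> (e i) (e j) = (if i = j then 1 else 0)) \<and>
     (\<forall>f\<in>L2 \<mu>. (\<forall>i\<in>I. l2_inner \<mu> (e i) f = 0) \<longrightarrow> (AE x in \<mu>. f x = 0))"

definition trace_class :: "'a measure \<Rightarrow> (('a \<Rightarrow> complex) \<Rightarrow> ('a \<Rightarrow> complex)) \<Rightarrow> bool" where
  "trace_class \<mu> T \<longleftrightarrow>
     bounded_l2_operator \<mu> T \<and>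
     (\<exists>P I e. l2_abs \<mu> T P \<and> orthonormal_basis \<mu> I e \<and>
        (\<lambda>i. l2_inner \<mu> (e i) (P (e i))) summable_on I)"

definition has_trace :: "'a measure \<Rightarrow> (('a \<Rightarrow> complex) \<Rightarrow> ('a \<Rightarrow> complex)) \<Rightarrow> complex \<Rightarrow> bool" where
  "has_trace \<mu> T t \<longleftrightarrow>
     (\<forall>I e. orthonormal_basis \<mu> I e \<longrightarrow> ((\<lambda>i. l2_inner \<mu> (e i) (T (e i))) has_sum t) I)"


section \<open>Integral operators\<close>

definition integral_op ::
    "'a measure \<Rightarrow> ('a \<Rightarrow> 'a \<Rightarrow> complex) \<Rightarrow> ('a \<Rightarrow> complex) \<Rightarrow> ('a \<Rightarrow> complex)" where
  "integral_op \<mu> K f = (\<lambda>x. LINT y|\<mu>. K x y * f y)"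

text \<open>
  The almost everywhere integrability makes the defining integral genuine: the Bochner integral of a
  non-integrable function is zero by convention.
\<close>

definition bounded_integral_operator :: "'a measure \<Rightarrow> ('a \<Rightarrow> 'a \<Rightarrow> complex) \<Rightarrow> bool" where
  "bounded_integral_operator \<mu> K \<longleftrightarrow>
     (\<forall>f\<in>L2 \<mu>. AE x in \<mu>. integrable \<mu> (\<lambda>y. K x y * f y)) \<and>
     bounded_l2_operator \<mu> (integral_op \<mu> K)"

text \<open>The operator \<open>\<one>\<^sub>B T \<one>\<^sub>B\<close>.\<close>

definition compress ::
    "'a set \<Rightarrow> (('a \<Rightarrow> complex) \<Rightarrow> ('a \<Rightarrow> complex)) \<Rightarrow> ('a \<Rightarrow> complex) \<Rightarrow> ('a \<Rightarrow> complex)" where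
  "compress B T f = (\<lambda>x. indicator B x * T (\<lambda>y. indicator B y * f y) x)"

definition locally_trace_class ::
    "'a::topological_space measure \<Rightarrow> ('a \<Rightarrow> 'a \<Rightarrow> complex) \<Rightarrow> bool" where
  "locally_trace_class \<mu> K \<longleftrightarrow>
     (\<forall>B. compact B \<longrightarrow> trace_class \<mu> (compress B (integral_op \<mu> K)))"

definition diagonal_normalized ::
    "'a::topological_space measure \<Rightarrow> ('a \<Rightarrow> 'a \<Rightarrow> complex) \<Rightarrow> bool" where
  "diagonal_normalized \<mu> K \<longleftrightarrow>
     (\<forall>B. compact B \<longrightarrow>
        set_integrable \<mu> B (\<lambda>x. K x x) \<and>
        has_trace \<mu> (compress B (integral_op \<mu> K)) (LINT x:B|\<mu>. K x x))"


section \<open>Point processes\<close>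

definition point_process :: "'w measure \<Rightarrow> ('w \<Rightarrow> 'a::euclidean_space set) \<Rightarrow> bool" where
  "point_process M X \<longleftrightarrow>
     (\<forall>\<omega>\<in>space M. \<forall>B. compact B \<longrightarrow> finite (X \<omega> \<inter> B)) \<and>
     (\<forall>B\<in>sets borel. bounded B \<longrightarrow>
        (\<lambda>\<omega>. card (X \<omega> \<inter> B)) \<in> measurable M (count_space UNIV))"

text \<open>
  For every non-negative measurable test function \<open>f\<close>, the sum of \<open>f\<close> over the \<open>n\<close>-tuples of distinct
  points of the process has expectation \<open>\<integral> f \<rho> d\<mu>\<^sup>n\<close>. An \<open>n\<close>-tuple is an extensional function on \<open>{..<n}\<close>,
  and the inner integral against the counting measure is the sum over the tuples.
\<close>

definition has_correlation_function ::
    "'w measure \<Rightarrow> ('w \<Rightarrow> 'a::euclidean_space set) \<Rightarrow> 'a measure \<Rightarrow> nat \<Rightarrow> ((nat \<Rightarrow> 'a) \<Rightarrow> complex) \<Rightarrow> bool" where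
  "has_correlation_function M X \<mu> n \<rho> \<longleftrightarrow>
     \<rho> \<in> borel_measurable (\<Pi>\<^sub>M i\<in>{..<n}. \<mu>) \<and>
     (AE x in (\<Pi>\<^sub>M i\<in>{..<n}. \<mu>). \<rho> x \<in> \<real>\<^sub>\<ge>\<^sub>0) \<and>
     (\<forall>f :: (nat \<Rightarrow> 'a) \<Rightarrow> ennreal. f \<in> borel_measurable (\<Pi>\<^sub>M i\<in>{..<n}. \<mu>) \<longrightarrow>
        (\<integral>\<^sup>+\<omega>. (\<integral>\<^sup>+x. f x \<partial>count_space {x \<in> {..<n} \<rightarrow>\<^sub>E X \<omega>. inj_on x {..<n}}) \<partial>M)
          = (\<integral>\<^sup>+x. f x * ennreal (Re (\<rho> x)) \<partial>(\<Pi>\<^sub>M i\<in>{..<n}. \<mu>)))"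

definition alpha_determinantal_process ::
    "'w measure \<Rightarrow> ('w \<Rightarrow> 'a::euclidean_space set) \<Rightarrow> real \<Rightarrow> ('a \<Rightarrow> 'a \<Rightarrow> complex) \<Rightarrow> 'a measure \<Rightarrow> bool" where
  "alpha_determinantal_process M X \<alpha> K \<mu> \<longleftrightarrow>
     point_process M X \<and>
     (\<forall>n\<ge>1. has_correlation_function M X \<mu> n (\<lambda>x. alpha_det \<alpha> n (\<lambda>i j. K (x i) (x j))))"

text \<open>
  For \<open>g\<close> vanishing outside a compact set and a locally finite \<open>X \<omega>\<close>, only finitely many terms of the
  sum are nonzero.
\<close>

definition linear_statistic :: "('w \<Rightarrow> 'a set) \<Rightarrow> ('a \<Rightarrow> real) \<Rightarrow> 'w \<Rightarrow> real" where
  "linear_statistic X g \<omega> = (\<Sum>\<^sub>\<infinity>x\<in>X \<omega>. g x)"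

definition rescale :: "('a::real_vector \<Rightarrow> real) \<Rightarrow> real \<Rightarrow> 'a \<Rightarrow> real" where
  "rescale \<phi> L = (\<lambda>x. \<phi> (x /\<^sub>R L))"


section \<open>Comparison of distributions\<close>

definition standardized :: "'w measure \<Rightarrow> ('w \<Rightarrow> real) \<Rightarrow> 'w \<Rightarrow> real" where
  "standardized M Y =
     (\<lambda>\<omega>. (Y \<omega> - prob_space.expectation M Y) / sqrt (prob_space.variance M Y))"

text \<open>The notion \<^const>\<open>weak_conv_m\<close> along an arbitrary filter instead of a sequence.\<close>

definition converges_in_law :: "('i \<Rightarrow> real measure) \<Rightarrow> real measure \<Rightarrow> 'i filter \<Rightarrow> bool" where
  "converges_in_law N N' F \<longleftrightarrow>
     (\<forall>x. isCont (cdf N') x \<longrightarrow> ((\<lambda>i. cdf (N i) x) \<longlongrightarrow> cdf N' x) F)"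

definition ks_dist :: "real measure \<Rightarrow> real measure \<Rightarrow> real" where
  "ks_dist N N' = (SUP x. \<bar>cdf N x - cdf N' x\<bar>)"

end

theory Submission
  imports Defs
begin

text \<open>
  On a compact set \<open>S\<close> containing the support of \<open>\<phi>\<^sub>L\<close> the kernel factors almost everywhere as
  \<open>K x y = (\<Sum>p. s p x * cnj (s p y))\<close>, by Gram-Schmidt for the form of the compressed operator and the
  trace normalisation of the diagonal. The expansion of \<open>\<Lambda> * iexp (y * \<Lambda>)\<close> over tuples of points
  then becomes a limit of traces of finite matrices. For \<open>y\<close> below a constant that depends only on
  \<open>\<alpha>\<close>, the norm of \<open>K\<close> and the bound of \<open>\<phi>\<close>, positivity of \<open>I + \<alpha>K\<close> makes the logarithmic
  derivative of the characteristic function equal to \<open>\<i> * (m + \<i> * y * \<sigma>\<^sup>2)\<close> up to an error of order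
  \<open>y\<^sup>2 * \<sigma>\<^sup>2\<close>. A Gronwall argument compares the characteristic function of the standardised
  statistic with that of the normal law on \<open>\<bar>t\<bar> \<le> c * \<sigma>\<close>, and Esseen's smoothing inequality turns
  this into a Kolmogorov-Smirnov distance of order \<open>1 / \<sigma>\<close>.
\<close>

section \<open>Positive semi-definite forms\<close>

text \<open>The obstacle: each trace in the expansion is by itself of the order of the expected
  number of points in the support, and the variance may be far smaller. The cancellation is captured
  by writing the variance as a squared Hilbert-Schmidt norm, that of J^(1/2) \<phi> K^(1/2) with J =
  I + \<alpha> K (\<open>nJ\<close>). This norm obeys a product rule up to constants
  (\<open>nJ_mult\<close>), so replacing \<phi> by exp(i y \<phi>) - 1 costs only a factor of order
  y, and after regrouping every term beyond the mean is a pairing under J. Square roots of operators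
  and the spectral theorem are avoided by working with degenerate positive semi-definite forms and
  the vectors \<open>s p\<close>; all estimates concern the first N of these and are uniform in N.
  The characteristic function is never divided by: the series for its derivative is a controlled
  factor times the series for the function itself, and the resulting inequality is linear in it, so
  zeros do no harm. The restriction to small y comes from the Neumann series in \<alpha> K
  \<psi>.\<close>

lemma cnj_mult_self: "cnj z * z = complex_of_real ((cmod z)\<^sup>2)"
  by (metis complex_norm_square mult.commute)

text \<open>Vectors of norm zero are allowed: the same locale serves the \<open>L2\<close> inner
  product on functions, where null functions have norm zero, and the forms of the compressed
  operator and of I + \<alpha> K. The form is linear in its second argument.\<close>

locale psd_form =
  fixes V :: "('a \<Rightarrow> complex) set" and B :: "('a \<Rightarrow> complex) \<Rightarrow> ('a \<Rightarrow> complex) \<Rightarrow> complex"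
  assumes zero_mem: "(\<lambda>x. 0) \<in> V"
    and lin_mem: "f \<in> V \<Longrightarrow> g \<in> V \<Longrightarrow> (\<lambda>x. a * f x + b * g x) \<in> V"
    and lin_right: "f \<in> V \<Longrightarrow> g \<in> V \<Longrightarrow> h \<in> V \<Longrightarrow> B f (\<lambda>x. a * g x + b * h x) = a * B f g + b * B f h"
    and herm: "f \<in> V \<Longrightarrow> g \<in> V \<Longrightarrow> B g f = cnj (B f g)"
    and pos: "f \<in> V \<Longrightarrow> 0 \<le> Re (B f f)"
begin

definition q :: "('a \<Rightarrow> complex) \<Rightarrow> real" where "q f = Re (B f f)"

lemma q_nonneg: "f \<in> V \<Longrightarrow> 0 \<le> q f"
  by (simp add: q_def pos)

lemma B_self: "f \<in> V \<Longrightarrow> B f f = complex_of_real (q f)"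
  using herm[of f f] by (simp add: complex_eq_iff q_def)

lemma lin_left: "f \<in> V \<Longrightarrow> g \<in> V \<Longrightarrow> h \<in> V \<Longrightarrow>
    B (\<lambda>x. a * g x + b * h x) f = cnj a * B g f + cnj b * B h f"
  using herm[of f "\<lambda>x. a * g x + b * h x"] herm[of f g] herm[of f h]
  by (simp add: lin_mem lin_right)

lemma scale_mem: "f \<in> V \<Longrightarrow> (\<lambda>x. a * f x) \<in> V"
  using lin_mem[of f f a 0] by simp

lemma add_mem: "f \<in> V \<Longrightarrow> g \<in> V \<Longrightarrow> (\<lambda>x. f x + g x) \<in> V"
  using lin_mem[of f g 1 1] by simp

lemma diff_mem: "f \<in> V \<Longrightarrow> g \<in> V \<Longrightarrow> (\<lambda>x. f x - g x) \<in> V"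
  using lin_mem[of f g 1 "-1"] by simp

lemma B_zero_right: "f \<in> V \<Longrightarrow> B f (\<lambda>x. 0) = 0"
  using lin_right[of f f f 0 0] by simp

lemma B_zero_left: "f \<in> V \<Longrightarrow> B (\<lambda>x. 0) f = 0"
  using lin_left[of f f f 0 0] by simp

lemma B_scale_right: "f \<in> V \<Longrightarrow> g \<in> V \<Longrightarrow> B f (\<lambda>x. a * g x) = a * B f g"
  using lin_right[of f g g a 0] by simp

lemma B_scale_left: "f \<in> V \<Longrightarrow> g \<in> V \<Longrightarrow> B (\<lambda>x. a * g x) f = cnj a * B g f"
  using lin_left[of f g g a 0] by simp

lemma B_add_right: "f \<in> V \<Longrightarrow> g \<in> V \<Longrightarrow> h \<in> V \<Longrightarrow> B f (\<lambda>x. g x + h x) = B f g + B f h"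
  using lin_right[of f g h 1 1] by simp

lemma B_add_left: "f \<in> V \<Longrightarrow> g \<in> V \<Longrightarrow> h \<in> V \<Longrightarrow> B (\<lambda>x. g x + h x) f = B g f + B h f"
  using lin_left[of f g h 1 1] by simp

lemma B_diff_right: "f \<in> V \<Longrightarrow> g \<in> V \<Longrightarrow> h \<in> V \<Longrightarrow> B f (\<lambda>x. g x - h x) = B f g - B f h"
  using lin_right[of f g h 1 "-1"] by simp

lemma B_diff_left: "f \<in> V \<Longrightarrow> g \<in> V \<Longrightarrow> h \<in> V \<Longrightarrow> B (\<lambda>x. g x - h x) f = B g f - B h f"
  using lin_left[of f g h 1 "-1"] by simp

lemma sum_mem:
  assumes "\<And>i. i \<in> A \<Longrightarrow> u i \<in> V" shows "(\<lambda>x. \<Sum>i\<in>A. c i * u i x) \<in> V"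
  using assms
proof (induction A rule: infinite_finite_induct)
  case (insert i A)
  then show ?case using lin_mem[of "u i" "\<lambda>x. \<Sum>i\<in>A. c i * u i x" "c i" 1] by simp
qed (auto simp: zero_mem)

lemma B_sum_right:
  assumes "f \<in> V" "\<And>i. i \<in> A \<Longrightarrow> u i \<in> V"
  shows "B f (\<lambda>x. \<Sum>i\<in>A. c i * u i x) = (\<Sum>i\<in>A. c i * B f (u i))"
  using assms(2)
proof (induction A rule: infinite_finite_induct)
  case (insert i A)
  then show ?case
    using lin_right[of f "u i" "\<lambda>x. \<Sum>i\<in>A. c i * u i x" "c i" 1] assms(1) sum_mem[of A u c] by simp
qed (auto simp: B_zero_right assms(1))

lemma B_sum_left:
  assumes "f \<in> V" "\<And>i. i \<in> A \<Longrightarrow> u i \<in> V"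
  shows "B (\<lambda>x. \<Sum>i\<in>A. c i * u i x) f = (\<Sum>i\<in>A. cnj (c i) * B (u i) f)"
proof -
  have "B (\<lambda>x. \<Sum>i\<in>A. c i * u i x) f = cnj (B f (\<lambda>x. \<Sum>i\<in>A. c i * u i x))"
    by (rule herm) (use assms sum_mem in auto)
  also have "\<dots> = (\<Sum>i\<in>A. cnj (c i) * cnj (B f (u i)))"
    using B_sum_right[of f A u c] assms by simp
  also have "\<dots> = (\<Sum>i\<in>A. cnj (c i) * B (u i) f)"
    using assms herm[of f] by (intro sum.cong refl) simp
  finally show ?thesis .
qed

lemma q_scale: "f \<in> V \<Longrightarrow> q (\<lambda>x. a * f x) = (cmod a)\<^sup>2 * q f"
proof -
  assume f: "f \<in> V"
  have "complex_of_real (q (\<lambda>x. a * f x)) = (cnj a * a) * complex_of_real (q f)"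
    using f by (simp add: B_self[symmetric] scale_mem B_scale_left B_scale_right mult_ac)
  also have "cnj a * a = complex_of_real ((cmod a)\<^sup>2)"
    by (rule cnj_mult_self)
  finally show ?thesis by (metis of_real_eq_iff of_real_mult)
qed

lemma q_add: "f \<in> V \<Longrightarrow> g \<in> V \<Longrightarrow> q (\<lambda>x. f x + g x) = q f + q g + 2 * Re (B f g)"
  using herm[of f g] by (simp add: q_def B_add_left B_add_right add_mem)

lemma cauchy_schwarz_sq:
  assumes f: "f \<in> V" and g: "g \<in> V" shows "(cmod (B f g))\<^sup>2 \<le> q f * q g"
proof -
  define z where "z = B f g"
  have zz: "z * cnj z = complex_of_real ((cmod z)\<^sup>2)" by (metis complex_norm_square)
  \<comment> \<open>The multiple of \<open>f\<close> carries the phase of \<open>B f g\<close>, so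
    that the cross term is real. For \<open>q f = 0\<close> a large \<open>t\<close> violates the
    bound; otherwise \<open>t = 1 / q f\<close> is the minimiser.\<close>
  have key: "0 \<le> t\<^sup>2 * (cmod z)\<^sup>2 * q f + q g - 2 * t * (cmod z)\<^sup>2" for t :: real
  proof -
    define a where "a = - complex_of_real t * z"
    have "0 \<le> q (\<lambda>x. a * f x + g x)" using f g by (intro q_nonneg) (simp add: add_mem scale_mem)
    also have "\<dots> = (cmod a)\<^sup>2 * q f + q g + 2 * Re (cnj a * z)"
      using f g by (simp add: q_add scale_mem q_scale B_scale_left z_def)
    also have "cnj a * z = - (complex_of_real t * (z * cnj z))"
      by (simp add: a_def mult_ac)
    also have "\<dots> = - complex_of_real (t * (cmod z)\<^sup>2)"
      by (simp only: zz of_real_mult)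
    also have "(cmod a)\<^sup>2 = t\<^sup>2 * (cmod z)\<^sup>2"
      by (simp add: a_def norm_mult power_mult_distrib)
    finally show ?thesis by simp
  qed
  show ?thesis
  proof (cases "q f = 0")
    case True
    have "(cmod z)\<^sup>2 \<le> 0"
    proof (rule ccontr)
      assume *: "\<not> (cmod z)\<^sup>2 \<le> 0"
      with key[of "(q g + 1) / (2 * (cmod z)\<^sup>2)"] True show False by (auto simp: field_simps)
    qed
    then show ?thesis using True by (simp add: z_def)
  next
    case False
    then have p: "q f > 0" using q_nonneg[OF f] by simp
    show ?thesis using key[of "1 / q f"] p
      by (simp add: z_def field_simps power2_eq_square)
  qed
qed

lemma cauchy_schwarz:
  assumes f: "f \<in> V" and g: "g \<in> V" shows "cmod (B f g) \<le> sqrt (q f) * sqrt (q g)"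
  using real_le_rsqrt[OF cauchy_schwarz_sq[OF assms]] by (simp add: real_sqrt_mult)

lemma B_null: "f \<in> V \<Longrightarrow> g \<in> V \<Longrightarrow> q g = 0 \<Longrightarrow> B f g = 0"
  using cauchy_schwarz[of f g] by simp

text \<open>Cauchy-Schwarz for a direct sum of copies of the form; the square root of the sum of the
  \<open>q\<close> values plays the role of a Hilbert-Schmidt norm of the family.\<close>

lemma sum_B_le:
  assumes "\<And>l. l \<in> A \<Longrightarrow> u l \<in> V" "\<And>l. l \<in> A \<Longrightarrow> w l \<in> V"
  shows "cmod (\<Sum>l\<in>A. B (u l) (w l)) \<le> sqrt (\<Sum>l\<in>A. q (u l)) * sqrt (\<Sum>l\<in>A. q (w l))"
proof -
  have "cmod (\<Sum>l\<in>A. B (u l) (w l)) \<le> (\<Sum>l\<in>A. \<bar>sqrt (q (u l))\<bar> * \<bar>sqrt (q (w l))\<bar>)"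
    using assms by (intro sum_norm_le) (use cauchy_schwarz q_nonneg in \<open>simp\<close>)
  also have "\<dots> \<le> L2_set (\<lambda>l. sqrt (q (u l))) A * L2_set (\<lambda>l. sqrt (q (w l))) A"
    by (rule L2_set_mult_ineq)
  also have "\<dots> = sqrt (\<Sum>l\<in>A. q (u l)) * sqrt (\<Sum>l\<in>A. q (w l))"
    using assms q_nonneg by (simp add: L2_set_def cong: sum.cong)
  finally show ?thesis .
qed

lemma sum_q_triangle:
  assumes "\<And>l. l \<in> A \<Longrightarrow> u l \<in> V" "\<And>l. l \<in> A \<Longrightarrow> w l \<in> V"
  shows "sqrt (\<Sum>l\<in>A. q (\<lambda>x. u l x + w l x)) \<le> sqrt (\<Sum>l\<in>A. q (u l)) + sqrt (\<Sum>l\<in>A. q (w l))"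
proof (rule real_le_lsqrt)
  have n: "0 \<le> (\<Sum>l\<in>A. q (u l))" "0 \<le> (\<Sum>l\<in>A. q (w l))"
    using assms by (auto intro!: sum_nonneg q_nonneg)
  have "(\<Sum>l\<in>A. q (\<lambda>x. u l x + w l x)) = (\<Sum>l\<in>A. q (u l)) + (\<Sum>l\<in>A. q (w l)) + 2 * Re (\<Sum>l\<in>A. B (u l) (w l))"
    using assms by (simp add: q_add sum.distrib sum_distrib_left cong: sum.cong)
  also have "Re (\<Sum>l\<in>A. B (u l) (w l)) \<le> sqrt (\<Sum>l\<in>A. q (u l)) * sqrt (\<Sum>l\<in>A. q (w l))"
    by (rule order_trans[OF complex_Re_le_cmod sum_B_le[OF assms]])
  finally show "(\<Sum>l\<in>A. q (\<lambda>x. u l x + w l x)) \<le> (sqrt (\<Sum>l\<in>A. q (u l)) + sqrt (\<Sum>l\<in>A. q (w l)))\<^sup>2"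
    using n by (simp add: power2_sum)
  show "0 \<le> sqrt (\<Sum>l\<in>A. q (u l)) + sqrt (\<Sum>l\<in>A. q (w l))" using n by simp
qed

end

text \<open>Symmetric Gaussian elimination, one vector at a time.\<close>

lemma (in psd_form) gram_cholesky:
  assumes "\<And>m. m < (N::nat) \<Longrightarrow> u m \<in> V"
  obtains C :: "nat \<Rightarrow> nat \<Rightarrow> complex" where
    "\<And>l m. l < N \<Longrightarrow> m < N \<Longrightarrow> B (u l) (u m) = (\<Sum>p<N. cnj (C p l) * C p m)"
proof -
  have "\<exists>C. \<forall>l<N. \<forall>m<N. B (u l) (u m) = (\<Sum>p<N. cnj (C p l) * (C p m :: complex))" using assms
  proof (induction N arbitrary: u)
    case 0
    then show ?case by simp
  next
    case (Suc N)
    define z where "z = u N"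
    \<comment> \<open>A pseudo-inverse of \<open>q z\<close>: a null pivot contributes nothing, and
      by \<open>B_null\<close> its whole row vanishes, which is what \<open>lastq\<close>
      records.\<close>
    define r where "r = (if q z = 0 then 0 else complex_of_real (1 / q z))"
    define w where "w m = (\<lambda>x. u m x - (r * B z (u m)) * z x)" for m
    have z: "z \<in> V" using Suc.prems by (simp add: z_def)
    have u: "m < N \<Longrightarrow> u m \<in> V" for m using Suc.prems by simp
    have w: "w m \<in> V" if "m < N" for m
      unfolding w_def by (intro diff_mem scale_mem z u that)
    obtain C where C: "\<And>l m. l < N \<Longrightarrow> m < N \<Longrightarrow> B (w l) (w m) = (\<Sum>p<N. cnj (C p l) * C p m)"
      using Suc.IH[of w] w by blast
    have rr: "cnj r = r" by (simp add: r_def)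
    have rq: "r * complex_of_real (q z) * r = r" by (simp add: r_def)
    define s where "s = (if q z = 0 then 0 else complex_of_real (1 / sqrt (q z)))"
    have ss: "cnj s * s = r" using q_nonneg[OF z]
      by (simp add: s_def r_def flip: of_real_mult)
    define C' where "C' p m = (if p = N then s * B z (u m) else if m = N then 0 else C p m)" for p m
    have old: "B (u l) (u m) = (\<Sum>p<Suc N. cnj (C' p l) * C' p m)" if lm: "l < N" "m < N" for l m
    proof -
      have "B (w l) (w m) = B (u l) (u m) - r * B z (u m) * B (u l) z - r * cnj (B z (u l)) * B z (u m)
           + (r * complex_of_real (q z) * r) * cnj (B z (u l)) * B z (u m)"
      proof -
        have "B (w l) (w m) = B (u l) (w m) - cnj (r * B z (u l)) * B z (w m)"
          using lm z w[of m] u unfolding w_def[of l] by (simp add: B_diff_left B_scale_left scale_mem)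
        moreover have "B v (w m) = B v (u m) - r * B z (u m) * B v z" if "v \<in> V" for v
          using lm z u that unfolding w_def[of m] by (simp add: B_diff_right B_scale_right scale_mem)
        ultimately show ?thesis
          using lm z u by (simp add: B_self rr ring_distribs mult_ac)
      qed
      also have "B (u l) z = cnj (B z (u l))" by (rule herm) (use z u lm in auto)
      finally have "B (u l) (u m) = B (w l) (w m) + (cnj s * s) * cnj (B z (u l)) * B z (u m)"
        by (simp only: rq ss) (simp add: algebra_simps)
      also have "B (w l) (w m) = (\<Sum>p<N. cnj (C' p l) * C' p m)"
        using lm by (simp add: C C'_def)
      also have "(cnj s * s) * cnj (B z (u l)) * B z (u m) = cnj (C' N l) * C' N m"
        by (simp add: C'_def)
      finally show ?thesis by simp
    qed
    have lastq: "B z (u m) = r * complex_of_real (q z) * B z (u m)" if "m \<le> N" for m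
    proof (cases "q z = 0")
      case True
      then have "B (u m) z = 0" using B_null[of "u m" z] z Suc.prems that by auto
      then have "B z (u m) = 0" using herm[of "u m" z] z Suc.prems that by auto
      then show ?thesis by simp
    qed (simp add: r_def)
    have mN: "B (u N) (u m) = (\<Sum>p<Suc N. cnj (C' p N) * C' p m)" if "m \<le> N" for m
    proof -
      have "(\<Sum>p<Suc N. cnj (C' p N) * C' p m) = cnj (s * B z z) * (s * B z (u m))"
        by (simp add: C'_def z_def)
      also have "\<dots> = (cnj s * s) * complex_of_real (q z) * B z (u m)"
        by (simp add: B_self z mult_ac)
      finally show ?thesis using lastq[OF that] by (simp add: ss z_def)
    qed
    have Nm: "B (u m) (u N) = (\<Sum>p<Suc N. cnj (C' p m) * C' p N)" if "m \<le> N" for m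
    proof -
      have "B (u m) (u N) = cnj (B (u N) (u m))" using Suc.prems that by (intro herm) auto
      then show ?thesis using mN[OF that] by (simp add: mult_ac)
    qed
    have "B (u l) (u m) = (\<Sum>p<Suc N. cnj (C' p l) * C' p m)" if "l < Suc N" "m < Suc N" for l m
      using that old[of l m] mN[of m] Nm[of l] by (cases "l = N"; cases "m = N") auto
    then show ?case by blast
  qed
  then show ?thesis using that by blast
qed

section \<open>Operator norms of finite matrices\<close>

definition form_bound :: "nat \<Rightarrow> real \<Rightarrow> (nat \<Rightarrow> nat \<Rightarrow> complex) \<Rightarrow> bool" where
  "form_bound N g H \<longleftrightarrow> 0 \<le> g \<and> (\<forall>a b. cmod (\<Sum>m<N. \<Sum>l<N. a m * H m l * b l) \<le>
     g * sqrt (\<Sum>m<N. (cmod (a m))\<^sup>2) * sqrt (\<Sum>l<N. (cmod (b l))\<^sup>2))"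

text \<open>Testing the bilinear bound on the conjugate of the row \<open>a H\<close> turns it into
  a bound on the length of that row. \<open>form_bound\<close> itself carries no conjugation, so
  that it is also stable under transposition.\<close>

lemma form_bound_row:
  assumes "form_bound N g H"
  shows "(\<Sum>l<N. (cmod (\<Sum>m<N. a m * H m l))\<^sup>2) \<le> g\<^sup>2 * (\<Sum>m<N. (cmod (a m))\<^sup>2)"
proof -
  define b where "b l = cnj (\<Sum>m<N. a m * H m l)" for l
  define S where "S = (\<Sum>l<N. (cmod (b l))\<^sup>2)"
  have S0: "0 \<le> S" by (simp add: S_def sum_nonneg)
  have "(\<Sum>m<N. \<Sum>l<N. a m * H m l * b l) = (\<Sum>l<N. cnj (b l) * b l)"
    by (subst sum.swap) (simp add: b_def sum_distrib_right)
  also have "\<dots> = complex_of_real S"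
    unfolding S_def of_real_sum by (rule sum.cong[OF refl], rule cnj_mult_self)
  finally have "cmod (\<Sum>m<N. \<Sum>l<N. a m * H m l * b l) = S"
    using S0 by simp
  moreover have "cmod (\<Sum>m<N. \<Sum>l<N. a m * H m l * b l) \<le> g * sqrt (\<Sum>m<N. (cmod (a m))\<^sup>2) * sqrt S"
    using assms unfolding form_bound_def S_def by blast
  ultimately have "S \<le> g * sqrt (\<Sum>m<N. (cmod (a m))\<^sup>2) * sqrt S" by simp
  then have "sqrt S * sqrt S \<le> g * sqrt (\<Sum>m<N. (cmod (a m))\<^sup>2) * sqrt S" using S0 by simp
  then have "sqrt S \<le> g * sqrt (\<Sum>m<N. (cmod (a m))\<^sup>2)"
  proof (cases "S = 0")
    case True
    then show ?thesis using assms by (simp add: form_bound_def sum_nonneg)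
  next
    case False
    then have "0 < sqrt S" using S0 by simp
    with \<open>sqrt S * sqrt S \<le> _\<close> show ?thesis by (simp only: mult_le_cancel_right_pos)
  qed
  then have "(sqrt S)\<^sup>2 \<le> (g * sqrt (\<Sum>m<N. (cmod (a m))\<^sup>2))\<^sup>2" using S0 by (intro power_mono) auto
  moreover have "S = (\<Sum>l<N. (cmod (\<Sum>m<N. a m * H m l))\<^sup>2)"
    unfolding S_def b_def complex_mod_cnj ..
  ultimately show ?thesis using S0 by (simp add: power_mult_distrib sum_nonneg)
qed

lemma form_bound_mult:
  assumes "form_bound N g G" "form_bound N h H"
  shows "form_bound N (g * h) (\<lambda>i j. \<Sum>k<N. G i k * H k j)"
  unfolding form_bound_def
proof (intro conjI allI)
  show "0 \<le> g * h" using assms by (simp add: form_bound_def)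
  fix a b :: "nat \<Rightarrow> complex"
  define c where "c k = (\<Sum>m<N. a m * G m k)" for k
  have "(\<Sum>m<N. \<Sum>l<N. a m * (\<Sum>k<N. G m k * H k l) * b l) = (\<Sum>m<N. \<Sum>l<N. \<Sum>k<N. a m * G m k * H k l * b l)"
    by (simp add: sum_distrib_left sum_distrib_right mult_ac)
  also have "\<dots> = (\<Sum>m<N. \<Sum>k<N. \<Sum>l<N. a m * G m k * H k l * b l)"
    by (rule sum.cong[OF refl], rule sum.swap)
  also have "\<dots> = (\<Sum>k<N. \<Sum>m<N. \<Sum>l<N. a m * G m k * H k l * b l)"
    by (rule sum.swap)
  also have "\<dots> = (\<Sum>k<N. \<Sum>l<N. \<Sum>m<N. a m * G m k * H k l * b l)"
    by (rule sum.cong[OF refl], rule sum.swap)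
  also have "\<dots> = (\<Sum>k<N. \<Sum>l<N. c k * H k l * b l)"
    by (simp only: c_def sum_distrib_right)
  finally have "cmod (\<Sum>m<N. \<Sum>l<N. a m * (\<Sum>k<N. G m k * H k l) * b l)
      \<le> h * sqrt (\<Sum>k<N. (cmod (c k))\<^sup>2) * sqrt (\<Sum>l<N. (cmod (b l))\<^sup>2)"
    using assms(2) by (simp add: form_bound_def)
  also have "\<dots> \<le> h * sqrt (g\<^sup>2 * (\<Sum>m<N. (cmod (a m))\<^sup>2)) * sqrt (\<Sum>l<N. (cmod (b l))\<^sup>2)"
    using assms(2) form_bound_row[OF assms(1), of a]
    by (intro mult_right_mono mult_left_mono) (auto simp: c_def form_bound_def sum_nonneg)
  also have "\<dots> = g * h * sqrt (\<Sum>m<N. (cmod (a m))\<^sup>2) * sqrt (\<Sum>l<N. (cmod (b l))\<^sup>2)"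
    using assms(1) by (simp add: real_sqrt_mult form_bound_def)
  finally show "cmod (\<Sum>m<N. \<Sum>l<N. a m * (\<Sum>k<N. G m k * H k l) * b l)
     \<le> g * h * sqrt (\<Sum>m<N. (cmod (a m))\<^sup>2) * sqrt (\<Sum>l<N. (cmod (b l))\<^sup>2)" .
qed

text \<open>Ideal property of the Hilbert-Schmidt norm. With a Cholesky factor \<open>C\<close> of
  the Gram matrix both sides become squared Frobenius norms, of \<open>C H\<close> and of
  \<open>C\<close>, and the row bound applies to each row of \<open>C\<close>.\<close>

lemma (in psd_form) sum_q_matrix:
  assumes u: "\<And>m. m < N \<Longrightarrow> u m \<in> V" and H: "form_bound N g H"
  shows "(\<Sum>l<N. q (\<lambda>x. \<Sum>m<N. H m l * u m x)) \<le> g\<^sup>2 * (\<Sum>m<N. q (u m))"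
proof -
  obtain C where C: "\<And>l m. l < N \<Longrightarrow> m < N \<Longrightarrow> B (u l) (u m) = (\<Sum>p<N. cnj (C p l) * C p m)"
    using gram_cholesky u by blast
  have qC: "q (\<lambda>x. \<Sum>m<N. h m * u m x) = (\<Sum>p<N. (cmod (\<Sum>m<N. C p m * h m))\<^sup>2)" for h
  proof -
    have "complex_of_real (q (\<lambda>x. \<Sum>m<N. h m * u m x)) = (\<Sum>m<N. cnj (h m) * (\<Sum>k<N. h k * B (u m) (u k)))"
    proof -
      let ?v = "\<lambda>x. \<Sum>m<N. h m * u m x"
      have v: "?v \<in> V" by (intro sum_mem) (simp add: u)
      have "complex_of_real (q ?v) = (\<Sum>m<N. cnj (h m) * B (u m) ?v)"
        unfolding B_self[OF v, symmetric] by (rule B_sum_left[OF v]) (simp add: u)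
      also have "\<dots> = (\<Sum>m<N. cnj (h m) * (\<Sum>k<N. h k * B (u m) (u k)))"
        by (intro sum.cong refl arg_cong2[where f="(*)"] B_sum_right) (auto simp: u)
      finally show ?thesis .
    qed
    also have "\<dots> = (\<Sum>m<N. \<Sum>k<N. \<Sum>p<N. cnj (C p m * h m) * (C p k * h k))"
      by (intro sum.cong refl) (simp add: C sum_distrib_left mult_ac)
    also have "\<dots> = (\<Sum>m<N. \<Sum>p<N. \<Sum>k<N. cnj (C p m * h m) * (C p k * h k))"
      by (rule sum.cong[OF refl], rule sum.swap)
    also have "\<dots> = (\<Sum>p<N. \<Sum>m<N. \<Sum>k<N. cnj (C p m * h m) * (C p k * h k))"
      by (rule sum.swap)
    also have "\<dots> = (\<Sum>p<N. cnj (\<Sum>m<N. C p m * h m) * (\<Sum>k<N. C p k * h k))"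
      by (simp add: sum_product)
    also have "\<dots> = complex_of_real (\<Sum>p<N. (cmod (\<Sum>m<N. C p m * h m))\<^sup>2)"
      unfolding of_real_sum by (rule sum.cong[OF refl], rule cnj_mult_self)
    finally show ?thesis unfolding of_real_eq_iff .
  qed
  have qu: "q (u m) = (\<Sum>p<N. (cmod (C p m))\<^sup>2)" if "m < N" for m
  proof -
    have "complex_of_real (q (u m)) = complex_of_real (\<Sum>p<N. (cmod (C p m))\<^sup>2)"
      using that unfolding of_real_sum
      by (subst B_self[symmetric, OF u[OF that]], subst C[OF that that]) 
         (rule sum.cong[OF refl], rule cnj_mult_self)
    then show ?thesis unfolding of_real_eq_iff .
  qed
  have "(\<Sum>l<N. q (\<lambda>x. \<Sum>m<N. H m l * u m x)) = (\<Sum>p<N. \<Sum>l<N. (cmod (\<Sum>m<N. C p m * H m l))\<^sup>2)"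
    by (simp add: qC) (rule sum.swap)
  also have "\<dots> \<le> (\<Sum>p<N. g\<^sup>2 * (\<Sum>m<N. (cmod (C p m))\<^sup>2))"
    by (intro sum_mono form_bound_row H)
  also have "\<dots> = g\<^sup>2 * (\<Sum>m<N. \<Sum>p<N. (cmod (C p m))\<^sup>2)"
    unfolding sum_distrib_left[symmetric] by (subst sum.swap) (rule refl)
  also have "\<dots> = g\<^sup>2 * (\<Sum>m<N. q (u m))"
    by (simp add: qu)
  finally show ?thesis .
qed

text \<open>A trace of two Hilbert-Schmidt families with a bounded matrix in between: the matrix is
  absorbed into the second family before Cauchy-Schwarz, so no dimension factor appears.\<close>

lemma (in psd_form) sum_B_matrix:
  assumes u: "\<And>m. m < N \<Longrightarrow> u m \<in> V" and w: "\<And>m. m < N \<Longrightarrow> w m \<in> V" and H: "form_bound N g H"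
  shows "cmod (\<Sum>l<N. \<Sum>m<N. B (u l) (w m) * H m l) \<le> g * sqrt (\<Sum>l<N. q (u l)) * sqrt (\<Sum>l<N. q (w l))"
proof -
  have g: "0 \<le> g" using H by (simp add: form_bound_def)
  have "(\<Sum>l<N. \<Sum>m<N. B (u l) (w m) * H m l) = (\<Sum>l<N. B (u l) (\<lambda>x. \<Sum>m<N. H m l * w m x))"
  proof (intro sum.cong refl)
    fix l assume "l \<in> {..<N}"
    then show "(\<Sum>m<N. B (u l) (w m) * H m l) = B (u l) (\<lambda>x. \<Sum>m<N. H m l * w m x)"
      by (subst B_sum_right) (auto simp: u w mult.commute)
  qed
  also have "cmod \<dots> \<le> sqrt (\<Sum>l<N. q (u l)) * sqrt (\<Sum>l<N. q (\<lambda>x. \<Sum>m<N. H m l * w m x))"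
    using u w by (intro sum_B_le sum_mem) auto
  also have "\<dots> \<le> sqrt (\<Sum>l<N. q (u l)) * sqrt (g\<^sup>2 * (\<Sum>l<N. q (w l)))"
    using u w sum_q_matrix[OF w H] by (intro mult_left_mono) (auto intro!: sum_nonneg q_nonneg)
  finally show ?thesis using g by (simp add: real_sqrt_mult mult_ac)
qed

section \<open>Square integrable functions\<close>

lemma L2D: "f \<in> L2 M \<Longrightarrow> f \<in> borel_measurable M" "f \<in> L2 M \<Longrightarrow> integrable M (\<lambda>x. (cmod (f x))\<^sup>2)"
  by (auto simp: L2_def)

lemma measurable_cnj[measurable]: "cnj \<in> borel_measurable borel"
  by (intro borel_measurable_continuous_onI continuous_intros)

lemma norm_mult_le_squares: "cmod a * cmod b \<le> (cmod a)\<^sup>2 + (cmod b)\<^sup>2"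
proof -
  have "0 \<le> (cmod a - cmod b)\<^sup>2" "0 \<le> cmod a * cmod b" by auto
  then show ?thesis unfolding power2_diff by linarith
qed

lemma L2_mult_integrable:
  assumes "f \<in> L2 M" "g \<in> L2 M"
  shows "integrable M (\<lambda>x. cnj (f x) * g x)" "integrable M (\<lambda>x. f x * g x)"
    "integrable M (\<lambda>x. cmod (f x) * cmod (g x))"
proof -
  note [measurable] = L2D(1)[OF assms(1)] L2D(1)[OF assms(2)]
  have i: "integrable M (\<lambda>x. (cmod (f x))\<^sup>2 + (cmod (g x))\<^sup>2)"
    using assms by (intro Bochner_Integration.integrable_add L2D)
  show "integrable M (\<lambda>x. cnj (f x) * g x)"
    by (rule Bochner_Integration.integrable_bound[OF i]) (auto simp: norm_mult norm_mult_le_squares)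
  show "integrable M (\<lambda>x. f x * g x)"
    by (rule Bochner_Integration.integrable_bound[OF i]) (auto simp: norm_mult norm_mult_le_squares)
  show "integrable M (\<lambda>x. cmod (f x) * cmod (g x))"
    by (rule Bochner_Integration.integrable_bound[OF i]) (auto simp: norm_mult_le_squares)
qed

lemma L2_lin:
  assumes "f \<in> L2 M" "g \<in> L2 M" shows "(\<lambda>x. a * f x + b * g x) \<in> L2 M"
proof -
  note [measurable] = L2D(1)[OF assms(1)] L2D(1)[OF assms(2)]
  have i: "integrable M (\<lambda>x. 2 * (cmod a)\<^sup>2 * (cmod (f x))\<^sup>2 + 2 * (cmod b)\<^sup>2 * (cmod (g x))\<^sup>2)"
    using assms by (intro Bochner_Integration.integrable_add integrable_mult_right L2D)
  have "(cmod (a * f x + b * g x))\<^sup>2 \<le> 2 * (cmod a)\<^sup>2 * (cmod (f x))\<^sup>2 + 2 * (cmod b)\<^sup>2 * (cmod (g x))\<^sup>2" for x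
  proof -
    have "(cmod (a * f x + b * g x))\<^sup>2 \<le> (cmod a * cmod (f x) + cmod b * cmod (g x))\<^sup>2"
      by (intro power_mono) (metis norm_mult norm_triangle_ineq, simp)
    also have "\<dots> \<le> 2 * (cmod a * cmod (f x))\<^sup>2 + 2 * (cmod b * cmod (g x))\<^sup>2"
      using sum_squares_ge_zero[of "cmod a * cmod (f x) - cmod b * cmod (g x)" 0]
      by (simp add: power2_eq_square algebra_simps)
    finally show ?thesis by (simp add: power_mult_distrib)
  qed
  then have "integrable M (\<lambda>x. (cmod (a * f x + b * g x))\<^sup>2)"
    by (intro Bochner_Integration.integrable_bound[OF i]) auto
  then show ?thesis by (simp add: L2_def)
qed

lemma L2_zero: "(\<lambda>x. 0) \<in> L2 M"
  by (simp add: L2_def)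

interpretation l2: psd_form "L2 M" "l2_inner M" for M
proof
  fix f g h :: "'a \<Rightarrow> complex" and a b
  assume *: "f \<in> L2 M" "g \<in> L2 M"
  show "l2_inner M g f = cnj (l2_inner M f g)"
    unfolding l2_inner_def Bochner_Integration.integral_cnj[symmetric] by (simp add: mult.commute)
  assume "h \<in> L2 M"
  note ** = L2_mult_integrable(1)[OF *] L2_mult_integrable(1)[OF *(1) this]
  have "l2_inner M f (\<lambda>x. a * g x + b * h x) = (LINT x|M. a * (cnj (f x) * g x) + b * (cnj (f x) * h x))"
    by (simp add: l2_inner_def algebra_simps)
  also have "\<dots> = a * l2_inner M f g + b * l2_inner M f h"
    using ** by (simp add: l2_inner_def)
  finally show "l2_inner M f (\<lambda>x. a * g x + b * h x) = a * l2_inner M f g + b * l2_inner M f h" .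
next
  fix f :: "'a \<Rightarrow> complex" 
  have "l2_inner M f f = complex_of_real (LINT x|M. (cmod (f x))\<^sup>2)"
    unfolding l2_inner_def cnj_mult_self by (rule integral_complex_of_real)
  then show "0 \<le> Re (l2_inner M f f)" by simp
qed (auto simp: L2_zero L2_lin)

lemma l2_q: "l2.q M f = (LINT x|M. (cmod (f x))\<^sup>2)"
proof -
  have "l2_inner M f f = complex_of_real (LINT x|M. (cmod (f x))\<^sup>2)"
    unfolding l2_inner_def cnj_mult_self by (rule integral_complex_of_real)
  then show ?thesis by (simp add: l2.q_def)
qed

lemma l2_norm_eq: "l2_norm M f = sqrt (l2.q M f)"
  by (simp add: l2_norm_def l2_q)

lemma L2_bounded_mult:
  assumes f: "f \<in> L2 M" and h[measurable]: "h \<in> borel_measurable M" and c: "\<And>x. x \<in> space M \<Longrightarrow> cmod (h x) \<le> c"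
  shows "(\<lambda>x. h x * f x) \<in> L2 M" "l2.q M (\<lambda>x. h x * f x) \<le> c\<^sup>2 * l2.q M f"
proof -
  note [measurable] = L2D(1)[OF f]
  have i: "integrable M (\<lambda>x. c\<^sup>2 * (cmod (f x))\<^sup>2)" using L2D(2)[OF f] by simp
  have le: "(cmod (h x * f x))\<^sup>2 \<le> c\<^sup>2 * (cmod (f x))\<^sup>2" if "x \<in> space M" for x
    using c[OF that] unfolding norm_mult power_mult_distrib by (intro mult_right_mono power_mono) auto
  have i2: "integrable M (\<lambda>x. (cmod (h x * f x))\<^sup>2)"
    by (rule Bochner_Integration.integrable_bound[OF i]) (use le in \<open>auto intro!: AE_I2\<close>)
  then show "(\<lambda>x. h x * f x) \<in> L2 M" by (simp add: L2_def)
  show "l2.q M (\<lambda>x. h x * f x) \<le> c\<^sup>2 * l2.q M f"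
    unfolding l2_q by (subst integral_mult_right_zero[symmetric]) (intro integral_mono i i2 le)
qed

text \<open>The measure may be infinite, so \<open>L2\<close> bounds give no bounds on integrals of
  the moduli. The weights \<open>2^k\<close> keep the sum of the squares integrable, and a modulus t
  satisfies t \<le> (1/2)^k + 2^k t^2.\<close>

lemma L2_norm_summable_AE:
  assumes D: "\<And>k. D k \<in> L2 M" and b: "\<And>k. l2.q M (D k) \<le> (1/4)^k"
  shows "AE x in M. summable (\<lambda>k. D k x)"
proof -
  note [measurable] = L2D(1)[OF D]
  have "(\<integral>\<^sup>+x. (\<Sum>k. ennreal (2^k * (cmod (D k x))\<^sup>2)) \<partial>M) = (\<Sum>k. \<integral>\<^sup>+x. ennreal (2^k * (cmod (D k x))\<^sup>2) \<partial>M)"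
    by (rule nn_integral_suminf) auto
  also have "\<dots> = (\<Sum>k. ennreal (2^k * l2.q M (D k)))"
    using L2D(2)[OF D] by (simp add: nn_integral_eq_integral l2_q)
  also have "\<dots> \<le> (\<Sum>k. ennreal ((1/2)^k))"
  proof (intro suminf_le ennreal_leI)
    fix k
    have "2^k * l2.q M (D k) \<le> 2^k * (1/4)^k" by (intro mult_left_mono b) auto
    then show "2^k * l2.q M (D k) \<le> (1/2)^k" by (simp add: power_mult_distrib[symmetric])
  qed auto
  also have "\<dots> < \<infinity>"
    by (subst suminf_ennreal2) (auto intro!: summable_geometric)
  finally have "AE x in M. (\<Sum>k. ennreal (2^k * (cmod (D k x))\<^sup>2)) \<noteq> \<infinity>"
    by (intro nn_integral_PInf_AE) auto
  then show ?thesis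
  proof eventually_elim
    case (elim x)
    have s: "summable (\<lambda>k. 2^k * (cmod (D k x))\<^sup>2)"
      using elim by (intro summable_suminf_not_top) auto
    have "summable (\<lambda>k. (1/2)^k + 2^k * (cmod (D k x))\<^sup>2)"
      by (intro summable_add s summable_geometric) auto
    then show ?case
    proof (rule summable_comparison_test_ev[rotated], intro always_eventually allI)
      fix k
      define t where "t = cmod (D k x)"
      have "0 \<le> (1 - 2^k * t)\<^sup>2" by simp
      then have "2 * (2^k * t) \<le> 1 + (2^k * t)\<^sup>2" by (simp add: power2_diff)
      moreover have "0 \<le> (2::real)^k * t" by (simp add: t_def)
      ultimately have "2^k * t \<le> 1 + (2^k * t)\<^sup>2" by linarith
      then have "(1/2)^k * (2^k * t) \<le> (1/2)^k * (1 + (2^k * t)\<^sup>2)" by (intro mult_left_mono) auto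
      then show "norm (D k x) \<le> (1/2)^k + 2^k * (cmod (D k x))\<^sup>2"
        by (simp add: t_def power_one_over power2_eq_square field_simps)
    qed
  qed
qed

text \<open>Riesz-Fischer: a rapidly Cauchy subsequence converges almost everywhere, and Fatou's
  lemma carries the Cauchy bound to its limit.\<close>

lemma L2_complete:
  assumes f: "\<And>n. f n \<in> L2 M"
    and cauchy: "\<And>\<epsilon>. \<epsilon> > 0 \<Longrightarrow> \<exists>N. \<forall>m\<ge>N. \<forall>n\<ge>N. l2.q M (\<lambda>x. f m x - f n x) < \<epsilon>"
  obtains g where "g \<in> L2 M" "(\<lambda>n. l2.q M (\<lambda>x. f n x - g x)) \<longlonglongrightarrow> 0"
proof -
  note [measurable] = L2D(1)[OF f]
  have "\<exists>N. \<forall>m\<ge>N. \<forall>n\<ge>N. l2.q M (\<lambda>x. f m x - f n x) < (1/4)^k" for k :: nat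
    by (intro cauchy) simp
  then obtain N where N: "\<And>k m n. m \<ge> N k \<Longrightarrow> n \<ge> N k \<Longrightarrow> l2.q M (\<lambda>x. f m x - f n x) < (1/4)^k"
    by metis
  \<comment> \<open>Accumulating the thresholds makes the subsequence monotone while keeping it
    above each \<open>N k\<close>.\<close>
  define r where "r k = (\<Sum>j\<le>k. N j)" for k
  have rN: "N k \<le> r k" for k unfolding r_def by (intro member_le_sum) auto
  have rS: "r k \<le> r (Suc k)" for k by (simp add: r_def)
  have rmono: "k \<le> l \<Longrightarrow> r k \<le> r l" for k l by (rule lift_Suc_mono_le[of r]) (auto intro: rS)
  define D where "D k x = f (r (Suc k)) x - f (r k) x" for k x
  have D: "D k \<in> L2 M" for k unfolding D_def by (intro l2.diff_mem f)
  have "AE x in M. summable (\<lambda>k. D k x)"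
  proof (rule L2_norm_summable_AE[OF D])
    show "l2.q M (D k) \<le> (1/4)^k" for k
      unfolding D_def using N[of k "r (Suc k)" "r k"] rN[of k] rS[of k] by simp
  qed
  then have conv: "AE x in M. convergent (\<lambda>k. f (r k) x)"
  proof eventually_elim
    case (elim x)
    have "(\<lambda>k. f (r k) x) = (\<lambda>k. f (r 0) x + (\<Sum>j<k. D j x))"
      using sum_lessThan_telescope[of "\<lambda>k. f (r k) x"] by (auto simp: D_def fun_eq_iff)
    moreover have "convergent (\<lambda>k. f (r 0) x + (\<Sum>j<k. D j x))"
      using elim by (intro convergent_add convergent_const) (simp add: summable_iff_convergent)
    ultimately show ?case by simp
  qed
  define g where "g x = lim (\<lambda>k. f (r k) x)" for x
  have g[measurable]: "g \<in> borel_measurable M" unfolding g_def by measurable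
  have bound: "(\<integral>\<^sup>+x. ennreal ((cmod (f n x - g x))\<^sup>2) \<partial>M) \<le> ennreal ((1/4)^K)" if n: "n \<ge> r K" for n K
  proof -
    have "(\<integral>\<^sup>+x. ennreal ((cmod (f n x - g x))\<^sup>2) \<partial>M) = (\<integral>\<^sup>+x. liminf (\<lambda>k. ennreal ((cmod (f n x - f (r k) x))\<^sup>2)) \<partial>M)"
    proof (rule nn_integral_cong_AE, use conv in eventually_elim)
      case (elim x)
      then have "(\<lambda>k. f (r k) x) \<longlonglongrightarrow> g x" by (simp add: g_def convergent_LIMSEQ_iff)
      then have "(\<lambda>k. ennreal ((cmod (f n x - f (r k) x))\<^sup>2)) \<longlonglongrightarrow> ennreal ((cmod (f n x - g x))\<^sup>2)"
        by (intro tendsto_ennrealI tendsto_intros)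
      then show ?case by (intro lim_imp_Liminf[symmetric]) auto
    qed
    also have "\<dots> \<le> liminf (\<lambda>k. \<integral>\<^sup>+x. ennreal ((cmod (f n x - f (r k) x))\<^sup>2) \<partial>M)"
      by (rule nn_integral_liminf) auto
    also have "\<dots> = liminf (\<lambda>k. ennreal (l2.q M (\<lambda>x. f n x - f (r k) x)))"
      using L2D(2)[OF l2.diff_mem[OF f f]] by (simp add: nn_integral_eq_integral l2_q)
    also have "\<dots> \<le> liminf (\<lambda>k. ennreal ((1/4)^K))"
    proof (rule Liminf_mono, use eventually_ge_at_top[of K] in eventually_elim)
      case (elim k)
      then show ?case using N[of K n "r k"] rmono[of K k] rN[of K] n by (intro ennreal_leI) auto
    qed
    also have "\<dots> = ennreal ((1/4)^K)" by (simp add: Liminf_const)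
    finally show ?thesis .
  qed
  have in_L2: "(\<lambda>x. f n x - g x) \<in> L2 M" if n: "n \<ge> r K" for n K
    unfolding L2_def using bound[OF n] by (auto intro!: integrableI_bounded simp: top_unique less_top[symmetric])
  have gL2: "g \<in> L2 M"
    using l2.diff_mem[OF f in_L2[OF order_refl], of "r 0" 0] by simp
  have q_le: "l2.q M (\<lambda>x. f n x - g x) \<le> (1/4)^K" if n: "n \<ge> r K" for n K
    using bound[OF n] L2D(2)[OF in_L2[OF n]] by (simp add: nn_integral_eq_integral l2_q ennreal_le_iff)
  have "(\<lambda>n. l2.q M (\<lambda>x. f n x - g x)) \<longlonglongrightarrow> 0"
  proof (rule LIMSEQ_I)
    fix e :: real assume "e > 0"
    then obtain K where "(1/4::real)^K < e" using real_arch_pow_inv[of e "1/4"] by auto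
    then show "\<exists>no. \<forall>n\<ge>no. norm (l2.q M (\<lambda>x. f n x - g x) - 0) < e"
      using q_le[of K] l2.q_nonneg[OF l2.diff_mem[OF f gL2]] by (intro exI[of _ "r K"]) force
  qed
  then show ?thesis using that gL2 by blast
qed

text \<open>Padding with zero vectors lets a possibly finite index set be treated by sums over all
  naturals; the coefficients outside \<open>I\<close> vanish.\<close>

definition zero_ext :: "nat set \<Rightarrow> (nat \<Rightarrow> 'a \<Rightarrow> complex) \<Rightarrow> nat \<Rightarrow> 'a \<Rightarrow> complex" where
  "zero_ext I e i = (if i \<in> I then e i else (\<lambda>x. 0))"

section \<open>Fourier expansion in an orthonormal basis\<close>

context
  fixes M :: "'a measure" and I e assumes onb: "orthonormal_basis M I e"
begin

lemma zero_ext_L2: "zero_ext I e i \<in> L2 M"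
  using onb by (auto simp: zero_ext_def orthonormal_basis_def L2_zero)

lemma zero_ext_inner: "l2_inner M (zero_ext I e i) (zero_ext I e j) = (if i = j \<and> i \<in> I then 1 else 0)"
  using onb by (auto simp: zero_ext_def orthonormal_basis_def l2_inner_def)

lemma q_partial_fourier:
  assumes f: "f \<in> L2 M" and A: "finite A"
  shows "l2.q M (\<lambda>x. f x - (\<Sum>i\<in>A. l2_inner M (zero_ext I e i) f * zero_ext I e i x))
    = l2.q M f - (\<Sum>i\<in>A. (cmod (l2_inner M (zero_ext I e i) f))\<^sup>2)"
    and "l2.q M (\<lambda>x. (\<Sum>i\<in>A. l2_inner M (zero_ext I e i) f * zero_ext I e i x))
    = (\<Sum>i\<in>A. (cmod (l2_inner M (zero_ext I e i) f))\<^sup>2)"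
proof -
  define c where "c i = l2_inner M (zero_ext I e i) f" for i
  define p where "p x = (\<Sum>i\<in>A. c i * zero_ext I e i x)" for x
  have p: "p \<in> L2 M" unfolding p_def by (intro l2.sum_mem zero_ext_L2)
  have ci: "i \<notin> I \<Longrightarrow> c i = 0" for i by (simp add: c_def zero_ext_def l2_inner_def)
  have pf: "l2_inner M p f = complex_of_real (\<Sum>i\<in>A. (cmod (c i))\<^sup>2)"
    unfolding p_def using f
    by (subst l2.B_sum_left) (auto simp: zero_ext_L2 c_def[symmetric] cnj_mult_self simp del: of_real_power)
  have ep: "l2_inner M (zero_ext I e i) p = c i" if "i \<in> A" for i
  proof -
    have "l2_inner M (zero_ext I e i) p = (\<Sum>j\<in>A. c j * (if i = j \<and> i \<in> I then 1 else 0))"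
      unfolding p_def by (subst l2.B_sum_right) (auto simp: zero_ext_L2 zero_ext_inner)
    also have "\<dots> = (\<Sum>j\<in>A. if i = j then c j * (if i \<in> I then 1 else 0) else 0)"
      by (intro sum.cong) auto
    also have "\<dots> = c i" using A that ci by simp
    finally show ?thesis .
  qed
  have pp: "l2_inner M p p = complex_of_real (\<Sum>i\<in>A. (cmod (c i))\<^sup>2)"
  proof -
    have "l2_inner M p p = (\<Sum>i\<in>A. cnj (c i) * l2_inner M (zero_ext I e i) p)"
      using l2.B_sum_left[OF p, of A "zero_ext I e" c] by (simp add: zero_ext_L2 p_def[abs_def])
    also have "\<dots> = (\<Sum>i\<in>A. complex_of_real ((cmod (c i))\<^sup>2))"
      by (intro sum.cong refl) (simp add: ep cnj_mult_self del: of_real_power)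
    finally show ?thesis by simp
  qed
  show "l2.q M (\<lambda>x. (\<Sum>i\<in>A. l2_inner M (zero_ext I e i) f * zero_ext I e i x))
    = (\<Sum>i\<in>A. (cmod (l2_inner M (zero_ext I e i) f))\<^sup>2)"
    using pp unfolding l2.q_def p_def[abs_def] c_def[symmetric] by simp
  have "l2_inner M (\<lambda>x. f x - p x) (\<lambda>x. f x - p x) = complex_of_real (l2.q M f) - complex_of_real (\<Sum>i\<in>A. (cmod (c i))\<^sup>2)"
    using f p l2.herm[OF p f] by (simp add: l2.B_diff_left l2.B_diff_right l2.diff_mem pf pp l2.B_self[OF f])
  then show "l2.q M (\<lambda>x. f x - (\<Sum>i\<in>A. l2_inner M (zero_ext I e i) f * zero_ext I e i x))
    = l2.q M f - (\<Sum>i\<in>A. (cmod (l2_inner M (zero_ext I e i) f))\<^sup>2)"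
    unfolding l2.q_def p_def c_def[symmetric] by simp
qed

text \<open>Orthonormal bases are defined by having no nonzero vector orthogonal to them, so density
  has to be derived: the partial sums are Cauchy by Bessel's inequality, completeness gives a limit
  \<open>g\<close>, and \<open>f - g\<close> is orthogonal to every basis vector.\<close>

lemma fourier_tendsto:
  assumes f: "f \<in> L2 M"
  shows "(\<lambda>N. l2.q M (\<lambda>x. f x - (\<Sum>i<N. l2_inner M (zero_ext I e i) f * zero_ext I e i x))) \<longlonglongrightarrow> 0"
proof -
  define c where "c i = l2_inner M (zero_ext I e i) f" for i
  define p where "p N x = (\<Sum>i<N. c i * zero_ext I e i x)" for N :: nat and x
  have p: "p N \<in> L2 M" for N unfolding p_def by (intro l2.sum_mem zero_ext_L2)
  have "(\<Sum>i<n. (cmod (c i))\<^sup>2) \<le> l2.q M f" for n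
    using q_partial_fourier(1)[OF f, of "{..<n}"] l2.q_nonneg[OF l2.diff_mem[OF f p[of n]]]
    by (simp add: c_def p_def)
  then have sc: "summable (\<lambda>i. (cmod (c i))\<^sup>2)" by (intro summableI_nonneg_bounded) auto
  have diff: "l2.q M (\<lambda>x. p n x - p m x) = (\<Sum>i=m..<n. (cmod (c i))\<^sup>2)" if "m \<le> n" for m n
  proof -
    have "(\<lambda>x. p n x - p m x) = (\<lambda>x. \<Sum>i=m..<n. c i * zero_ext I e i x)"
      using that by (auto simp: p_def fun_eq_iff sum_diff_nat_ivl lessThan_atLeast0)
    then show ?thesis using q_partial_fourier(2)[OF f, of "{m..<n}"] by (simp add: c_def)
  qed
  have symm: "l2.q M (\<lambda>x. p n x - p m x) = l2.q M (\<lambda>x. p m x - p n x)" for m n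
    unfolding l2_q by (simp add: norm_minus_commute)
  obtain g where g: "g \<in> L2 M" and lim: "(\<lambda>n. l2.q M (\<lambda>x. p n x - g x)) \<longlonglongrightarrow> 0"
  proof (rule L2_complete[of p M])
    fix \<epsilon> :: real assume "\<epsilon> > 0"
    then obtain N where N: "\<And>m n. m \<ge> N \<Longrightarrow> norm (\<Sum>i=m..<n. (cmod (c i))\<^sup>2) < \<epsilon>"
      using sc unfolding summable_Cauchy by meson
    have "l2.q M (\<lambda>x. p m x - p n x) < \<epsilon>" if "m \<ge> N" "n \<ge> N" for m n
      using diff[of m n] diff[of n m] symm[of m n] N[of m n] N[of n m] that
      by (cases m n rule: le_cases) (auto simp: sum_nonneg)
    then show "\<exists>N. \<forall>m\<ge>N. \<forall>n\<ge>N. l2.q M (\<lambda>x. p m x - p n x) < \<epsilon>" by blast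
  qed (use p in auto)
  have "l2_inner M (e i) (\<lambda>x. f x - g x) = 0" if i: "i \<in> I" for i
  proof -
    let ?e = "zero_ext I e i"
    have ep: "l2_inner M ?e (p n) = c i" if "n > i" for n
    proof -
      have "l2_inner M ?e (p n) = (\<Sum>j<n. c j * (if i = j \<and> i \<in> I then 1 else 0))"
        unfolding p_def by (subst l2.B_sum_right) (auto simp: zero_ext_L2 zero_ext_inner)
      also have "\<dots> = (\<Sum>j<n. if i = j then c j else 0)"
        using i by (intro sum.cong) auto
      finally show ?thesis using that by simp
    qed
    have q1: "l2.q M ?e = 1" using zero_ext_inner[of i i] i by (simp add: l2.q_def)
    have "(\<lambda>n. sqrt (l2.q M (\<lambda>x. p n x - g x))) \<longlonglongrightarrow> sqrt 0" by (intro tendsto_intros lim)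
    moreover have "norm (c i - l2_inner M ?e g) \<le> sqrt (l2.q M (\<lambda>x. p n x - g x))" if "n > i" for n
      using l2.cauchy_schwarz[OF zero_ext_L2 l2.diff_mem[OF p g], of i n] q1 ep[OF that]
      by (simp add: l2.B_diff_right zero_ext_L2 p g)
    ultimately have "norm (c i - l2_inner M ?e g) \<le> sqrt 0"
      by (intro LIMSEQ_le_const) (auto intro!: exI[of _ "Suc i"])
    then have "c i = l2_inner M ?e g" by simp
    then have "l2_inner M ?e (\<lambda>x. f x - g x) = 0"
      using f g by (simp add: l2.B_diff_right zero_ext_L2 c_def)
    then show ?thesis using i by (simp add: zero_ext_def)
  qed
  then have "AE x in M. f x - g x = 0"
    using onb l2.diff_mem[OF f g] unfolding orthonormal_basis_def by blast
  then have "AE x in M. f x = g x" by simp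
  then have "l2.q M (\<lambda>x. p n x - g x) = l2.q M (\<lambda>x. f x - p n x)" for n
    unfolding l2_q using L2D(1)[OF f] L2D(1)[OF g] L2D(1)[OF p]
    by (intro integral_cong_AE) (auto simp: norm_minus_commute)
  then show ?thesis using lim by (simp add: p_def c_def)
qed

lemma parseval:
  assumes f: "f \<in> L2 M"
  shows "(\<lambda>i. (cmod (l2_inner M (zero_ext I e i) f))\<^sup>2) sums l2.q M f"
proof -
  have "(\<lambda>N. l2.q M f - (\<Sum>i<N. (cmod (l2_inner M (zero_ext I e i) f))\<^sup>2)) \<longlonglongrightarrow> 0"
    using fourier_tendsto[OF f] q_partial_fourier(1)[OF f] by simp
  then have "(\<lambda>N. l2.q M f - (l2.q M f - (\<Sum>i<N. (cmod (l2_inner M (zero_ext I e i) f))\<^sup>2))) \<longlonglongrightarrow> l2.q M f - 0"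
    by (intro tendsto_intros)
  then show ?thesis by (simp add: sums_def)
qed

end

section \<open>Gram-Schmidt orthogonalisation for a positive semi-definite form\<close>

context psd_form
begin

text \<open>The form may be degenerate, so a null residual yields the zero vector instead of being
  normalised or skipped. Indices then stay aligned with those of \<open>E\<close>, and each
  \<open>gs E p\<close> has norm 1 or is zero.\<close>

fun gs :: "(nat \<Rightarrow> 'a \<Rightarrow> complex) \<Rightarrow> nat \<Rightarrow> 'a \<Rightarrow> complex" where
  "gs E p = (let r = (\<lambda>x. E p x - (\<Sum>j<p. B (gs E j) (E p) * gs E j x))
     in if q r = 0 then (\<lambda>x. 0) else (\<lambda>x. complex_of_real (1 / sqrt (q r)) * r x))"

declare gs.simps[simp del]

definition proj_res :: "(nat \<Rightarrow> 'a \<Rightarrow> complex) \<Rightarrow> nat \<Rightarrow> ('a \<Rightarrow> complex) \<Rightarrow> 'a \<Rightarrow> complex" where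
  "proj_res E n f x = f x - (\<Sum>j<n. B (gs E j) f * gs E j x)"

lemma gs_eq: "gs E p = (if q (proj_res E p (E p)) = 0 then (\<lambda>x. 0)
    else (\<lambda>x. complex_of_real (1 / sqrt (q (proj_res E p (E p)))) * proj_res E p (E p) x))"
  by (subst gs.simps) (simp add: Let_def proj_res_def[abs_def])

context
  fixes E :: "nat \<Rightarrow> 'a \<Rightarrow> complex" assumes E: "\<And>i. E i \<in> V"
begin

lemma gs_mem: "gs E p \<in> V"
proof (induction p rule: less_induct)
  case (less p)
  have "proj_res E p (E p) \<in> V"
    unfolding proj_res_def[abs_def] by (intro diff_mem E sum_mem) (use less in auto)
  then show ?case by (simp add: gs_eq[of E p] zero_mem scale_mem del: of_real_divide)
qed

lemma proj_res_mem: "f \<in> V \<Longrightarrow> proj_res E n f \<in> V"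
  unfolding proj_res_def[abs_def] by (intro diff_mem sum_mem gs_mem)

text \<open>Orthonormality enters as a hypothesis below \<open>n\<close> because it is itself being
  proved by strong induction; \<open>B_gs_proj_res\<close> is the version available
  afterwards.\<close>

lemma B_gs_proj_res_aux:
  assumes orth: "\<And>i j. i < n \<Longrightarrow> j < n \<Longrightarrow> i \<noteq> j \<Longrightarrow> B (gs E i) (gs E j) = 0"
    and nrm: "\<And>i. i < n \<Longrightarrow> q (gs E i) = 1 \<or> gs E i = (\<lambda>x. 0)"
    and f: "f \<in> V" and i: "i < n"
  shows "B (gs E i) (proj_res E n f) = 0"
proof -
  have "B (gs E i) (proj_res E n f) = B (gs E i) f - (\<Sum>j<n. B (gs E j) f * B (gs E i) (gs E j))"
    unfolding proj_res_def[abs_def]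
    by (subst B_diff_right) (auto simp: gs_mem f sum_mem B_sum_right)
  also have "(\<Sum>j<n. B (gs E j) f * B (gs E i) (gs E j)) = (\<Sum>j<n. if j = i then B (gs E i) f * B (gs E i) (gs E i) else 0)"
    using orth i by (intro sum.cong) auto
  also have "\<dots> = B (gs E i) f * B (gs E i) (gs E i)" using i by simp
  also have "\<dots> = B (gs E i) f"
    using nrm[OF i] f by (auto simp: B_self[OF gs_mem] B_zero_left)
  finally show ?thesis by simp
qed

lemma gs_orthonormal:
  "(\<forall>j<p. B (gs E j) (gs E p) = 0) \<and> (q (gs E p) = 1 \<or> gs E p = (\<lambda>x. 0))"
proof (induction p rule: less_induct)
  case (less p)
  let ?r = "proj_res E p (E p)"
  have r: "?r \<in> V" by (intro proj_res_mem E)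
  have orth: "B (gs E i) (gs E j) = 0" if "i < p" "j < p" "i \<noteq> j" for i j
  proof (cases "i < j")
    case True
    then show ?thesis using less[of j] that by blast
  next
    case False
    then have "B (gs E j) (gs E i) = 0" using less[of i] that by simp
    then show ?thesis using herm[OF gs_mem gs_mem, of j i] by simp
  qed
  have "B (gs E j) ?r = 0" if "j < p" for j
    by (rule B_gs_proj_res_aux[OF orth _ E that]) (use less in auto)
  then have 1: "B (gs E j) (gs E p) = 0" if "j < p" for j
    using that r unfolding gs_eq[of E p] by (simp add: B_zero_right gs_mem B_scale_right del: of_real_divide)
  have 2: "q (gs E p) = 1 \<or> gs E p = (\<lambda>x. 0)"
    unfolding gs_eq[of E p] using q_nonneg[OF r] r
    by (auto simp: q_scale norm_divide power_divide simp del: of_real_divide)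
  show ?case using 1 2 by blast
qed

lemma B_gs_gs: "i \<noteq> j \<Longrightarrow> B (gs E i) (gs E j) = 0"
  using gs_orthonormal[of i] gs_orthonormal[of j] herm[OF gs_mem gs_mem, of j i]
  by (cases "i < j") (auto simp: not_less_iff_gr_or_eq)

lemma B_gs_proj_res: "f \<in> V \<Longrightarrow> i < n \<Longrightarrow> B (gs E i) (proj_res E n f) = 0"
  by (rule B_gs_proj_res_aux) (use B_gs_gs gs_orthonormal in auto)

lemma B_proj_res:
  assumes f: "f \<in> V" and g: "g \<in> V"
  shows "B (proj_res E n f) (proj_res E n g) = B f g - (\<Sum>p<n. cnj (B (gs E p) f) * B (gs E p) g)"
proof -
  have "B (proj_res E n f) (proj_res E n g) = B f (proj_res E n g) - (\<Sum>p<n. cnj (B (gs E p) f) * B (gs E p) (proj_res E n g))"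
  proof -
    have "proj_res E n f = (\<lambda>x. f x - (\<Sum>j<n. B (gs E j) f * gs E j x))" by (simp add: proj_res_def fun_eq_iff)
    moreover have "proj_res E n g \<in> V" by (intro proj_res_mem g)
    ultimately show ?thesis
      using f by (simp add: B_diff_left gs_mem sum_mem B_sum_left)
  qed
  also have "(\<Sum>p<n. cnj (B (gs E p) f) * B (gs E p) (proj_res E n g)) = 0"
    using B_gs_proj_res[OF g] by simp
  also have "B f (proj_res E n g) = B f g - (\<Sum>p<n. B (gs E p) g * B f (gs E p))"
    unfolding proj_res_def[abs_def]
    using f g by (subst B_diff_right) (auto simp: gs_mem sum_mem B_sum_right)
  finally show ?thesis using herm[OF gs_mem f] by (simp add: mult.commute)
qed

lemma q_proj_res:
  assumes f: "f \<in> V"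
  shows "q (proj_res E n f) = q f - (\<Sum>p<n. (cmod (B (gs E p) f))\<^sup>2)"
proof -
  have "complex_of_real (q (proj_res E n f)) = complex_of_real (q f - (\<Sum>p<n. (cmod (B (gs E p) f))\<^sup>2))"
    using B_proj_res[OF f f, of n] by (simp add: B_self f proj_res_mem cnj_mult_self del: of_real_power)
  then show ?thesis unfolding of_real_eq_iff .
qed

lemma bessel: "f \<in> V \<Longrightarrow> (\<Sum>p<n. (cmod (B (gs E p) f))\<^sup>2) \<le> q f"
  using q_proj_res[of f n] q_nonneg[OF proj_res_mem[of f n]] by simp

text \<open>The residual that produced \<open>gs E i\<close> has exactly the squared norm that the
  \<open>i\<close>-th coefficient removes, so one more step leaves a null vector; further steps only
  decrease the norm.\<close>

lemma q_proj_res_gen: "i < n \<Longrightarrow> q (proj_res E n (E i)) = 0"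
proof -
  assume i: "i < n"
  let ?r = "proj_res E i (E i)"
  have r: "?r \<in> V" by (intro proj_res_mem E)
  have "q (proj_res E (Suc i) (E i)) = 0"
  proof (cases "q ?r = 0")
    case True
    then have "gs E i = (\<lambda>x. 0)" by (simp add: gs_eq[of E i])
    then have "(cmod (B (gs E i) (E i)))\<^sup>2 = 0" by (simp add: B_zero_left E)
    then show ?thesis using True q_proj_res[OF E, of i i] q_proj_res[OF E, of "Suc i" i] by simp
  next
    case False
    define a where "a = complex_of_real (1 / sqrt (q ?r))"
    have gi: "gs E i = (\<lambda>x. a * ?r x)" using False by (simp add: gs_eq[of E i] a_def)
    have "B (gs E i) (E i) = cnj a * B ?r (E i)" unfolding gi by (rule B_scale_left) (use r E in auto)
    also have "B ?r (E i) = B ?r ?r + (\<Sum>p<i. B (gs E p) (E i) * B ?r (gs E p))"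
    proof -
      have "E i = (\<lambda>x. ?r x + (\<Sum>p<i. B (gs E p) (E i) * gs E p x))" by (simp add: proj_res_def fun_eq_iff)
      then have "B ?r (E i) = B ?r (\<lambda>x. ?r x + (\<Sum>p<i. B (gs E p) (E i) * gs E p x))" by (rule arg_cong)
      then show ?thesis using r by (simp add: B_add_right gs_mem sum_mem B_sum_right)
    qed
    also have "(\<Sum>p<i. B (gs E p) (E i) * B ?r (gs E p)) = 0"
      using B_gs_proj_res[OF E, of _ i i] herm[OF gs_mem r] by simp
    finally have "B (gs E i) (E i) = cnj a * complex_of_real (q ?r)" by (simp add: B_self r)
    then have "(cmod (B (gs E i) (E i)))\<^sup>2 = q ?r"
      using q_nonneg[OF r] False
      by (simp add: a_def norm_mult norm_divide power_mult_distrib power_divide power2_eq_square)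
    then show ?thesis using q_proj_res[OF E, of i i] q_proj_res[OF E, of "Suc i" i] by simp
  qed
  moreover have "q (proj_res E n (E i)) \<le> q (proj_res E (Suc i) (E i))"
    unfolding q_proj_res[OF E] using i by (intro diff_left_mono sum_mono2) auto
  ultimately show "q (proj_res E n (E i)) = 0" using q_nonneg[OF proj_res_mem[OF E, of n i]] by simp
qed

lemma q_add_null: "f \<in> V \<Longrightarrow> g \<in> V \<Longrightarrow> q g = 0 \<Longrightarrow> q (\<lambda>x. f x + g x) = q f"
  by (simp add: q_add B_null)

lemma q_sum_null:
  assumes "\<And>i. i \<in> A \<Longrightarrow> u i \<in> V" "\<And>i. i \<in> A \<Longrightarrow> q (u i) = 0"
  shows "q (\<lambda>x. \<Sum>i\<in>A. c i * u i x) = 0"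
  using assms by (simp add: q_def B_sum_right sum_mem B_null)

text \<open>Best approximation. Projecting a combination of the first \<open>n\<close> generators
  leaves only null vectors, so \<open>f\<close> and \<open>f\<close> minus that combination have
  residuals of the same norm.\<close>

lemma q_proj_res_le:
  assumes f: "f \<in> V"
  shows "q (proj_res E n f) \<le> q (\<lambda>x. f x - (\<Sum>i<n. c i * E i x))"
proof -
  define g where "g = (\<lambda>x. f x - (\<Sum>i<n. c i * E i x))"
  have g: "g \<in> V" unfolding g_def by (intro diff_mem f sum_mem E)
  have Bg: "B (gs E p) f = B (gs E p) g + (\<Sum>i<n. c i * B (gs E p) (E i))" for p
    unfolding g_def using f by (subst B_diff_right) (auto simp: gs_mem sum_mem E B_sum_right)
  have "proj_res E n f x = proj_res E n g x + (\<Sum>i<n. c i * proj_res E n (E i) x)" for x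
  proof -
    have "(\<Sum>p<n. \<Sum>i<n. c i * B (gs E p) (E i) * gs E p x) = (\<Sum>i<n. \<Sum>p<n. c i * B (gs E p) (E i) * gs E p x)"
      by (rule sum.swap)
    then show ?thesis
      unfolding proj_res_def Bg
      by (simp add: g_def ring_distribs sum.distrib sum_subtractf sum_distrib_left sum_distrib_right mult.assoc)
  qed
  then have "q (proj_res E n f) = q (\<lambda>x. proj_res E n g x + (\<Sum>i<n. c i * proj_res E n (E i) x))"
    by presburger
  also have "\<dots> = q (proj_res E n g)"
    by (intro q_add_null proj_res_mem g sum_mem E q_sum_null q_proj_res_gen) auto
  also have "\<dots> \<le> q g" unfolding q_proj_res[OF g] by (simp add: sum_nonneg)
  finally show ?thesis unfolding g_def .
qed

text \<open>Parseval's identity for the form. What is asked of \<open>E\<close> is density of its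
  span in the seminorm; the bilinear identity then follows from Cauchy-Schwarz for the two
  residuals.\<close>

lemma gs_complete:
  assumes f: "f \<in> V" and g: "g \<in> V"
    and lim: "\<And>f. f \<in> V \<Longrightarrow> \<exists>c. (\<lambda>n. q (\<lambda>x. f x - (\<Sum>i<n. c i * E i x))) \<longlonglongrightarrow> 0"
  shows "(\<lambda>p. cnj (B (gs E p) f) * B (gs E p) g) sums B f g"
proof -
  have z: "(\<lambda>n. q (proj_res E n f)) \<longlonglongrightarrow> 0" if f: "f \<in> V" for f
  proof -
    obtain c where "(\<lambda>n. q (\<lambda>x. f x - (\<Sum>i<n. c i * E i x))) \<longlonglongrightarrow> 0" using lim[OF f] by blast
    then show ?thesis
      by (rule Lim_null_comparison[rotated])
         (use q_proj_res_le[OF f] q_nonneg[OF proj_res_mem[OF f]] in \<open>auto intro!: always_eventually\<close>)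
  qed
  have "(\<lambda>n. B (proj_res E n f) (proj_res E n g)) \<longlonglongrightarrow> 0"
  proof (rule Lim_null_comparison)
    show "\<forall>\<^sub>F n in sequentially. norm (B (proj_res E n f) (proj_res E n g)) \<le> sqrt (q (proj_res E n f)) * sqrt (q (proj_res E n g))"
      by (intro always_eventually allI cauchy_schwarz proj_res_mem f g)
    have "(\<lambda>n. sqrt (q (proj_res E n f)) * sqrt (q (proj_res E n g))) \<longlonglongrightarrow> sqrt 0 * sqrt 0"
      by (intro tendsto_intros z f g)
    then show "(\<lambda>n. sqrt (q (proj_res E n f)) * sqrt (q (proj_res E n g))) \<longlonglongrightarrow> 0" by simp
  qed
  then have "(\<lambda>n. B f g - B (proj_res E n f) (proj_res E n g)) \<longlonglongrightarrow> B f g - 0"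
    by (intro tendsto_intros)
  then show ?thesis unfolding sums_def B_proj_res[OF f g] by simp
qed

end

end

section \<open>Functions determined by integrals over a generator\<close>

lemma AE_eq_generator:
  fixes f g :: "'a \<Rightarrow> ennreal"
  assumes [measurable]: "f \<in> borel_measurable M" "g \<in> borel_measurable M"
    and G: "Int_stable G" "G \<subseteq> Pow (space M)" "sets M = sigma_sets (space M) G" "space M \<in> G"
    and eq: "\<And>A. A \<in> G \<Longrightarrow> (\<integral>\<^sup>+x. f x * indicator A x \<partial>M) = (\<integral>\<^sup>+x. g x * indicator A x \<partial>M)"
    and fin: "(\<integral>\<^sup>+x. f x \<partial>M) \<noteq> \<infinity>"
  shows "AE x in M. f x = g x"
proof -
  have GM: "A \<in> G \<Longrightarrow> A \<in> sets M" for A using G(3) by auto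
  have "density M f = density M g"
  proof (rule measure_eqI_generator_eq[OF G(1,2), where A="\<lambda>_::nat. space M"])
    show "emeasure (density M f) X = emeasure (density M g) X" if "X \<in> G" for X
      using eq[OF that] GM[OF that] by (simp add: emeasure_density)
    show "emeasure (density M f) (space M) \<noteq> \<infinity>"
    proof -
      have "(\<integral>\<^sup>+x. f x * indicator (space M) x \<partial>M) = (\<integral>\<^sup>+x. f x \<partial>M)"
        by (intro nn_integral_cong) auto
      then show ?thesis using fin by (simp add: emeasure_density)
    qed
  qed (use G in auto)
  then show ?thesis
    by (subst (asm) finite_density_unique) (use fin in auto)
qed

lemma AE_zero_generator:
  fixes h :: "'a \<Rightarrow> complex"
  assumes h: "integrable M h"
    and G: "Int_stable G" "G \<subseteq> Pow (space M)" "sets M = sigma_sets (space M) G" "space M \<in> G"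
    and eq: "\<And>A. A \<in> G \<Longrightarrow> (LINT x|M. indicator A x *\<^sub>R h x) = 0"
  shows "AE x in M. h x = 0"
proof -
  have real: "AE x in M. r x = 0" if r: "integrable M r" and z: "\<And>A. A \<in> G \<Longrightarrow> (LINT x|M. indicator A x * r x) = 0"
    for r :: "'a \<Rightarrow> real"
  proof -
    note [measurable] = borel_measurable_integrable[OF r]
    \<comment> \<open>\<open>ennreal\<close> truncates at zero, so the two sides are the positive
      and the negative part of \<open>r\<close>; they agree only where \<open>r\<close>
      vanishes.\<close>
    have "AE x in M. ennreal (r x) = ennreal (- r x)"
    proof (rule AE_eq_generator[OF _ _ G])
      fix A assume A: "A \<in> G"
      then have [measurable]: "A \<in> sets M" using G(3) by auto
      have i: "integrable M (\<lambda>x. indicator A x * r x)"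
        using r by (simp add: integrable_mult_indicator[where 'b=real, simplified])
      have p: "integrable M (\<lambda>x. max 0 (indicator A x * r x))" "integrable M (\<lambda>x. max 0 (- (indicator A x * r x)))"
        using i by (auto intro!: integrable_max)
      have "(LINT x|M. max 0 (indicator A x * r x)) - (LINT x|M. max 0 (- (indicator A x * r x)))
          = (LINT x|M. indicator A x * r x)"
        by (subst Bochner_Integration.integral_diff[symmetric, OF p]) (intro Bochner_Integration.integral_cong, auto)
      then have e: "(LINT x|M. max 0 (indicator A x * r x)) = (LINT x|M. max 0 (- (indicator A x * r x)))"
        using z[OF A] by simp
      have "(\<integral>\<^sup>+x. ennreal (r x) * indicator A x \<partial>M) = (\<integral>\<^sup>+x. ennreal (max 0 (indicator A x * r x)) \<partial>M)"
        by (intro nn_integral_cong) (auto split: split_indicator simp: max_def ennreal_neg)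
      moreover have "(\<integral>\<^sup>+x. ennreal (- r x) * indicator A x \<partial>M) = (\<integral>\<^sup>+x. ennreal (max 0 (- (indicator A x * r x))) \<partial>M)"
        by (intro nn_integral_cong) (auto split: split_indicator simp: max_def ennreal_neg)
      ultimately show "(\<integral>\<^sup>+x. ennreal (r x) * indicator A x \<partial>M) = (\<integral>\<^sup>+x. ennreal (- r x) * indicator A x \<partial>M)"
        using p e by (simp add: nn_integral_eq_integral del: ennreal_max_0)
    next
      show "(\<integral>\<^sup>+x. ennreal (r x) \<partial>M) \<noteq> \<infinity>"
        using r unfolding real_integrable_def by simp
    qed auto
    then show ?thesis
    proof eventually_elim
      case (elim x)
      then show ?case by (cases "r x" "0::real" rule: linorder_cases) (auto simp: ennreal_neg)
    qed
  qed
  have "AE x in M. Re (h x) = 0"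
  proof (rule real)
    show "(LINT x|M. indicator A x * Re (h x)) = 0" if "A \<in> G" for A
    proof -
      have "A \<in> sets M" using G(3) that by auto
      then have "integrable M (\<lambda>x. indicator A x *\<^sub>R h x)" using h by (rule integrable_mult_indicator)
      then have "(LINT x|M. Re (indicator A x *\<^sub>R h x)) = 0" using eq[OF that] by (subst integral_Re) (assumption, simp)
      then show ?thesis by simp
    qed
  qed (use h in simp)
  moreover have "AE x in M. Im (h x) = 0"
  proof (rule real)
    show "(LINT x|M. indicator A x * Im (h x)) = 0" if "A \<in> G" for A
    proof -
      have "A \<in> sets M" using G(3) that by auto
      then have "integrable M (\<lambda>x. indicator A x *\<^sub>R h x)" using h by (rule integrable_mult_indicator)
      then have "(LINT x|M. Im (indicator A x *\<^sub>R h x)) = 0" using eq[OF that] by (subst integral_Im) (assumption, simp)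
      then show ?thesis by simp
    qed
  qed (use h in simp)
  ultimately show ?thesis by eventually_elim (simp add: complex_eq_iff)
qed

section \<open>Factorisation of a locally trace class kernel\<close>

lemma cnj_indicator [simp]: "cnj (indicator A x) = indicator A x"
  by (simp split: split_indicator)

lemma pair_product_integral:
  fixes f :: "'a \<Rightarrow> complex" and g :: "'b \<Rightarrow> complex"
  assumes "sigma_finite_measure M" "sigma_finite_measure N"
    and f: "integrable M f" and g: "integrable N g"
  shows "integrable (M \<Otimes>\<^sub>M N) (\<lambda>z. f (fst z) * g (snd z))"
    and "(\<integral>z. f (fst z) * g (snd z) \<partial>(M \<Otimes>\<^sub>M N)) = (\<integral>x. f x \<partial>M) * (\<integral>y. g y \<partial>N)"
proof -
  interpret pair_sigma_finite M N using assms by (simp add: pair_sigma_finite_def)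
  note [measurable] = borel_measurable_integrable[OF f] borel_measurable_integrable[OF g]
  show i: "integrable (M \<Otimes>\<^sub>M N) (\<lambda>z. f (fst z) * g (snd z))"
    by (rule Fubini_integrable) (use f g in \<open>auto simp: norm_mult\<close>)
  have "(\<integral>z. f (fst z) * g (snd z) \<partial>(M \<Otimes>\<^sub>M N)) = (\<integral>x. \<integral>y. f x * g y \<partial>N \<partial>M)"
    using integral_fst'[OF i] by simp
  also have "\<dots> = (\<integral>x. f x \<partial>M) * (\<integral>y. g y \<partial>N)" by simp
  finally show "(\<integral>z. f (fst z) * g (snd z) \<partial>(M \<Otimes>\<^sub>M N)) = (\<integral>x. f x \<partial>M) * (\<integral>y. g y \<partial>N)" .
qed

lemma ennreal_suminf_swap: "(\<Sum>i. \<Sum>j. (f i j :: ennreal)) = (\<Sum>j. \<Sum>i. f i j)"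
proof -
  have "(\<Sum>i. \<Sum>j. f i j) = (\<integral>\<^sup>+i. (\<Sum>j. f i j) \<partial>count_space UNIV)"
    by (simp add: nn_integral_count_space_nat)
  also have "\<dots> = (\<Sum>j. \<integral>\<^sup>+i. f i j \<partial>count_space UNIV)" by (rule nn_integral_suminf) simp
  finally show ?thesis by (simp add: nn_integral_count_space_nat)
qed

text \<open>\<open>S\<close> is a compact set that will contain the support of the test function.
  \<open>\<kappa>\<close> bounds the operator norm of K on all of \<open>L2\<close>, so it can be
  chosen independently of \<open>S\<close>. Non-negativity of the diagonal will come from the
  one-point correlation function.\<close>

locale trace_kernel =
  fixes \<mu> :: "'a::euclidean_space measure" and K :: "'a \<Rightarrow> 'a \<Rightarrow> complex" and S :: "'a set" and \<kappa> :: real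
  assumes sets_mu: "sets \<mu> = sets borel" and sigma_fin: "sigma_finite_measure \<mu>"
    and K_meas: "case_prod K \<in> borel_measurable (borel \<Otimes>\<^sub>M borel)"
    and bounded_op: "bounded_integral_operator \<mu> K"
    and symm: "l2_symmetric \<mu> (integral_op \<mu> K)"
    and psd: "l2_psd \<mu> (integral_op \<mu> K)"
    and loc_trace: "locally_trace_class \<mu> K" and diag_norm: "diagonal_normalized \<mu> K"
    and diag_pos: "AE x in \<mu>. K x x \<in> \<real>\<^sub>\<ge>\<^sub>0"
    and S: "compact S"
    and \<kappa>: "0 \<le> \<kappa>" "\<And>f. f \<in> L2 \<mu> \<Longrightarrow> l2_norm \<mu> (integral_op \<mu> K f) \<le> \<kappa> * l2_norm \<mu> f"
begin

abbreviation "T \<equiv> integral_op \<mu> K"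
abbreviation "TS \<equiv> compress S (integral_op \<mu> K)"

definition Q :: "('a \<Rightarrow> complex) \<Rightarrow> ('a \<Rightarrow> complex) \<Rightarrow> complex" where "Q f g = l2_inner \<mu> f (TS g)"

lemma space_mu [simp]: "space \<mu> = UNIV"
  using sets_eq_imp_space_eq[OF sets_mu] by simp

lemma S_sets [measurable]: "S \<in> sets \<mu>" "S \<in> sets borel"
  using S by (auto simp: sets_mu compact_imp_closed)

lemma T_L2: "f \<in> L2 \<mu> \<Longrightarrow> T f \<in> L2 \<mu>"
  using bounded_op by (simp add: bounded_integral_operator_def bounded_l2_operator_def)

lemma T_lin: "f \<in> L2 \<mu> \<Longrightarrow> g \<in> L2 \<mu> \<Longrightarrow> AE x in \<mu>. T (\<lambda>y. a * f y + b * g y) x = a * T f x + b * T g x"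
  using bounded_op by (simp add: bounded_integral_operator_def bounded_l2_operator_def)

lemma ind_L2: "f \<in> L2 \<mu> \<Longrightarrow> A \<in> sets \<mu> \<Longrightarrow> (\<lambda>x. indicator A x * f x) \<in> L2 \<mu>"
  by (rule L2_bounded_mult(1)[where c=1]) (auto split: split_indicator)

lemma q_ind_le: "f \<in> L2 \<mu> \<Longrightarrow> A \<in> sets \<mu> \<Longrightarrow> l2.q \<mu> (\<lambda>x. indicator A x * f x) \<le> l2.q \<mu> f"
  using L2_bounded_mult(2)[of f \<mu> "indicator A" 1] by (auto split: split_indicator)

lemma inner_ind: "l2_inner \<mu> f (\<lambda>x. indicator A x * g x) = l2_inner \<mu> (\<lambda>x. indicator A x * f x) g"
  unfolding l2_inner_def by (simp add: mult_ac)

lemma compress_L2: "A \<in> sets \<mu> \<Longrightarrow> f \<in> L2 \<mu> \<Longrightarrow> compress A T f \<in> L2 \<mu>"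
  unfolding compress_def by (intro ind_L2 T_L2)

lemma Q_eq: "Q f g = l2_inner \<mu> (\<lambda>x. indicator S x * f x) (T (\<lambda>x. indicator S x * g x))"
  unfolding Q_def compress_def by (rule inner_ind)

sublocale Q: psd_form "L2 \<mu>" Q
proof
  fix f g h :: "'a \<Rightarrow> complex" and a b
  assume f: "f \<in> L2 \<mu>" and g: "g \<in> L2 \<mu>"
  let ?i = "\<lambda>f x. indicator S x * f x :: complex"
  have i: "?i f \<in> L2 \<mu>" "?i g \<in> L2 \<mu>" using f g by (auto intro!: ind_L2)
  show "Q g f = cnj (Q f g)"
  proof -
    have "Q g f = cnj (l2_inner \<mu> (T (?i f)) (?i g))"
      unfolding Q_eq by (intro l2.herm T_L2 i)
    also have "l2_inner \<mu> (T (?i f)) (?i g) = l2_inner \<mu> (?i f) (T (?i g))"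
      using symm i by (simp add: l2_symmetric_def)
    finally show ?thesis by (simp add: Q_eq)
  qed
  assume h: "h \<in> L2 \<mu>"
  have ih: "?i h \<in> L2 \<mu>" using h by (auto intro!: ind_L2)
  have e: "(\<lambda>x. indicator S x * (a * g x + b * h x)) = (\<lambda>x. a * ?i g x + b * ?i h x)"
    by (simp add: fun_eq_iff algebra_simps)
  have m1: "T (\<lambda>x. a * ?i g x + b * ?i h x) \<in> borel_measurable \<mu>"
    by (intro L2D(1) T_L2 L2_lin i ih)
  have m2: "(\<lambda>x. a * T (?i g) x + b * T (?i h) x) \<in> borel_measurable \<mu>"
    by (intro L2D(1) L2_lin T_L2 i ih)
  have m3: "(\<lambda>x. cnj (?i f x)) \<in> borel_measurable \<mu>"
    using L2D(1)[OF i(1)] by measurable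
  have "Q f (\<lambda>x. a * g x + b * h x) = l2_inner \<mu> (?i f) (\<lambda>x. a * T (?i g) x + b * T (?i h) x)"
    unfolding Q_eq e l2_inner_def
    by (rule integral_cong_AE) (use m1 m2 m3 T_lin[OF i(2) ih, of a b] in \<open>auto elim!: AE_mp intro!: borel_measurable_times\<close>)
  also have "\<dots> = a * Q f g + b * Q f h"
    unfolding Q_eq by (intro l2.lin_right T_L2 i ih)
  finally show "Q f (\<lambda>x. a * g x + b * h x) = a * Q f g + b * Q f h" .
next
  fix f assume "f \<in> L2 \<mu>"
  then have "(\<lambda>x. indicator S x * f x) \<in> L2 \<mu>" by (auto intro!: ind_L2)
  then have "Q f f \<in> \<real>\<^sub>\<ge>\<^sub>0" using psd by (simp add: Q_eq l2_psd_def)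
  then show "0 \<le> Re (Q f f)" by (simp add: complex_nonneg_Reals_iff)
qed (auto simp: L2_zero L2_lin)

lemma qQ_le: 
  assumes f: "f \<in> L2 \<mu>" shows "Q.q f \<le> \<kappa> * l2.q \<mu> f"
proof -
  define g where "g x = indicator S x * f x" for x
  have g: "g \<in> L2 \<mu>" unfolding g_def using f by (auto intro!: ind_L2)
  have "Q.q f \<le> cmod (l2_inner \<mu> g (T g))"
    unfolding Q.q_def Q_eq g_def[abs_def] by (rule complex_Re_le_cmod)
  also have "\<dots> \<le> sqrt (l2.q \<mu> g) * sqrt (l2.q \<mu> (T g))" by (intro l2.cauchy_schwarz g T_L2)
  also have "\<dots> \<le> sqrt (l2.q \<mu> g) * (\<kappa> * sqrt (l2.q \<mu> g))"
    using \<kappa>(2)[OF g] l2.q_nonneg[OF g] by (intro mult_left_mono) (auto simp: l2_norm_eq)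
  also have "\<dots> = \<kappa> * l2.q \<mu> g" using l2.q_nonneg[OF g] by simp
  also have "\<dots> \<le> \<kappa> * l2.q \<mu> f" using q_ind_le[OF f, of S] \<kappa>(1) by (intro mult_left_mono) (auto simp: g_def[abs_def])
  finally show ?thesis .
qed

lemma Q_integral: "Q f g = (LINT x|\<mu>. LINT y|\<mu>. cnj (indicator S x * f x) * (K x y * (indicator S y * g y)))"
  unfolding Q_eq l2_inner_def integral_op_def by simp

text \<open>The definition of a trace class operator carries an orthonormal basis, which supplies
  the countable family for Gram-Schmidt.\<close>

lemma onb_exists: "\<exists>I e. orthonormal_basis \<mu> I e"
proof -
  have "trace_class \<mu> (compress S T)" using loc_trace S by (simp add: locally_trace_class_def)
  then show ?thesis unfolding trace_class_def by blast
qed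

definition onb where "onb = (SOME p. orthonormal_basis \<mu> (fst p) (snd p))"

lemma onb: "orthonormal_basis \<mu> (fst onb) (snd onb)"
proof -
  have "\<exists>p. orthonormal_basis \<mu> (fst p) (snd p)" using onb_exists by auto
  then show ?thesis unfolding onb_def by (rule someI_ex)
qed

definition E where "E = zero_ext (fst onb) (snd onb)"

lemma E_L2: "E i \<in> L2 \<mu>" unfolding E_def by (rule zero_ext_L2[OF onb])

text \<open>The operator K, compressed to \<open>S\<close>, applied to a Q-orthonormal family v p.
  Formally K^(1/2) v p is orthonormal and \<open>s0 p\<close> is K^(1/2) of it, so the rank one
  kernels built from the \<open>s0 p\<close> add up to K.\<close>

definition s0 where "s0 p = TS (Q.gs E p)"

lemma s0_L2: "s0 p \<in> L2 \<mu>"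
  unfolding s0_def by (intro compress_L2 S_sets Q.gs_mem E_L2)

lemma s0_meas [measurable]: "s0 p \<in> borel_measurable \<mu>"
  by (rule L2D(1)[OF s0_L2])

lemma Q_gs: "g \<in> L2 \<mu> \<Longrightarrow> Q (Q.gs E p) g = l2_inner \<mu> (s0 p) g"
proof -
  assume g: "g \<in> L2 \<mu>"
  have v: "Q.gs E p \<in> L2 \<mu>" by (intro Q.gs_mem E_L2)
  have "Q (Q.gs E p) g = cnj (Q g (Q.gs E p))" using Q.herm[OF g v] by simp
  also have "\<dots> = cnj (l2_inner \<mu> g (s0 p))" by (simp add: Q_def s0_def)
  also have "\<dots> = l2_inner \<mu> (s0 p) g" using l2.herm[OF s0_L2 g] by simp
  finally show ?thesis .
qed

text \<open>The factorisation in its weak form. Fourier series that converge in \<open>L2\<close>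
  also converge in the seminorm of Q, because Q is bounded by \<open>\<kappa>\<close> times the
  inner product.\<close>

lemma Q_sums:
  assumes f: "f \<in> L2 \<mu>" and g: "g \<in> L2 \<mu>"
  shows "(\<lambda>p. l2_inner \<mu> f (s0 p) * l2_inner \<mu> (s0 p) g) sums Q f g"
proof -
  have "(\<lambda>p. cnj (Q (Q.gs E p) f) * Q (Q.gs E p) g) sums Q f g"
  proof (rule Q.gs_complete[OF E_L2 f g])
    fix f assume f: "f \<in> L2 \<mu>"
    let ?r = "\<lambda>n x. f x - (\<Sum>i<n. l2_inner \<mu> (E i) f * E i x)"
    have r: "?r n \<in> L2 \<mu>" for n by (intro l2.diff_mem f l2.sum_mem E_L2)
    have "(\<lambda>n. \<kappa> * l2.q \<mu> (?r n)) \<longlonglongrightarrow> \<kappa> * 0"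
      using fourier_tendsto[OF onb f] by (intro tendsto_intros) (simp add: E_def)
    then have lim: "(\<lambda>n. \<kappa> * l2.q \<mu> (?r n)) \<longlonglongrightarrow> 0" by simp
    have "(\<lambda>n. Q.q (?r n)) \<longlonglongrightarrow> 0"
    proof (rule tendsto_sandwich[OF _ _ tendsto_const lim])
      show "\<forall>\<^sub>F n in sequentially. 0 \<le> Q.q (?r n)" by (intro always_eventually allI Q.q_nonneg r)
      show "\<forall>\<^sub>F n in sequentially. Q.q (?r n) \<le> \<kappa> * l2.q \<mu> (?r n)" by (intro always_eventually allI qQ_le r)
    qed
    then show "\<exists>c. (\<lambda>n. Q.q (\<lambda>x. f x - (\<Sum>i<n. c i * E i x))) \<longlonglongrightarrow> 0"
      by (rule exI[of _ "\<lambda>i. l2_inner \<mu> (E i) f"])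
  qed
  moreover have "cnj (Q (Q.gs E p) f) = l2_inner \<mu> f (s0 p)" for p
    unfolding Q_gs[OF f] by (rule l2.herm[OF s0_L2 f, symmetric])
  ultimately show ?thesis by (simp add: Q_gs[OF g])
qed

lemma qQ_sums: "f \<in> L2 \<mu> \<Longrightarrow> (\<lambda>p. (cmod (l2_inner \<mu> (s0 p) f))\<^sup>2) sums Q.q f"
proof -
  assume f: "f \<in> L2 \<mu>"
  have "(\<lambda>p. Re (l2_inner \<mu> f (s0 p) * l2_inner \<mu> (s0 p) f)) sums Q.q f"
    unfolding Q.q_def by (intro sums_Re Q_sums f)
  also have "(\<lambda>p. Re (l2_inner \<mu> f (s0 p) * l2_inner \<mu> (s0 p) f)) = (\<lambda>p. (cmod (l2_inner \<mu> (s0 p) f))\<^sup>2)"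
    by (subst l2.herm[OF s0_L2 f]) (simp add: cnj_mult_self del: of_real_power)
  finally show ?thesis .
qed

lemma bessel_s0: "f \<in> L2 \<mu> \<Longrightarrow> (\<Sum>p<N. (cmod (l2_inner \<mu> (s0 p) f))\<^sup>2) \<le> Q.q f"
  using Q.bessel[of E f N] E_L2 by (simp add: Q_gs)

text \<open>Both sides are the trace of the compression to \<open>A\<close>.\<close>

lemma diag_compact:
  assumes A: "compact A" "A \<subseteq> S"
  shows "(\<integral>\<^sup>+x. (\<Sum>p. ennreal ((cmod (s0 p x))\<^sup>2)) * indicator A x \<partial>\<mu>) = ennreal (Re (LINT x:A|\<mu>. K x x))"
proof -
  have Am[measurable]: "A \<in> sets \<mu>" using A by (simp add: sets_mu compact_imp_closed)
  let ?i = "\<lambda>f x. indicator A x * f x :: complex"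
  have iL: "?i (E i) \<in> L2 \<mu>" for i by (intro ind_L2 E_L2 Am)
  have isL: "?i (s0 p) \<in> L2 \<mu>" for p by (intro ind_L2 s0_L2 Am)
  have QA: "l2_inner \<mu> (E i) (compress A T (E i)) = complex_of_real (Q.q (?i (E i)))" for i
  proof -
    have "(\<lambda>x. indicator S x * (indicator A x * E i x)) = ?i (E i)"
      using A(2) by (auto simp: fun_eq_iff split: split_indicator)
    then have "Q (?i (E i)) (?i (E i)) = l2_inner \<mu> (E i) (compress A T (E i))"
      unfolding Q_eq compress_def by (simp add: inner_ind)
    then show ?thesis using Q.B_self[OF iL] by simp
  qed
  have "has_trace \<mu> (compress A T) (LINT x:A|\<mu>. K x x)"
    using diag_norm A by (simp add: diagonal_normalized_def)
  then have "((\<lambda>i. l2_inner \<mu> (snd onb i) (compress A T (snd onb i))) has_sum (LINT x:A|\<mu>. K x x)) (fst onb)"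
    using onb unfolding has_trace_def by blast
  then have "((\<lambda>i. complex_of_real (Q.q (?i (E i)))) has_sum (LINT x:A|\<mu>. K x x)) (fst onb)"
  proof (rule has_sum_cong[THEN iffD1, rotated])
    fix i assume "i \<in> fst onb"
    then have "E i = snd onb i" by (simp add: E_def zero_ext_def)
    then show "l2_inner \<mu> (snd onb i) (compress A T (snd onb i)) = complex_of_real (Q.q (?i (E i)))"
      using QA[of i] by simp
  qed
  then have "((\<lambda>i. complex_of_real (Q.q (?i (E i)))) has_sum (LINT x:A|\<mu>. K x x)) UNIV"
  proof (rule has_sum_cong_neutral[THEN iffD1, rotated -1])
    fix i assume "i \<in> UNIV - fst onb"
    then show "complex_of_real (Q.q (?i (E i))) = 0" 
      by (simp add: E_def zero_ext_def Q.q_def Q.B_zero_right L2_zero)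
  qed auto
  then have "(\<lambda>i. complex_of_real (Q.q (?i (E i)))) sums (LINT x:A|\<mu>. K x x)" by (rule has_sum_imp_sums)
  then have "(\<lambda>i. Re (complex_of_real (Q.q (?i (E i))))) sums Re (LINT x:A|\<mu>. K x x)" by (rule sums_Re)
  then have "(\<lambda>i. Q.q (?i (E i))) sums Re (LINT x:A|\<mu>. K x x)" by simp
  then have t: "(\<Sum>i. ennreal (Q.q (?i (E i)))) = ennreal (Re (LINT x:A|\<mu>. K x x))"
    by (intro suminf_ennreal_eq) (auto intro: Q.q_nonneg iL)
  \<comment> \<open>The same double array can be summed over \<open>i\<close> first, which is
    Parseval for the restriction of \<open>s0 p\<close> to \<open>A\<close>, or over
    \<open>p\<close> first, which is \<open>qQ_sums\<close> for the restriction of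
    \<open>E i\<close>.\<close>
  have sw: "cmod (l2_inner \<mu> (s0 p) (?i (E i))) = cmod (l2_inner \<mu> (E i) (?i (s0 p)))" for p i
    unfolding l2.herm[OF iL[of i] s0_L2[of p]] inner_ind[of "E i"] by simp
  have "(\<integral>\<^sup>+x. (\<Sum>p. ennreal ((cmod (s0 p x))\<^sup>2)) * indicator A x \<partial>\<mu>)
      = (\<integral>\<^sup>+x. (\<Sum>p. ennreal ((cmod (?i (s0 p) x))\<^sup>2)) \<partial>\<mu>)"
  proof (rule nn_integral_cong)
    fix x
    show "(\<Sum>p. ennreal ((cmod (s0 p x))\<^sup>2)) * indicator A x = (\<Sum>p. ennreal ((cmod (?i (s0 p) x))\<^sup>2))"
      by (cases "x \<in> A") simp_all
  qed
  also have "\<dots> = (\<Sum>p. \<integral>\<^sup>+x. ennreal ((cmod (?i (s0 p) x))\<^sup>2) \<partial>\<mu>)"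
    by (rule nn_integral_suminf) measurable
  also have "\<dots> = (\<Sum>p. ennreal (l2.q \<mu> (?i (s0 p))))"
    using L2D(2)[OF isL] by (simp add: nn_integral_eq_integral l2_q)
  also have "\<dots> = (\<Sum>p. \<Sum>i. ennreal ((cmod (l2_inner \<mu> (E i) (?i (s0 p))))\<^sup>2))"
  proof (rule suminf_cong)
    fix p
    show "ennreal (l2.q \<mu> (?i (s0 p))) = (\<Sum>i. ennreal ((cmod (l2_inner \<mu> (E i) (?i (s0 p))))\<^sup>2))"
      unfolding E_def by (rule suminf_ennreal_eq[OF _ parseval[OF onb isL], symmetric]) simp
  qed
  also have "\<dots> = (\<Sum>i. \<Sum>p. ennreal ((cmod (l2_inner \<mu> (s0 p) (?i (E i))))\<^sup>2))"
    unfolding sw by (rule ennreal_suminf_swap)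
  also have "\<dots> = (\<Sum>i. ennreal (Q.q (?i (E i))))"
    by (rule suminf_cong, rule suminf_ennreal_eq[OF _ qQ_sums[OF iL]]) simp
  finally show ?thesis by (simp add: t)
qed

lemma K_diag_meas [measurable]: "(\<lambda>x. K x x) \<in> borel_measurable \<mu>"
proof -
  have "(\<lambda>x. case_prod K (x, x)) \<in> borel_measurable borel"
    by (rule measurable_compose[OF _ K_meas]) measurable
  then show ?thesis by (simp add: measurable_cong_sets[OF sets_mu refl])
qed

text \<open>Closed sets form a generator, and cutting them down to the compact set \<open>S\<close>
  brings them within reach of \<open>diag_compact\<close>; agreement of the integrals then
  identifies the densities.\<close>

lemma diag_AE: "AE x in \<mu>. x \<in> S \<longrightarrow> (\<Sum>p. ennreal ((cmod (s0 p x))\<^sup>2)) = ennreal (Re (K x x))"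
proof -
  let ?f = "\<lambda>x. (\<Sum>p. ennreal ((cmod (s0 p x))\<^sup>2)) * indicator S x"
  let ?g = "\<lambda>x. ennreal (Re (K x x)) * indicator S x"
  have gi: "(\<integral>\<^sup>+x. ennreal (Re (K x x)) * indicator A x \<partial>\<mu>) = ennreal (Re (LINT x:A|\<mu>. K x x))"
    if A: "compact A" for A
  proof -
    have Am[measurable]: "A \<in> sets \<mu>" using A by (simp add: sets_mu compact_imp_closed)
    have si: "integrable \<mu> (\<lambda>x. indicator A x *\<^sub>R K x x)"
      using diag_norm A by (simp add: diagonal_normalized_def set_integrable_def)
    have "AE x in \<mu>. 0 \<le> Re (indicator A x *\<^sub>R K x x)"
      using diag_pos by eventually_elim (auto simp: complex_nonneg_Reals_iff split: split_indicator)
    then have "(\<integral>\<^sup>+x. ennreal (Re (indicator A x *\<^sub>R K x x)) \<partial>\<mu>) = ennreal (LINT x|\<mu>. Re (indicator A x *\<^sub>R K x x))"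
      using si by (intro nn_integral_eq_integral integrable_Re) auto
    also have "(LINT x|\<mu>. Re (indicator A x *\<^sub>R K x x)) = Re (LINT x:A|\<mu>. K x x)"
      unfolding set_lebesgue_integral_def by (rule integral_Re[OF si])
    also have "(\<integral>\<^sup>+x. ennreal (Re (indicator A x *\<^sub>R K x x)) \<partial>\<mu>) = (\<integral>\<^sup>+x. ennreal (Re (K x x)) * indicator A x \<partial>\<mu>)"
      by (intro nn_integral_cong) (auto split: split_indicator)
    finally show ?thesis .
  qed
  have "AE x in \<mu>. ?f x = ?g x"
  proof (rule AE_eq_generator[where G="{A. closed A}"])
    show "Int_stable {A::'a set. closed A}" by (auto simp: Int_stable_def)
    show "sets \<mu> = sigma_sets (space \<mu>) {A. closed A}"
      by (simp add: sets_mu borel_eq_closed)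
    fix A :: "'a set" assume "A \<in> {A. closed A}"
    then have c: "compact (S \<inter> A)" using S by (auto intro: compact_Int_closed)
    have "(\<integral>\<^sup>+x. ?f x * indicator A x \<partial>\<mu>) = (\<integral>\<^sup>+x. (\<Sum>p. ennreal ((cmod (s0 p x))\<^sup>2)) * indicator (S \<inter> A) x \<partial>\<mu>)"
      by (intro nn_integral_cong) (simp only: indicator_inter_arith mult.assoc)
    moreover have "(\<integral>\<^sup>+x. ?g x * indicator A x \<partial>\<mu>) = (\<integral>\<^sup>+x. ennreal (Re (K x x)) * indicator (S \<inter> A) x \<partial>\<mu>)"
      by (intro nn_integral_cong) (simp only: indicator_inter_arith mult.assoc)
    ultimately show "(\<integral>\<^sup>+x. ?f x * indicator A x \<partial>\<mu>) = (\<integral>\<^sup>+x. ?g x * indicator A x \<partial>\<mu>)"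
      by (simp only: diag_compact[OF c Int_lower1] gi[OF c])
  next
    show "(\<integral>\<^sup>+x. ?f x \<partial>\<mu>) \<noteq> \<infinity>" unfolding diag_compact[OF S order_refl] by simp
  qed auto
  then show ?thesis
  proof (rule AE_mp, intro AE_I2 impI)
    fix x assume e: "?f x = ?g x" and x: "x \<in> S"
    show "(\<Sum>p. ennreal ((cmod (s0 p x))\<^sup>2)) = ennreal (Re (K x x))"
      using e unfolding indicator_eq_1_iff[THEN iffD2, OF x] mult_1_right .
  qed
qed

end

lemma summable_prod_l2:
  fixes a b :: "nat \<Rightarrow> complex"
  assumes "summable (\<lambda>p. (cmod (a p))\<^sup>2)" "summable (\<lambda>p. (cmod (b p))\<^sup>2)"
  shows "summable (\<lambda>p. cmod (a p) * cmod (b p))"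
    and "(\<Sum>p<N. cmod (a p) * cmod (b p)) \<le> sqrt (\<Sum>p. (cmod (a p))\<^sup>2) * sqrt (\<Sum>p. (cmod (b p))\<^sup>2)"
proof -
  show "summable (\<lambda>p. cmod (a p) * cmod (b p))"
    by (rule summable_comparison_test[OF _ summable_add[OF assms]])
       (auto intro!: exI[of _ 0] norm_mult_le_squares)
  have "(\<Sum>p<N. cmod (a p) * cmod (b p)) \<le> L2_set (\<lambda>p. cmod (a p)) {..<N} * L2_set (\<lambda>p. cmod (b p)) {..<N}"
    using L2_set_mult_ineq[of "\<lambda>p. cmod (a p)" "\<lambda>p. cmod (b p)" "{..<N}"] by simp
  also have "\<dots> \<le> sqrt (\<Sum>p. (cmod (a p))\<^sup>2) * sqrt (\<Sum>p. (cmod (b p))\<^sup>2)"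
    unfolding L2_set_def
    by (intro mult_mono real_sqrt_le_mono sum_le_suminf assms) (auto intro!: sum_nonneg suminf_nonneg assms)
  finally show "(\<Sum>p<N. cmod (a p) * cmod (b p)) \<le> sqrt (\<Sum>p. (cmod (a p))\<^sup>2) * sqrt (\<Sum>p. (cmod (b p))\<^sup>2)" .
qed

section \<open>The kernel as a pointwise convergent series\<close>

context trace_kernel
begin

definition dens where "dens x = (\<Sum>p. ennreal ((cmod (s0 p x))\<^sup>2))"

definition dom where "dom = {x. dens x \<noteq> \<infinity>}"

text \<open>Setting the vectors to zero on the null set where the diagonal series diverges makes the
  later bounds hold at every point, so that no null sets have to be carried to product
  spaces.\<close>

definition s where "s p x = (if x \<in> dom then s0 p x else 0)"

text \<open>Almost everywhere on \<open>S\<close> this is the square root of the diagonal of K. By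
  Cauchy-Schwarz \<open>bb x * bb y\<close> dominates every partial kernel at (x, y), which makes it
  the majorant in all dominated convergence arguments.\<close>

definition bb where "bb x = sqrt (\<Sum>p. (cmod (s p x))\<^sup>2)"

definition kN where "kN N x y = (\<Sum>p<N. s p x * cnj (s p y))"

definition kk where "kk x y = (\<Sum>p. s p x * cnj (s p y))"

lemma dom_sets [measurable]: "dom \<in> sets \<mu>"
proof -
  have "{x \<in> space \<mu>. dens x \<noteq> \<infinity>} \<in> sets \<mu>" unfolding dens_def by measurable
  then show ?thesis by (simp add: dom_def)
qed

lemma s_meas [measurable]: "s p \<in> borel_measurable \<mu>"
  unfolding s_def[abs_def] by measurable

lemma s0_supp: "x \<notin> S \<Longrightarrow> s0 p x = 0"
  by (simp add: s0_def compress_def)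

lemma s_supp: "x \<notin> S \<Longrightarrow> s p x = 0"
  by (simp add: s_def s0_supp)

lemma dens_supp: "x \<notin> S \<Longrightarrow> dens x = 0"
  unfolding dens_def by (subst s0_supp) simp_all

lemma AE_dom: "AE x in \<mu>. x \<in> dom"
proof (rule AE_mp[OF diag_AE[folded dens_def]], intro AE_I2 impI)
  fix x assume *: "x \<in> S \<longrightarrow> dens x = ennreal (Re (K x x))"
  show "x \<in> dom" by (cases "x \<in> S") (use * in \<open>simp_all add: dom_def dens_supp\<close>)
qed

lemma AE_s: "AE x in \<mu>. s p x = s0 p x"
  using AE_dom by eventually_elim (simp add: s_def)

lemma s_L2: "s p \<in> L2 \<mu>"
proof -
  have "s p = (\<lambda>x. indicator dom x * s0 p x)" by (auto simp: s_def fun_eq_iff)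
  then show ?thesis by (simp add: ind_L2 s0_L2)
qed

lemma inner_s: "f \<in> L2 \<mu> \<Longrightarrow> l2_inner \<mu> f (s p) = l2_inner \<mu> f (s0 p)"
proof -
  assume f: "f \<in> L2 \<mu>"
  note [measurable] = L2D(1)[OF f]
  show ?thesis unfolding l2_inner_def
    by (rule integral_cong_AE) (use AE_s[of p] in \<open>auto elim!: AE_mp\<close>)
qed

lemma inner_s_left: "f \<in> L2 \<mu> \<Longrightarrow> l2_inner \<mu> (s p) f = l2_inner \<mu> (s0 p) f"
  using inner_s[of f p] l2.herm[of f \<mu> "s p"] l2.herm[of f \<mu> "s0 p"] s_L2 s0_L2 by simp

lemma bessel_s: "f \<in> L2 \<mu> \<Longrightarrow> (\<Sum>p<N. (cmod (l2_inner \<mu> (s p) f))\<^sup>2) \<le> Q.q f"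
  using bessel_s0[of f N] by (simp add: inner_s_left)

lemma s_summable: "summable (\<lambda>p. (cmod (s p x))\<^sup>2)"
proof (cases "x \<in> dom")
  case True
  then have "dens x \<noteq> top" by (simp add: dom_def)
  then have "summable (\<lambda>p. (cmod (s0 p x))\<^sup>2)"
    unfolding dens_def by (rule summable_suminf_not_top[rotated]) (rule zero_le_power2)
  then show ?thesis using True by (simp add: s_def)
qed (simp add: s_def)

lemma bb_sq: "(bb x)\<^sup>2 = (\<Sum>p. (cmod (s p x))\<^sup>2)"
  by (simp add: bb_def suminf_nonneg s_summable)

lemma bb_nonneg: "0 \<le> bb x"
  by (simp add: bb_def suminf_nonneg s_summable)

lemma bb_meas [measurable]: "bb \<in> borel_measurable \<mu>"
  unfolding bb_def[abs_def] by measurable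

lemma ennreal_bb: "x \<in> dom \<Longrightarrow> ennreal ((bb x)\<^sup>2) = dens x"
  unfolding bb_sq dens_def using s_summable[of x] by (subst suminf_ennreal2[symmetric]) (simp_all only: s_def if_True zero_le_power2)

lemma bb_integrable: "integrable \<mu> (\<lambda>x. (bb x)\<^sup>2)"
proof (rule integrableI_nonneg)
  have "(\<integral>\<^sup>+x. ennreal ((bb x)\<^sup>2) \<partial>\<mu>) = (\<integral>\<^sup>+x. dens x * indicator S x \<partial>\<mu>)"
  proof (rule nn_integral_cong_AE, rule AE_mp[OF AE_dom], intro AE_I2 impI)
    fix x assume "x \<in> dom"
    then show "ennreal ((bb x)\<^sup>2) = dens x * indicator S x"
      by (cases "x \<in> S") (simp_all add: ennreal_bb dens_supp)
  qed
  also have "\<dots> = ennreal (Re (LINT x:S|\<mu>. K x x))"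
    unfolding dens_def by (rule diag_compact[OF S order_refl])
  finally show "(\<integral>\<^sup>+x. ennreal ((bb x)\<^sup>2) \<partial>\<mu>) < \<infinity>" by simp
qed auto

lemma bb_L2: "(\<lambda>x. complex_of_real (bb x)) \<in> L2 \<mu>"
  using bb_integrable by (simp add: L2_def)

lemma kN_bound: "cmod (kN N x y) \<le> bb x * bb y"
proof -
  have "cmod (kN N x y) \<le> (\<Sum>p<N. cmod (s p x) * cmod (s p y))"
    unfolding kN_def by (intro sum_norm_le) (simp add: norm_mult)
  also have "\<dots> \<le> bb x * bb y"
    unfolding bb_def by (intro summable_prod_l2(2) s_summable)
  finally show ?thesis .
qed

lemma kN_tendsto: "(\<lambda>N. kN N x y) \<longlonglongrightarrow> kk x y"
proof -
  have "summable (\<lambda>p. s p x * cnj (s p y))"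
    by (rule summable_norm_cancel) (simp add: norm_mult summable_prod_l2(1) s_summable)
  then show ?thesis unfolding kN_def[abs_def] kk_def by (rule summable_LIMSEQ)
qed

lemma kk_bound: "cmod (kk x y) \<le> bb x * bb y"
  by (rule LIMSEQ_le_const2[OF tendsto_norm[OF kN_tendsto]]) (auto intro: kN_bound)

lemma kk_diag: "kk x x = complex_of_real ((bb x)\<^sup>2)"
proof -
  have "kk x x = (\<Sum>p. complex_of_real ((cmod (s p x))\<^sup>2))"
    unfolding kk_def by (rule suminf_cong) (metis cnj_mult_self mult.commute)
  also have "\<dots> = complex_of_real ((bb x)\<^sup>2)"
    unfolding bb_sq by (rule suminf_of_real[OF s_summable, symmetric])
  finally show ?thesis .
qed

text \<open>The diagonal is in general a null set of the product measure, so the identity off the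
  diagonal says nothing here. This one rests on the trace normalisation, and it is the one seen by
  the fixed points of permutations.\<close>

lemma K_diag_eq: "AE x in \<mu>. x \<in> S \<longrightarrow> K x x = kk x x"
  using diag_AE[folded dens_def] AE_dom diag_pos
proof eventually_elim
  case (elim x)
  show ?case
  proof
    assume x: "x \<in> S"
    have "ennreal ((bb x)\<^sup>2) = ennreal (Re (K x x))" using elim x by (simp add: ennreal_bb)
    moreover have "0 \<le> Re (K x x)" "Im (K x x) = 0" using elim(3) by (auto simp: complex_nonneg_Reals_iff)
    ultimately show "K x x = kk x x" by (simp add: kk_diag complex_eq_iff)
  qed
qed

lemma K_meas_mu [measurable]: "(\<lambda>z. K (fst z) (snd z)) \<in> borel_measurable (\<mu> \<Otimes>\<^sub>M \<mu>)"
proof -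
  have "sets (\<mu> \<Otimes>\<^sub>M \<mu>) = sets (borel \<Otimes>\<^sub>M borel)" by (intro sets_pair_measure_cong sets_mu)
  moreover have "(\<lambda>z. K (fst z) (snd z)) \<in> borel_measurable (borel \<Otimes>\<^sub>M borel)"
    using K_meas by (simp add: case_prod_beta')
  ultimately show ?thesis using measurable_cong_sets by blast
qed

lemma kN_meas [measurable]: "(\<lambda>z. kN N (fst z) (snd z)) \<in> borel_measurable (\<mu> \<Otimes>\<^sub>M \<mu>)"
  unfolding kN_def by measurable

lemma kk_meas [measurable]: "(\<lambda>z. kk (fst z) (snd z)) \<in> borel_measurable (\<mu> \<Otimes>\<^sub>M \<mu>)"
  unfolding kk_def by measurable

text \<open>Both kernels represent the form Q on pairs of indicators, hence have equal integrals
  over rectangles. The bound \<open>m\<close> on the row integrals makes K integrable on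
  \<open>C\<close> times \<open>D\<close>, which boundedness of the operator alone does not
  give.\<close>

lemma kernel_eq_on:
  assumes C: "C \<in> sets \<mu>" "emeasure \<mu> C < \<infinity>" "C \<subseteq> S" and D: "D \<in> sets \<mu>" "emeasure \<mu> D < \<infinity>" "D \<subseteq> S"
    and m: "\<And>x. x \<in> C \<Longrightarrow> (\<integral>\<^sup>+y. ennreal (cmod (K x y)) * indicator D y \<partial>\<mu>) \<le> ennreal m"
  shows "AE z in \<mu> \<Otimes>\<^sub>M \<mu>. fst z \<in> C \<longrightarrow> snd z \<in> D \<longrightarrow> K (fst z) (snd z) = kk (fst z) (snd z)"
proof -
  interpret M: sigma_finite_measure \<mu> by (rule sigma_fin)
  interpret P: pair_sigma_finite \<mu> \<mu> by (intro pair_sigma_finite.intro sigma_fin)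
  note [measurable] = C(1) D(1)
  have ind: "(indicator A :: _ \<Rightarrow> complex) \<in> L2 \<mu>" if "A \<in> sets \<mu>" "emeasure \<mu> A < \<infinity>" for A
  proof -
    have "(\<lambda>x. (cmod (indicator A x))\<^sup>2) = (indicator A :: _ \<Rightarrow> real)" by (auto simp: fun_eq_iff split: split_indicator)
    moreover have "integrable \<mu> (indicator A :: _ \<Rightarrow> real)" using that by simp
    ultimately show ?thesis using that by (simp add: L2_def)
  qed
  define f where "f z = (indicator C (fst z) * indicator D (snd z) :: complex)" for z :: "'a \<times> 'a"
  define h1 where "h1 z = f z * K (fst z) (snd z)" for z
  define h2 where "h2 z = f z * kk (fst z) (snd z)" for z
  define h2N where "h2N N z = f z * kN N (fst z) (snd z)" for N z
  have [measurable]: "f \<in> borel_measurable (\<mu> \<Otimes>\<^sub>M \<mu>)" unfolding f_def[abs_def] by measurable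
  have [measurable]: "h1 \<in> borel_measurable (\<mu> \<Otimes>\<^sub>M \<mu>)" unfolding h1_def[abs_def] by measurable
  have [measurable]: "h2 \<in> borel_measurable (\<mu> \<Otimes>\<^sub>M \<mu>)" unfolding h2_def[abs_def] by measurable
  have [measurable]: "h2N N \<in> borel_measurable (\<mu> \<Otimes>\<^sub>M \<mu>)" for N unfolding h2N_def[abs_def] by measurable
  have i1: "integrable (\<mu> \<Otimes>\<^sub>M \<mu>) h1"
  proof (rule integrableI_bounded)
    have "(\<integral>\<^sup>+z. ennreal (norm (h1 z)) \<partial>(\<mu> \<Otimes>\<^sub>M \<mu>)) = (\<integral>\<^sup>+x. \<integral>\<^sup>+y. ennreal (norm (h1 (x, y))) \<partial>\<mu> \<partial>\<mu>)"
      by (rule M.nn_integral_fst[symmetric]) measurable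
    also have "\<dots> \<le> (\<integral>\<^sup>+x. ennreal m * indicator C x \<partial>\<mu>)"
    proof (rule nn_integral_mono)
      fix x
      have "(\<integral>\<^sup>+y. ennreal (norm (h1 (x, y))) \<partial>\<mu>) = indicator C x * (\<integral>\<^sup>+y. ennreal (cmod (K x y)) * indicator D y \<partial>\<mu>)"
      proof (cases "x \<in> C")
        case True
        then have "(\<integral>\<^sup>+y. ennreal (norm (h1 (x, y))) \<partial>\<mu>) = (\<integral>\<^sup>+y. ennreal (cmod (K x y)) * indicator D y \<partial>\<mu>)"
          by (intro nn_integral_cong) (simp add: h1_def f_def split: split_indicator)
        then show ?thesis using True by simp
      qed (simp add: h1_def f_def)
      also have "\<dots> \<le> ennreal m * indicator C x"
        by (cases "x \<in> C") (use m in auto)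
      finally show "(\<integral>\<^sup>+y. ennreal (norm (h1 (x, y))) \<partial>\<mu>) \<le> ennreal m * indicator C x" .
    qed
    also have "\<dots> < \<infinity>" using C by (simp add: nn_integral_cmult ennreal_mult_less_top)
    finally show "(\<integral>\<^sup>+z. ennreal (norm (h1 z)) \<partial>(\<mu> \<Otimes>\<^sub>M \<mu>)) < \<infinity>" .
  qed measurable
  \<comment> \<open>\<open>bb\<close> lies in \<open>L2\<close>, hence is integrable on sets of
    finite measure; \<open>w\<close> therefore dominates all truncations by an integrable
    function.\<close>
  define w where "w z = (indicator C (fst z) * complex_of_real (bb (fst z))) * (indicator D (snd z) * complex_of_real (bb (snd z)))"
    for z :: "'a \<times> 'a"
  have iw: "integrable (\<mu> \<Otimes>\<^sub>M \<mu>) w"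
    unfolding w_def[abs_def]
    by (rule pair_product_integral(1)) (intro sigma_fin L2_mult_integrable(2) ind bb_L2 C D)+
  have wb: "norm (h2N N z) \<le> norm (w z)" "norm (h2 z) \<le> norm (w z)" for N z
    using kN_bound[of N "fst z" "snd z"] kk_bound[of "fst z" "snd z"] bb_nonneg
    by (auto simp: h2N_def h2_def w_def f_def norm_mult split: split_indicator)
  have i2: "integrable (\<mu> \<Otimes>\<^sub>M \<mu>) h2"
    by (rule Bochner_Integration.integrable_bound[OF iw]) (auto simp: wb)
  have "AE z in \<mu> \<Otimes>\<^sub>M \<mu>. h1 z - h2 z = 0"
  proof (rule AE_zero_generator[where G="{a \<times> b | a b. a \<in> sets \<mu> \<and> b \<in> sets \<mu>}"])
    show "integrable (\<mu> \<Otimes>\<^sub>M \<mu>) (\<lambda>z. h1 z - h2 z)" using i1 i2 by simp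
    show "Int_stable {a \<times> b |a b. a \<in> sets \<mu> \<and> b \<in> sets \<mu>}" by (rule Int_stable_pair_measure_generator)
    show "sets (\<mu> \<Otimes>\<^sub>M \<mu>) = sigma_sets (space (\<mu> \<Otimes>\<^sub>M \<mu>)) {a \<times> b |a b. a \<in> sets \<mu> \<and> b \<in> sets \<mu>}"
      by (simp add: sets_pair_measure space_pair_measure)
    show "space (\<mu> \<Otimes>\<^sub>M \<mu>) \<in> {a \<times> b |a b. a \<in> sets \<mu> \<and> b \<in> sets \<mu>}"
      unfolding space_pair_measure by blast
    fix A assume "A \<in> {a \<times> b |a b. a \<in> sets \<mu> \<and> b \<in> sets \<mu>}"
    then obtain a b where A: "A = a \<times> b" and ab [measurable]: "a \<in> sets \<mu>" "b \<in> sets \<mu>" by auto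
    have [measurable]: "A \<in> sets (\<mu> \<Otimes>\<^sub>M \<mu>)" unfolding A by simp
    define u v :: "'a \<Rightarrow> complex" where "u = indicator (a \<inter> C)" and "v = indicator (b \<inter> D)"
    have "emeasure \<mu> (a \<inter> C) < \<infinity>" "emeasure \<mu> (b \<inter> D) < \<infinity>"
      using emeasure_mono[of "a \<inter> C" C \<mu>] emeasure_mono[of "b \<inter> D" D \<mu>] C D by (auto simp: order_le_less_trans)
    then have uv: "u \<in> L2 \<mu>" "v \<in> L2 \<mu>" unfolding u_def v_def by (auto intro!: ind)
    have su: "indicator S x * u x = u x" "indicator S x * v x = v x" for x
      using C(3) D(3) by (auto simp: u_def v_def split: split_indicator)
    have e: "indicator A z *\<^sub>R (f z * c) = u (fst z) * (c * v (snd z))" for z c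
      by (cases z) (auto simp: A f_def u_def v_def split: split_indicator)
    have I1: "integrable (\<mu> \<Otimes>\<^sub>M \<mu>) (\<lambda>z. u (fst z) * (K (fst z) (snd z) * v (snd z)))"
      using integrable_mult_indicator[OF \<open>A \<in> sets (\<mu> \<Otimes>\<^sub>M \<mu>)\<close> i1] by (simp only: h1_def e)
    have "(LINT z|(\<mu> \<Otimes>\<^sub>M \<mu>). indicator A z *\<^sub>R h1 z) = (LINT z|(\<mu> \<Otimes>\<^sub>M \<mu>). u (fst z) * (K (fst z) (snd z) * v (snd z)))"
      unfolding h1_def e ..
    also have "\<dots> = (LINT x|\<mu>. LINT y|\<mu>. u x * (K x y * v y))"
      using P.integral_fst'[OF I1] by simp
    also have "\<dots> = Q u v"
      unfolding Q_integral su by (simp add: u_def)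
    finally have H1: "(LINT z|(\<mu> \<Otimes>\<^sub>M \<mu>). indicator A z *\<^sub>R h1 z) = Q u v" .
    have "(\<lambda>N. LINT z|(\<mu> \<Otimes>\<^sub>M \<mu>). indicator A z *\<^sub>R h2N N z) \<longlonglongrightarrow> (LINT z|(\<mu> \<Otimes>\<^sub>M \<mu>). indicator A z *\<^sub>R h2 z)"
    proof (rule integral_dominated_convergence[where w="\<lambda>z. norm (w z)"])
      show "AE z in \<mu> \<Otimes>\<^sub>M \<mu>. (\<lambda>N. indicator A z *\<^sub>R h2N N z) \<longlonglongrightarrow> indicator A z *\<^sub>R h2 z"
        unfolding h2N_def h2_def by (intro AE_I2 tendsto_intros kN_tendsto)
      show "AE z in \<mu> \<Otimes>\<^sub>M \<mu>. norm (indicator A z *\<^sub>R h2N N z) \<le> norm (w z)" for N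
        using wb(1)[of N] by (intro AE_I2) (auto split: split_indicator)
    qed (use iw in auto)
    moreover have "(LINT z|(\<mu> \<Otimes>\<^sub>M \<mu>). indicator A z *\<^sub>R h2N N z) = (\<Sum>p<N. l2_inner \<mu> u (s0 p) * l2_inner \<mu> (s0 p) v)" for N
    proof -
      have ip: "integrable \<mu> (\<lambda>x. u x * s p x)" "integrable \<mu> (\<lambda>y. cnj (s p y) * v y)" for p
        by (intro L2_mult_integrable uv s_L2)+
      have "(LINT z|(\<mu> \<Otimes>\<^sub>M \<mu>). indicator A z *\<^sub>R h2N N z)
         = (LINT z|(\<mu> \<Otimes>\<^sub>M \<mu>). (\<Sum>p<N. (u (fst z) * s p (fst z)) * (cnj (s p (snd z)) * v (snd z))))"
        unfolding h2N_def e by (simp add: kN_def sum_distrib_left sum_distrib_right mult_ac)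
      also have "\<dots> = (\<Sum>p<N. LINT z|(\<mu> \<Otimes>\<^sub>M \<mu>). (u (fst z) * s p (fst z)) * (cnj (s p (snd z)) * v (snd z)))"
        by (intro Bochner_Integration.integral_sum pair_product_integral(1)[OF sigma_fin sigma_fin ip])
      also have "\<dots> = (\<Sum>p<N. (LINT x|\<mu>. u x * s p x) * (LINT y|\<mu>. cnj (s p y) * v y))"
        by (intro sum.cong refl pair_product_integral(2)[OF sigma_fin sigma_fin ip])
      also have "\<dots> = (\<Sum>p<N. l2_inner \<mu> u (s0 p) * l2_inner \<mu> (s0 p) v)"
      proof -
        have "cnj (u x) = u x" for x by (simp add: u_def)
        then have "(LINT x|\<mu>. u x * s p x) = l2_inner \<mu> u (s0 p)" for p
          using inner_s[OF uv(1), of p] by (simp add: l2_inner_def)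
        moreover have "(LINT y|\<mu>. cnj (s p y) * v y) = l2_inner \<mu> (s0 p) v" for p
          using inner_s_left[OF uv(2), of p] by (simp add: l2_inner_def)
        ultimately show ?thesis by simp
      qed
      finally show ?thesis .
    qed
    ultimately have "(\<lambda>N. \<Sum>p<N. l2_inner \<mu> u (s0 p) * l2_inner \<mu> (s0 p) v) \<longlonglongrightarrow> (LINT z|(\<mu> \<Otimes>\<^sub>M \<mu>). indicator A z *\<^sub>R h2 z)"
      by simp
    then have H2: "(LINT z|(\<mu> \<Otimes>\<^sub>M \<mu>). indicator A z *\<^sub>R h2 z) = Q u v"
      using Q_sums[OF uv] unfolding sums_def by (rule LIMSEQ_unique)
    have "(LINT z|(\<mu> \<Otimes>\<^sub>M \<mu>). indicator A z *\<^sub>R (h1 z - h2 z))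
      = (LINT z|(\<mu> \<Otimes>\<^sub>M \<mu>). indicator A z *\<^sub>R h1 z) - (LINT z|(\<mu> \<Otimes>\<^sub>M \<mu>). indicator A z *\<^sub>R h2 z)"
      unfolding scaleR_diff_right by (intro Bochner_Integration.integral_diff integrable_mult_indicator i1 i2) simp_all
    then show "(LINT z|(\<mu> \<Otimes>\<^sub>M \<mu>). indicator A z *\<^sub>R (h1 z - h2 z)) = 0" by (simp add: H1 H2)
  qed (use sets.space_closed in \<open>auto simp: space_pair_measure\<close>)
  then show ?thesis
    by (rule AE_mp) (auto intro!: AE_I2 simp: h1_def h2_def f_def)
qed

text \<open>Almost every row of K is integrable over a set of finite measure. Sublevel sets of the
  row integral, inside an exhaustion of \<open>S\<close> by sets of finite measure, cover almost all
  pairs by rectangles to which \<open>kernel_eq_on\<close> applies.\<close>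

lemma K_offdiag_eq: "AE z in \<mu> \<Otimes>\<^sub>M \<mu>. fst z \<in> S \<longrightarrow> snd z \<in> S \<longrightarrow> K (fst z) (snd z) = kk (fst z) (snd z)"
proof -
  interpret M: sigma_finite_measure \<mu> by (rule sigma_fin)
  interpret P: pair_sigma_finite \<mu> \<mu> by (intro pair_sigma_finite.intro sigma_fin)
  obtain A where A: "range A \<subseteq> sets \<mu>" "(\<Union>i. A i) = space \<mu>" "\<And>i. emeasure \<mu> (A i) \<noteq> \<infinity>" "incseq A"
    using M.sigma_finite_incseq by blast
  define D where "D n = A n \<inter> S" for n :: nat
  have Dm[measurable]: "D n \<in> sets \<mu>" for n using A(1) by (auto simp: D_def)
  have Df: "emeasure \<mu> (D n) < \<infinity>" for n
    using emeasure_mono[of "D n" "A n" \<mu>] A by (auto simp: D_def less_top[symmetric] top_unique)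
  have Dind: "(indicator (D n) :: _ \<Rightarrow> complex) \<in> L2 \<mu>" for n
  proof -
    have "(\<lambda>x. (cmod (indicator (D n) x))\<^sup>2) = (indicator (D n) :: _ \<Rightarrow> real)" by (auto simp: fun_eq_iff split: split_indicator)
    moreover have "integrable \<mu> (indicator (D n) :: _ \<Rightarrow> real)" using Df[of n] by simp
    ultimately show ?thesis by (simp add: L2_def)
  qed
  define J where "J n x = (\<integral>\<^sup>+y. ennreal (cmod (K x y)) * indicator (D n) y \<partial>\<mu>)" for n x
  have Jm[measurable]: "J n \<in> borel_measurable \<mu>" for n
  proof -
    have "(\<lambda>z. ennreal (cmod (K (fst z) (snd z))) * indicator (D n) (snd z)) \<in> borel_measurable (\<mu> \<Otimes>\<^sub>M \<mu>)" by measurable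
    from M.borel_measurable_nn_integral_fst[OF this] show ?thesis by (simp add: J_def[abs_def])
  qed
  have Jfin: "AE x in \<mu>. J n x < \<infinity>" for n
  proof -
    have "AE x in \<mu>. integrable \<mu> (\<lambda>y. K x y * indicator (D n) y)"
      using bounded_op Dind[of n] by (auto simp: bounded_integral_operator_def)
    then show ?thesis
    proof eventually_elim
      case (elim x)
      have "J n x = (\<integral>\<^sup>+y. ennreal (norm (K x y * indicator (D n) y)) \<partial>\<mu>)"
        unfolding J_def by (intro nn_integral_cong) (auto simp: norm_mult split: split_indicator)
      also have "\<dots> < \<infinity>" using elim by (simp add: integrable_iff_bounded)
      finally show ?case .
    qed
  qed
  define C where "C n m = {x \<in> space \<mu>. J n x \<le> ennreal (real m)} \<inter> D n" for n m :: nat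
  have Cm[measurable]: "C n m \<in> sets \<mu>" for n m unfolding C_def by measurable
  have CD: "C n m \<subseteq> D n" for n m by (auto simp: C_def)
  have "AE z in \<mu> \<Otimes>\<^sub>M \<mu>. fst z \<in> C n m \<longrightarrow> snd z \<in> D n \<longrightarrow> K (fst z) (snd z) = kk (fst z) (snd z)" for n m
  proof (rule kernel_eq_on)
    show "emeasure \<mu> (C n m) < \<infinity>" using emeasure_mono[OF CD Dm] Df[of n] order_le_less_trans by blast
    show "(\<integral>\<^sup>+y. ennreal (cmod (K x y)) * indicator (D n) y \<partial>\<mu>) \<le> ennreal (real m)" if "x \<in> C n m" for x
      using that by (simp add: C_def J_def)
    show "D n \<subseteq> S" "C n m \<subseteq> S" using CD[of n m] by (auto simp: D_def)
  qed (fact Cm Dm Df)+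
  then have all: "AE z in \<mu> \<Otimes>\<^sub>M \<mu>. \<forall>n m. fst z \<in> C n m \<longrightarrow> snd z \<in> D n \<longrightarrow> K (fst z) (snd z) = kk (fst z) (snd z)"
    unfolding AE_all_countable by blast
  have "AE x in \<mu>. \<forall>n. J n x < \<infinity>" using Jfin by (simp add: AE_all_countable)
  then have fin: "AE z in \<mu> \<Otimes>\<^sub>M \<mu>. \<forall>n. J n (fst z) < \<infinity>"
  proof -
    assume "AE x in \<mu>. \<forall>n. J n x < \<infinity>"
    then have "AE x in \<mu>. AE y in \<mu>. \<forall>n. J n (fst (x, y)) < \<infinity>" by eventually_elim simp
    then show ?thesis by (intro P.AE_pair_measure) auto
  qed
  from all fin show ?thesis
  proof eventually_elim
    case (elim z)
    show ?case
    proof (intro impI)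
      assume z: "fst z \<in> S" "snd z \<in> S"
      have "fst z \<in> (\<Union>i. A i)" "snd z \<in> (\<Union>i. A i)" unfolding A(2) by simp_all
      then obtain i j where "fst z \<in> A i" "snd z \<in> A j" by blast
      then have "fst z \<in> D (max i j)" "snd z \<in> D (max i j)"
        using z incseqD[OF A(4), of i "max i j"] incseqD[OF A(4), of j "max i j"] by (auto simp: D_def)
      moreover obtain m where "J (max i j) (fst z) \<le> ennreal (real m)"
      proof -
        have "J (max i j) (fst z) < \<infinity>" using elim by blast
        then obtain r where "J (max i j) (fst z) = ennreal r" "0 \<le> r" by (cases "J (max i j) (fst z)") auto
        moreover obtain m :: nat where "r \<le> real m" using real_arch_simple by blast
        ultimately show ?thesis using that by (simp add: ennreal_leI)
      qed
      ultimately have "fst z \<in> C (max i j) m" by (simp add: C_def)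
      then show "K (fst z) (snd z) = kk (fst z) (snd z)" using elim \<open>snd z \<in> D (max i j)\<close> by blast
    qed
  qed
qed

end

section \<open>A recursion for alpha-determinants\<close>

text \<open>Counts cycles relative to an arbitrary finite set so that points can be added one at a
  time; on \<open>{..<n}\<close> it is \<open>num_cycles\<close>.\<close>

definition cyc :: "nat set \<Rightarrow> (nat \<Rightarrow> nat) \<Rightarrow> nat" where
  "cyc S \<sigma> = card (orbit \<sigma> ` S)"

lemma cyc_le: "finite S \<Longrightarrow> cyc S \<sigma> \<le> card S"
  unfolding cyc_def by (rule card_image_le)

lemma orbit_step_mem: "y \<in> orbit p x \<Longrightarrow> p y \<in> orbit p x"
  by (rule orbit.step)

lemma cyc_insert_fixed:
  assumes S: "finite S" "a \<notin> S" and q: "q permutes S"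
  shows "cyc (insert a S) q = Suc (cyc S q)"
proof -
  have "q a = a" using q S by (simp add: permutes_def)
  then have oa: "orbit q a = {a}" by (simp add: orbit_eq_singleton_iff)
  have "orbit q a \<notin> orbit q ` S"
  proof
    assume "orbit q a \<in> orbit q ` S"
    then obtain x where x: "x \<in> S" "orbit q x = {a}" using oa by auto
    have "q x \<in> orbit q x" by (rule orbit.base)
    then show False using x q S(2) by (auto dest: permutes_in_image)
  qed
  then show ?thesis using S by (simp add: cyc_def)
qed

text \<open>Composing with the transposition threads \<open>a\<close> into a cycle, between
  \<open>b\<close> and its predecessor \<open>c\<close>. Intersecting with \<open>S\<close> deletes
  \<open>a\<close> again and is a bijection between the two sets of orbits.\<close>

lemma cyc_insert_transpose:
  assumes S: "finite S" "a \<notin> S" and q: "q permutes S" and b: "b \<in> S"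
  shows "cyc (insert a S) (Transposition.transpose a b \<circ> q) = cyc S q"
proof -
  define p where "p = Transposition.transpose a b \<circ> q"
  define c where "c = inv q b"
  have qc: "q c = b" unfolding c_def using permutes_inverses(1)[OF q] by simp
  have cS: "c \<in> S" using q b qc by (metis permutes_in_image)
  have qa: "q a = a" using q S by (simp add: permutes_def)
  have pa: "p a = b" by (simp add: p_def qa)
  have pc: "p c = a" by (simp add: p_def qc)
  have qS: "q x \<in> S" if "x \<in> S" for x using that q by (simp add: permutes_in_image)
  have px: "p x = q x" if "x \<in> S" "x \<noteq> c" for x
  proof -
    have "q x \<noteq> b" using qc that permutes_inj[OF q] by (metis injD)
    moreover have "q x \<noteq> a" using qS[OF that(1)] S by auto
    ultimately show ?thesis by (simp add: p_def transpose_apply_other)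
  qed
  have perm_q: "permutation q" using q S(1) by (rule permutation_permutes[THEN iffD2, OF exI, OF conjI, rotated])
  have pperm: "p permutes insert a S"
    unfolding p_def using b q by (intro permutes_compose permutes_swap_id) (auto intro: permutes_subset)
  have perm_p: "permutation p" using pperm S(1) unfolding permutation_permutes by blast
  \<comment> \<open>Once the orbit of \<open>p\<close> reaches \<open>a\<close>, the induction has
    to remember that it came through \<open>c\<close>; the step from \<open>a\<close> to
    \<open>b\<close> is then the step of \<open>q\<close> from \<open>c\<close>.\<close>
  have sub1: "y \<in> insert a S \<and> (y \<in> S \<longrightarrow> y \<in> orbit q x) \<and> (y = a \<longrightarrow> c \<in> orbit q x)" if x: "x \<in> S" and y: "y \<in> orbit p x" for x y
    using y
  proof induction
    case base
    show ?case
    proof (cases "x = c")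
      case True
      then show ?thesis using permutation_self_in_orbit[OF perm_q, of c] S pc by auto
    next
      case False
      then show ?thesis using px[OF x False] qS[OF x] S by (auto intro: orbit.base)
    qed
  next
    case (step y)
    consider "y = a" | "y = c" | "y \<in> S" "y \<noteq> c" using step by auto
    then show ?case
    proof cases
      case 1
      then have "c \<in> orbit q x" using step by auto
      then have "b \<in> orbit q x" using orbit_step_mem qc by metis
      then show ?thesis using 1 pa b S by auto
    next
      case 2
      then show ?thesis using step pc cS S by auto
    next
      case 3
      then have "q y \<in> orbit q x" using step by (intro orbit.step) auto
      then show ?thesis using 3 px[of y] qS[of y] S by auto
    qed
  qed
  have sub2: "y \<in> orbit p x \<and> y \<in> S" if x: "x \<in> S" and y: "y \<in> orbit q x" for x y
    using y
  proof induction
    case base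
    show ?case
    proof (cases "x = c")
      case True
      have "p (p c) \<in> orbit p c" by (intro orbit.step orbit.base)
      then show ?thesis using True pa pc qc b by simp
    next
      case False
      then show ?thesis using px[OF x False] qS[OF x] orbit.base[of p x] by simp
    qed
  next
    case (step y)
    show ?case
    proof (cases "y = c")
      case True
      have "p (p y) \<in> orbit p x" using step by (intro orbit.step) auto
      then show ?thesis using True pa pc qc b by simp
    next
      case False
      have "p y \<in> orbit p x" using step by (intro orbit.step) auto
      then show ?thesis using False step px qS by auto
    qed
  qed
  have eq: "orbit p x \<inter> S = orbit q x" if "x \<in> S" for x
    using sub1[OF that] sub2[OF that] by auto
  have "orbit p a = orbit p b"
  proof -
    have "b \<in> orbit p a" using orbit.base[of p a] pa by simp
    then show ?thesis using orbit_cyclic_eq3[OF cyclic_on_orbit[OF pperm finite.insertI[OF S(1)]], of b a] by simp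
  qed
  then have im: "orbit p ` insert a S = orbit p ` S" using b by auto
  \<comment> \<open>Orbits with the same nonempty intersection with \<open>S\<close> share a point,
    and orbits of a permutation are equal or disjoint.\<close>
  have "inj_on (\<lambda>X. X \<inter> S) (orbit p ` S)"
  proof (rule inj_onI)
    fix X Y assume "X \<in> orbit p ` S" "Y \<in> orbit p ` S" and XY: "X \<inter> S = Y \<inter> S"
    then obtain x y where x: "x \<in> S" "X = orbit p x" and y: "y \<in> S" "Y = orbit p y" by auto
    have "y \<in> Y" using y permutation_self_in_orbit[OF perm_p] by simp
    then have "y \<in> orbit p x" using XY x y by auto
    then show "X = Y" using orbit_cyclic_eq3[OF cyclic_on_orbit[OF pperm finite.insertI[OF S(1)]], of y x] x y by simp
  qed
  then have "card (orbit p ` S) = card ((\<lambda>X. X \<inter> S) ` orbit p ` S)" by (rule card_image[symmetric])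
  also have "(\<lambda>X. X \<inter> S) ` orbit p ` S = orbit q ` S" using eq by (auto simp: image_image)
  finally show ?thesis unfolding cyc_def p_def[symmetric] im .
qed

definition mm :: "nat \<Rightarrow> (nat \<Rightarrow> nat \<Rightarrow> complex) \<Rightarrow> (nat \<Rightarrow> nat \<Rightarrow> complex) \<Rightarrow> nat \<Rightarrow> nat \<Rightarrow> complex" where
  "mm N A C i j = (\<Sum>l<N. A i l * C l j)"

definition mtr :: "nat \<Rightarrow> (nat \<Rightarrow> nat \<Rightarrow> complex) \<Rightarrow> complex" where
  "mtr N A = (\<Sum>l<N. A l l)"

text \<open>The alpha-determinant integrated against counting measure on \<open>{..<N}\<close>, with a separate
  kernel \<open>k i\<close> leaving each vertex \<open>i\<close>.\<close>

definition cyc_sum :: "complex \<Rightarrow> nat \<Rightarrow> nat set \<Rightarrow> (nat \<Rightarrow> nat \<Rightarrow> nat \<Rightarrow> complex) \<Rightarrow> complex" where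
  "cyc_sum \<alpha> N S k = (\<Sum>\<sigma> | \<sigma> permutes S. \<alpha> ^ (card S - cyc S \<sigma>) *
      (\<Sum>m\<in>PiE S (\<lambda>_. {..<N}). \<Prod>i\<in>S. k i (m i) (m (\<sigma> i))))"

lemma sum_PiE_insert:
  fixes f :: "(nat \<Rightarrow> nat) \<Rightarrow> complex"
  assumes "a \<notin> S"
  shows "(\<Sum>m\<in>PiE (insert a S) (\<lambda>_. {..<N}). f m) = (\<Sum>m\<in>PiE S (\<lambda>_. {..<N}). \<Sum>l<N. f (m(a := l)))"
proof -
  have "(\<Sum>m\<in>PiE (insert a S) (\<lambda>_. {..<N}). f m) = (\<Sum>(l, m)\<in>{..<N} \<times> PiE S (\<lambda>_. {..<N}). f (m(a := l)))"
    unfolding PiE_insert_eq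
    by (subst sum.reindex) (use inj_combinator[OF assms, of "\<lambda>_. {..<N}"] in \<open>auto simp: case_prod_beta intro!: sum.cong\<close>)
  also have "\<dots> = (\<Sum>l<N. \<Sum>m\<in>PiE S (\<lambda>_. {..<N}). f (m(a := l)))" by (rule sum.cartesian_product[symmetric])
  also have "\<dots> = (\<Sum>m\<in>PiE S (\<lambda>_. {..<N}). \<Sum>l<N. f (m(a := l)))" by (rule sum.swap)
  finally show ?thesis .
qed

text \<open>Expansion along the vertex \<open>a\<close>. Either \<open>a\<close> is a fixed point
  and splits off a trace, or it is cut out of its cycle: summing over its label multiplies the
  kernel of the predecessor \<open>c\<close> by that of \<open>a\<close>. In the second case one
  factor \<alpha> appears, because the cardinality drops while the number of cycles does
  not.\<close>

lemma cyc_sum_insert: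
  assumes S: "finite S" "a \<notin> S"
  shows "cyc_sum \<alpha> N (insert a S) k = mtr N (k a) * cyc_sum \<alpha> N S k
     + \<alpha> * (\<Sum>c\<in>S. cyc_sum \<alpha> N S (k(c := mm N (k c) (k a))))"
proof -
  let ?P = "\<lambda>S. PiE S (\<lambda>_. {..<N})"
  define F where "F \<sigma> = \<alpha> ^ (card (insert a S) - cyc (insert a S) \<sigma>) *
      (\<Sum>m\<in>?P (insert a S). \<Prod>i\<in>insert a S. k i (m i) (m (\<sigma> i)))" for \<sigma>
  define w where "w q k = \<alpha> ^ (card S - cyc S q) * (\<Sum>m\<in>?P S. \<Prod>i\<in>S. k i (m i) (m (q i)))"
    for q and k :: "nat \<Rightarrow> nat \<Rightarrow> nat \<Rightarrow> complex"
  have ne: "q i \<noteq> a" if "q permutes S" "i \<in> S" for q i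
    using that S by (auto dest: permutes_in_image)
  have Fa: "F q = mtr N (k a) * w q k" if q: "q permutes S" for q
  proof -
    have qa: "q a = a" using q S by (simp add: permutes_def)
    have "(\<Sum>m\<in>?P (insert a S). \<Prod>i\<in>insert a S. k i (m i) (m (q i)))
       = (\<Sum>m\<in>?P S. \<Sum>l<N. k a l l * (\<Prod>i\<in>S. k i (m i) (m (q i))))"
      unfolding sum_PiE_insert[OF S(2)] 
    proof (intro sum.cong refl)
      fix m l
      have "(\<Prod>i\<in>S. k i ((m(a := l)) i) ((m(a := l)) (q i))) = (\<Prod>i\<in>S. k i (m i) (m (q i)))"
        using S(2) ne[OF q] by (intro prod.cong refl) auto
      then show "(\<Prod>i\<in>insert a S. k i ((m(a := l)) i) ((m(a := l)) (q i))) = k a l l * (\<Prod>i\<in>S. k i (m i) (m (q i)))"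
        using S by (simp add: qa)
    qed
    also have "\<dots> = mtr N (k a) * (\<Sum>m\<in>?P S. \<Prod>i\<in>S. k i (m i) (m (q i)))"
      by (simp add: mtr_def sum_distrib_left sum_distrib_right)
    finally show ?thesis
      unfolding F_def w_def using S by (simp add: cyc_insert_fixed[OF S q])
  qed
  have Fb: "F (Transposition.transpose a (q c) \<circ> q) = \<alpha> * w q (k(c := mm N (k c) (k a)))" if q: "q permutes S" and c: "c \<in> S" for q c
  proof -
    let ?p = "Transposition.transpose a (q c) \<circ> q"
    have qc: "q c \<in> S" using q c by (simp add: permutes_in_image)
    have qa: "q a = a" using q S by (simp add: permutes_def)
    have pa: "?p a = q c" by (simp add: qa)
    have pc: "?p c = a" by simp
    have px: "?p x = q x" if "x \<in> S" "x \<noteq> c" for x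
    proof -
      have "q x \<noteq> q c" using that permutes_inj[OF q] by (metis injD)
      then show ?thesis using ne[OF q that(1)] by (simp add: transpose_apply_other)
    qed
    have split: "(\<Prod>i\<in>S. g i) = g c * (\<Prod>i\<in>S - {c}. g i)" for g :: "nat \<Rightarrow> complex"
      using S c by (simp add: prod.remove)
    have "(\<Sum>m\<in>?P (insert a S). \<Prod>i\<in>insert a S. k i (m i) (m (?p i)))
       = (\<Sum>m\<in>?P S. \<Sum>l<N. k c (m c) l * k a l (m (q c)) * (\<Prod>i\<in>S - {c}. k i (m i) (m (q i))))"
      unfolding sum_PiE_insert[OF S(2)]
    proof (intro sum.cong refl)
      fix m :: "nat \<Rightarrow> nat" and l :: nat
      let ?m = "m(a := l)"
      have ca: "c \<noteq> a" "q c \<noteq> a" using c S ne[OF q c] by auto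
      have "(\<Prod>i\<in>S - {c}. k i (?m i) (?m (?p i))) = (\<Prod>i\<in>S - {c}. k i (m i) (m (q i)))"
      proof (intro prod.cong refl)
        fix i assume i: "i \<in> S - {c}"
        then have "?p i = q i" "q i \<noteq> a" "i \<noteq> a" using px[of i] ne[OF q, of i] S by auto
        then show "k i (?m i) (?m (?p i)) = k i (m i) (m (q i))" by (simp only: fun_upd_apply if_False simp_thms)
      qed
      then have "(\<Prod>i\<in>S. k i (?m i) (?m (?p i))) = k c (m c) l * (\<Prod>i\<in>S - {c}. k i (m i) (m (q i)))"
        unfolding split pc using ca by simp
      moreover have "(\<Prod>i\<in>insert a S. k i (?m i) (?m (?p i))) = k a (?m a) (?m (?p a)) * (\<Prod>i\<in>S. k i (?m i) (?m (?p i)))"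
        using S by (rule prod.insert)
      ultimately show "(\<Prod>i\<in>insert a S. k i (?m i) (?m (?p i))) = k c (m c) l * k a l (m (q c)) * (\<Prod>i\<in>S - {c}. k i (m i) (m (q i)))"
        unfolding pa using ca by simp
    qed
    also have "\<dots> = (\<Sum>m\<in>?P S. \<Prod>i\<in>S. (k(c := mm N (k c) (k a))) i (m i) (m (q i)))"
    proof (intro sum.cong refl)
      fix m
      have "(\<Prod>i\<in>S - {c}. (k(c := mm N (k c) (k a))) i (m i) (m (q i))) = (\<Prod>i\<in>S - {c}. k i (m i) (m (q i)))"
        by (intro prod.cong refl) auto
      then show "(\<Sum>l<N. k c (m c) l * k a l (m (q c)) * (\<Prod>i\<in>S - {c}. k i (m i) (m (q i))))
        = (\<Prod>i\<in>S. (k(c := mm N (k c) (k a))) i (m i) (m (q i)))"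
        unfolding split by (simp add: mm_def sum_distrib_right)
    qed
    finally show ?thesis
      unfolding F_def w_def using S cyc_le[OF S(1), of q]
      by (simp add: cyc_insert_transpose[OF S q qc] Suc_diff_le del: o_apply)
  qed
  have "cyc_sum \<alpha> N (insert a S) k = (\<Sum>\<sigma> | \<sigma> permutes (insert a S). F \<sigma>)"
    by (simp add: cyc_sum_def F_def)
  also have "\<dots> = (\<Sum>b\<in>insert a S. \<Sum>q | q permutes S. F (Transposition.transpose a b \<circ> q))"
    by (rule sum_over_permutations_insert[OF S])
  also have "\<dots> = (\<Sum>q | q permutes S. F q) + (\<Sum>q | q permutes S. \<Sum>b\<in>S. F (Transposition.transpose a b \<circ> q))"
    using S by (simp add: sum.swap[of _ S])
  also have "(\<Sum>q | q permutes S. F q) = mtr N (k a) * cyc_sum \<alpha> N S k"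
    by (simp add: Fa cyc_sum_def w_def sum_distrib_left)
  \<comment> \<open>The image \<open>b\<close> of the inserted vertex is reparametrised by its
    preimage \<open>c\<close>, the vertex whose outgoing kernel changes.\<close>
  also have "(\<Sum>q | q permutes S. \<Sum>b\<in>S. F (Transposition.transpose a b \<circ> q)) = (\<Sum>q | q permutes S. \<Sum>c\<in>S. F (Transposition.transpose a (q c) \<circ> q))"
  proof (rule sum.cong[OF refl])
    fix q assume "q \<in> {q. q permutes S}"
    then have "bij_betw q S S" by (simp add: permutes_imp_bij)
    then show "(\<Sum>b\<in>S. F (Transposition.transpose a b \<circ> q)) = (\<Sum>c\<in>S. F (Transposition.transpose a (q c) \<circ> q))"
      using sum.reindex_bij_betw[of q S S "\<lambda>b. F (Transposition.transpose a b \<circ> q)"] by simp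
  qed
  also have "\<dots> = (\<Sum>q | q permutes S. \<Sum>c\<in>S. \<alpha> * w q (k(c := mm N (k c) (k a))))"
    by (intro sum.cong refl Fb) auto
  also have "\<dots> = \<alpha> * (\<Sum>c\<in>S. cyc_sum \<alpha> N S (k(c := mm N (k c) (k a))))"
    by (subst sum.swap) (simp add: cyc_sum_def w_def sum_distrib_left)
  finally show ?thesis .
qed

text \<open>This is \<open>G^n A\<close>. The factors accumulate in the argument because each
  contraction of a marked vertex into its predecessor multiplies the marking matrix by
  \<open>G\<close> from the left.\<close>

primrec mpow :: "nat \<Rightarrow> (nat \<Rightarrow> nat \<Rightarrow> complex) \<Rightarrow> nat \<Rightarrow> (nat \<Rightarrow> nat \<Rightarrow> complex) \<Rightarrow> nat \<Rightarrow> nat \<Rightarrow> complex" where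
  "mpow N G 0 A = A"
| "mpow N G (Suc n) A = mpow N G n (mm N G A)"

text \<open>For nonzero \<alpha>, the Taylor coefficients of det(1 - \<alpha> z G)^(-1/\<alpha>),
  the generating function of alpha-determinants.\<close>

definition cyc_coeff :: "complex \<Rightarrow> nat \<Rightarrow> (nat \<Rightarrow> nat \<Rightarrow> complex) \<Rightarrow> nat \<Rightarrow> complex" where
  "cyc_coeff \<alpha> N G n = cyc_sum \<alpha> N {..<n} (\<lambda>_. G) / fact n"

text \<open>Coefficients of the same function times the trace of (1 - \<alpha> z G)^(-1) A; up to a
  factor z this is its derivative in the direction \<open>A\<close>.\<close>

definition mark_coeff :: "complex \<Rightarrow> nat \<Rightarrow> (nat \<Rightarrow> nat \<Rightarrow> complex) \<Rightarrow> (nat \<Rightarrow> nat \<Rightarrow> complex) \<Rightarrow> nat \<Rightarrow> complex" where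
  "mark_coeff \<alpha> N G A n = (\<Sum>k\<le>n. \<alpha> ^ k * mtr N (mpow N G k A) * cyc_coeff \<alpha> N G (n - k))"

lemma mark_coeff_Suc:
  "mark_coeff \<alpha> N G A (Suc n) = mtr N A * cyc_coeff \<alpha> N G (Suc n) + \<alpha> * mark_coeff \<alpha> N G (mm N G A) n"
  unfolding mark_coeff_def by (subst sum.atMost_Suc_shift) (simp add: sum_distrib_left mult_ac)

text \<open>Both sums depend on the vertex set only through its cardinality, which is why the
  induction runs over all sets of a given size. The truncated \<open>n - 1\<close> does no harm: the
  empty set has no vertex to mark.\<close>

lemma cyc_sum_marked_aux:
  "finite S \<Longrightarrow> card S = n \<Longrightarrow> cyc_sum \<alpha> N S (\<lambda>_. G) = fact n * cyc_coeff \<alpha> N G n \<and>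
    (\<forall>j\<in>S. \<forall>A. cyc_sum \<alpha> N S ((\<lambda>_. G)(j := A)) = fact (n - 1) * mark_coeff \<alpha> N G A (n - 1))"
proof (induction n arbitrary: S)
  case 0
  then show ?case by (simp add: cyc_coeff_def)
next
  case (Suc n)
  have mark: "cyc_sum \<alpha> N S ((\<lambda>_. G)(j := A)) = fact n * mark_coeff \<alpha> N G A n"
    if S: "finite S" "card S = Suc n" and j: "j \<in> S" for S j A
  proof -
    \<comment> \<open>The expansion is made along the marked vertex itself. Its matrix either closes
      to a trace or passes to its predecessor, which becomes the new marked vertex and carries
      \<open>G A\<close>.\<close>
    define T where "T = S - {j}"
    have T: "finite T" "j \<notin> T" "S = insert j T" "card T = n" using S j by (auto simp: T_def)
    have "cyc_sum \<alpha> N S ((\<lambda>_. G)(j := A)) = mtr N A * cyc_sum \<alpha> N T ((\<lambda>_. G)(j := A))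
      + \<alpha> * (\<Sum>c\<in>T. cyc_sum \<alpha> N T (((\<lambda>_. G)(j := A))(c := mm N (((\<lambda>_. G)(j := A)) c) A)))"
      unfolding T(3) by (subst cyc_sum_insert[OF T(1,2)]) simp
    also have "cyc_sum \<alpha> N T ((\<lambda>_. G)(j := A)) = cyc_sum \<alpha> N T (\<lambda>_. G)"
      unfolding cyc_sum_def using T(2) by (intro sum.cong refl arg_cong2[where f="(*)"] prod.cong) auto
    also have "\<dots> = fact n * cyc_coeff \<alpha> N G n" using Suc.IH[OF T(1,4)] by blast
    also have "(\<Sum>c\<in>T. cyc_sum \<alpha> N T (((\<lambda>_. G)(j := A))(c := mm N (((\<lambda>_. G)(j := A)) c) A)))
       = (\<Sum>c\<in>T. cyc_sum \<alpha> N T ((\<lambda>_. G)(c := mm N G A)))"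
      unfolding cyc_sum_def using T(2) by (intro sum.cong refl arg_cong2[where f="(*)"] prod.cong) auto
    also have "\<dots> = (\<Sum>c\<in>T. fact (n - 1) * mark_coeff \<alpha> N G (mm N G A) (n - 1))"
      by (intro sum.cong refl) (use Suc.IH[OF T(1,4)] in blast)
    also have "\<dots> = of_nat n * (fact (n - 1) * mark_coeff \<alpha> N G (mm N G A) (n - 1))"
      by (simp add: T(4))
    finally have *: "cyc_sum \<alpha> N S ((\<lambda>_. G)(j := A)) = mtr N A * (fact n * cyc_coeff \<alpha> N G n)
      + \<alpha> * (of_nat n * (fact (n - 1) * mark_coeff \<alpha> N G (mm N G A) (n - 1)))" .
    show ?thesis unfolding *
      by (cases n) (simp_all add: mark_coeff_Suc mark_coeff_def[of _ _ _ _ 0] algebra_simps)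
  qed
  \<comment> \<open>An unmarked sum is a sum marked by \<open>G\<close> itself, at any
    vertex.\<close>
  have all: "cyc_sum \<alpha> N S (\<lambda>_. G) = fact n * mark_coeff \<alpha> N G G n" if "finite S" "card S = Suc n" for S
  proof -
    have "S \<noteq> {}" using that by auto
    then obtain j where j: "j \<in> S" by blast
    have "(\<lambda>_. G)(j := G) = (\<lambda>_. G)" by (simp add: fun_eq_iff)
    then show ?thesis using mark[OF that j, of G] by simp
  qed
  have "cyc_sum \<alpha> N S (\<lambda>_. G) = fact (Suc n) * cyc_coeff \<alpha> N G (Suc n)"
    using all[OF Suc.prems] all[of "{..<Suc n}"] by (simp add: cyc_coeff_def del: fact_Suc)
  then show ?case using mark[OF Suc.prems] unfolding diff_Suc_1 by blast
qed

lemma cyc_sum_marked: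
  "cyc_sum \<alpha> N {..<Suc n} ((\<lambda>_. G)(n := A)) / fact n = mark_coeff \<alpha> N G A n"
  using cyc_sum_marked_aux[of "{..<Suc n}" "Suc n" \<alpha> N G] by auto

lemma cyc_coeff_0: "cyc_coeff \<alpha> N G 0 = 1"
  by (simp add: cyc_coeff_def cyc_sum_def cyc_def)

text \<open>Newton's identity for general \<alpha>: the coefficients are determined recursively by
  traces of powers of \<open>G\<close>.\<close>

lemma cyc_coeff_Suc: "of_nat (Suc n) * cyc_coeff \<alpha> N G (Suc n) = mark_coeff \<alpha> N G G n"
proof -
  have "(\<lambda>_. G)(n := G) = (\<lambda>_. G)" by (simp add: fun_eq_iff)
  then have "mark_coeff \<alpha> N G G n = cyc_sum \<alpha> N {..<Suc n} (\<lambda>_. G) / fact n"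
    using cyc_sum_marked[of \<alpha> N n G G] by simp
  then show ?thesis by (simp add: cyc_coeff_def field_simps del: of_nat_Suc)
qed

section \<open>Geometric decay of the coefficients, uniform in the rank\<close>

definition growth :: "real \<Rightarrow> real" where
  "growth c = max 1 (4 * c) ^ nat \<lceil>4 * c\<rceil>"

lemma growth_ge_1: "1 \<le> growth c"
  by (simp add: growth_def one_le_power)

text \<open>The rate 3/4 lies strictly above 1/2, so the convolution of the two geometric sequences
  decays at the slower rate without a polynomial factor.\<close>

lemma geometric_ratio_bound:
  assumes "0 \<le> r" "r \<le> 1/2"
  shows "(\<Sum>k\<le>n. r ^ k * (3/4) ^ (n - k)) \<le> 3 * (3/4::real) ^ n"
proof -
  have "(\<Sum>k\<le>n. r ^ k * (3/4) ^ (n - k)) \<le> (\<Sum>k\<le>n. (1/2) ^ k * (3/4::real) ^ (n - k))"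
    using assms by (intro sum_mono mult_right_mono power_mono) auto
  also have "\<dots> = (\<Sum>k\<le>n. (3/4) ^ n * (2/3) ^ k)"
  proof (intro sum.cong refl)
    fix k assume "k \<in> {..n}"
    then have "(3/4::real) ^ n = (3/4) ^ k * (3/4) ^ (n - k)" by (simp flip: power_add)
    then show "(1/2) ^ k * (3/4::real) ^ (n - k) = (3/4) ^ n * (2/3) ^ k"
      by (simp add: power_mult_distrib[symmetric])
  qed
  also have "\<dots> = (3/4) ^ n * (\<Sum>k<Suc n. (2/3) ^ k)"
    by (simp only: sum_distrib_left[symmetric] lessThan_Suc_atMost)
  also have "(\<Sum>k<Suc n. (2/3::real) ^ k) \<le> 3"
    by (subst geometric_sum) (auto simp: field_simps)
  finally show ?thesis by simp
qed

text \<open>Relative to (3/4)^n one step of the recursion costs at most a factor 4c / (n + 1), since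
  3 (3/4)^n is 4 (3/4)^(n+1). Beyond \<open>nat \<lceil>4 * c\<rceil>\<close> this factor is at most
  1, so only finitely many steps can lose; this is the origin of \<open>growth\<close>. No matrix
  size enters.\<close>

lemma recursion_bound:
  fixes e :: "nat \<Rightarrow> complex" and t :: "nat \<Rightarrow> complex"
  assumes e0: "e 0 = 1" and rec: "\<And>n. of_nat (Suc n) * e (Suc n) = (\<Sum>k\<le>n. t k * e (n - k))"
    and t: "\<And>k. cmod (t k) \<le> c * r ^ k" and r: "0 \<le> r" "r \<le> 1/2" and c: "0 \<le> c"
  shows "cmod (e n) \<le> growth c * (3/4) ^ n"
proof -
  define L where "L = max 1 (4 * c)"
  define n0 where "n0 = nat \<lceil>4 * c\<rceil>"
  have L1: "1 \<le> L" "4 * c \<le> L" by (auto simp: L_def)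
  have "cmod (e n) \<le> L ^ min n n0 * (3/4) ^ n"
  proof (induction n rule: less_induct)
    case (less n)
    show ?case
    proof (cases n)
      case 0
      then show ?thesis by (simp add: e0)
    next
      case (Suc m)
      have "real (Suc m) * cmod (e (Suc m)) = cmod (\<Sum>k\<le>m. t k * e (m - k))"
        unfolding rec[symmetric] by (simp add: norm_mult del: of_nat_Suc)
      also have "\<dots> \<le> (\<Sum>k\<le>m. (c * r ^ k) * (L ^ min m n0 * (3/4) ^ (m - k)))"
      proof (rule sum_norm_le)
        fix k assume "k \<in> {..m}"
        have "cmod (e (m - k)) \<le> L ^ min (m - k) n0 * (3/4) ^ (m - k)" using less[of "m - k"] Suc by simp
        also have "\<dots> \<le> L ^ min m n0 * (3/4) ^ (m - k)"
          using L1 by (intro mult_right_mono power_increasing) auto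
        finally show "norm (t k * e (m - k)) \<le> (c * r ^ k) * (L ^ min m n0 * (3/4) ^ (m - k))"
          unfolding norm_mult using t[of k] c r by (intro mult_mono) auto
      qed
      also have "\<dots> = c * L ^ min m n0 * (\<Sum>k\<le>m. r ^ k * (3/4) ^ (m - k))"
        by (simp add: sum_distrib_left mult_ac)
      also have "\<dots> \<le> c * L ^ min m n0 * (3 * (3/4) ^ m)"
        using c L1 r by (intro mult_left_mono geometric_ratio_bound) auto
      also have "\<dots> = (4 * c) * L ^ min m n0 * (3/4) ^ Suc m" by simp
      finally have *: "real (Suc m) * cmod (e (Suc m)) \<le> (4 * c) * L ^ min m n0 * (3/4) ^ Suc m" .
      show ?thesis
      proof (cases "Suc m \<le> n0")
        case True
        have "(4 * c) * L ^ min m n0 * (3/4) ^ Suc m \<le> L * L ^ min m n0 * (3/4) ^ Suc m"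
          using L1 by (intro mult_right_mono) auto
        also have "\<dots> = L ^ min (Suc m) n0 * (3/4) ^ Suc m" using True by (simp add: min_def)
        finally have "real (Suc m) * cmod (e (Suc m)) \<le> L ^ min (Suc m) n0 * (3/4) ^ Suc m" using * by linarith
        moreover have "1 * cmod (e (Suc m)) \<le> real (Suc m) * cmod (e (Suc m))" by (intro mult_right_mono) auto
        ultimately show ?thesis using Suc by simp
      next
        case False
        then have "4 * c \<le> real (Suc m)" unfolding n0_def by linarith
        then have "(4 * c) * L ^ min m n0 * (3/4) ^ Suc m \<le> real (Suc m) * (L ^ min (Suc m) n0 * (3/4) ^ Suc m)"
        proof -
          have "min m n0 = min (Suc m) n0" using False by simp
          then show ?thesis
            using mult_right_mono[OF \<open>4 * c \<le> real (Suc m)\<close>, of "L ^ min m n0 * (3/4) ^ Suc m"] L1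
            by (simp add: mult.assoc del: power_Suc of_nat_Suc)
        qed
        with * have "real (Suc m) * cmod (e (Suc m)) \<le> real (Suc m) * (L ^ min (Suc m) n0 * (3/4) ^ Suc m)" by linarith
        then show ?thesis using Suc by (simp del: of_nat_Suc)
      qed
    qed
  qed
  also have "\<dots> \<le> L ^ n0 * (3/4) ^ n"
    using L1 by (intro mult_right_mono power_increasing) auto
  finally show ?thesis by (simp add: growth_def L_def n0_def)
qed

lemma cyc_coeff_bound:
  assumes "\<And>k. cmod (\<alpha> ^ k * mtr N (mpow N G k G)) \<le> c * r ^ k" "0 \<le> r" "r \<le> 1/2" "0 \<le> c"
  shows "cmod (cyc_coeff \<alpha> N G n) \<le> growth c * (3/4) ^ n"
  by (rule recursion_bound[where t="\<lambda>k. \<alpha> ^ k * mtr N (mpow N G k G)" and e="cyc_coeff \<alpha> N G", OF cyc_coeff_0 _ assms])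
     (simp add: cyc_coeff_Suc mark_coeff_def del: of_nat_Suc)

lemma mark_coeff_bound:
  assumes G: "\<And>k. cmod (\<alpha> ^ k * mtr N (mpow N G k G)) \<le> c * r ^ k" and r: "0 \<le> r" "r \<le> 1/2" and c: "0 \<le> c"
    and A: "\<And>k. cmod (\<alpha> ^ k * mtr N (mpow N G k A)) \<le> c' * r ^ k" and c': "0 \<le> c'"
  shows "cmod (mark_coeff \<alpha> N G A n) \<le> 3 * c' * growth c * (3/4) ^ n"
proof -
  have "cmod (mark_coeff \<alpha> N G A n) \<le> (\<Sum>k\<le>n. (c' * r ^ k) * (growth c * (3/4) ^ (n - k)))"
    unfolding mark_coeff_def
  proof (rule sum_norm_le)
    fix k
    show "norm (\<alpha> ^ k * mtr N (mpow N G k A) * cyc_coeff \<alpha> N G (n - k)) \<le> (c' * r ^ k) * (growth c * (3/4) ^ (n - k))"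
      unfolding norm_mult[of "_ * _"] using A[of k] cyc_coeff_bound[OF G r c] c' r by (intro mult_mono) auto
  qed
  also have "\<dots> = c' * growth c * (\<Sum>k\<le>n. r ^ k * (3/4) ^ (n - k))"
    by (simp add: sum_distrib_left mult_ac)
  also have "\<dots> \<le> c' * growth c * (3 * (3/4) ^ n)"
    using c' growth_ge_1[of c] r by (intro mult_left_mono geometric_ratio_bound) auto
  finally show ?thesis by (simp add: mult_ac)
qed

text \<open>The marked coefficients are a convolution, so their sum is a Neumann series of traces
  times the sum of the plain ones. That series takes the place of a logarithmic derivative.\<close>

lemma mark_coeff_suminf:
  assumes G: "\<And>k. cmod (\<alpha> ^ k * mtr N (mpow N G k G)) \<le> c * r ^ k" and r: "0 \<le> r" "r \<le> 1/2" and c: "0 \<le> c"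
    and A: "\<And>k. cmod (\<alpha> ^ k * mtr N (mpow N G k A)) \<le> c' * r ^ k"
  shows "(\<lambda>n. mark_coeff \<alpha> N G A n) sums ((\<Sum>k. \<alpha> ^ k * mtr N (mpow N G k A)) * (\<Sum>n. cyc_coeff \<alpha> N G n))"
  unfolding mark_coeff_def
proof (rule Cauchy_product_sums)
  show "summable (\<lambda>k. norm (\<alpha> ^ k * mtr N (mpow N G k A)))"
    by (rule summable_comparison_test[OF _ summable_mult[OF summable_geometric[of r]]]) (use A r in auto)
  show "summable (\<lambda>k. norm (cyc_coeff \<alpha> N G k))"
    by (rule summable_comparison_test[OF _ summable_mult[OF summable_geometric[of "3/4::real"]]])
       (use cyc_coeff_bound[OF G r c] in auto)
qed

section \<open>Traces of finite rank approximations\<close>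

definition mone :: "nat \<Rightarrow> nat \<Rightarrow> complex" where
  "mone i j = (if i = j then 1 else 0)"

text \<open>Associativity of the matrix product; the row index has to lie below \<open>N\<close>
  because \<open>mone\<close> is the identity only within the truncation.\<close>

lemma mpow_mm: "i < N \<Longrightarrow> mpow N G k A i j = (\<Sum>l<N. mpow N G k mone i l * A l j)"
proof (induction k arbitrary: A j)
  case 0
  have "(\<Sum>l<N. mone i l * A l j) = (\<Sum>l<N. if i = l then A l j else 0)"
    by (intro sum.cong) (auto simp: mone_def)
  then show ?case using 0 by simp
next
  case (Suc k)
  have one: "mm N G mone l p = G l p" if "p < N" for l p
  proof -
    have "mm N G mone l p = (\<Sum>q<N. if q = p then G l q else 0)"
      unfolding mm_def by (intro sum.cong) (auto simp: mone_def)
    then show ?thesis using that by simp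
  qed
  have "mpow N G (Suc k) A i j = (\<Sum>l<N. mpow N G k mone i l * mm N G A l j)"
    using Suc.IH[OF Suc.prems, of "mm N G A"] by simp
  also have "\<dots> = (\<Sum>l<N. \<Sum>p<N. mpow N G k mone i l * G l p * A p j)"
    by (simp only: mm_def sum_distrib_left mult.assoc)
  also have "\<dots> = (\<Sum>p<N. \<Sum>l<N. mpow N G k mone i l * G l p * A p j)" by (rule sum.swap)
  also have "\<dots> = (\<Sum>p<N. mpow N G (Suc k) mone i p * A p j)"
  proof (rule sum.cong[OF refl])
    fix p assume "p \<in> {..<N}"
    then have "mpow N G (Suc k) mone i p = (\<Sum>l<N. mpow N G k mone i l * G l p)"
      using Suc.IH[OF Suc.prems, of "mm N G mone" p] by (simp add: one)
    then show "(\<Sum>l<N. mpow N G k mone i l * G l p * A p j) = mpow N G (Suc k) mone i p * A p j"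
      by (simp only: sum_distrib_right)
  qed
  finally show ?case .
qed

lemma mtr_mpow: "mtr N (mpow N G k A) = (\<Sum>m<N. \<Sum>l<N. mpow N G k mone m l * A l m)"
  unfolding mtr_def by (rule sum.cong[OF refl]) (rule mpow_mm, simp)

lemma form_bound_mone: "form_bound N 1 mone"
  unfolding form_bound_def
proof (intro conjI allI)
  fix a b :: "nat \<Rightarrow> complex"
  have "(\<Sum>l<N. a m * mone m l * b l) = a m * b m" if "m < N" for m
  proof -
    have "(\<Sum>l<N. a m * mone m l * b l) = (\<Sum>l<N. if m = l then a m * b m else 0)"
      by (intro sum.cong) (auto simp: mone_def)
    then show ?thesis using that by simp
  qed
  then have "(\<Sum>m<N. \<Sum>l<N. a m * mone m l * b l) = (\<Sum>m<N. a m * b m)" by simp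
  also have "cmod \<dots> \<le> (\<Sum>m<N. \<bar>cmod (a m)\<bar> * \<bar>cmod (b m)\<bar>)" by (intro sum_norm_le) (simp add: norm_mult)
  also have "\<dots> \<le> L2_set (\<lambda>m. cmod (a m)) {..<N} * L2_set (\<lambda>m. cmod (b m)) {..<N}" by (rule L2_set_mult_ineq)
  finally show "cmod (\<Sum>m<N. \<Sum>l<N. a m * mone m l * b l) \<le> 1 * sqrt (\<Sum>m<N. (cmod (a m))\<^sup>2) * sqrt (\<Sum>l<N. (cmod (b l))\<^sup>2)"
    by (simp add: L2_set_def)
qed simp

lemma form_bound_mpow: "form_bound N g G \<Longrightarrow> form_bound N h A \<Longrightarrow> form_bound N (g ^ k * h) (mpow N G k A)"
proof (induction k arbitrary: A h)
  case (Suc k)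
  have "form_bound N (g ^ k * (g * h)) (mpow N G k (mm N G A))"
    by (rule Suc.IH[OF Suc.prems(1)]) (use form_bound_mult[OF Suc.prems] in \<open>simp add: mm_def[abs_def]\<close>)
  then show ?case by (simp add: mult_ac)
qed simp

lemma form_bound_transpose: "form_bound N g H \<Longrightarrow> form_bound N g (\<lambda>i j. H j i)"
  unfolding form_bound_def
proof (elim conjE, intro conjI allI)
  fix a b assume H: "\<forall>a b. cmod (\<Sum>m<N. \<Sum>l<N. a m * H m l * b l) \<le> g * sqrt (\<Sum>m<N. (cmod (a m))\<^sup>2) * sqrt (\<Sum>l<N. (cmod (b l))\<^sup>2)"
  have "(\<Sum>m<N. \<Sum>l<N. a m * H l m * b l) = (\<Sum>l<N. \<Sum>m<N. b l * H l m * a m)"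
    by (subst sum.swap) (simp add: mult_ac)
  then show "cmod (\<Sum>m<N. \<Sum>l<N. a m * H l m * b l) \<le> g * sqrt (\<Sum>m<N. (cmod (a m))\<^sup>2) * sqrt (\<Sum>l<N. (cmod (b l))\<^sup>2)"
    using H[rule_format, of b a] by (simp add: mult_ac)
qed

text \<open>Powers of \<open>G\<close> enter through their operator norm and the pairing through
  Hilbert-Schmidt norms. The lemma serves twice: with the inner product of \<open>L2\<close> it
  gives convergence, with \<open>BJ\<close> it gives bounds by the variance.\<close>

lemma (in psd_form) mtr_mpow_bound:
  assumes u: "\<And>m. m < N \<Longrightarrow> u m \<in> V" and w: "\<And>m. m < N \<Longrightarrow> w m \<in> V" and G: "form_bound N g G"
    and A: "\<And>l m. l < N \<Longrightarrow> m < N \<Longrightarrow> A l m = B (u m) (w l)"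
  shows "cmod (mtr N (mpow N G k A)) \<le> g ^ k * sqrt (\<Sum>l<N. q (u l)) * sqrt (\<Sum>l<N. q (w l))"
proof -
  have "form_bound N (g ^ k) (\<lambda>i j. mpow N G k mone j i)"
    by (rule form_bound_transpose) (use form_bound_mpow[OF G form_bound_mone, of k] in simp)
  then have "cmod (\<Sum>l<N. \<Sum>m<N. B (u l) (w m) * mpow N G k mone l m) \<le> g ^ k * sqrt (\<Sum>l<N. q (u l)) * sqrt (\<Sum>l<N. q (w l))"
    by (intro sum_B_matrix u w)
  also have "(\<Sum>l<N. \<Sum>m<N. B (u l) (w m) * mpow N G k mone l m) = mtr N (mpow N G k A)"
    unfolding mtr_mpow by (intro sum.cong refl) (simp add: A mult.commute)
  finally show ?thesis .
qed

section \<open>Finite rank traces and the variance norm\<close>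

locale alpha_kernel = trace_kernel +
  fixes \<alpha> :: real
  assumes J_psd: "f \<in> L2 \<mu> \<Longrightarrow> 0 \<le> l2.q \<mu> f + \<alpha> * Q.q f"
begin

definition bm :: "real \<Rightarrow> ('a \<Rightarrow> complex) \<Rightarrow> bool" where
  "bm c h \<longleftrightarrow> 0 \<le> c \<and> h \<in> borel_measurable \<mu> \<and> (\<forall>x. cmod (h x) \<le> c)"

lemma bm_meas: "bm c h \<Longrightarrow> h \<in> borel_measurable \<mu>"
  by (simp add: bm_def)

lemma bm_L2: "bm c h \<Longrightarrow> f \<in> L2 \<mu> \<Longrightarrow> (\<lambda>x. h x * f x) \<in> L2 \<mu>"
  by (rule L2_bounded_mult(1)[where c=c]) (auto simp: bm_def)

lemma bm_q: "bm c h \<Longrightarrow> f \<in> L2 \<mu> \<Longrightarrow> l2.q \<mu> (\<lambda>x. h x * f x) \<le> c\<^sup>2 * l2.q \<mu> f"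
  by (rule L2_bounded_mult(2)) (auto simp: bm_def)

lemma bm_mult: "bm c h \<Longrightarrow> bm d g \<Longrightarrow> bm (c * d) (\<lambda>x. h x * g x)"
  unfolding bm_def by (auto simp: norm_mult intro!: mult_mono)

lemma bm_add: "bm c h \<Longrightarrow> bm d g \<Longrightarrow> bm (c + d) (\<lambda>x. h x + g x)"
  unfolding bm_def by (auto intro!: norm_triangle_mono)

lemma bm_scale: "bm c h \<Longrightarrow> bm (cmod a * c) (\<lambda>x. a * h x)"
  unfolding bm_def by (auto simp: norm_mult intro!: mult_left_mono)

text \<open>The trace of K compressed to \<open>S\<close>, the expected number of points there. It
  secures convergence and is absent from the final estimates.\<close>

definition Tr where "Tr = (LINT x|\<mu>. (bb x)\<^sup>2)"

lemma sum_q_s_le: "(\<Sum>l<N. l2.q \<mu> (s l)) \<le> Tr"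
proof -
  have "(\<Sum>l<N. l2.q \<mu> (s l)) = (LINT x|\<mu>. (\<Sum>l<N. (cmod (s l x))\<^sup>2))"
    unfolding l2_q using L2D(2)[OF s_L2] by simp
  also have "\<dots> \<le> Tr"
    unfolding Tr_def bb_sq
    by (intro integral_mono Bochner_Integration.integrable_sum L2D(2) s_L2 sum_le_suminf s_summable)
       (use bb_integrable in \<open>auto simp: bb_sq\<close>)
  finally show ?thesis .
qed

lemma Tr_nonneg: "0 \<le> Tr"
  by (simp add: Tr_def)

text \<open>A finite section of K^(1/2) h K^(1/2). The indices are transposed so that
  \<open>mm\<close> composes from left to right: the product of \<open>G \<theta>\<close> and
  \<open>G \<phi>\<close> at (l, m) pairs \<open>s m\<close> with \<phi> K_N \<theta> applied to
  \<open>s l\<close>, where K_N is the truncated kernel operator.\<close>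

definition G :: "('a \<Rightarrow> complex) \<Rightarrow> nat \<Rightarrow> nat \<Rightarrow> complex" where
  "G h l m = l2_inner \<mu> (s m) (\<lambda>x. h x * s l x)"

text \<open>Forming combinations of the \<open>s l\<close> is the adjoint of taking inner products
  with them, and Bessel's inequality bounds the latter in terms of \<open>\<kappa>\<close>; duality
  transfers the bound.\<close>

lemma q_comb_s: "l2.q \<mu> (\<lambda>x. \<Sum>l<N. a l * s l x) \<le> \<kappa> * (\<Sum>l<N. (cmod (a l))\<^sup>2)"
proof -
  define v where "v = (\<lambda>x. \<Sum>l<N. a l * s l x)"
  define A where "A = (\<Sum>l<N. (cmod (a l))\<^sup>2)"
  have A: "0 \<le> A" by (simp add: A_def sum_nonneg)
  have v: "v \<in> L2 \<mu>" unfolding v_def by (intro l2.sum_mem s_L2)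
  have v0: "0 \<le> l2.q \<mu> v" by (rule l2.q_nonneg[OF v])
  have "l2_inner \<mu> v v = (\<Sum>l<N. a l * l2_inner \<mu> v (s l))"
    using l2.B_sum_right[OF v, of "{..<N}" s a] by (simp add: s_L2 v_def)
  then have "l2.q \<mu> v \<le> cmod (\<Sum>l<N. a l * l2_inner \<mu> v (s l))"
    unfolding l2.q_def by (metis complex_Re_le_cmod)
  also have "\<dots> \<le> (\<Sum>l<N. \<bar>cmod (a l)\<bar> * \<bar>cmod (l2_inner \<mu> v (s l))\<bar>)" by (intro sum_norm_le) (simp add: norm_mult)
  also have "\<dots> \<le> L2_set (\<lambda>l. cmod (a l)) {..<N} * L2_set (\<lambda>l. cmod (l2_inner \<mu> v (s l))) {..<N}" by (rule L2_set_mult_ineq)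
  also have "\<dots> \<le> sqrt A * sqrt (\<kappa> * l2.q \<mu> v)"
  proof -
    have "(\<Sum>l<N. (cmod (l2_inner \<mu> v (s l)))\<^sup>2) = (\<Sum>l<N. (cmod (l2_inner \<mu> (s l) v))\<^sup>2)"
      by (intro sum.cong refl) (subst l2.herm[OF s_L2 v], simp)
    also have "\<dots> \<le> \<kappa> * l2.q \<mu> v" using bessel_s[OF v, of N] qQ_le[OF v] by linarith
    finally show ?thesis using A unfolding L2_set_def A_def by (intro mult_left_mono) (auto simp: sum_nonneg)
  qed
  finally have "sqrt (l2.q \<mu> v) * sqrt (l2.q \<mu> v) \<le> sqrt (\<kappa> * A) * sqrt (l2.q \<mu> v)"
    using v0 by (simp add: real_sqrt_mult mult_ac)
  then have "sqrt (l2.q \<mu> v) \<le> sqrt (\<kappa> * A)"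
  proof (cases "l2.q \<mu> v = 0")
    case True
    then show ?thesis using A \<kappa>(1) by simp
  next
    case False
    then have "0 < sqrt (l2.q \<mu> v)" using v0 by simp
    with \<open>sqrt (l2.q \<mu> v) * sqrt (l2.q \<mu> v) \<le> _\<close> show ?thesis by (simp only: mult_le_cancel_right_pos)
  qed
  then show ?thesis unfolding v_def A_def by simp
qed

text \<open>The entries pair two combinations of the \<open>s l\<close> with \<open>h\<close> in
  between, and each of the two contributes a factor \<open>sqrt \<kappa>\<close> by
  \<open>q_comb_s\<close>.\<close>

lemma form_bound_G:
  assumes h: "bm c h" shows "form_bound N (\<kappa> * c) (G h)"
  unfolding form_bound_def
proof (intro conjI allI)
  show "0 \<le> \<kappa> * c" using h \<kappa> by (simp add: bm_def)
  fix a b :: "nat \<Rightarrow> complex"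
  define u where "u = (\<lambda>x. \<Sum>l<N. a l * s l x)"
  define v where "v = (\<lambda>x. \<Sum>m<N. cnj (b m) * s m x)"
  have uv: "u \<in> L2 \<mu>" "v \<in> L2 \<mu>" unfolding u_def v_def by (intro l2.sum_mem s_L2)+
  have hs: "(\<lambda>x. h x * s l x) \<in> L2 \<mu>" for l by (intro bm_L2[OF h] s_L2)
  have "l2_inner \<mu> v (\<lambda>x. h x * u x) = l2_inner \<mu> v (\<lambda>x. \<Sum>l<N. a l * (h x * s l x))"
    by (simp add: u_def sum_distrib_left mult_ac)
  also have "\<dots> = (\<Sum>l<N. a l * l2_inner \<mu> v (\<lambda>x. h x * s l x))"
    by (rule l2.B_sum_right[OF uv(2) hs])
  also have "\<dots> = (\<Sum>l<N. a l * (\<Sum>m<N. b m * G h l m))"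
  proof (rule sum.cong[OF refl])
    fix l
    show "a l * l2_inner \<mu> v (\<lambda>x. h x * s l x) = a l * (\<Sum>m<N. b m * G h l m)"
      unfolding v_def by (subst l2.B_sum_left[OF hs]) (simp_all add: s_L2 G_def)
  qed
  finally have e: "(\<Sum>l<N. \<Sum>m<N. a l * G h l m * b m) = l2_inner \<mu> v (\<lambda>x. h x * u x)"
    by (simp add: sum_distrib_left mult_ac)
  have c: "0 \<le> c" using h by (simp add: bm_def)
  have "cmod (l2_inner \<mu> v (\<lambda>x. h x * u x)) \<le> sqrt (l2.q \<mu> v) * sqrt (l2.q \<mu> (\<lambda>x. h x * u x))"
    by (intro l2.cauchy_schwarz uv bm_L2[OF h])
  also have "\<dots> \<le> sqrt (\<kappa> * (\<Sum>m<N. (cmod (b m))\<^sup>2)) * (c * sqrt (\<kappa> * (\<Sum>l<N. (cmod (a l))\<^sup>2)))"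
  proof (intro mult_mono)
    show "sqrt (l2.q \<mu> v) \<le> sqrt (\<kappa> * (\<Sum>m<N. (cmod (b m))\<^sup>2))"
      using q_comb_s[where a="\<lambda>m. cnj (b m)" and N=N] by (simp add: v_def)
    have "sqrt (l2.q \<mu> (\<lambda>x. h x * u x)) \<le> sqrt (c\<^sup>2 * l2.q \<mu> u)"
      using bm_q[OF h uv(1)] by simp
    also have "\<dots> \<le> c * sqrt (\<kappa> * (\<Sum>l<N. (cmod (a l))\<^sup>2))"
      using c q_comb_s[where a=a and N=N] by (simp add: real_sqrt_mult u_def mult_left_mono del: real_sqrt_le_iff)
         (simp add: real_sqrt_mult[symmetric] mult_left_mono)
    finally show "sqrt (l2.q \<mu> (\<lambda>x. h x * u x)) \<le> c * sqrt (\<kappa> * (\<Sum>l<N. (cmod (a l))\<^sup>2))" .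
  qed (use \<kappa> l2.q_nonneg[OF bm_L2[OF h uv(1)]] in \<open>auto simp: sum_nonneg\<close>)
  also have "\<dots> = \<kappa> * c * sqrt (\<Sum>l<N. (cmod (a l))\<^sup>2) * sqrt (\<Sum>m<N. (cmod (b m))\<^sup>2)"
    using \<kappa> by (simp add: real_sqrt_mult mult_ac)
  finally show "cmod (\<Sum>l<N. \<Sum>m<N. a l * G h l m * b m) \<le> \<kappa> * c * sqrt (\<Sum>l<N. (cmod (a l))\<^sup>2) * sqrt (\<Sum>m<N. (cmod (b m))\<^sup>2)"
    unfolding e .
qed

lemma trace_bound:
  assumes \<psi>: "bm \<delta> \<psi>" and h: "bm c h"
  shows "cmod (mtr N (mpow N (G \<psi>) k (G h))) \<le> (\<kappa> * \<delta>) ^ k * (c * Tr)"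
proof -
  have c: "0 \<le> c" using h by (simp add: bm_def)
  have "cmod (mtr N (mpow N (G \<psi>) k (G h))) \<le> (\<kappa> * \<delta>) ^ k * sqrt (\<Sum>l<N. l2.q \<mu> (s l)) * sqrt (\<Sum>l<N. l2.q \<mu> (\<lambda>x. h x * s l x))"
    by (rule l2.mtr_mpow_bound[OF _ _ form_bound_G[OF \<psi>]]) (auto simp: s_L2 bm_L2[OF h] G_def)
  also have "\<dots> \<le> (\<kappa> * \<delta>) ^ k * sqrt Tr * sqrt (c\<^sup>2 * Tr)"
  proof (intro mult_mono mult_left_mono)
    have "(\<Sum>l<N. l2.q \<mu> (\<lambda>x. h x * s l x)) \<le> (\<Sum>l<N. c\<^sup>2 * l2.q \<mu> (s l))"
      by (intro sum_mono bm_q[OF h] s_L2)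
    also have "\<dots> \<le> c\<^sup>2 * Tr" unfolding sum_distrib_left[symmetric] by (intro mult_left_mono sum_q_s_le) auto
    finally show "sqrt (\<Sum>l<N. l2.q \<mu> (\<lambda>x. h x * s l x)) \<le> sqrt (c\<^sup>2 * Tr)" by simp
  qed (use sum_q_s_le \<psi> \<kappa> Tr_nonneg in \<open>auto simp: bm_def intro!: sum_nonneg l2.q_nonneg bm_L2[OF h] s_L2\<close>)
  also have "\<dots> = (\<kappa> * \<delta>) ^ k * (c * Tr)" using c Tr_nonneg by (simp add: real_sqrt_mult)
  finally show ?thesis .
qed

text \<open>The threshold 1/2 makes the Neumann series geometric with a ratio that is independent of
  \<open>N\<close>.\<close>

lemma trace_bound_half:
  assumes \<psi>: "bm \<delta> \<psi>" and h: "bm c h" and \<delta>: "\<bar>\<alpha>\<bar> * \<kappa> * \<delta> \<le> 1/2"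
  shows "cmod (complex_of_real \<alpha> ^ k * mtr N (mpow N (G \<psi>) k (G h))) \<le> c * Tr * (1/2) ^ k"
proof -
  have c: "0 \<le> c" "0 \<le> \<delta>" using h \<psi> by (simp_all add: bm_def)
  have "cmod (complex_of_real \<alpha> ^ k * mtr N (mpow N (G \<psi>) k (G h))) \<le> \<bar>\<alpha>\<bar> ^ k * ((\<kappa> * \<delta>) ^ k * (c * Tr))"
    unfolding norm_mult norm_power using trace_bound[OF \<psi> h, of N k] by (simp add: mult_left_mono)
  also have "\<dots> = (\<bar>\<alpha>\<bar> * \<kappa> * \<delta>) ^ k * (c * Tr)" by (simp add: power_mult_distrib mult_ac)
  also have "\<dots> \<le> (1/2) ^ k * (c * Tr)"
    using \<delta> c \<kappa> Tr_nonneg by (intro mult_right_mono power_mono) auto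
  finally show ?thesis by (simp add: mult_ac)
qed

text \<open>The form of J = I + \<alpha> K with K replaced by its truncation to the first
  \<open>N\<close> vectors.\<close>

definition BJ :: "nat \<Rightarrow> ('a \<Rightarrow> complex) \<Rightarrow> ('a \<Rightarrow> complex) \<Rightarrow> complex" where
  "BJ N f g = l2_inner \<mu> f g + complex_of_real \<alpha> * (\<Sum>p<N. l2_inner \<mu> f (s p) * l2_inner \<mu> (s p) g)"

lemma BJ_self:
  assumes f: "f \<in> L2 \<mu>"
  shows "Re (BJ N f f) = l2.q \<mu> f + \<alpha> * (\<Sum>p<N. (cmod (l2_inner \<mu> (s p) f))\<^sup>2)"
proof -
  have "l2_inner \<mu> f (s p) * l2_inner \<mu> (s p) f = complex_of_real ((cmod (l2_inner \<mu> (s p) f))\<^sup>2)" for p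
    unfolding l2.herm[OF s_L2 f] by (rule cnj_mult_self)
  then have "BJ N f f = complex_of_real (l2.q \<mu> f + \<alpha> * (\<Sum>p<N. (cmod (l2_inner \<mu> (s p) f))\<^sup>2))"
    by (simp add: BJ_def l2.B_self[OF f])
  then show ?thesis by simp
qed

sublocale BJ: psd_form "L2 \<mu>" "BJ N" for N
proof
  fix f g h :: "'a \<Rightarrow> complex" and a b
  assume f: "f \<in> L2 \<mu>" and g: "g \<in> L2 \<mu>"
  show "BJ N g f = cnj (BJ N f g)"
    unfolding BJ_def l2.herm[OF f g] using l2.herm[OF f s_L2] l2.herm[OF s_L2 g]
    by (simp add: l2.herm[OF s_L2 f] l2.herm[OF s_L2 g] mult.commute)
  assume h: "h \<in> L2 \<mu>"
  show "BJ N f (\<lambda>x. a * g x + b * h x) = a * BJ N f g + b * BJ N f h"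
    unfolding BJ_def using f g h
    by (simp add: l2.lin_right s_L2 ring_distribs sum.distrib sum_distrib_left mult_ac)
next
  fix f assume f: "f \<in> L2 \<mu>"
  define Z where "Z = (\<Sum>p<N. (cmod (l2_inner \<mu> (s p) f))\<^sup>2)"
  have Z: "0 \<le> Z" "Z \<le> Q.q f" using bessel_s[OF f] by (auto simp: Z_def sum_nonneg)
  show "0 \<le> Re (BJ N f f)"
  proof (cases "0 \<le> \<alpha>")
    case True
    then show ?thesis unfolding BJ_self[OF f] Z_def[symmetric] using Z l2.q_nonneg[OF f] by simp
  next
    case False
    \<comment> \<open>For negative \<alpha> truncation shrinks the subtracted part, so the truncated
      form dominates the full one and inherits its positivity.\<close>
    then have "\<alpha> * Q.q f \<le> \<alpha> * Z" using Z by (intro mult_left_mono_neg) auto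
    then show ?thesis unfolding BJ_self[OF f] Z_def[symmetric] using J_psd[OF f] by simp
  qed
qed (auto simp: L2_zero L2_lin)

text \<open>Bounds both J and \<alpha> K in operator norm, uniformly in \<open>N\<close>. It
  involves \<alpha> and \<open>\<kappa>\<close> but not \<open>S\<close>, which is what makes the
  final constant independent of the scale.\<close>

definition C0 where "C0 = 1 + \<bar>\<alpha>\<bar> * \<kappa>"

lemma C0: "1 \<le> C0" "\<bar>\<alpha>\<bar> * \<kappa> \<le> C0"
  using \<kappa> by (auto simp: C0_def)

lemma qJ_le:
  assumes f: "f \<in> L2 \<mu>" shows "BJ.q N f \<le> C0 * l2.q \<mu> f"
proof -
  have "BJ.q N f \<le> l2.q \<mu> f + \<bar>\<alpha>\<bar> * (\<Sum>p<N. (cmod (l2_inner \<mu> (s p) f))\<^sup>2)"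
    unfolding BJ.q_def BJ_self[OF f] by (intro add_mono mult_right_mono) (auto simp: sum_nonneg)
  also have "\<dots> \<le> l2.q \<mu> f + \<bar>\<alpha>\<bar> * (\<kappa> * l2.q \<mu> f)"
    using bessel_s[OF f, of N] qQ_le[OF f] by (intro add_left_mono mult_left_mono) auto
  finally show ?thesis by (simp add: C0_def algebra_simps)
qed

definition JN :: "nat \<Rightarrow> ('a \<Rightarrow> complex) \<Rightarrow> 'a \<Rightarrow> complex" where
  "JN N w x = w x + complex_of_real \<alpha> * (\<Sum>p<N. l2_inner \<mu> (s p) w * s p x)"

lemma JN_L2: "w \<in> L2 \<mu> \<Longrightarrow> JN N w \<in> L2 \<mu>"
  unfolding JN_def[abs_def] by (intro l2.add_mem l2.scale_mem l2.sum_mem s_L2)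

lemma BJ_JN:
  assumes f: "f \<in> L2 \<mu>" and w: "w \<in> L2 \<mu>" shows "BJ N f w = l2_inner \<mu> f (JN N w)"
proof -
  have "l2_inner \<mu> f (JN N w) = l2_inner \<mu> f w + complex_of_real \<alpha> * (\<Sum>p<N. l2_inner \<mu> (s p) w * l2_inner \<mu> f (s p))"
    unfolding JN_def[abs_def] using f w
    by (simp add: l2.B_add_right l2.B_scale_right l2.B_sum_right l2.scale_mem l2.sum_mem s_L2)
  then show ?thesis by (simp add: BJ_def mult.commute)
qed

text \<open>The inequality |J w|^2 \<le> |J| <w, J w> without a square root of J: Cauchy-Schwarz for
  the form of J is applied to J w and w, and one factor is cancelled.\<close>

lemma q_JN_le:
  assumes w: "w \<in> L2 \<mu>" shows "l2.q \<mu> (JN N w) \<le> C0 * BJ.q N w"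
proof -
  let ?J = "JN N w"
  have J: "?J \<in> L2 \<mu>" by (rule JN_L2[OF w])
  have "l2.q \<mu> ?J = Re (BJ N ?J w)" unfolding BJ_JN[OF J w] l2.q_def ..
  also have "\<dots> \<le> sqrt (BJ.q N ?J) * sqrt (BJ.q N w)"
    by (rule order_trans[OF complex_Re_le_cmod BJ.cauchy_schwarz[OF J w]])
  finally have "(l2.q \<mu> ?J)\<^sup>2 \<le> (sqrt (BJ.q N ?J) * sqrt (BJ.q N w))\<^sup>2"
    using l2.q_nonneg[OF J] by (intro power_mono)
  also have "\<dots> = BJ.q N ?J * BJ.q N w"
    using BJ.q_nonneg[OF J] BJ.q_nonneg[OF w] by (simp add: power_mult_distrib)
  also have "\<dots> \<le> (C0 * l2.q \<mu> ?J) * BJ.q N w"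
    using qJ_le[OF J] BJ.q_nonneg[OF w] by (intro mult_right_mono)
  finally have "l2.q \<mu> ?J * l2.q \<mu> ?J \<le> (C0 * BJ.q N w) * l2.q \<mu> ?J"
    by (simp add: power2_eq_square mult_ac)
  then show ?thesis
    using l2.q_nonneg[OF J] C0 BJ.q_nonneg[OF w, of N]
    by (cases "l2.q \<mu> ?J = 0") (auto simp: mult_le_cancel_right)
qed

text \<open>The Hilbert-Schmidt norm of J^(1/2) \<theta> K^(1/2) in truncated form. For the test
  function itself its square converges to the variance.\<close>

definition nJ :: "nat \<Rightarrow> ('a \<Rightarrow> complex) \<Rightarrow> real" where
  "nJ N \<theta> = sqrt (\<Sum>l<N. BJ.q N (\<lambda>x. \<theta> x * s l x))"

lemma nJ_nonneg: "bm c \<theta> \<Longrightarrow> 0 \<le> nJ N \<theta>"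
  unfolding nJ_def by (intro real_sqrt_ge_zero sum_nonneg BJ.q_nonneg bm_L2 s_L2)

lemma nJ_add:
  assumes "bm c \<theta>" "bm d \<eta>" shows "nJ N (\<lambda>x. \<theta> x + \<eta> x) \<le> nJ N \<theta> + nJ N \<eta>"
  using BJ.sum_q_triangle[of "{..<N}" "\<lambda>l x. \<theta> x * s l x" "\<lambda>l x. \<eta> x * s l x" N] assms
  by (simp add: nJ_def bm_L2 s_L2 ring_distribs)

lemma nJ_scale: "bm c \<theta> \<Longrightarrow> nJ N (\<lambda>x. a * \<theta> x) = cmod a * nJ N \<theta>"
proof -
  assume \<theta>: "bm c \<theta>"
  have "BJ.q N (\<lambda>x. a * \<theta> x * s l x) = (cmod a)\<^sup>2 * BJ.q N (\<lambda>x. \<theta> x * s l x)" for l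
    using BJ.q_scale[OF bm_L2[OF \<theta> s_L2], of N a l] by (simp add: mult.assoc)
  then show ?thesis by (simp add: nJ_def sum_distrib_left[symmetric] real_sqrt_mult)
qed

lemma nJ_le:
  assumes \<theta>: "bm c \<theta>" shows "nJ N \<theta> \<le> c * sqrt (C0 * Tr)"
proof -
  have c: "0 \<le> c" using \<theta> by (simp add: bm_def)
  have "(\<Sum>l<N. BJ.q N (\<lambda>x. \<theta> x * s l x)) \<le> (\<Sum>l<N. C0 * (c\<^sup>2 * l2.q \<mu> (s l)))"
  proof (rule sum_mono)
    fix l
    show "BJ.q N (\<lambda>x. \<theta> x * s l x) \<le> C0 * (c\<^sup>2 * l2.q \<mu> (s l))"
      using qJ_le[OF bm_L2[OF \<theta> s_L2[of l]], of N] mult_left_mono[OF bm_q[OF \<theta> s_L2[of l]], of C0] C0 by linarith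
  qed
  also have "\<dots> = C0 * c\<^sup>2 * (\<Sum>l<N. l2.q \<mu> (s l))" by (simp add: sum_distrib_left mult_ac)
  also have "\<dots> \<le> C0 * c\<^sup>2 * Tr" using C0 by (intro mult_left_mono sum_q_s_le) auto
  finally have "nJ N \<theta> \<le> sqrt (C0 * c\<^sup>2 * Tr)" unfolding nJ_def by (rule real_sqrt_le_mono)
  also have "\<dots> = c * sqrt (C0 * Tr)" using c by (simp add: real_sqrt_mult)
  finally show ?thesis .
qed

text \<open>The identity \<open>1 = J - \<alpha> K\<close> is inserted between the two multiplication operators.\<close>

lemma nJ_mult:
  assumes \<theta>: "bm c \<theta>" and \<eta>: "bm d \<eta>"
  shows "nJ N (\<lambda>x. \<theta> x * \<eta> x) \<le> C0 * (c * nJ N \<eta> + d * nJ N \<theta>)"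
proof -
  have cd: "0 \<le> c" "0 \<le> d" using \<theta> \<eta> by (simp_all add: bm_def)
  define u where "u l x = \<theta> x * JN N (\<lambda>x. \<eta> x * s l x) x" for l x
  define w where "w l x = (- complex_of_real \<alpha>) * (\<Sum>p<N. G \<eta> l p * (\<theta> x * s p x))" for l x
  have es: "(\<lambda>x. \<eta> x * s l x) \<in> L2 \<mu>" and ts: "(\<lambda>x. \<theta> x * s l x) \<in> L2 \<mu>" for l
    by (intro bm_L2[OF \<eta>] bm_L2[OF \<theta>] s_L2)+
  have u: "u l \<in> L2 \<mu>" for l unfolding u_def[abs_def] by (intro bm_L2[OF \<theta>] JN_L2 es)
  have w0: "(\<lambda>x. \<Sum>p<N. G \<eta> l p * (\<theta> x * s p x)) \<in> L2 \<mu>" for l by (intro l2.sum_mem ts)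
  have w: "w l \<in> L2 \<mu>" for l unfolding w_def[abs_def] by (intro l2.scale_mem w0)
  \<comment> \<open>The vector \<eta> s l is J applied to it minus \<alpha> K applied to it. In the
    first part \<open>q_JN_le\<close> recovers the norm of \<eta>; the second is a combination of
    the vectors \<theta> s p with the bounded matrix \<open>G \<eta>\<close>, which leaves the norm
    of \<theta>.\<close>
  have split: "(\<lambda>x. \<theta> x * \<eta> x * s l x) = (\<lambda>x. u l x + w l x)" for l
    unfolding u_def w_def JN_def G_def by (auto simp: fun_eq_iff ring_distribs sum_distrib_left sum_negf mult_ac)
  have "nJ N (\<lambda>x. \<theta> x * \<eta> x) \<le> sqrt (\<Sum>l<N. BJ.q N (u l)) + sqrt (\<Sum>l<N. BJ.q N (w l))"
    unfolding nJ_def split by (intro BJ.sum_q_triangle u w)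
  also have "sqrt (\<Sum>l<N. BJ.q N (u l)) \<le> C0 * c * nJ N \<eta>"
  proof -
    have "(\<Sum>l<N. BJ.q N (u l)) \<le> (\<Sum>l<N. (C0 * c)\<^sup>2 * BJ.q N (\<lambda>x. \<eta> x * s l x))"
    proof (rule sum_mono)
      fix l
      have "BJ.q N (u l) \<le> C0 * l2.q \<mu> (u l)" by (rule qJ_le[OF u])
      also have "\<dots> \<le> C0 * (c\<^sup>2 * l2.q \<mu> (JN N (\<lambda>x. \<eta> x * s l x)))"
        unfolding u_def[abs_def] using C0 by (intro mult_left_mono bm_q[OF \<theta>] JN_L2 es) auto
      also have "\<dots> \<le> C0 * (c\<^sup>2 * (C0 * BJ.q N (\<lambda>x. \<eta> x * s l x)))"
        using C0 by (intro mult_left_mono q_JN_le es) auto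
      finally show "BJ.q N (u l) \<le> (C0 * c)\<^sup>2 * BJ.q N (\<lambda>x. \<eta> x * s l x)"
        by (simp add: power2_eq_square mult_ac)
    qed
    then have "sqrt (\<Sum>l<N. BJ.q N (u l)) \<le> sqrt ((C0 * c)\<^sup>2 * (\<Sum>l<N. BJ.q N (\<lambda>x. \<eta> x * s l x)))"
      by (simp add: sum_distrib_left)
    also have "\<dots> = C0 * c * nJ N \<eta>" using C0 cd by (simp add: real_sqrt_mult nJ_def)
    finally show ?thesis .
  qed
  also have "sqrt (\<Sum>l<N. BJ.q N (w l)) \<le> C0 * d * nJ N \<theta>"
  proof -
    have "(\<Sum>l<N. BJ.q N (\<lambda>x. \<Sum>p<N. G \<eta> l p * (\<theta> x * s p x))) \<le> (\<kappa> * d)\<^sup>2 * (\<Sum>p<N. BJ.q N (\<lambda>x. \<theta> x * s p x))"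
      by (rule BJ.sum_q_matrix[OF ts form_bound_transpose[OF form_bound_G[OF \<eta>]]])
    moreover have "BJ.q N (w l) = \<alpha>\<^sup>2 * BJ.q N (\<lambda>x. \<Sum>p<N. G \<eta> l p * (\<theta> x * s p x))" for l
      unfolding w_def[abs_def] by (subst BJ.q_scale[OF w0]) simp
    ultimately have "(\<Sum>l<N. BJ.q N (w l)) \<le> \<alpha>\<^sup>2 * ((\<kappa> * d)\<^sup>2 * (\<Sum>p<N. BJ.q N (\<lambda>x. \<theta> x * s p x)))"
      by (simp add: sum_distrib_left[symmetric] mult_left_mono)
    then have "sqrt (\<Sum>l<N. BJ.q N (w l)) \<le> sqrt (\<alpha>\<^sup>2 * ((\<kappa> * d)\<^sup>2 * (\<Sum>p<N. BJ.q N (\<lambda>x. \<theta> x * s p x))))"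
      by (rule real_sqrt_le_mono)
    also have "\<dots> = \<bar>\<alpha>\<bar> * \<kappa> * d * nJ N \<theta>" using \<kappa> cd by (simp add: real_sqrt_mult nJ_def mult_ac)
    also have "\<dots> \<le> C0 * d * nJ N \<theta>"
      using C0 cd nJ_nonneg[OF \<theta>] by (intro mult_right_mono) auto
    finally show ?thesis .
  qed
  finally show ?thesis by (simp add: algebra_simps)
qed

end

lemma exp_partial_le:
  fixes x :: real assumes "0 \<le> x"
  shows "(\<Sum>n<M. x ^ n / fact n) \<le> exp x"
proof -
  have "(\<lambda>n. x ^ n / fact n) sums exp x"
    using exp_converges[of x] by (simp add: divide_inverse mult.commute)
  then have "(\<Sum>n<M. x ^ n / fact n) \<le> (\<Sum>n. x ^ n / fact n)"
    using assms by (intro sum_le_suminf) (auto simp: sums_iff)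
  then show ?thesis using \<open>_ sums exp x\<close> by (simp add: sums_iff)
qed

section \<open>Power series in the test function\<close>

context alpha_kernel
begin

lemma bm_sum: "finite A \<Longrightarrow> (\<And>n. n \<in> A \<Longrightarrow> bm (d n) (f n)) \<Longrightarrow> bm (\<Sum>n\<in>A. cmod (c n) * d n) (\<lambda>x. \<Sum>n\<in>A. c n * f n x)"
proof (induction A rule: finite_induct)
  case (insert n A)
  then show ?case using bm_add[OF bm_scale[of "d n" "f n" "c n"]] by simp
qed (simp add: bm_def)

lemma nJ_sum: "finite A \<Longrightarrow> (\<And>n. n \<in> A \<Longrightarrow> bm (d n) (f n)) \<Longrightarrow>
   nJ N (\<lambda>x. \<Sum>n\<in>A. c n * f n x) \<le> (\<Sum>n\<in>A. cmod (c n) * nJ N (f n))"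
proof (induction A rule: finite_induct)
  case empty
  then show ?case by (simp add: nJ_def BJ.q_def BJ.B_zero_left L2_zero)
next
  case (insert n A)
  have 1: "bm (cmod (c n) * d n) (\<lambda>x. c n * f n x)" using insert by (intro bm_scale) simp
  have 2: "bm (\<Sum>n\<in>A. cmod (c n) * d n) (\<lambda>x. \<Sum>n\<in>A. c n * f n x)" using insert by (intro bm_sum) auto
  have 3: "nJ N (\<lambda>x. c n * f n x) = cmod (c n) * nJ N (f n)" by (rule nJ_scale[of "d n"]) (use insert.prems in simp)
  show ?case using nJ_add[OF 1 2, of N] insert 3 by simp
qed

lemma mpow_G_diff:
  "mtr N (mpow N H k (\<lambda>l m. A l m + a * D l m)) = mtr N (mpow N H k A) + a * mtr N (mpow N H k D)"
  unfolding mtr_mpow by (simp add: ring_distribs sum.distrib sum_distrib_left mult_ac)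

context
  fixes \<phi> :: "'a \<Rightarrow> real" and b :: real
  assumes \<phi>: "\<phi> \<in> borel_measurable \<mu>" "\<And>x. \<bar>\<phi> x\<bar> \<le> b" and b: "0 \<le> b"
begin

abbreviation cphi :: "'a \<Rightarrow> complex" where "cphi \<equiv> \<lambda>x. complex_of_real (\<phi> x)"

lemma bm_cphi: "bm b cphi"
  using \<phi> b by (simp add: bm_def)

lemma bm_power: "bm (b ^ Suc n) (\<lambda>x. cphi x ^ Suc n)"
proof (induction n)
  case (Suc n)
  then show ?case using bm_mult[OF bm_cphi Suc] by simp
qed (use bm_cphi in simp)

text \<open>\<open>nJ_mult\<close> is iterated like the product rule for a power: the exponent
  appears as a factor, which the factorials of the exponential series later absorb.\<close>

lemma nJ_power: "nJ N (\<lambda>x. cphi x ^ Suc n) \<le> real (Suc n) * (C0 * b) ^ n * nJ N cphi"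
proof (induction n)
  case (Suc n)
  have s: "0 \<le> nJ N cphi" by (rule nJ_nonneg[OF bm_cphi])
  have "nJ N (\<lambda>x. cphi x * cphi x ^ Suc n) \<le> C0 * (b * nJ N (\<lambda>x. cphi x ^ Suc n) + b ^ Suc n * nJ N cphi)"
    by (rule nJ_mult[OF bm_cphi bm_power])
  also have "\<dots> \<le> C0 * (b * (real (Suc n) * (C0 * b) ^ n * nJ N cphi)) + C0 ^ Suc n * b ^ Suc n * nJ N cphi"
  proof -
    have "C0 ^ 1 \<le> C0 ^ Suc n" using C0 by (intro power_increasing) auto
    then have "C0 * (b ^ Suc n * nJ N cphi) \<le> C0 ^ Suc n * (b ^ Suc n * nJ N cphi)"
      using b s by (intro mult_right_mono) auto
    moreover have "C0 * (b * nJ N (\<lambda>x. cphi x ^ Suc n)) \<le> C0 * (b * (real (Suc n) * (C0 * b) ^ n * nJ N cphi))"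
      using Suc b C0 by (intro mult_left_mono) auto
    ultimately show ?thesis by (simp add: distrib_left mult.assoc)
  qed
  also have "\<dots> = real (Suc (Suc n)) * (C0 * b) ^ Suc n * nJ N cphi"
    by (simp add: power_mult_distrib algebra_simps)
  finally show ?case by (simp add: mult_ac)
qed simp

text \<open>For fixed \<open>N\<close> the norm is continuous under uniform convergence by
  \<open>nJ_le\<close>. The trace enters only through the modulus of continuity, where it is
  multiplied by \<open>\<epsilon> M\<close> and disappears in the limit.\<close>

lemma nJ_series:
  assumes \<theta>: "bm d \<theta>"
    and \<epsilon>: "\<And>M x. cmod (\<theta> x - (\<Sum>n<M. c n * cphi x ^ Suc n)) \<le> \<epsilon> M" "\<epsilon> \<longlonglongrightarrow> 0"
    and Z: "\<And>M. (\<Sum>n<M. cmod (c n) * (real (Suc n) * (C0 * b) ^ n)) \<le> Z"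
  shows "nJ N \<theta> \<le> Z * nJ N cphi"
proof -
  have s: "0 \<le> nJ N cphi" by (rule nJ_nonneg[OF bm_cphi])
  have "nJ N \<theta> \<le> Z * nJ N cphi + \<epsilon> M * sqrt (C0 * Tr)" for M
  proof -
    define p where "p = (\<lambda>x. \<Sum>n<M. c n * cphi x ^ Suc n)"
    have p: "bm (\<Sum>n<M. cmod (c n) * b ^ Suc n) p" unfolding p_def by (intro bm_sum bm_power) simp
    have \<epsilon>0: "0 \<le> \<epsilon> M" using norm_ge_zero[of "\<theta> undefined - p undefined"] \<epsilon>(1)[of undefined M] unfolding p_def by linarith
    have r: "bm (\<epsilon> M) (\<lambda>x. \<theta> x - p x)"
      using bm_meas[OF \<theta>] bm_meas[OF p] \<epsilon>(1)[of _ M] \<epsilon>0 by (simp add: bm_def p_def)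
    have "nJ N \<theta> = nJ N (\<lambda>x. p x + (\<theta> x - p x))" by simp
    also have "\<dots> \<le> nJ N p + nJ N (\<lambda>x. \<theta> x - p x)" by (rule nJ_add[OF p r])
    also have "nJ N (\<lambda>x. \<theta> x - p x) \<le> \<epsilon> M * sqrt (C0 * Tr)" by (rule nJ_le[OF r])
    also have "nJ N p \<le> (\<Sum>n<M. cmod (c n) * nJ N (\<lambda>x. cphi x ^ Suc n))"
      unfolding p_def by (rule nJ_sum[OF finite_lessThan bm_power])
    also have "\<dots> \<le> (\<Sum>n<M. cmod (c n) * (real (Suc n) * (C0 * b) ^ n * nJ N cphi))"
      by (intro sum_mono mult_left_mono nJ_power) auto
    also have "\<dots> = (\<Sum>n<M. cmod (c n) * (real (Suc n) * (C0 * b) ^ n)) * nJ N cphi"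
      by (simp only: sum_distrib_right mult.assoc)
    also have "\<dots> \<le> Z * nJ N cphi" using Z[of M] s by (rule mult_right_mono)
    finally show ?thesis by simp
  qed
  moreover have "(\<lambda>M. Z * nJ N cphi + \<epsilon> M * sqrt (C0 * Tr)) \<longlonglongrightarrow> Z * nJ N cphi + 0 * sqrt (C0 * Tr)"
    by (intro tendsto_intros \<epsilon>)
  ultimately show ?thesis by (intro LIMSEQ_le_const[of "\<lambda>M. Z * nJ N cphi + \<epsilon> M * sqrt (C0 * Tr)"]) auto
qed

text \<open>Chosen so that the product of \<open>1 + psi y\<close> over the points is the
  exponential of \<i> y times the linear statistic.\<close>

definition psi :: "real \<Rightarrow> 'a \<Rightarrow> complex" where "psi y x = iexp (y * \<phi> x) - 1"

lemma psi_le: "cmod (psi y x) \<le> \<bar>y\<bar> * b"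
proof -
  have "cmod (psi y x) \<le> \<bar>y * \<phi> x\<bar>" unfolding psi_def using iexp_approx1[of "y * \<phi> x" 0] by simp
  also have "\<dots> \<le> \<bar>y\<bar> * b" using \<phi>(2)[of x] by (simp add: abs_mult mult_left_mono)
  finally show ?thesis .
qed

lemma bm_psi: "bm (\<bar>y\<bar> * b) (psi y)"
proof -
  note [measurable] = \<phi>(1)
  have "psi y \<in> borel_measurable \<mu>" unfolding psi_def[abs_def] by measurable
  then show ?thesis using psi_le b by (simp add: bm_def)
qed

lemma fact_inverse_tendsto: "(\<lambda>M. 1 / fact (Suc M) :: real) \<longlonglongrightarrow> 0"
proof (rule Lim_null_comparison[OF always_eventually LIMSEQ_inverse_real_of_nat], rule allI)
  fix M
  have "real (Suc M) \<le> fact (Suc M)" using fact_ge_self[of "Suc M"] of_nat_mono by fastforce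
  then show "norm (1 / fact (Suc M) :: real) \<le> inverse (real (Suc M))"
    by (simp add: inverse_eq_divide frac_le del: fact_Suc of_nat_Suc)
qed

lemma psi_partial:
  assumes y: "\<bar>y\<bar> * (C0 * b) \<le> 1"
  shows "cmod (psi y x - (\<Sum>n<M. ((\<i> * y) ^ Suc n / fact (Suc n)) * cphi x ^ Suc n)) \<le> 1 / fact (Suc M)"
proof -
  have "\<bar>y * \<phi> x\<bar> \<le> \<bar>y\<bar> * b" using \<phi>(2)[of x] by (simp add: abs_mult mult_left_mono)
  also have "\<dots> \<le> \<bar>y\<bar> * (C0 * b)" using C0 b by (intro mult_left_mono) (auto simp: mult_le_cancel_right1)
  finally have u: "\<bar>y * \<phi> x\<bar> \<le> 1" using y by simp
  have "(\<Sum>k\<le>M. (\<i> * (y * \<phi> x)) ^ k / fact k) = 1 + (\<Sum>n<M. (\<i> * (y * \<phi> x)) ^ Suc n / fact (Suc n))"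
    by (subst sum.atMost_shift) simp
  also have "(\<Sum>n<M. (\<i> * (y * \<phi> x)) ^ Suc n / fact (Suc n)) = (\<Sum>n<M. ((\<i> * y) ^ Suc n / fact (Suc n)) * cphi x ^ Suc n)"
    by (intro sum.cong refl) (simp only: of_real_mult power_mult_distrib mult.assoc[symmetric] times_divide_eq_left)
  finally have "psi y x - (\<Sum>n<M. ((\<i> * y) ^ Suc n / fact (Suc n)) * cphi x ^ Suc n)
     = iexp (y * \<phi> x) - (\<Sum>k\<le>M. (\<i> * (y * \<phi> x)) ^ k / fact k)"
    by (simp add: psi_def)
  also have "cmod \<dots> \<le> \<bar>y * \<phi> x\<bar> ^ Suc M / fact (Suc M)" by (rule iexp_approx1)
  also have "\<dots> \<le> 1 / fact (Suc M)"
    using u by (intro divide_right_mono power_le_one) auto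
  finally show ?thesis .
qed

text \<open>The factor \<open>Suc n\<close> from \<open>nJ_power\<close> cancels against the
  factorial, so the majorant is an exponential series.\<close>

lemma psi_coeff:
  "cmod ((\<i> * y) ^ Suc n / fact (Suc n)) * (real (Suc n) * (C0 * b) ^ n) = \<bar>y\<bar> * ((\<bar>y\<bar> * (C0 * b)) ^ n / fact n)"
proof -
  have "fact (Suc n) = real (Suc n) * fact n" by simp
  then show ?thesis
    by (simp add: norm_divide norm_power norm_mult power_mult_distrib del: of_nat_Suc)
qed

text \<open>The weights from \<open>psi_coeff\<close> sum to at most \<bar>y\<bar> times
  \<open>exp 1\<close>, and 3 bounds the latter.\<close>

lemma nJ_psi:
  assumes y: "\<bar>y\<bar> * (C0 * b) \<le> 1" shows "nJ N (psi y) \<le> 3 * \<bar>y\<bar> * nJ N cphi"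
proof (rule nJ_series[OF bm_psi psi_partial[OF y] fact_inverse_tendsto])
  fix M
  have x: "0 \<le> \<bar>y\<bar> * (C0 * b)" using C0 b by simp
  have "(\<Sum>n<M. cmod ((\<i> * y) ^ Suc n / fact (Suc n)) * (real (Suc n) * (C0 * b) ^ n)) = \<bar>y\<bar> * (\<Sum>n<M. (\<bar>y\<bar> * (C0 * b)) ^ n / fact n)"
    by (simp only: psi_coeff sum_distrib_left)
  also have "\<dots> \<le> \<bar>y\<bar> * exp (\<bar>y\<bar> * (C0 * b))" by (intro mult_left_mono exp_partial_le x) simp
  also have "\<dots> \<le> \<bar>y\<bar> * 3"
    using order_trans[OF _ exp_le, of "exp (\<bar>y\<bar> * (C0 * b))"] y by (intro mult_left_mono) auto
  finally show "(\<Sum>n<M. cmod ((\<i> * y) ^ Suc n / fact (Suc n)) * (real (Suc n) * (C0 * b) ^ n)) \<le> 3 * \<bar>y\<bar>" by simp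
qed

lemma bm_psi_diff: "bm (\<bar>y\<bar> * b + cmod (- (\<i> * y)) * b) (\<lambda>x. psi y x + (- (\<i> * y)) * cphi x)"
  by (intro bm_add bm_psi bm_scale bm_cphi)

lemma nJ_psi_diff:
  assumes y: "\<bar>y\<bar> * (C0 * b) \<le> 1"
  shows "nJ N (\<lambda>x. psi y x + (- (\<i> * y)) * cphi x) \<le> 2 * C0 * b * y\<^sup>2 * nJ N cphi"
proof (rule nJ_series[OF bm_psi_diff])
  define c where "c n = (\<i> * y) ^ Suc n / fact (Suc n)" for n
  define c' where "c' n = (if n = 0 then 0 else c n)" for n
  \<comment> \<open>With no term subtracted, the linear term removed from the coefficients
    \<open>c'\<close> has no counterpart in a partial sum of psi, so the first error is the crude
    uniform bound; the limit does not see it.\<close>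
  show "(\<lambda>M. if M = 0 then \<bar>y\<bar> * b + cmod (- (\<i> * y)) * b else 1 / fact (Suc M) :: real) \<longlonglongrightarrow> 0"
    by (rule Lim_transform_eventually[OF fact_inverse_tendsto]) (use eventually_gt_at_top[of 0] in eventually_elim, simp)
  show "cmod (psi y x + (- (\<i> * y)) * cphi x - (\<Sum>n<M. c' n * cphi x ^ Suc n))
    \<le> (if M = 0 then \<bar>y\<bar> * b + cmod (- (\<i> * y)) * b else 1 / fact (Suc M))" for M x
  proof (cases M)
    case 0
    then show ?thesis using bm_psi_diff[of y] by (simp add: bm_def)
  next
    case (Suc m)
    have "(\<Sum>n<M. c n * cphi x ^ Suc n) = c 0 * cphi x + (\<Sum>n<M. c' n * cphi x ^ Suc n)"
      unfolding Suc sum.lessThan_Suc_shift by (simp add: c'_def)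
    then have "psi y x + (- (\<i> * y)) * cphi x - (\<Sum>n<M. c' n * cphi x ^ Suc n) = psi y x - (\<Sum>n<M. c n * cphi x ^ Suc n)"
      by (simp add: c_def)
    then show ?thesis using psi_partial[OF y, of x M, folded c_def] Suc by (simp only: nat.distinct if_False)
  qed
  fix M
  define t where "t = \<bar>y\<bar> * (C0 * b)"
  have t: "0 \<le> t" "t \<le> 1" using C0 b y by (auto simp: t_def)
  have "(\<Sum>n<M. cmod (c' n) * (real (Suc n) * (C0 * b) ^ n)) \<le> \<bar>y\<bar> * (2 * t)"
  proof (cases M)
    case 0
    then show ?thesis using t by simp
  next
    case (Suc m)
    have "(\<Sum>n<M. cmod (c' n) * (real (Suc n) * (C0 * b) ^ n)) = (\<Sum>n<m. \<bar>y\<bar> * (t ^ Suc n / fact (Suc n)))"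
      unfolding Suc sum.lessThan_Suc_shift c'_def c_def t_def
      using psi_coeff[of y] by (simp del: fact_Suc power_Suc of_nat_Suc)
    also have "\<dots> = \<bar>y\<bar> * ((\<Sum>n<M. t ^ n / fact n) - 1)"
      unfolding Suc sum.lessThan_Suc_shift by (simp add: sum_distrib_left del: fact_Suc power_Suc)
    also have "\<dots> \<le> \<bar>y\<bar> * (exp t - 1)"
      by (intro mult_left_mono diff_right_mono exp_partial_le t) simp
    also have "\<dots> \<le> \<bar>y\<bar> * (2 * t)"
    proof -
      have "exp t \<le> 1 + t + t\<^sup>2" using t by (intro exp_bound)
      also have "t\<^sup>2 \<le> t" using t by (simp add: power2_eq_square mult_left_le)
      finally show ?thesis by (intro mult_left_mono) auto
    qed
    finally show ?thesis .
  qed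
  also have "\<dots> = 2 * C0 * b * y\<^sup>2" by (simp add: t_def power2_eq_square mult_ac abs_mult_self_eq flip: power2_abs)
  finally show "(\<Sum>n<M. cmod (c' n) * (real (Suc n) * (C0 * b) ^ n)) \<le> 2 * C0 * b * y\<^sup>2" .
qed

text \<open>Here J enters: the \<open>L2\<close> pairing of the two families, corrected by \<alpha>
  times a product of their matrices, is their pairing under J. The product has one factor more and
  will be supplied by the next term of the Neumann series.\<close>

lemma G_J:
  assumes \<theta>: "bm d \<theta>"
  shows "G (\<lambda>x. cphi x * \<theta> x) l m + complex_of_real \<alpha> * mm N (G \<theta>) (G cphi) l m
    = BJ N (\<lambda>x. cphi x * s m x) (\<lambda>x. \<theta> x * s l x)"
proof -
  have ps: "(\<lambda>x. cphi x * s m x) \<in> L2 \<mu>" for m by (intro bm_L2[OF bm_cphi] s_L2)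
  have "G (\<lambda>x. cphi x * \<theta> x) l m = l2_inner \<mu> (\<lambda>x. cphi x * s m x) (\<lambda>x. \<theta> x * s l x)"
    unfolding G_def l2_inner_def by (simp add: mult_ac)
  moreover have "G cphi p m = l2_inner \<mu> (\<lambda>x. cphi x * s m x) (s p)" for p
    unfolding G_def l2_inner_def by (simp add: mult_ac)
  ultimately show ?thesis
    unfolding BJ_def mm_def by (simp add: G_def mult.commute)
qed

text \<open>The variance formula tr(\<phi>^2 K) + \<alpha> tr(\<phi> K \<phi> K) in finite rank,
  recognised as a squared norm.\<close>

lemma nJ_sq_mtr:
  "complex_of_real ((nJ N cphi)\<^sup>2) = mtr N (G (\<lambda>x. cphi x * cphi x)) + complex_of_real \<alpha> * mtr N (mm N (G cphi) (G cphi))"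
proof -
  have ps: "(\<lambda>x. cphi x * s m x) \<in> L2 \<mu>" for m by (intro bm_L2[OF bm_cphi] s_L2)
  have "complex_of_real ((nJ N cphi)\<^sup>2) = (\<Sum>l<N. BJ N (\<lambda>x. cphi x * s l x) (\<lambda>x. cphi x * s l x))"
    by (simp add: nJ_def sum_nonneg BJ.q_nonneg ps BJ.B_self)
  also have "\<dots> = (\<Sum>l<N. G (\<lambda>x. cphi x * cphi x) l l + complex_of_real \<alpha> * mm N (G cphi) (G cphi) l l)"
    by (simp add: G_J[OF bm_cphi])
  finally show ?thesis by (simp add: mtr_def sum.distrib sum_distrib_left)
qed

text \<open>The logarithmic derivative of the finite rank characteristic function is \<open>\<i>\<close> times the
  series below.\<close>

lemma log_deriv_bound:
  assumes y: "\<bar>y\<bar> * (C0 * b) \<le> 1/2"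
  shows "cmod ((\<Sum>k. complex_of_real \<alpha> ^ k * mtr N (mpow N (G (psi y)) k (G (\<lambda>x. cphi x * (1 + psi y x)))))
      - mtr N (G cphi) - \<i> * y * (nJ N cphi)\<^sup>2) \<le> 8 * C0 * b * y\<^sup>2 * (nJ N cphi)\<^sup>2"
proof -
  define \<sigma> where "\<sigma> = nJ N cphi"
  have \<sigma>: "0 \<le> \<sigma>" unfolding \<sigma>_def by (rule nJ_nonneg[OF bm_cphi])
  define g where "g = \<bar>\<alpha>\<bar> * \<kappa> * (\<bar>y\<bar> * b)"
  have "g \<le> C0 * (\<bar>y\<bar> * b)" unfolding g_def using C0 b by (intro mult_right_mono) auto
  then have g: "0 \<le> g" "g \<le> 1/2" "g \<le> \<bar>y\<bar> * (C0 * b)" using y \<kappa> b by (auto simp: g_def mult_ac)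
  have y1: "\<bar>y\<bar> * (C0 * b) \<le> 1" using y by simp
  define t where "t k = mtr N (mpow N (G (psi y)) k (G cphi))" for k
  define u where "u k = mtr N (mpow N (G (psi y)) k (G (\<lambda>x. cphi x * psi y x)))" for k
  \<comment> \<open>By themselves \<open>t\<close> and \<open>u\<close> are controlled only through
    \<open>Tr\<close>. Shifting the index of the first series pairs each \<open>u k\<close> with
    \<alpha> times \<open>t (Suc k)\<close>; by \<open>G_J\<close> this is a pairing under J and
    hence of the order of the variance. What is left over is \<open>t 0\<close>, the mean.\<close>
  define z where "z k = u k + complex_of_real \<alpha> * t (Suc k)" for k
  have bmp: "bm (b * (\<bar>y\<bar> * b)) (\<lambda>x. cphi x * psi y x)" by (intro bm_mult bm_cphi bm_psi)
  have half: "\<bar>\<alpha>\<bar> * \<kappa> * (\<bar>y\<bar> * b) \<le> 1/2" using g by (simp add: g_def)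
  have sum_half: "summable (\<lambda>k. c * Tr * (1/2::real) ^ k)" for c by (intro summable_mult summable_geometric) simp
  have st: "summable (\<lambda>k. complex_of_real \<alpha> ^ k * t k)"
    by (rule summable_comparison_test[OF _ sum_half[of b]])
       (use trace_bound_half[OF bm_psi bm_cphi half] in \<open>auto simp: t_def\<close>)
  have su: "summable (\<lambda>k. complex_of_real \<alpha> ^ k * u k)"
    by (rule summable_comparison_test[OF _ sum_half[of "b * (\<bar>y\<bar> * b)"]])
       (use trace_bound_half[OF bm_psi bmp half] in \<open>auto simp: u_def\<close>)
  have Gadd: "G (\<lambda>x. cphi x * (1 + psi y x)) = (\<lambda>l m. G cphi l m + 1 * G (\<lambda>x. cphi x * psi y x) l m)"
  proof (intro ext)
    fix l m
    have "G (\<lambda>x. cphi x * (1 + psi y x)) l m = l2_inner \<mu> (s m) (\<lambda>x. cphi x * s l x + cphi x * psi y x * s l x)"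
      by (simp add: G_def algebra_simps)
    also have "\<dots> = G cphi l m + 1 * G (\<lambda>x. cphi x * psi y x) l m"
      unfolding G_def by (subst l2.B_add_right) (auto intro!: s_L2 bm_L2[OF bm_cphi] bm_L2[OF bmp])
    finally show "G (\<lambda>x. cphi x * (1 + psi y x)) l m = G cphi l m + 1 * G (\<lambda>x. cphi x * psi y x) l m" .
  qed
  have "(\<Sum>k. complex_of_real \<alpha> ^ k * mtr N (mpow N (G (psi y)) k (G (\<lambda>x. cphi x * (1 + psi y x)))))
     = (\<Sum>k. complex_of_real \<alpha> ^ k * t k + complex_of_real \<alpha> ^ k * u k)"
    unfolding Gadd mpow_G_diff t_def u_def by (simp add: ring_distribs)
  also have "\<dots> = (\<Sum>k. complex_of_real \<alpha> ^ k * t k) + (\<Sum>k. complex_of_real \<alpha> ^ k * u k)"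
    by (rule suminf_add[OF st su, symmetric])
  also have "(\<Sum>k. complex_of_real \<alpha> ^ k * t k) = t 0 + (\<Sum>k. complex_of_real \<alpha> ^ Suc k * t (Suc k))"
    using suminf_split_head[OF st] by simp
  also have "t 0 + (\<Sum>k. complex_of_real \<alpha> ^ Suc k * t (Suc k)) + (\<Sum>k. complex_of_real \<alpha> ^ k * u k)
     = t 0 + ((\<Sum>k. complex_of_real \<alpha> ^ Suc k * t (Suc k)) + (\<Sum>k. complex_of_real \<alpha> ^ k * u k))" by simp
  also have "(\<Sum>k. complex_of_real \<alpha> ^ Suc k * t (Suc k)) + (\<Sum>k. complex_of_real \<alpha> ^ k * u k)
     = (\<Sum>k. complex_of_real \<alpha> ^ k * z k)"
  proof -
    have "summable (\<lambda>k. complex_of_real \<alpha> ^ Suc k * t (Suc k))"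
      using st summable_Suc_iff[of "\<lambda>k. complex_of_real \<alpha> ^ k * t k"] by simp
    then have "(\<Sum>k. complex_of_real \<alpha> ^ Suc k * t (Suc k)) + (\<Sum>k. complex_of_real \<alpha> ^ k * u k)
       = (\<Sum>k. complex_of_real \<alpha> ^ Suc k * t (Suc k) + complex_of_real \<alpha> ^ k * u k)"
      by (rule suminf_add[OF _ su])
    then show ?thesis by (simp add: z_def algebra_simps)
  qed
  finally have h: "(\<Sum>k. complex_of_real \<alpha> ^ k * mtr N (mpow N (G (psi y)) k (G (\<lambda>x. cphi x * (1 + psi y x)))))
     = t 0 + (\<Sum>k. complex_of_real \<alpha> ^ k * z k)" .
  have ps: "(\<lambda>x. cphi x * s m x) \<in> L2 \<mu>" and qs: "(\<lambda>x. psi y x * s m x) \<in> L2 \<mu>" for m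
    by (intro bm_L2[OF bm_cphi] bm_L2[OF bm_psi] s_L2)+
  have zk: "z k = mtr N (mpow N (G (psi y)) k (\<lambda>l m. BJ N (\<lambda>x. cphi x * s m x) (\<lambda>x. psi y x * s l x)))" for k
  proof -
    have "z k = mtr N (mpow N (G (psi y)) k (\<lambda>l m. G (\<lambda>x. cphi x * psi y x) l m + complex_of_real \<alpha> * mm N (G (psi y)) (G cphi) l m))"
      unfolding mpow_G_diff z_def u_def t_def by simp
    then show ?thesis unfolding G_J[OF bm_psi] .
  qed
  have zb: "cmod (complex_of_real \<alpha> ^ k * z k) \<le> g ^ k * (3 * \<bar>y\<bar> * \<sigma>\<^sup>2)" for k
  proof -
    have k: "0 \<le> \<kappa> * (\<bar>y\<bar> * b)" using \<kappa> b by simp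
    have "cmod (z k) \<le> (\<kappa> * (\<bar>y\<bar> * b)) ^ k * \<sigma> * nJ N (psi y)"
      unfolding zk \<sigma>_def nJ_def by (rule BJ.mtr_mpow_bound[OF ps qs form_bound_G[OF bm_psi]]) simp
    also have "\<dots> \<le> (\<kappa> * (\<bar>y\<bar> * b)) ^ k * \<sigma> * (3 * \<bar>y\<bar> * \<sigma>)"
      using nJ_psi[OF y1, of N] k \<sigma> by (intro mult_left_mono) (auto simp: \<sigma>_def)
    finally have "\<bar>\<alpha>\<bar> ^ k * cmod (z k) \<le> \<bar>\<alpha>\<bar> ^ k * ((\<kappa> * (\<bar>y\<bar> * b)) ^ k * \<sigma> * (3 * \<bar>y\<bar> * \<sigma>))"
      by (intro mult_left_mono) auto
    then show ?thesis by (simp add: norm_mult norm_power g_def power_mult_distrib power2_eq_square mult_ac)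
  qed
  have sz: "summable (\<lambda>k. complex_of_real \<alpha> ^ k * z k)"
    by (rule summable_comparison_test[OF _ summable_mult2[OF summable_geometric[of g]]]) (use zb g in auto)
  \<comment> \<open>Splitting the linear part \<i> y \<phi> off psi isolates the variance; the
    remainder has a norm of second order in y.\<close>
  have z0: "cmod (z 0 - \<i> * y * \<sigma>\<^sup>2) \<le> 2 * C0 * b * y\<^sup>2 * \<sigma>\<^sup>2"
  proof -
    have rs: "(\<lambda>x. (psi y x + (- (\<i> * y)) * cphi x) * s m x) \<in> L2 \<mu>" for m
      by (intro bm_L2[OF bm_psi_diff] s_L2)
    have e: "(\<lambda>x. psi y x * s l x) = (\<lambda>x. (psi y x + (- (\<i> * y)) * cphi x) * s l x + (\<i> * y) * (cphi x * s l x))" for l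
      by (simp add: fun_eq_iff algebra_simps)
    have "z 0 = (\<Sum>l<N. BJ N (\<lambda>x. cphi x * s l x) (\<lambda>x. psi y x * s l x))"
      unfolding zk by (simp add: mtr_def)
    also have "\<dots> = (\<Sum>l<N. BJ N (\<lambda>x. cphi x * s l x) (\<lambda>x. (psi y x + (- (\<i> * y)) * cphi x) * s l x)
        + \<i> * y * complex_of_real (BJ.q N (\<lambda>x. cphi x * s l x)))"
      unfolding e by (simp only: BJ.B_add_right[OF ps rs BJ.scale_mem[OF ps]] BJ.B_scale_right[OF ps ps] BJ.B_self[OF ps])
    also have "\<dots> = (\<Sum>l<N. BJ N (\<lambda>x. cphi x * s l x) (\<lambda>x. (psi y x + (- (\<i> * y)) * cphi x) * s l x)) + \<i> * y * \<sigma>\<^sup>2"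
      by (simp add: sum.distrib sum_distrib_left \<sigma>_def nJ_def sum_nonneg BJ.q_nonneg ps)
    finally have "z 0 - \<i> * y * \<sigma>\<^sup>2 = (\<Sum>l<N. BJ N (\<lambda>x. cphi x * s l x) (\<lambda>x. (psi y x + (- (\<i> * y)) * cphi x) * s l x))"
      by simp
    also have "cmod \<dots> \<le> \<sigma> * nJ N (\<lambda>x. psi y x + (- (\<i> * y)) * cphi x)"
      unfolding \<sigma>_def nJ_def by (rule BJ.sum_B_le[OF ps rs])
    also have "\<dots> \<le> \<sigma> * (2 * C0 * b * y\<^sup>2 * \<sigma>)"
      using nJ_psi_diff[OF y1, of N] \<sigma> by (intro mult_left_mono) (auto simp: \<sigma>_def)
    finally show ?thesis by (simp add: power2_eq_square mult_ac)
  qed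
  \<comment> \<open>The tail starts at k = 1 and so carries a factor \<open>g\<close>, at most
    \<bar>y\<bar> C0 b. Together with 3 from \<open>nJ_psi\<close> and 2 from the geometric series
    this gives 6, and with the 2 of \<open>z0\<close> the total 8.\<close>
  have tail: "cmod (\<Sum>k. complex_of_real \<alpha> ^ Suc k * z (Suc k)) \<le> 6 * C0 * b * y\<^sup>2 * \<sigma>\<^sup>2"
  proof -
    have b1: "cmod (complex_of_real \<alpha> ^ Suc k * z (Suc k)) \<le> (1/2) ^ k * (g * (3 * \<bar>y\<bar> * \<sigma>\<^sup>2))" for k
    proof -
      have "g ^ Suc k \<le> (1/2) ^ k * g" using g by (simp add: mult_right_mono power_mono mult.commute[of g])
      then have "g ^ Suc k * (3 * \<bar>y\<bar> * \<sigma>\<^sup>2) \<le> (1/2) ^ k * g * (3 * \<bar>y\<bar> * \<sigma>\<^sup>2)" by (intro mult_right_mono) auto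
      then have "g ^ Suc k * (3 * \<bar>y\<bar> * \<sigma>\<^sup>2) \<le> (1/2) ^ k * (g * (3 * \<bar>y\<bar> * \<sigma>\<^sup>2))" by (simp only: mult.assoc)
      then show ?thesis using zb[of "Suc k"] by linarith
    qed
    have sg: "(\<lambda>k. (1/2::real) ^ k * (g * (3 * \<bar>y\<bar> * \<sigma>\<^sup>2))) sums (2 * (g * (3 * \<bar>y\<bar> * \<sigma>\<^sup>2)))"
      using sums_mult2[OF geometric_sums[of "1/2::real"], of "g * (3 * \<bar>y\<bar> * \<sigma>\<^sup>2)"] by simp
    have "cmod (\<Sum>k. complex_of_real \<alpha> ^ Suc k * z (Suc k)) \<le> (\<Sum>k. (1/2) ^ k * (g * (3 * \<bar>y\<bar> * \<sigma>\<^sup>2)))"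
      by (rule norm_suminf_le[OF b1 sums_summable[OF sg]])
    also have "\<dots> = 2 * (g * (3 * \<bar>y\<bar> * \<sigma>\<^sup>2))" by (rule sums_unique[OF sg, symmetric])
    also have "\<dots> \<le> 2 * ((\<bar>y\<bar> * (C0 * b)) * (3 * \<bar>y\<bar> * \<sigma>\<^sup>2))"
      using g by (intro mult_left_mono mult_right_mono) auto
    also have "\<dots> = 6 * C0 * b * (\<bar>y\<bar> * \<bar>y\<bar>) * \<sigma>\<^sup>2" by (simp add: mult_ac)
    also have "\<bar>y\<bar> * \<bar>y\<bar> = y\<^sup>2" by (simp add: power2_eq_square)
    finally show ?thesis .
  qed
  have "(\<Sum>k. complex_of_real \<alpha> ^ k * z k) = z 0 + (\<Sum>k. complex_of_real \<alpha> ^ Suc k * z (Suc k))"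
    using suminf_split_head[OF sz] by simp
  then have "(\<Sum>k. complex_of_real \<alpha> ^ k * mtr N (mpow N (G (psi y)) k (G (\<lambda>x. cphi x * (1 + psi y x)))))
      - mtr N (G cphi) - \<i> * y * \<sigma>\<^sup>2 = (z 0 - \<i> * y * \<sigma>\<^sup>2) + (\<Sum>k. complex_of_real \<alpha> ^ Suc k * z (Suc k))"
    unfolding h by (simp add: t_def)
  also have "cmod \<dots> \<le> 2 * C0 * b * y\<^sup>2 * \<sigma>\<^sup>2 + 6 * C0 * b * y\<^sup>2 * \<sigma>\<^sup>2"
    by (rule norm_triangle_mono[OF z0 tail])
  finally show ?thesis unfolding \<sigma>_def by (simp add: mult_ac)
qed

end

end

section \<open>Sums over tuples of distinct points\<close>

definition tup :: "nat \<Rightarrow> 'a set \<Rightarrow> (nat \<Rightarrow> 'a) set" where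
  "tup n A = {x \<in> {..<n} \<rightarrow>\<^sub>E A. inj_on x {..<n}}"

text \<open>Each slot has its own test function, so that one slot can be marked and the expression
  is multilinear. The expectations of these sums are the correlation integrals.\<close>

definition tsum :: "(nat \<Rightarrow> 'a \<Rightarrow> 'b::comm_ring_1) \<Rightarrow> nat \<Rightarrow> 'a set \<Rightarrow> 'b" where
  "tsum h n A = (\<Sum>x\<in>tup n A. \<Prod>i<n. h i (x i))"

lemma finite_tup: "finite A \<Longrightarrow> finite (tup n A)"
  unfolding tup_def by (rule finite_subset[of _ "{..<n} \<rightarrow>\<^sub>E A"]) (auto intro: finite_PiE)

lemma tsum_0: "tsum h 0 A = 1"
proof -
  have "tup 0 A = {\<lambda>_. undefined}" by (auto simp: tup_def)
  then show ?thesis by (simp add: tsum_def)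
qed

lemma sum_tup_Suc:
  fixes f :: "(nat \<Rightarrow> 'a) \<Rightarrow> 'b::comm_monoid_add"
  assumes A: "finite A"
  shows "(\<Sum>x\<in>tup (Suc n) A. f x) = (\<Sum>x\<in>tup n A. \<Sum>a\<in>A - x ` {..<n}. f (x(n := a)))"
proof -
  have "(\<Sum>x\<in>tup n A. \<Sum>a\<in>A - x ` {..<n}. f (x(n := a))) = (\<Sum>(x, a)\<in>Sigma (tup n A) (\<lambda>x. A - x ` {..<n}). f (x(n := a)))"
    using A by (intro sum.Sigma finite_tup) auto
  also have "\<dots> = (\<Sum>x\<in>tup (Suc n) A. f x)"
  proof (rule sum.reindex_bij_witness[where i="\<lambda>x. (x(n := undefined), x n)" and j="\<lambda>(x, a). x(n := a)"])
    fix p assume p: "p \<in> Sigma (tup n A) (\<lambda>x. A - x ` {..<n})"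
    obtain x a where xa: "p = (x, a)" "x \<in> tup n A" "a \<in> A" "a \<notin> x ` {..<n}" using p by auto
    have x: "x \<in> extensional {..<n}" "\<And>i. i < n \<Longrightarrow> x i \<in> A" "inj_on x {..<n}"
      using xa by (auto simp: tup_def PiE_def)
    show "(((\<lambda>(x, a). x(n := a)) p)(n := undefined), (\<lambda>(x, a). x(n := a)) p n) = p"
      using x(1) by (auto simp: xa(1) fun_eq_iff extensional_def)
    have "inj_on (x(n := a)) {..<Suc n}"
      unfolding lessThan_Suc using xa(4) x(3) by (auto simp: inj_on_def)
    then show "(\<lambda>(x, a). x(n := a)) p \<in> tup (Suc n) A"
      using x xa by (auto simp: tup_def PiE_def extensional_def less_Suc_eq)
    show "f ((\<lambda>(x, a). x(n := a)) p) = (case p of (x, a) \<Rightarrow> f (x(n := a)))" by (simp add: xa(1))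
  next
    fix y assume y: "y \<in> tup (Suc n) A"
    then have y': "y \<in> extensional {..<Suc n}" "\<And>i. i < Suc n \<Longrightarrow> y i \<in> A" "inj_on y {..<Suc n}"
      by (auto simp: tup_def PiE_def)
    show "(\<lambda>(x, a). x(n := a)) (y(n := undefined), y n) = y" by simp
    have "inj_on (y(n := undefined)) {..<n}" using y'(3) by (auto simp: inj_on_def)
    moreover have "y n \<notin> (y(n := undefined)) ` {..<n}"
      using inj_onD[OF y'(3), of n] by force
    ultimately show "(y(n := undefined), y n) \<in> Sigma (tup n A) (\<lambda>x. A - x ` {..<n})"
      using y' by (auto simp: tup_def PiE_def extensional_def)
  qed
  finally show ?thesis ..
qed

text \<open>Isolates the entry with the highest index, which is the one that carries the mark in the
  marked sums.\<close>

lemma tsum_Suc_first: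
  assumes A: "finite A"
  shows "tsum h (Suc n) A = (\<Sum>a\<in>A. h n a * tsum h n (A - {a}))"
proof -
  have "tsum h (Suc n) A = (\<Sum>x\<in>tup n A. \<Sum>a\<in>A - x ` {..<n}. (\<Prod>i<n. h i (x i)) * h n a)"
    unfolding tsum_def sum_tup_Suc[OF A] by (intro sum.cong refl) simp
  also have "\<dots> = (\<Sum>(x, a)\<in>Sigma (tup n A) (\<lambda>x. A - x ` {..<n}). (\<Prod>i<n. h i (x i)) * h n a)"
    using A by (intro sum.Sigma finite_tup) auto
  also have "\<dots> = (\<Sum>(a, x)\<in>Sigma A (\<lambda>a. tup n (A - {a})). (\<Prod>i<n. h i (x i)) * h n a)"
  proof (rule sum.reindex_bij_witness[where i="\<lambda>(a, x). (x, a)" and j="\<lambda>(x, a). (a, x)"])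
    fix p assume "p \<in> Sigma (tup n A) (\<lambda>x. A - x ` {..<n})"
    then show "(\<lambda>(x, a). (a, x)) p \<in> Sigma A (\<lambda>a. tup n (A - {a}))"
      by (auto simp: tup_def PiE_def Pi_def)
  next
    fix p assume "p \<in> Sigma A (\<lambda>a. tup n (A - {a}))"
    then show "(\<lambda>(a, x). (x, a)) p \<in> Sigma (tup n A) (\<lambda>x. A - x ` {..<n})"
      by (auto simp: tup_def PiE_def Pi_def)
  qed auto
  also have "\<dots> = (\<Sum>a\<in>A. \<Sum>x\<in>tup n (A - {a}). (\<Prod>i<n. h i (x i)) * h n a)"
    using A by (intro sum.Sigma[symmetric]) (auto intro: finite_tup)
  finally show ?thesis by (simp add: tsum_def sum_distrib_left mult.commute)
qed

text \<open>The last entry is freed from the distinctness condition and the collisions are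
  subtracted. All sums then run over the same configuration, as the measurability proof
  requires.\<close>

lemma tsum_Suc_last:
  assumes A: "finite A"
  shows "tsum h (Suc n) A = tsum h n A * (\<Sum>a\<in>A. h n a) - (\<Sum>j<n. tsum (h(j := \<lambda>x. h j x * h n x)) n A)"
proof -
  have "tsum h (Suc n) A = (\<Sum>x\<in>tup n A. (\<Prod>i<n. h i (x i)) * (\<Sum>a\<in>A - x ` {..<n}. h n a))"
    unfolding tsum_def sum_tup_Suc[OF A] by (intro sum.cong refl) (simp add: sum_distrib_left)
  also have "\<dots> = (\<Sum>x\<in>tup n A. (\<Prod>i<n. h i (x i)) * (\<Sum>a\<in>A. h n a) - (\<Sum>j<n. \<Prod>i<n. (h(j := \<lambda>x. h j x * h n x)) i (x i)))"
  proof (intro sum.cong refl)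
    fix x assume x: "x \<in> tup n A"
    then have sub: "x ` {..<n} \<subseteq> A" "inj_on x {..<n}" by (auto simp: tup_def)
    have "(\<Sum>a\<in>A - x ` {..<n}. h n a) = (\<Sum>a\<in>A. h n a) - (\<Sum>a\<in>x ` {..<n}. h n a)"
      by (rule sum_diff[OF A sub(1)])
    also have "(\<Sum>a\<in>x ` {..<n}. h n a) = (\<Sum>j<n. h n (x j))" using sub(2) by (simp add: sum.reindex)
    finally have "(\<Prod>i<n. h i (x i)) * (\<Sum>a\<in>A - x ` {..<n}. h n a) = (\<Prod>i<n. h i (x i)) * (\<Sum>a\<in>A. h n a)
      - (\<Sum>j<n. (\<Prod>i<n. h i (x i)) * h n (x j))"
      by (simp add: right_diff_distrib sum_distrib_left)
    also have "(\<Sum>j<n. (\<Prod>i<n. h i (x i)) * h n (x j)) = (\<Sum>j<n. \<Prod>i<n. (h(j := \<lambda>x. h j x * h n x)) i (x i))"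
    proof (intro sum.cong refl)
      fix j assume j: "j \<in> {..<n}"
      have "(\<Prod>i\<in>{..<n} - {j}. (h(j := \<lambda>x. h j x * h n x)) i (x i)) = (\<Prod>i\<in>{..<n} - {j}. h i (x i))"
        by (intro prod.cong refl) auto
      then show "(\<Prod>i<n. h i (x i)) * h n (x j) = (\<Prod>i<n. (h(j := \<lambda>x. h j x * h n x)) i (x i))"
        using prod.remove[OF finite_lessThan j, of "\<lambda>i. h i (x i)"] prod.remove[OF finite_lessThan j, of "\<lambda>i. (h(j := \<lambda>x. h j x * h n x)) i (x i)"]
        by (simp add: mult_ac)
    qed
    finally show "(\<Prod>i<n. h i (x i)) * (\<Sum>a\<in>A - x ` {..<n}. h n a) = (\<Prod>i<n. h i (x i)) * (\<Sum>a\<in>A. h n a)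
      - (\<Sum>j<n. \<Prod>i<n. (h(j := \<lambda>x. h j x * h n x)) i (x i))" .
  qed
  also have "\<dots> = tsum h n A * (\<Sum>a\<in>A. h n a) - (\<Sum>j<n. tsum (h(j := \<lambda>x. h j x * h n x)) n A)"
    unfolding tsum_def sum_subtractf sum_distrib_right[symmetric] by (subst (2) sum.swap) simp
  finally show ?thesis .
qed

lemma tsum_cong: "(\<And>i x. i < n \<Longrightarrow> x \<in> A \<Longrightarrow> h i x = h' i x) \<Longrightarrow> tsum h n A = tsum h' n A"
  unfolding tsum_def by (intro sum.cong prod.cong refl) (auto simp: tup_def PiE_def)

text \<open>Every set of \<open>n\<close> points is counted once per ordering; the induction reads a
  set with a distinguished element in two ways.\<close>

lemma tsum_subsets:
  fixes \<psi> :: "'a \<Rightarrow> complex"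
  assumes "finite A"
  shows "tsum (\<lambda>_. \<psi>) n A = fact n * (\<Sum>B | B \<subseteq> A \<and> card B = n. \<Prod>b\<in>B. \<psi> b)"
  using assms
proof (induction n arbitrary: A)
  case 0
  have "{B. B \<subseteq> A \<and> card B = 0} = {{}}" using 0 by (auto simp: card_eq_0_iff dest: finite_subset)
  then show ?case by (simp add: tsum_0)
next
  case (Suc n)
  let ?F = "\<lambda>C. \<Prod>b\<in>C. \<psi> b"
  have fin: "finite {B. B \<subseteq> C \<and> card B = k}" if "finite C" for C :: "'a set" and k
    using that by (rule finite_subset[rotated, OF finite_Pow_iff[THEN iffD2]]) auto
  have fA: "finite B" if "B \<subseteq> A" for B using that Suc.prems finite_subset by blast
  have "tsum (\<lambda>_. \<psi>) (Suc n) A = (\<Sum>a\<in>A. \<psi> a * (fact n * (\<Sum>B | B \<subseteq> A - {a} \<and> card B = n. ?F B)))"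
    unfolding tsum_Suc_first[OF Suc.prems] using Suc by simp
  also have "\<dots> = fact n * (\<Sum>a\<in>A. \<Sum>B | B \<subseteq> A - {a} \<and> card B = n. ?F (insert a B))"
  proof -
    have e: "\<psi> a * (\<Sum>B | B \<subseteq> A - {a} \<and> card B = n. ?F B) = (\<Sum>B | B \<subseteq> A - {a} \<and> card B = n. ?F (insert a B))" for a
      unfolding sum_distrib_left
    proof (intro sum.cong refl)
      fix B assume "B \<in> {B. B \<subseteq> A - {a} \<and> card B = n}"
      then have "finite B" "a \<notin> B" using fA[of B] by auto
      then show "\<psi> a * ?F B = ?F (insert a B)" by simp
    qed
    show ?thesis by (simp only: mult.left_commute[of "\<psi> _" "fact n"] e sum_distrib_left[of "fact n" _ A])
  qed
  also have "(\<Sum>a\<in>A. \<Sum>B | B \<subseteq> A - {a} \<and> card B = n. ?F (insert a B))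
     = (\<Sum>(a, B)\<in>Sigma A (\<lambda>a. {B. B \<subseteq> A - {a} \<and> card B = n}). ?F (insert a B))"
    using Suc.prems by (intro sum.Sigma) (auto intro!: fin)
  also have "\<dots> = (\<Sum>(C, a)\<in>Sigma {C. C \<subseteq> A \<and> card C = Suc n} (\<lambda>C. C). ?F C)"
  proof (rule sum.reindex_bij_witness[where i="\<lambda>(C, a). (a, C - {a})" and j="\<lambda>(a, B). (insert a B, a)"])
    fix p assume "p \<in> Sigma A (\<lambda>a. {B. B \<subseteq> A - {a} \<and> card B = n})"
    then obtain a B where p: "p = (a, B)" "a \<in> A" "B \<subseteq> A - {a}" "card B = n" by auto
    then have "finite B" "a \<notin> B" using fA[of B] by auto
    then show "(\<lambda>(C, a). (a, C - {a})) ((\<lambda>(a, B). (insert a B, a)) p) = p"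
      "(\<lambda>(a, B). (insert a B, a)) p \<in> Sigma {C. C \<subseteq> A \<and> card C = Suc n} (\<lambda>C. C)"
      "(case (\<lambda>(a, B). (insert a B, a)) p of (C, a) \<Rightarrow> ?F C) = (case p of (a, B) \<Rightarrow> ?F (insert a B))"
      using p by auto
  next
    fix p assume "p \<in> Sigma {C. C \<subseteq> A \<and> card C = Suc n} (\<lambda>C. C)"
    then obtain C a where p: "p = (C, a)" "C \<subseteq> A" "card C = Suc n" "a \<in> C" by auto
    then have "finite C" using fA by auto
    then show "(\<lambda>(a, B). (insert a B, a)) ((\<lambda>(C, a). (a, C - {a})) p) = p"
      "(\<lambda>(C, a). (a, C - {a})) p \<in> Sigma A (\<lambda>a. {B. B \<subseteq> A - {a} \<and> card B = n})"
      using p by (auto simp: card_Diff_singleton)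
  qed
  also have "\<dots> = (\<Sum>C | C \<subseteq> A \<and> card C = Suc n. \<Sum>a\<in>C. ?F C)"
    using Suc.prems by (intro sum.Sigma[symmetric] fin) (auto intro: fA)
  also have "\<dots> = (\<Sum>C | C \<subseteq> A \<and> card C = Suc n. of_nat (Suc n) * ?F C)"
    by (intro sum.cong refl) simp
  finally show ?case by (simp add: sum_distrib_left mult_ac del: of_nat_Suc)
qed

text \<open>The product is expanded over all subsets. For a given finite configuration the series
  terminates; convergence becomes a question only after taking expectations.\<close>

lemma tsum_sums:
  fixes \<psi> :: "'a \<Rightarrow> complex"
  assumes A: "finite A"
  shows "(\<lambda>n. tsum (\<lambda>_. \<psi>) n A / fact n) sums (\<Prod>a\<in>A. 1 + \<psi> a)"
proof -
  let ?F = "\<lambda>B. \<Prod>b\<in>B. \<psi> b"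
  have e: "tsum (\<lambda>_. \<psi>) n A / fact n = (\<Sum>B | B \<subseteq> A \<and> card B = n. ?F B)" for n
    using tsum_subsets[OF A, of \<psi> n] by simp
  have "(\<Prod>a\<in>A. 1 + \<psi> a) = (\<Prod>a\<in>A. \<psi> a + 1)" by (simp add: add.commute)
  also have "\<dots> = (\<Sum>B\<in>Pow A. ?F B)"
    using prod_add[OF A, of \<psi> "\<lambda>_. 1"] by simp
  also have "\<dots> = (\<Sum>n\<in>{..card A}. \<Sum>B | B \<in> Pow A \<and> card B = n. ?F B)"
    using A by (intro sum.group[symmetric]) (auto intro: card_mono)
  also have "\<dots> = (\<Sum>n\<in>{..card A}. tsum (\<lambda>_. \<psi>) n A / fact n)"
    unfolding e by simp
  finally have p: "(\<Prod>a\<in>A. 1 + \<psi> a) = (\<Sum>n\<in>{..card A}. tsum (\<lambda>_. \<psi>) n A / fact n)" .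
  show ?thesis unfolding p
  proof (rule sums_finite)
    fix n assume "n \<notin> {..card A}"
    then have "{B. B \<subseteq> A \<and> card B = n} = {}" using A card_mono[of A] by force
    then show "tsum (\<lambda>_. \<psi>) n A / fact n = 0" unfolding e by (simp only: sum.empty)
  qed simp
qed

text \<open>The previous expansion applied to the configuration without the marked point
  \<open>a\<close>, and summed over \<open>a\<close>.\<close>

lemma tsum_marked_sums:
  fixes \<psi> \<eta> :: "'a \<Rightarrow> complex"
  assumes A: "finite A"
  shows "(\<lambda>n. tsum ((\<lambda>_. \<psi>)(n := \<eta>)) (Suc n) A / fact n) sums (\<Sum>a\<in>A. \<eta> a * (\<Prod>b\<in>A - {a}. 1 + \<psi> b))"
proof -
  have "tsum ((\<lambda>_. \<psi>)(n := \<eta>)) (Suc n) A / fact n = (\<Sum>a\<in>A. \<eta> a * (tsum (\<lambda>_. \<psi>) n (A - {a}) / fact n))" for n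
  proof -
    have "tsum ((\<lambda>_. \<psi>)(n := \<eta>)) n (A - {a}) = tsum (\<lambda>_. \<psi>) n (A - {a})" for a
      by (rule tsum_cong) auto
    then show ?thesis by (simp add: tsum_Suc_first[OF A] sum_divide_distrib)
  qed
  then show ?thesis
    using A by (simp only:) (intro sums_sum sums_mult tsum_sums finite_Diff)
qed

lemma norm_tsum_le: "cmod (tsum h n A) \<le> tsum (\<lambda>i x. cmod (h i x)) n A"
  unfolding tsum_def by (rule order_trans[OF norm_sum]) (simp add: prod_norm)

lemma of_real_tsum: "complex_of_real (tsum h n A) = tsum (\<lambda>i x. complex_of_real (h i x)) n A"
  by (simp add: tsum_def)

section \<open>Measurability of sums over the points\<close>

lemma point_sum_measurable_ennreal:
  assumes X: "point_process M X" and S: "compact S" and g: "g \<in> borel_measurable borel"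
  shows "(\<lambda>\<omega>. \<Sum>a\<in>X \<omega> \<inter> S. (g a :: ennreal)) \<in> borel_measurable M"
  using g
proof (induction rule: borel_measurable_induct)
  case (cong f g)
  then show ?case by simp
next
  \<comment> \<open>Measurability is given for counts in bounded Borel sets; intersecting with
    \<open>S\<close> keeps the set bounded.\<close>
  case (set A)
  have "(\<lambda>\<omega>. card (X \<omega> \<inter> (S \<inter> A))) \<in> measurable M (count_space UNIV)"
  proof -
    have "S \<inter> A \<in> sets borel" by (rule sets.Int[OF borel_closed[OF compact_imp_closed[OF S]] set])
    moreover have "bounded (S \<inter> A)" using compact_imp_bounded[OF S] bounded_subset by blast
    ultimately show ?thesis using X by (simp add: point_process_def)
  qed
  then have "(\<lambda>\<omega>. of_nat (card (X \<omega> \<inter> (S \<inter> A))) :: ennreal) \<in> borel_measurable M"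
    by (rule measurable_compose) simp
  moreover have "(\<Sum>a\<in>X \<omega> \<inter> S. indicator A a) = (of_nat (card (X \<omega> \<inter> (S \<inter> A))) :: ennreal)" if "\<omega> \<in> space M" for \<omega>
  proof -
    have "finite (X \<omega> \<inter> S)" using X S that by (simp add: point_process_def)
    then show ?thesis by (simp add: indicator_def sum.If_cases Int_assoc)
  qed
  ultimately show ?case by (subst measurable_cong) auto
next
  case (mult u v)
  have "(\<lambda>\<omega>. v * (\<Sum>a\<in>X \<omega> \<inter> S. u a)) \<in> borel_measurable M" using mult by measurable
  then show ?case by (simp add: sum_distrib_left)
next
  case (add u v)
  have "(\<lambda>\<omega>. (\<Sum>a\<in>X \<omega> \<inter> S. v a) + (\<Sum>a\<in>X \<omega> \<inter> S. u a)) \<in> borel_measurable M" using add by measurable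
  then show ?case by (simp add: sum.distrib)
next
  case (seq U)
  have "(\<lambda>\<omega>. \<Sum>a\<in>X \<omega> \<inter> S. (SUP i. U i a)) \<in> borel_measurable M"
  proof (rule borel_measurable_LIMSEQ_order)
    show "(\<lambda>\<omega>. \<Sum>a\<in>X \<omega> \<inter> S. U i a) \<in> borel_measurable M" for i by (rule seq)
    fix \<omega>
    show "(\<lambda>i. \<Sum>a\<in>X \<omega> \<inter> S. U i a) \<longlonglongrightarrow> (\<Sum>a\<in>X \<omega> \<inter> S. (SUP i. U i a))"
      using seq(3) by (intro tendsto_sum LIMSEQ_SUP) (auto simp: incseq_def le_fun_def)
  qed
  then show ?case by (simp add: image_comp SUP_apply)
qed

lemma point_sum_measurable_real:
  assumes X: "point_process M X" and S: "compact S" and g: "g \<in> borel_measurable borel"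
  shows "(\<lambda>\<omega>. \<Sum>a\<in>X \<omega> \<inter> S. (g a :: real)) \<in> borel_measurable M"
proof -
  have 1: "(\<lambda>\<omega>. enn2real (\<Sum>a\<in>X \<omega> \<inter> S. ennreal (f a))) \<in> borel_measurable M" if "f \<in> borel_measurable borel" for f :: "_ \<Rightarrow> real"
    by (intro borel_measurable_enn2real point_sum_measurable_ennreal[OF X S]) (use that in measurable)
  have 2: "enn2real (\<Sum>a\<in>A. ennreal (f a)) = (\<Sum>a\<in>A. max 0 (f a))" for f :: "'b \<Rightarrow> real" and A
  proof -
    have "(\<Sum>a\<in>A. ennreal (f a)) = (\<Sum>a\<in>A. ennreal (max 0 (f a)))" by (simp only: ennreal_max_0)
    also have "\<dots> = ennreal (\<Sum>a\<in>A. max 0 (f a))" by (rule sum_ennreal) simp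
    finally show ?thesis by (simp add: sum_nonneg)
  qed
  have "(\<Sum>a\<in>A. g a) = (\<Sum>a\<in>A. max 0 (g a)) - (\<Sum>a\<in>A. max 0 (- g a))" for A
    by (simp add: sum_subtractf[symmetric] max_def) (intro sum.cong, auto)
  then have "(\<lambda>\<omega>. \<Sum>a\<in>X \<omega> \<inter> S. g a) = (\<lambda>\<omega>. enn2real (\<Sum>a\<in>X \<omega> \<inter> S. ennreal (g a)) - enn2real (\<Sum>a\<in>X \<omega> \<inter> S. ennreal (- g a)))"
    by (simp only: 2)
  also have "\<dots> \<in> borel_measurable M" using g by (intro borel_measurable_diff 1) auto
  finally show ?thesis .
qed

lemma point_sum_measurable:
  assumes X: "point_process M X" and S: "compact S" and g: "g \<in> borel_measurable borel"
  shows "(\<lambda>\<omega>. \<Sum>a\<in>X \<omega> \<inter> S. (g a :: complex)) \<in> borel_measurable M"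
proof -
  have "(\<lambda>\<omega>. \<Sum>a\<in>X \<omega> \<inter> S. g a) = (\<lambda>\<omega>. complex_of_real (\<Sum>a\<in>X \<omega> \<inter> S. Re (g a)) + \<i> * complex_of_real (\<Sum>a\<in>X \<omega> \<inter> S. Im (g a)))"
    by (simp add: fun_eq_iff complex_eq_iff)
  moreover have [measurable]: "(\<lambda>\<omega>. \<Sum>a\<in>X \<omega> \<inter> S. Re (g a)) \<in> borel_measurable M" "(\<lambda>\<omega>. \<Sum>a\<in>X \<omega> \<inter> S. Im (g a)) \<in> borel_measurable M"
    using g by (intro point_sum_measurable_real[OF X S]; measurable)+
  moreover have "(\<lambda>\<omega>. complex_of_real (\<Sum>a\<in>X \<omega> \<inter> S. Re (g a)) + \<i> * complex_of_real (\<Sum>a\<in>X \<omega> \<inter> S. Im (g a))) \<in> borel_measurable M"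
    by measurable
  ultimately show ?thesis by (simp only:)
qed

text \<open>\<open>tsum_Suc_last\<close> expresses a tuple sum by shorter ones over the same
  configuration. Its last term merges two test functions, hence the induction over arbitrary
  families.\<close>

lemma tsum_measurable:
  fixes h :: "nat \<Rightarrow> _ \<Rightarrow> complex"
  assumes X: "point_process M X" and S: "compact S" and "\<And>i. i < n \<Longrightarrow> h i \<in> borel_measurable borel"
  shows "(\<lambda>\<omega>. tsum h n (X \<omega> \<inter> S)) \<in> borel_measurable M"
  using assms(3)
proof (induction n arbitrary: h)
  case 0
  then show ?case by (simp add: tsum_0)
next
  case (Suc n)
  have fin: "finite (X \<omega> \<inter> S)" if "\<omega> \<in> space M" for \<omega>
    using X S that by (simp add: point_process_def)
  have [measurable]: "h i \<in> borel_measurable borel" if "i \<le> n" for i using Suc.prems that by auto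
  have 1: "(\<lambda>\<omega>. tsum h n (X \<omega> \<inter> S)) \<in> borel_measurable M" by (rule Suc.IH) (use Suc.prems in auto)
  have 2: "(\<lambda>\<omega>. \<Sum>a\<in>X \<omega> \<inter> S. h n a) \<in> borel_measurable M" by (intro point_sum_measurable[OF X S]) (use Suc.prems in auto)
  have 3: "(\<lambda>\<omega>. tsum (h(j := \<lambda>x. h j x * h n x)) n (X \<omega> \<inter> S)) \<in> borel_measurable M" if "j < n" for j
  proof (rule Suc.IH)
    fix i assume "i < n"
    have "(\<lambda>x. h j x * h n x) \<in> borel_measurable borel" using Suc.prems[of j] Suc.prems[of n] that by (intro borel_measurable_times) auto
    then show "(h(j := \<lambda>x. h j x * h n x)) i \<in> borel_measurable borel" using Suc.prems[of i] \<open>i < n\<close> by simp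
  qed
  have "(\<lambda>\<omega>. tsum h n (X \<omega> \<inter> S) * (\<Sum>a\<in>X \<omega> \<inter> S. h n a) - (\<Sum>j<n. tsum (h(j := \<lambda>x. h j x * h n x)) n (X \<omega> \<inter> S))) \<in> borel_measurable M"
    using 1 2 3 by (intro borel_measurable_diff borel_measurable_times borel_measurable_sum) auto
  then show ?case using fin by (subst measurable_cong[OF tsum_Suc_last]) auto
qed

section \<open>Correlation functions and finite rank approximation\<close>

context
  fixes \<mu> :: "'a measure" assumes sf: "sigma_finite_measure \<mu>"
begin

interpretation product_sigma_finite "\<lambda>_. \<mu>"
  using sf by (simp add: product_sigma_finite_def)

text \<open>\<mu> may be infinite, so a coordinate map need not push the product measure to \<mu>.
  Instead the coordinate is split off by Fubini and the null set is integrated away.\<close>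

lemma AE_PiM_comp:
  assumes P: "AE x in \<mu>. P x" and I: "finite I" "i \<in> I"
  shows "AE x in Pi\<^sub>M I (\<lambda>_. \<mu>). P (x i)"
proof -
  obtain N where N: "{x \<in> space \<mu>. \<not> P x} \<subseteq> N" "emeasure \<mu> N = 0" "N \<in> sets \<mu>"
    using P by (rule AE_E)
  define J where "J = I - {i}"
  have J: "finite J" "i \<notin> J" "I = insert i J" using I by (auto simp: J_def)
  note [measurable] = N(3)
  have "AE y in \<mu>. y \<notin> N" using N(2,3) by (intro AE_not_in) (simp add: null_sets_def)
  then have z: "AE y in \<mu>. (\<integral>\<^sup>+x. indicator N y \<partial>Pi\<^sub>M J (\<lambda>_. \<mu>)) = 0"
    by eventually_elim simp
  have "(\<integral>\<^sup>+x. indicator N (x i) \<partial>Pi\<^sub>M I (\<lambda>_. \<mu>)) = (\<integral>\<^sup>+y. \<integral>\<^sup>+x. indicator N y \<partial>Pi\<^sub>M J (\<lambda>_. \<mu>) \<partial>\<mu>)"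
  proof -
    have "(\<lambda>x. indicator N (x i) :: ennreal) \<in> borel_measurable (Pi\<^sub>M (insert i J) (\<lambda>_. \<mu>))"
      by (rule measurable_compose[OF measurable_component_singleton[OF insertI1]]) measurable
    then show ?thesis unfolding J(3) by (subst product_nn_integral_insert_rev[OF J(1,2)]) simp_all
  qed
  also have "\<dots> = (\<integral>\<^sup>+y. 0 \<partial>\<mu>)" by (rule nn_integral_cong_AE[OF z])
  finally have "(\<integral>\<^sup>+x. indicator N (x i) \<partial>Pi\<^sub>M I (\<lambda>_. \<mu>)) = 0" by simp
  moreover have "(\<lambda>x. indicator N (x i) :: ennreal) \<in> borel_measurable (Pi\<^sub>M I (\<lambda>_. \<mu>))"
    by (rule measurable_compose[OF measurable_component_singleton[OF I(2)]]) measurable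
  ultimately have "AE x in Pi\<^sub>M I (\<lambda>_. \<mu>). (indicator N (x i) :: ennreal) = 0"
    by (simp add: nn_integral_0_iff_AE)
  then show ?thesis
  proof (rule AE_mp, intro AE_I2 impI)
    fix x assume x: "x \<in> space (Pi\<^sub>M I (\<lambda>_. \<mu>))" and z: "(indicator N (x i) :: ennreal) = 0"
    have "x i \<in> space \<mu>" using x I by (auto simp: space_PiM)
    then show "P (x i)" using N(1) z by (auto simp: indicator_def split: if_splits)
  qed
qed

text \<open>Splitting off the coordinate \<open>i\<close> leaves, for almost every value of it, a
  null section in the coordinate \<open>j\<close>, to which \<open>AE_PiM_comp\<close> applies; the
  indices have to differ for this.\<close>

lemma AE_PiM_pair:
  assumes P: "AE z in \<mu> \<Otimes>\<^sub>M \<mu>. P z" and I: "finite I" "i \<in> I" "j \<in> I" "i \<noteq> j"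
  shows "AE x in Pi\<^sub>M I (\<lambda>_. \<mu>). P (x i, x j)"
proof -
  interpret pair_sigma_finite \<mu> \<mu> using sf by (intro pair_sigma_finite.intro)
  obtain N where N: "{z \<in> space (\<mu> \<Otimes>\<^sub>M \<mu>). \<not> P z} \<subseteq> N" "emeasure (\<mu> \<Otimes>\<^sub>M \<mu>) N = 0" "N \<in> sets (\<mu> \<Otimes>\<^sub>M \<mu>)"
    using P by (rule AE_E)
  define J where "J = I - {i}"
  have J: "finite J" "i \<notin> J" "I = insert i J" "j \<in> J" using I by (auto simp: J_def)
  note [measurable] = N(3)
  have "AE z in \<mu> \<Otimes>\<^sub>M \<mu>. z \<notin> N" using N(2,3) by (intro AE_not_in) (auto simp: null_sets_def)
  then have "AE y in \<mu>. AE w in \<mu>. (y, w) \<notin> N" by (rule AE_pair)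
  then have z: "AE y in \<mu>. (\<integral>\<^sup>+x. indicator N (y, x j) \<partial>Pi\<^sub>M J (\<lambda>_. \<mu>)) = 0"
  proof eventually_elim
    case (elim y)
    have "AE x in Pi\<^sub>M J (\<lambda>_. \<mu>). (indicator N (y, x j) :: ennreal) = 0"
      using AE_PiM_comp[OF elim J(1,4)] by eventually_elim simp
    then have "(\<integral>\<^sup>+x. indicator N (y, x j) \<partial>Pi\<^sub>M J (\<lambda>_. \<mu>)) = (\<integral>\<^sup>+x. 0 \<partial>Pi\<^sub>M J (\<lambda>_. \<mu>))"
      by (rule nn_integral_cong_AE)
    then show ?case by simp
  qed
  have meas: "(\<lambda>x. indicator N (x i, x j) :: ennreal) \<in> borel_measurable (Pi\<^sub>M (insert i J) (\<lambda>_. \<mu>))"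
  proof -
    have "(\<lambda>x. (x i, x j)) \<in> Pi\<^sub>M (insert i J) (\<lambda>_. \<mu>) \<rightarrow>\<^sub>M \<mu> \<Otimes>\<^sub>M \<mu>"
      using J(4) by (intro measurable_Pair measurable_component_singleton) simp_all
    then show ?thesis by (rule measurable_compose) measurable
  qed
  have "(\<integral>\<^sup>+x. indicator N (x i, x j) \<partial>Pi\<^sub>M I (\<lambda>_. \<mu>)) = (\<integral>\<^sup>+y. \<integral>\<^sup>+x. indicator N (y, x j) \<partial>Pi\<^sub>M J (\<lambda>_. \<mu>) \<partial>\<mu>)"
  proof -
    have "(\<integral>\<^sup>+x. indicator N ((x(i := y)) i, (x(i := y)) j) \<partial>Pi\<^sub>M J (\<lambda>_. \<mu>)) = (\<integral>\<^sup>+x. indicator N (y, x j) \<partial>Pi\<^sub>M J (\<lambda>_. \<mu>))" for y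
      using I(4) by simp
    then show ?thesis
      unfolding J(3) product_nn_integral_insert_rev[OF J(1,2) meas] by presburger
  qed
  also have "\<dots> = (\<integral>\<^sup>+y. 0 \<partial>\<mu>)" by (rule nn_integral_cong_AE[OF z])
  finally have "(\<integral>\<^sup>+x. indicator N (x i, x j) \<partial>Pi\<^sub>M I (\<lambda>_. \<mu>)) = 0" by simp
  then have "AE x in Pi\<^sub>M I (\<lambda>_. \<mu>). (indicator N (x i, x j) :: ennreal) = 0"
    using meas[folded J(3)] by (simp add: nn_integral_0_iff_AE)
  then show ?thesis
  proof (rule AE_mp, intro AE_I2 impI)
    fix x assume x: "x \<in> space (Pi\<^sub>M I (\<lambda>_. \<mu>))" and z: "(indicator N (x i, x j) :: ennreal) = 0"
    have "(x i, x j) \<in> space (\<mu> \<Otimes>\<^sub>M \<mu>)" using x I by (auto simp: space_PiM space_pair_measure)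
    then show "P (x i, x j)" using N(1) z by (auto simp: indicator_def split: if_splits)
  qed
qed

end

context alpha_kernel
begin

sublocale PS: product_sigma_finite "\<lambda>_. \<mu>"
  using sigma_fin by (simp add: product_sigma_finite_def)

abbreviation "PM n \<equiv> Pi\<^sub>M {..<n::nat} (\<lambda>_. \<mu>)"

lemma alpha_det_cyc:
  "alpha_det a n A = (\<Sum>\<sigma> | \<sigma> permutes {..<n}. complex_of_real a ^ (card {..<n} - cyc {..<n} \<sigma>) * (\<Prod>i<n. A i (\<sigma> i)))"
  by (simp add: alpha_det_def num_cycles_def cyc_def)

lemma integrable_comp: "bm c h \<Longrightarrow> integrable \<mu> (\<lambda>x. h x * s p x * cnj (s q x))"
proof -
  assume h: "bm c h"
  have "integrable \<mu> (\<lambda>x. cnj (s q x) * (h x * s p x))"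
    by (intro L2_mult_integrable(1) s_L2 bm_L2[OF h])
  then show ?thesis by (simp add: mult_ac)
qed

text \<open>After expanding all kernels the factors are regrouped by integration point:
  \<open>x i\<close> meets the label of the kernel leaving it and the label of the kernel entering
  it, hence the inverse of \<sigma>.\<close>

lemma prod_kN:
  fixes n :: nat
  assumes \<sigma>: "\<sigma> permutes {..<n}"
  shows "(\<Prod>i<n. h i (x i)) * (\<Prod>i<n. kN N (x i) (x (\<sigma> i)))
    = (\<Sum>m\<in>PiE {..<n} (\<lambda>_. {..<N}). \<Prod>i<n. h i (x i) * s (m i) (x i) * cnj (s (m (inv \<sigma> i)) (x i)))"
proof -
  have "(\<Prod>i<n. kN N (x i) (x (\<sigma> i))) = (\<Sum>m\<in>PiE {..<n} (\<lambda>_. {..<N}). \<Prod>i<n. s (m i) (x i) * cnj (s (m i) (x (\<sigma> i))))"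
    unfolding kN_def by (rule prod_sum_PiE) auto
  moreover have "(\<Prod>i<n. cnj (s (m i) (x (\<sigma> i)))) = (\<Prod>i<n. cnj (s (m (inv \<sigma> i)) (x i)))" for m
    using prod.permute[OF \<sigma>, of "\<lambda>i. cnj (s (m (inv \<sigma> i)) (x i))"] permutes_inverses(2)[OF \<sigma>]
    by (simp add: o_def)
  ultimately show ?thesis
    by (simp add: sum_distrib_left prod.distrib mult.assoc)
qed

text \<open>For the truncated kernel the integral is a finite sum of products of matrix entries. The
  inverse permutations left by \<open>prod_kN\<close> are removed by reindexing, since \<sigma> and
  its inverse have the same number of cycles.\<close>

lemma kN_integral:
  assumes h: "\<And>i. i < n \<Longrightarrow> bm c (h i)"
  shows "integrable (PM n) (\<lambda>x. (\<Prod>i<n. h i (x i)) * alpha_det \<alpha> n (\<lambda>i j. kN N (x i) (x j)))"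
    and "(LINT x|PM n. (\<Prod>i<n. h i (x i)) * alpha_det \<alpha> n (\<lambda>i j. kN N (x i) (x j))) = cyc_sum \<alpha> N {..<n} (\<lambda>i. G (h i))"
proof -
  let ?E = "PiE {..<n} (\<lambda>_. {..<N})"
  let ?c = "\<lambda>\<sigma>. complex_of_real \<alpha> ^ (card {..<n} - cyc {..<n} \<sigma>)"
  let ?f = "\<lambda>\<sigma> m x. \<Prod>i<n. h i (x i) * s (m i) (x i) * cnj (s (m (inv \<sigma> i)) (x i))"
  have e: "(\<Prod>i<n. h i (x i)) * alpha_det \<alpha> n (\<lambda>i j. kN N (x i) (x j)) = (\<Sum>\<sigma> | \<sigma> permutes {..<n}. ?c \<sigma> * (\<Sum>m\<in>?E. ?f \<sigma> m x))" for x
    unfolding alpha_det_cyc sum_distrib_left[of "\<Prod>i<n. h i (x i)"]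
  proof (rule sum.cong[OF refl])
    fix \<sigma> assume "\<sigma> \<in> {\<sigma>. \<sigma> permutes {..<n}}"
    then have "\<sigma> permutes {..<n}" by simp
    from prod_kN[OF this, of h x N]
    show "(\<Prod>i<n. h i (x i)) * (?c \<sigma> * (\<Prod>i<n. kN N (x i) (x (\<sigma> i)))) = ?c \<sigma> * (\<Sum>m\<in>?E. ?f \<sigma> m x)"
      by (simp only: mult.left_commute[of "\<Prod>i<n. h i (x i)" "?c \<sigma>"])
  qed
  have i: "integrable (PM n) (?f \<sigma> m)" for \<sigma> m
    by (rule PS.product_integrable_prod) (auto intro!: integrable_comp h)
  show "integrable (PM n) (\<lambda>x. (\<Prod>i<n. h i (x i)) * alpha_det \<alpha> n (\<lambda>i j. kN N (x i) (x j)))"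
    unfolding e by (intro Bochner_Integration.integrable_sum integrable_mult_right i)
  have fi: "(LINT x|PM n. ?f \<sigma> m x) = (\<Prod>i<n. G (h i) (m i) (m (inv \<sigma> i)))" for \<sigma> m
  proof -
    have "(LINT x|PM n. ?f \<sigma> m x) = (\<Prod>i<n. LINT x|\<mu>. h i x * s (m i) x * cnj (s (m (inv \<sigma> i)) x))"
      by (rule PS.product_integral_prod) (auto intro!: integrable_comp h)
    then show ?thesis by (simp add: G_def l2_inner_def mult_ac)
  qed
  have "(LINT x|PM n. (\<Prod>i<n. h i (x i)) * alpha_det \<alpha> n (\<lambda>i j. kN N (x i) (x j)))
     = (\<Sum>\<sigma> | \<sigma> permutes {..<n}. ?c \<sigma> * (\<Sum>m\<in>?E. \<Prod>i<n. G (h i) (m i) (m (inv \<sigma> i))))"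
    unfolding e
    by (subst Bochner_Integration.integral_sum)
       (auto intro!: integrable_mult_right Bochner_Integration.integrable_sum i simp: i Bochner_Integration.integral_sum fi)
  also have "\<dots> = (\<Sum>\<sigma> | \<sigma> permutes {..<n}. ?c (inv \<sigma>) * (\<Sum>m\<in>?E. \<Prod>i<n. G (h i) (m i) (m (inv (inv \<sigma>) i))))"
    by (rule sum_permutations_inverse)
  also have "\<dots> = cyc_sum \<alpha> N {..<n} (\<lambda>i. G (h i))"
    unfolding cyc_sum_def
  proof (rule sum.cong[OF refl])
    fix \<sigma> assume "\<sigma> \<in> {\<sigma>. \<sigma> permutes {..<n}}"
    then have \<sigma>: "\<sigma> permutes {..<n}" by simp
    then have "permutation \<sigma>" unfolding permutation_permutes by blast
    then have "cyc {..<n} (inv \<sigma>) = cyc {..<n} \<sigma>" unfolding cyc_def by (simp add: orbit_inv_eq)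
    then show "?c (inv \<sigma>) * (\<Sum>m\<in>?E. \<Prod>i<n. G (h i) (m i) (m (inv (inv \<sigma>) i)))
       = ?c \<sigma> * (\<Sum>m\<in>?E. \<Prod>i<n. G (h i) (m i) (m (\<sigma> i)))"
      using permutes_inv_inv[OF \<sigma>] by simp
  qed
  finally show "(LINT x|PM n. (\<Prod>i<n. h i (x i)) * alpha_det \<alpha> n (\<lambda>i j. kN N (x i) (x j))) = cyc_sum \<alpha> N {..<n} (\<lambda>i. G (h i))" .
qed

text \<open>Each index occurs once as a row and once as a column, so a bound of product form is the
  same for all permutations.\<close>

lemma alpha_det_bound:
  assumes A: "\<And>i j. cmod (A i j) \<le> b i * b j" and b: "\<And>i. 0 \<le> (b i :: real)"
  shows "cmod (alpha_det \<alpha> n A) \<le> (\<Sum>\<sigma> | \<sigma> permutes {..<n}. \<bar>\<alpha>\<bar> ^ (card {..<n} - cyc {..<n} \<sigma>)) * (\<Prod>i<n. (b i)\<^sup>2)"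
  unfolding alpha_det_cyc sum_distrib_right
proof (rule sum_norm_le)
  fix \<sigma> assume "\<sigma> \<in> {\<sigma>. \<sigma> permutes {..<n}}"
  then have \<sigma>: "\<sigma> permutes {..<n}" by simp
  have "cmod (\<Prod>i<n. A i (\<sigma> i)) \<le> (\<Prod>i<n. b i * b (\<sigma> i))"
    unfolding prod_norm[symmetric] by (intro prod_mono) (auto simp: A)
  also have "\<dots> = (\<Prod>i<n. b i) * (\<Prod>i<n. b i)"
    using prod.permute[OF \<sigma>, of b] by (simp add: prod.distrib o_def)
  finally show "cmod (complex_of_real \<alpha> ^ (card {..<n} - cyc {..<n} \<sigma>) * (\<Prod>i<n. A i (\<sigma> i)))
     \<le> \<bar>\<alpha>\<bar> ^ (card {..<n} - cyc {..<n} \<sigma>) * (\<Prod>i<n. (b i)\<^sup>2)"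
    by (simp add: norm_mult norm_power mult_left_mono power2_eq_square prod.distrib)
qed

definition DD :: "nat \<Rightarrow> (nat \<Rightarrow> 'a \<Rightarrow> complex) \<Rightarrow> complex" where
  "DD n h = (LINT x|PM n. (\<Prod>i<n. h i (x i)) * alpha_det \<alpha> n (\<lambda>i j. K (x i) (x j)))"

definition bms :: "real \<Rightarrow> ('a \<Rightarrow> complex) \<Rightarrow> bool" where
  "bms c h \<longleftrightarrow> bm c h \<and> (\<forall>x. x \<notin> S \<longrightarrow> h x = 0)"

context
  fixes n :: nat
  assumes \<rho>_meas: "(\<lambda>x. alpha_det \<alpha> n (\<lambda>i j. K (x i) (x j))) \<in> borel_measurable (PM n)"
begin

text \<open>If some point lies outside \<open>S\<close> the test functions annihilate both sides.
  Otherwise equal indices use the identity on the diagonal, and distinct ones the identity off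
  it.\<close>

lemma density_eq:
  assumes h: "\<And>i. i < n \<Longrightarrow> bms c (h i)"
  shows "AE x in PM n. (\<Prod>i<n. h i (x i)) * alpha_det \<alpha> n (\<lambda>i j. K (x i) (x j))
     = (\<Prod>i<n. h i (x i)) * alpha_det \<alpha> n (\<lambda>i j. kk (x i) (x j))"
proof -
  have "AE x in PM n. \<forall>i\<in>{..<n}. \<forall>j\<in>{..<n}. x i \<in> S \<longrightarrow> x j \<in> S \<longrightarrow> K (x i) (x j) = kk (x i) (x j)"
  proof (intro AE_finite_allI finite_lessThan)
    fix i j assume ij: "i \<in> {..<n}" "j \<in> {..<n}"
    show "AE x in PM n. x i \<in> S \<longrightarrow> x j \<in> S \<longrightarrow> K (x i) (x j) = kk (x i) (x j)"
    proof (cases "i = j")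
      case True
      then show ?thesis using AE_PiM_comp[OF sigma_fin K_diag_eq finite_lessThan ij(1)] by (auto elim!: AE_mp)
    next
      case False
      then show ?thesis using AE_PiM_pair[OF sigma_fin K_offdiag_eq finite_lessThan ij] by simp
    qed
  qed
  then show ?thesis
  proof eventually_elim
    case (elim x)
    show ?case
    proof (cases "\<forall>i<n. x i \<in> S")
      case True
      have "alpha_det \<alpha> n (\<lambda>i j. K (x i) (x j)) = alpha_det \<alpha> n (\<lambda>i j. kk (x i) (x j))"
        unfolding alpha_det_cyc
      proof (rule sum.cong[OF refl])
        fix \<sigma> assume "\<sigma> \<in> {\<sigma>. \<sigma> permutes {..<n}}"
        then have "\<sigma> i < n" if "i < n" for i using that permutes_in_image[of \<sigma> "{..<n}" i] by simp
        then have "(\<Prod>i<n. K (x i) (x (\<sigma> i))) = (\<Prod>i<n. kk (x i) (x (\<sigma> i)))"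
          using True elim by (intro prod.cong refl) auto
        then show "complex_of_real \<alpha> ^ (card {..<n} - cyc {..<n} \<sigma>) * (\<Prod>i<n. K (x i) (x (\<sigma> i)))
          = complex_of_real \<alpha> ^ (card {..<n} - cyc {..<n} \<sigma>) * (\<Prod>i<n. kk (x i) (x (\<sigma> i)))" by simp
      qed
      then show ?thesis by simp
    next
      case False
      then obtain i where i: "i < n" "x i \<notin> S" by auto
      then have "h i (x i) = 0" using h[OF i(1)] by (simp add: bms_def)
      then have "(\<Prod>i<n. h i (x i)) = 0" using i by (intro prod_zero) auto
      then show ?thesis by simp
    qed
  qed
qed

lemma prod_h_meas: 
  assumes h: "\<And>i. i < n \<Longrightarrow> bm c (h i)"
  shows "(\<lambda>x. \<Prod>i<n. h i (x i)) \<in> borel_measurable (PM n)"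
proof (rule borel_measurable_prod)
  fix i assume i: "i \<in> {..<n}"
  show "(\<lambda>x. h i (x i)) \<in> borel_measurable (PM n)"
    by (rule measurable_compose[OF measurable_component_singleton[OF i]]) (use h i bm_meas in auto)
qed

text \<open>For fixed \<open>n\<close> this is dominated convergence. The majorant is a product of
  copies of \<open>bb\<close> squared, integrable because its one-variable integral is the
  trace.\<close>

lemma DD_tendsto:
  assumes h: "\<And>i. i < n \<Longrightarrow> bms c (h i)" and c: "0 \<le> c"
  shows "integrable (PM n) (\<lambda>x. (\<Prod>i<n. h i (x i)) * alpha_det \<alpha> n (\<lambda>i j. K (x i) (x j)))"
    and "(\<lambda>N. cyc_sum \<alpha> N {..<n} (\<lambda>i. G (h i))) \<longlonglongrightarrow> DD n h"
proof -
  have hb: "i < n \<Longrightarrow> bm c (h i)" for i using h by (simp add: bms_def)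
  note hm = prod_h_meas[OF hb]
  have de: "AE x in PM n. (\<Prod>i<n. h i (x i)) * alpha_det \<alpha> n (\<lambda>i j. K (x i) (x j))
     = (\<Prod>i<n. h i (x i)) * alpha_det \<alpha> n (\<lambda>i j. kk (x i) (x j))"
    by (rule density_eq) (rule h)
  define A where "A = (\<Sum>\<sigma> | \<sigma> permutes {..<n}. \<bar>\<alpha>\<bar> ^ (card {..<n} - cyc {..<n} \<sigma>))"
  have A: "0 \<le> A" by (simp add: A_def sum_nonneg)
  define w where "w x = c ^ n * A * (\<Prod>i<n. (bb (x i))\<^sup>2)" for x :: "nat \<Rightarrow> 'a"
  have iw: "integrable (PM n) w"
    unfolding w_def[abs_def] by (intro integrable_mult_right PS.product_integrable_prod bb_integrable) simp
  have hc: "cmod (\<Prod>i<n. h i (x i)) \<le> c ^ n" for x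
  proof -
    have "cmod (\<Prod>i<n. h i (x i)) \<le> (\<Prod>i<n. c)"
      unfolding prod_norm[symmetric] using hb by (intro prod_mono) (auto simp: bm_def)
    then show ?thesis by simp
  qed
  have bN: "cmod ((\<Prod>i<n. h i (x i)) * alpha_det \<alpha> n (\<lambda>i j. kN N (x i) (x j))) \<le> w x" for N x
    unfolding norm_mult w_def A_def mult.assoc
    by (intro mult_mono hc alpha_det_bound kN_bound bb_nonneg) (use c in auto)
  have bk: "cmod ((\<Prod>i<n. h i (x i)) * alpha_det \<alpha> n (\<lambda>i j. kk (x i) (x j))) \<le> w x" for x
    unfolding norm_mult w_def A_def mult.assoc
    by (intro mult_mono hc alpha_det_bound kk_bound bb_nonneg) (use c in auto)
  have m: "(\<lambda>x. (\<Prod>i<n. h i (x i)) * alpha_det \<alpha> n (\<lambda>i j. K (x i) (x j))) \<in> borel_measurable (PM n)"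
    by (intro borel_measurable_times hm \<rho>_meas)
  show "integrable (PM n) (\<lambda>x. (\<Prod>i<n. h i (x i)) * alpha_det \<alpha> n (\<lambda>i j. K (x i) (x j)))"
  proof (rule Bochner_Integration.integrable_bound[OF iw m])
    show "AE x in PM n. norm ((\<Prod>i<n. h i (x i)) * alpha_det \<alpha> n (\<lambda>i j. K (x i) (x j))) \<le> norm (w x)"
      using de
    proof eventually_elim
      case (elim x)
      have "norm ((\<Prod>i<n. h i (x i)) * alpha_det \<alpha> n (\<lambda>i j. K (x i) (x j))) \<le> w x" unfolding elim by (rule bk)
      then show ?case by simp
    qed
  qed
  have "(\<lambda>N. LINT x|PM n. (\<Prod>i<n. h i (x i)) * alpha_det \<alpha> n (\<lambda>i j. kN N (x i) (x j))) \<longlonglongrightarrow> DD n h"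
    unfolding DD_def
  proof (rule integral_dominated_convergence[OF m _ iw])
    show "(\<lambda>x. (\<Prod>i<n. h i (x i)) * alpha_det \<alpha> n (\<lambda>i j. kN N (x i) (x j))) \<in> borel_measurable (PM n)" for N
      using kN_integral(1)[OF hb] by (rule borel_measurable_integrable)
    show "AE x in PM n. norm ((\<Prod>i<n. h i (x i)) * alpha_det \<alpha> n (\<lambda>i j. kN N (x i) (x j))) \<le> w x" for N
      using bN by simp
    show "AE x in PM n. (\<lambda>N. (\<Prod>i<n. h i (x i)) * alpha_det \<alpha> n (\<lambda>i j. kN N (x i) (x j)))
       \<longlonglongrightarrow> (\<Prod>i<n. h i (x i)) * alpha_det \<alpha> n (\<lambda>i j. K (x i) (x j))"
      using de
    proof eventually_elim
      case (elim x)
      have "(\<lambda>N. (\<Prod>i<n. h i (x i)) * alpha_det \<alpha> n (\<lambda>i j. kN N (x i) (x j)))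
        \<longlonglongrightarrow> (\<Prod>i<n. h i (x i)) * alpha_det \<alpha> n (\<lambda>i j. kk (x i) (x j))"
        unfolding alpha_det_cyc by (intro tendsto_intros kN_tendsto)
      then show ?case unfolding elim .
    qed
  qed
  then show "(\<lambda>N. cyc_sum \<alpha> N {..<n} (\<lambda>i. G (h i))) \<longlonglongrightarrow> DD n h"
    by (simp add: kN_integral(2)[OF hb])
qed

end

end

section \<open>Characteristic functions of linear statistics\<close>

lemma prod_fun_upd_linear:
  fixes h :: "nat \<Rightarrow> 'a \<Rightarrow> complex"
  assumes k: "k < n" and hk: "\<And>x. h k x = (\<Sum>j\<in>J. a j * p j x)"
  shows "(\<Prod>i<n. h i (x i)) = (\<Sum>j\<in>J. a j * (\<Prod>i<n. (h(k := p j)) i (x i)))"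
proof -
  have r: "(\<Prod>i\<in>{..<n} - {k}. (h(k := p j)) i (x i)) = (\<Prod>i\<in>{..<n} - {k}. h i (x i))" for j
    by (intro prod.cong refl) auto
  have "(\<Prod>i<n. (h(k := p j)) i (x i)) = p j (x k) * (\<Prod>i\<in>{..<n} - {k}. h i (x i))" for j
    using prod.remove[of "{..<n}" k "\<lambda>i. (h(k := p j)) i (x i)"] k unfolding r by simp
  moreover have "(\<Prod>i<n. h i (x i)) = h k (x k) * (\<Prod>i\<in>{..<n} - {k}. h i (x i))"
    using k by (intro prod.remove) auto
  ultimately show ?thesis by (simp add: hk sum_distrib_right mult.assoc)
qed

text \<open>Written as an indexed sum with fixed coefficients, so that multilinearity can be applied
  to one slot at a time.\<close>

lemma complex_four_parts:
  "(z::complex) = (\<Sum>j<4::nat. [1, -1, \<i>, -\<i>] ! j * [complex_of_real (max 0 (Re z)), complex_of_real (max 0 (- Re z)),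
     complex_of_real (max 0 (Im z)), complex_of_real (max 0 (- Im z))] ! j)"
  by (simp add: eval_nat_numeral complex_eq_iff max_def)

locale alpha_process = alpha_kernel \<mu> K S \<kappa> \<alpha> + P: prob_space M
  for \<mu> :: "'a::euclidean_space measure" and K S \<kappa> \<alpha> and M :: "'w measure" +
  fixes X :: "'w \<Rightarrow> 'a set"
  assumes process: "alpha_determinantal_process M X \<alpha> K \<mu>"
begin

lemma pp: "point_process M X"
  using process by (simp add: alpha_determinantal_process_def)

lemma corr: "0 < n \<Longrightarrow> has_correlation_function M X \<mu> n (\<lambda>x. alpha_det \<alpha> n (\<lambda>i j. K (x i) (x j)))"
  using process by (simp add: alpha_determinantal_process_def)

lemma fin: "\<omega> \<in> space M \<Longrightarrow> finite (X \<omega> \<inter> S)"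
  using pp S by (simp add: point_process_def)

lemma bms_borel: "bms c h \<Longrightarrow> h \<in> borel_measurable borel"
  using measurable_cong_sets[OF sets_mu refl] by (auto simp: bms_def bm_def)

lemma tsum_meas: "(\<And>i. i < n \<Longrightarrow> bms c (h i)) \<Longrightarrow> (\<lambda>\<omega>. tsum h n (X \<omega> \<inter> S)) \<in> borel_measurable M"
  by (intro tsum_measurable[OF pp S] bms_borel) auto

text \<open>The correlation identity speaks of non-negative extended test functions. Integrability
  of the right-hand side is known from \<open>DD_tendsto\<close>, which turns it into an identity of
  Bochner integrals.\<close>

lemma expectation_tsum_nonneg:
  assumes n: "0 < n" and r: "\<And>i. i < n \<Longrightarrow> bms c (\<lambda>x. complex_of_real (r i x))" and r0: "\<And>i x. i < n \<Longrightarrow> 0 \<le> r i x" and c: "0 \<le> c"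
  shows "integrable M (\<lambda>\<omega>. tsum (\<lambda>i x. complex_of_real (r i x)) n (X \<omega> \<inter> S))"
    and "(LINT \<omega>|M. tsum (\<lambda>i x. complex_of_real (r i x)) n (X \<omega> \<inter> S)) = DD n (\<lambda>i x. complex_of_real (r i x))"
proof -
  define \<rho> where "\<rho> x = alpha_det \<alpha> n (\<lambda>i j. K (x i) (x j))" for x
  define h where "h i x = complex_of_real (r i x)" for i x
  have hb: "i < n \<Longrightarrow> bms c (h i)" for i unfolding h_def[abs_def] by (rule r)
  have \<rho>m: "\<rho> \<in> borel_measurable (PM n)" and \<rho>0: "AE x in PM n. \<rho> x \<in> \<real>\<^sub>\<ge>\<^sub>0"
    and \<rho>c: "\<And>f. f \<in> borel_measurable (PM n) \<Longrightarrow> (\<integral>\<^sup>+\<omega>. (\<integral>\<^sup>+x. f x \<partial>count_space {x \<in> {..<n} \<rightarrow>\<^sub>E X \<omega>. inj_on x {..<n}}) \<partial>M)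
          = (\<integral>\<^sup>+x. f x * ennreal (Re (\<rho> x)) \<partial>PM n)"
    using corr[OF n] unfolding has_correlation_function_def \<rho>_def[abs_def] by blast+
  have int: "integrable (PM n) (\<lambda>x. (\<Prod>i<n. h i (x i)) * \<rho> x)"
    unfolding \<rho>_def by (rule DD_tendsto(1)[OF _ hb c]) (use \<rho>m in \<open>auto simp: \<rho>_def[abs_def]\<close>)
  have ri: "i < n \<Longrightarrow> (\<lambda>x. r i x) \<in> borel_measurable \<mu>" for i
  proof -
    assume "i < n"
    then have "(\<lambda>x. Re (h i x)) \<in> borel_measurable \<mu>"
      using hb[of i] by (intro measurable_compose[OF bm_meas[of c] borel_measurable_Re]) (simp add: bms_def)
    then show ?thesis by (simp add: h_def)
  qed
  define f where "f x = (\<Prod>i<n. ennreal (r i (x i)))" for x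
  have fe: "f x = ennreal (\<Prod>i<n. r i (x i))" for x
    unfolding f_def using r0 by (intro prod_ennreal) auto
  have fm: "f \<in> borel_measurable (PM n)"
  proof -
    have "(\<lambda>x. \<Prod>i<n. r i (x i)) \<in> borel_measurable (PM n)"
    proof (rule borel_measurable_prod)
      fix i assume i: "i \<in> {..<n}"
      have "(\<lambda>x. x i) \<in> PM n \<rightarrow>\<^sub>M \<mu>" by (rule measurable_component_singleton[OF i])
      from measurable_compose[OF this ri[of i]] i show "(\<lambda>x. r i (x i)) \<in> borel_measurable (PM n)" by simp
    qed
    then show ?thesis unfolding fe[abs_def] by measurable
  qed
  \<comment> \<open>A tuple with an entry outside \<open>S\<close> has weight zero, so the sum over
    all of \<open>X \<omega>\<close> reduces to the finite configuration in
    \<open>S\<close>.\<close>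
  have inner: "(\<integral>\<^sup>+x. f x \<partial>count_space {x \<in> {..<n} \<rightarrow>\<^sub>E X \<omega>. inj_on x {..<n}}) = ennreal (tsum r n (X \<omega> \<inter> S))" if "\<omega> \<in> space M" for \<omega>
  proof -
    have "(\<integral>\<^sup>+x. f x \<partial>count_space {x \<in> {..<n} \<rightarrow>\<^sub>E X \<omega>. inj_on x {..<n}}) = (\<Sum>x\<in>tup n (X \<omega> \<inter> S). f x)"
    proof (rule nn_integral_count_space'[OF finite_tup[OF fin[OF that]]])
      show "tup n (X \<omega> \<inter> S) \<subseteq> {x \<in> {..<n} \<rightarrow>\<^sub>E X \<omega>. inj_on x {..<n}}" by (auto simp: tup_def PiE_def Pi_def)
      fix x assume x: "x \<in> {x \<in> {..<n} \<rightarrow>\<^sub>E X \<omega>. inj_on x {..<n}}" "x \<notin> tup n (X \<omega> \<inter> S)"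
      then obtain i where i: "i < n" "x i \<notin> S" by (auto simp: tup_def PiE_def Pi_def)
      then have "h i (x i) = 0" using hb[OF i(1)] by (simp add: bms_def)
      then have "ennreal (r i (x i)) = 0" by (simp add: h_def)
      then show "f x = 0" unfolding f_def using i by (intro prod_zero) auto
    qed
    also have "\<dots> = ennreal (tsum r n (X \<omega> \<inter> S))"
      unfolding fe tsum_def using r0 by (intro sum_ennreal prod_nonneg) auto
    finally show ?thesis .
  qed
  have rt: "complex_of_real (tsum r n A) = tsum h n A" for A
    unfolding h_def[abs_def] by (rule of_real_tsum)
  have t0: "0 \<le> tsum r n A" for A unfolding tsum_def using r0 by (intro sum_nonneg prod_nonneg) auto
  have tm: "(\<lambda>\<omega>. tsum r n (X \<omega> \<inter> S)) \<in> borel_measurable M"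
  proof -
    have "(\<lambda>\<omega>. Re (tsum h n (X \<omega> \<inter> S))) \<in> borel_measurable M" by (rule measurable_compose[OF tsum_meas[of n c h, OF hb] borel_measurable_Re])
    then show ?thesis by (simp add: rt[symmetric])
  qed
  have reim: "AE x in PM n. 0 \<le> Re ((\<Prod>i<n. h i (x i)) * \<rho> x) \<and> Im ((\<Prod>i<n. h i (x i)) * \<rho> x) = 0 \<and>
      f x * ennreal (Re (\<rho> x)) = ennreal (Re ((\<Prod>i<n. h i (x i)) * \<rho> x))"
    using \<rho>0
  proof eventually_elim
    case (elim x)
    define t where "t = (\<Prod>i<n. r i (x i))"
    have p: "(\<Prod>i<n. h i (x i)) = complex_of_real t" by (simp add: h_def t_def)
    have p0: "0 \<le> t" unfolding t_def using r0 by (intro prod_nonneg) auto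
    show ?case unfolding p fe t_def[symmetric] using elim p0
      by (auto simp: complex_nonneg_Reals_iff ennreal_mult)
  qed
  have "(\<integral>\<^sup>+\<omega>. ennreal (tsum r n (X \<omega> \<inter> S)) \<partial>M) = (\<integral>\<^sup>+x. f x * ennreal (Re (\<rho> x)) \<partial>PM n)"
    unfolding \<rho>c[OF fm, symmetric] by (rule nn_integral_cong) (simp add: inner)
  also have "\<dots> = (\<integral>\<^sup>+x. ennreal (Re ((\<Prod>i<n. h i (x i)) * \<rho> x)) \<partial>PM n)"
    by (rule nn_integral_cong_AE) (use reim in eventually_elim, blast)
  also have "\<dots> = ennreal (LINT x|PM n. Re ((\<Prod>i<n. h i (x i)) * \<rho> x))"
    by (intro nn_integral_eq_integral integrable_Re int) (use reim in eventually_elim, blast)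
  also have "(LINT x|PM n. Re ((\<Prod>i<n. h i (x i)) * \<rho> x)) = Re (DD n h)"
    unfolding DD_def \<rho>_def[symmetric] by (rule integral_Re[OF int])
  finally have nn: "(\<integral>\<^sup>+\<omega>. ennreal (tsum r n (X \<omega> \<inter> S)) \<partial>M) = ennreal (Re (DD n h))" .
  have D0: "0 \<le> Re (DD n h)"
    unfolding DD_def \<rho>_def[symmetric] integral_Re[OF int, symmetric]
    by (intro integral_nonneg_AE) (use reim in eventually_elim, blast)
  have DI: "Im (DD n h) = 0"
  proof -
    have "Im (DD n h) = (LINT x|PM n. Im ((\<Prod>i<n. h i (x i)) * \<rho> x))"
      unfolding DD_def \<rho>_def[symmetric] by (rule integral_Im[OF int, symmetric])
    also have "\<dots> = (LINT x|PM n. 0)"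
    proof (rule integral_cong_AE)
      show "(\<lambda>x. Im ((\<Prod>i<n. h i (x i)) * \<rho> x)) \<in> borel_measurable (PM n)"
        by (rule borel_measurable_integrable[OF integrable_Im[OF int]])
      show "AE x in PM n. Im ((\<Prod>i<n. h i (x i)) * \<rho> x) = 0" using reim by eventually_elim blast
    qed simp
    finally show ?thesis by simp
  qed
  have hb: "has_bochner_integral M (\<lambda>\<omega>. tsum r n (X \<omega> \<inter> S)) (Re (DD n h))"
    by (rule has_bochner_integral_nn_integral[OF tm _ D0 nn]) (simp add: t0)
  then have "has_bochner_integral M (\<lambda>\<omega>. complex_of_real (tsum r n (X \<omega> \<inter> S))) (complex_of_real (Re (DD n h)))"
    by (rule has_bochner_integral_of_real)
  moreover have "complex_of_real (Re (DD n h)) = DD n h" using DI by (simp add: complex_eq_iff)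
  ultimately have "has_bochner_integral M (\<lambda>\<omega>. tsum h n (X \<omega> \<inter> S)) (DD n h)" by (simp add: rt)
  then show "integrable M (\<lambda>\<omega>. tsum (\<lambda>i x. complex_of_real (r i x)) n (X \<omega> \<inter> S))"
    "(LINT \<omega>|M. tsum (\<lambda>i x. complex_of_real (r i x)) n (X \<omega> \<inter> S)) = DD n (\<lambda>i x. complex_of_real (r i x))"
    unfolding h_def[abs_def] by (auto simp: has_bochner_integral_iff)
qed

lemma expectation_tsum:
  assumes n: "0 < n" and h: "\<And>i. i < n \<Longrightarrow> bms c (h i)" and c: "0 \<le> c"
  shows "integrable M (\<lambda>\<omega>. tsum h n (X \<omega> \<inter> S)) \<and> (LINT \<omega>|M. tsum h n (X \<omega> \<inter> S)) = DD n h"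
proof -
  have \<rho>m: "(\<lambda>x. alpha_det \<alpha> n (\<lambda>i j. K (x i) (x j))) \<in> borel_measurable (PM n)"
    using corr[OF n] unfolding has_correlation_function_def by blast
  \<comment> \<open>Induction on the number \<open>k\<close> of leading slots that may be complex:
    the last of them is split into four non-negative parts, and at \<open>k = 0\<close> all slots
    are non-negative.\<close>
  have "integrable M (\<lambda>\<omega>. tsum h n (X \<omega> \<inter> S)) \<and> (LINT \<omega>|M. tsum h n (X \<omega> \<inter> S)) = DD n h"
    if "k \<le> n" "\<And>i. i < n \<Longrightarrow> bms c (h i)" "\<And>i x. k \<le> i \<Longrightarrow> i < n \<Longrightarrow> h i x \<in> \<real>\<^sub>\<ge>\<^sub>0" for k h
    using that
  proof (induction k arbitrary: h)
    case 0
    define r where "r i x = Re (h i x)" for i x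
    have e: "h i x = complex_of_real (r i x)" if "i < n" for i x
      using 0(3)[of i x] that by (auto simp: r_def complex_nonneg_Reals_iff complex_eq_iff)
    have r: "bms c (\<lambda>x. complex_of_real (r i x))" if "i < n" for i
      using 0(2)[OF that] e[OF that] by (simp add: bms_def bm_def cong: measurable_cong)
    have r0: "0 \<le> r i x" if "i < n" for i x using 0(3)[of i x] that by (simp add: r_def complex_nonneg_Reals_iff)
    have "tsum h n A = tsum (\<lambda>i x. complex_of_real (r i x)) n A" for A by (rule tsum_cong) (rule e)
    moreover have "DD n h = DD n (\<lambda>i x. complex_of_real (r i x))" unfolding DD_def by (simp add: e)
    ultimately show ?case using expectation_tsum_nonneg[OF n r r0 c] by simp
  next
    case (Suc k)
    define p where "p j x = [complex_of_real (max 0 (Re (h k x))), complex_of_real (max 0 (- Re (h k x))),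
       complex_of_real (max 0 (Im (h k x))), complex_of_real (max 0 (- Im (h k x)))] ! j" for j :: nat and x
    define a where "a j = [1, -1, \<i>, -\<i>] ! j" for j :: nat
    have kn: "k < n" using Suc.prems by simp
    have hk: "h k x = (\<Sum>j<4. a j * p j x)" for x
      unfolding a_def p_def by (rule complex_four_parts)
    have pr: "p j x \<in> \<real>\<^sub>\<ge>\<^sub>0" if "j < 4" for j x
      using that by (auto simp: p_def eval_nat_numeral less_Suc_eq)
    have pb: "bms c (p j)" if "j < 4" for j
    proof -
      have hkb: "bms c (h k)" using Suc.prems kn by simp
      then have [measurable]: "h k \<in> borel_measurable \<mu>" by (simp add: bms_def bm_def)
      have m: "\<bar>Re (h k x)\<bar> \<le> c" "\<bar>Im (h k x)\<bar> \<le> c" for x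
        using hkb abs_Re_le_cmod[of "h k x"] abs_Im_le_cmod[of "h k x"] unfolding bms_def bm_def by (meson order_trans)+
      have z: "x \<notin> S \<Longrightarrow> h k x = 0" for x using hkb by (simp add: bms_def)
      from that consider "j = 0" | "j = 1" | "j = 2" | "j = 3" by linarith
      then show ?thesis
        by cases (use c m z in \<open>auto simp: bms_def bm_def p_def[abs_def] eval_nat_numeral abs_le_iff\<close>)
    qed
    have good: "integrable M (\<lambda>\<omega>. tsum (h(k := p j)) n (X \<omega> \<inter> S)) \<and> (LINT \<omega>|M. tsum (h(k := p j)) n (X \<omega> \<inter> S)) = DD n (h(k := p j))"
      if j: "j < 4" for j
    proof (rule Suc.IH)
      show "bms c ((h(k := p j)) i)" if "i < n" for i using Suc.prems(2)[OF that] pb[OF j] by simp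
      show "(h(k := p j)) i x \<in> \<real>\<^sub>\<ge>\<^sub>0" if "k \<le> i" "i < n" for i x
        using Suc.prems(3)[of i x] pr[OF j] that by auto
    qed (use Suc.prems in simp)
    have t: "tsum h n A = (\<Sum>j<4. a j * tsum (h(k := p j)) n A)" for A
      unfolding tsum_def prod_fun_upd_linear[of k n h, OF kn hk] sum_distrib_left by (rule sum.swap)
    have D: "DD n h = (\<Sum>j<4. a j * DD n (h(k := p j)))"
    proof -
      have "DD n h = (LINT x|PM n. (\<Sum>j<4. a j * ((\<Prod>i<n. (h(k := p j)) i (x i)) * alpha_det \<alpha> n (\<lambda>i j. K (x i) (x j)))))"
        unfolding DD_def prod_fun_upd_linear[of k n h, OF kn hk] by (simp add: sum_distrib_right mult.assoc)
      also have "\<dots> = (\<Sum>j<4. LINT x|PM n. a j * ((\<Prod>i<n. (h(k := p j)) i (x i)) * alpha_det \<alpha> n (\<lambda>i j. K (x i) (x j))))"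
      proof (rule Bochner_Integration.integral_sum)
        fix j :: nat assume "j \<in> {..<4}"
        then have j: "j < 4" by simp
        have "bms c ((h(k := p j)) i)" if "i < n" for i using Suc.prems(2)[OF that] pb[OF j] by simp
        then show "integrable (PM n) (\<lambda>x. a j * ((\<Prod>i<n. (h(k := p j)) i (x i)) * alpha_det \<alpha> n (\<lambda>i j. K (x i) (x j))))"
          by (intro integrable_mult_right DD_tendsto(1)[OF \<rho>m _ c])
      qed
      also have "\<dots> = (\<Sum>j<4. a j * DD n (h(k := p j)))" by (simp add: DD_def)
      finally show ?thesis .
    qed
    show ?case unfolding t D
    proof
      show "integrable M (\<lambda>\<omega>. \<Sum>j<4. a j * tsum (h(k := p j)) n (X \<omega> \<inter> S))"
        by (intro Bochner_Integration.integrable_sum integrable_mult_right) (use good in auto)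
      have "(LINT \<omega>|M. (\<Sum>j<4. a j * tsum (h(k := p j)) n (X \<omega> \<inter> S))) = (\<Sum>j<4. LINT \<omega>|M. a j * tsum (h(k := p j)) n (X \<omega> \<inter> S))"
        by (intro Bochner_Integration.integral_sum integrable_mult_right) (use good in auto)
      also have "\<dots> = (\<Sum>j<4. a j * DD n (h(k := p j)))"
        by (intro sum.cong refl) (use good in simp)
      finally show "(LINT \<omega>|M. (\<Sum>j<4. a j * tsum (h(k := p j)) n (X \<omega> \<inter> S))) = (\<Sum>j<4. a j * DD n (h(k := p j)))" .
    qed
  qed
  from this[of n h] show ?thesis using h by auto
qed

lemma expectation_tsum_tendsto:
  assumes n: "0 < n" and h: "\<And>i. i < n \<Longrightarrow> bms c (h i)" and c: "0 \<le> c"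
  shows "(\<lambda>N. cyc_sum \<alpha> N {..<n} (\<lambda>i. G (h i))) \<longlonglongrightarrow> (LINT \<omega>|M. tsum h n (X \<omega> \<inter> S))"
proof -
  have "(\<lambda>x. alpha_det \<alpha> n (\<lambda>i j. K (x i) (x j))) \<in> borel_measurable (PM n)"
    using corr[OF n] unfolding has_correlation_function_def by blast
  from DD_tendsto(2)[OF this h c] show ?thesis using expectation_tsum[OF n h c] by simp
qed

end

section \<open>Exponential expectations as limits of matrix series\<close>

context alpha_process
begin

text \<open>Interchanges three limits. Replacing the test functions by their moduli gives tuple sums
  with the same geometric bound, so the series may be summed inside the expectation; the bound on
  \<open>a\<close> is uniform in \<open>N\<close>, so the limit in the rank passes through the
  series by Tannery's theorem.\<close>

lemma expectation_series:
  fixes len :: "nat \<Rightarrow> nat" and h :: "nat \<Rightarrow> nat \<Rightarrow> 'a \<Rightarrow> complex"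
  assumes h: "\<And>n i. i < len n \<Longrightarrow> bms c (h n i)" and c: "0 \<le> c"
    and a: "\<And>N n. cyc_sum \<alpha> N {..<len n} (\<lambda>i. G (h n i)) / fact n = a N n"
    and a_le: "\<And>N n. cmod (a N n) \<le> D * (3/4) ^ n"
    and abs_le: "\<And>N n. cmod (cyc_sum \<alpha> N {..<len n} (\<lambda>i. G (\<lambda>x. complex_of_real (cmod (h n i x)))) / fact n) \<le> D * (3/4) ^ n"
    and Z: "\<And>A. finite A \<Longrightarrow> (\<lambda>n. tsum (h n) (len n) A / fact n) sums Z A"
  shows "(\<lambda>N. \<Sum>n. a N n) \<longlonglongrightarrow> (LINT \<omega>|M. Z (X \<omega> \<inter> S))"
proof -
  have int: "integrable M (\<lambda>\<omega>. tsum g m (X \<omega> \<inter> S))" if "\<And>i. i < m \<Longrightarrow> bms c (g i)" for g m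
    using expectation_tsum[OF _ that c, of m] by (cases "m = 0") (auto simp: tsum_0)
  have lim: "(\<lambda>N. cyc_sum \<alpha> N {..<m} (\<lambda>i. G (g i))) \<longlonglongrightarrow> (LINT \<omega>|M. tsum g m (X \<omega> \<inter> S))"
    if "\<And>i. i < m \<Longrightarrow> bms c (g i)" for g m
  proof (cases "m = 0")
    \<comment> \<open>Correlation functions start at one point, so the empty tuple is treated
      directly.\<close>
    case True
    have "cyc_sum \<alpha> N {..<0} (\<lambda>i. G (g i)) = 1" for N by (simp add: cyc_sum_def cyc_def)
    then show ?thesis using True by (simp add: tsum_0 P.prob_space)
  next
    case False
    then show ?thesis by (intro expectation_tsum_tendsto[OF _ that c]) auto
  qed
  define E where "E n = (LINT \<omega>|M. tsum (h n) (len n) (X \<omega> \<inter> S) / fact n)" for n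
  have Elim: "(\<lambda>N. a N n) \<longlonglongrightarrow> E n" for n
    unfolding a[symmetric] E_def by (simp add: lim h tendsto_divide)
  have hc: "bms c (\<lambda>x. complex_of_real (cmod (h n i x)))" if "i < len n" for n i
    using h[OF that] by (auto simp: bms_def bm_def)
  have norm_le: "(LINT \<omega>|M. cmod (tsum (h n) (len n) (X \<omega> \<inter> S) / fact n)) \<le> D * (3/4) ^ n" for n
  proof -
    let ?h = "\<lambda>i x. complex_of_real (cmod (h n i x))"
    let ?T = "LINT \<omega>|M. tsum ?h (len n) (X \<omega> \<inter> S)"
    have iT: "integrable M (\<lambda>\<omega>. tsum (\<lambda>i x. cmod (h n i x)) (len n) (X \<omega> \<inter> S))"
      using int[of "len n" ?h] hc unfolding of_real_tsum[symmetric] complex_of_real_integrable_eq by simp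
    have "(LINT \<omega>|M. cmod (tsum (h n) (len n) (X \<omega> \<inter> S) / fact n))
        \<le> (LINT \<omega>|M. tsum (\<lambda>i x. cmod (h n i x)) (len n) (X \<omega> \<inter> S) / fact n)"
      by (intro integral_mono integrable_norm integrable_divide int h iT)
         (simp_all add: norm_divide divide_right_mono norm_tsum_le)
    also have "\<dots> \<le> cmod (complex_of_real (LINT \<omega>|M. tsum (\<lambda>i x. cmod (h n i x)) (len n) (X \<omega> \<inter> S) / fact n))"
      by (simp only: norm_of_real abs_ge_self)
    also have "complex_of_real (LINT \<omega>|M. tsum (\<lambda>i x. cmod (h n i x)) (len n) (X \<omega> \<inter> S) / fact n) = ?T / fact n"
      unfolding of_real_tsum[symmetric] by simp
    also have "cmod (?T / fact n) \<le> D * (3/4) ^ n"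
    proof (rule LIMSEQ_le_const2)
      show "(\<lambda>N. cmod (cyc_sum \<alpha> N {..<len n} (\<lambda>i. G (?h i)) / fact n)) \<longlonglongrightarrow> cmod (?T / fact n)"
        by (intro tendsto_norm tendsto_divide[OF lim tendsto_const] hc) simp_all
    qed (use abs_le in blast)
    finally show ?thesis .
  qed
  have sg: "summable (\<lambda>n. D * (3/4::real) ^ n)" by (intro summable_mult summable_geometric) simp
  have ni: "integrable M (\<lambda>\<omega>. tsum (h n) (len n) (X \<omega> \<inter> S) / fact n)" for n
    by (intro integrable_divide int h)
  have sn: "summable (\<lambda>n. LINT \<omega>|M. cmod (tsum (h n) (len n) (X \<omega> \<inter> S) / fact n))"
    by (rule summable_comparison_test[OF _ sg]) (use norm_le in \<open>auto intro!: exI[of _ 0]\<close>)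
  have AEs: "AE \<omega> in M. summable (\<lambda>n. cmod (tsum (h n) (len n) (X \<omega> \<inter> S) / fact n))"
  proof -
    have "(\<integral>\<^sup>+\<omega>. (\<Sum>n. ennreal (cmod (tsum (h n) (len n) (X \<omega> \<inter> S) / fact n))) \<partial>M)
        = (\<Sum>n. \<integral>\<^sup>+\<omega>. ennreal (cmod (tsum (h n) (len n) (X \<omega> \<inter> S) / fact n)) \<partial>M)"
      using ni by (intro nn_integral_suminf) (auto dest: borel_measurable_integrable)
    also have "\<dots> = (\<Sum>n. ennreal (LINT \<omega>|M. cmod (tsum (h n) (len n) (X \<omega> \<inter> S) / fact n)))"
      by (intro suminf_cong nn_integral_eq_integral integrable_norm ni) simp
    also have "\<dots> = ennreal (\<Sum>n. LINT \<omega>|M. cmod (tsum (h n) (len n) (X \<omega> \<inter> S) / fact n))"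
      by (rule suminf_ennreal2[OF _ sn]) simp
    finally have "(\<integral>\<^sup>+\<omega>. (\<Sum>n. ennreal (cmod (tsum (h n) (len n) (X \<omega> \<inter> S) / fact n))) \<partial>M) \<noteq> \<infinity>" by simp
    then have "AE \<omega> in M. (\<Sum>n. ennreal (cmod (tsum (h n) (len n) (X \<omega> \<inter> S) / fact n))) \<noteq> \<infinity>"
      by (rule nn_integral_PInf_AE[rotated]) (use ni in \<open>auto dest: borel_measurable_integrable\<close>)
    then show ?thesis
      by eventually_elim (rule summable_suminf_not_top, auto)
  qed
  have "(\<lambda>n. E n) sums (LINT \<omega>|M. (\<Sum>n. tsum (h n) (len n) (X \<omega> \<inter> S) / fact n))"
    unfolding E_def by (rule sums_integral[OF ni AEs sn])
  also have "(LINT \<omega>|M. (\<Sum>n. tsum (h n) (len n) (X \<omega> \<inter> S) / fact n)) = (LINT \<omega>|M. Z (X \<omega> \<inter> S))"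
    by (rule Bochner_Integration.integral_cong[OF refl]) (use Z[OF fin] in \<open>simp add: sums_iff\<close>)
  finally have Es: "(\<Sum>n. E n) = (LINT \<omega>|M. Z (X \<omega> \<inter> S))" by (simp add: sums_iff)
  have "eventually (\<lambda>(n, N). norm (a N n) \<le> D * (3/4) ^ n) (at_top \<times>\<^sub>F sequentially)"
    by (rule always_eventually) (use a_le in auto)
  from tannerys_theorem[of "\<lambda>n N. a N n", OF Elim this sg] show ?thesis unfolding Es by auto
qed

text \<open>The modulus of \<psi> obeys the same bound as \<psi>, so a single coefficient estimate
  yields both absolute convergence and the limit.\<close>

lemma expectation_prod:
  assumes \<psi>: "bms \<delta> \<psi>" and \<delta>: "\<bar>\<alpha>\<bar> * \<kappa> * \<delta> \<le> 1/2"
  shows "(\<lambda>N. \<Sum>n. cyc_coeff \<alpha> N (G \<psi>) n) \<longlonglongrightarrow> (LINT \<omega>|M. (\<Prod>a\<in>X \<omega> \<inter> S. 1 + \<psi> a))"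
proof (rule expectation_series[where len="\<lambda>n. n" and h="\<lambda>_ _. \<psi>" and c=\<delta> and D="growth (\<delta> * Tr)"])
  have b: "bm \<delta> \<psi>" and b': "bm \<delta> (\<lambda>x. complex_of_real (cmod (\<psi> x)))" using \<psi> by (auto simp: bms_def bm_def)
  show \<delta>0: "0 \<le> \<delta>" using b by (simp add: bm_def)
  have c: "0 \<le> \<delta> * Tr" using \<delta>0 Tr_nonneg by simp
  show "cyc_sum \<alpha> N {..<n} (\<lambda>i. G \<psi>) / fact n = cyc_coeff \<alpha> N (G \<psi>) n" for N n
    by (simp add: cyc_coeff_def)
  show "cmod (cyc_coeff \<alpha> N (G \<psi>) n) \<le> growth (\<delta> * Tr) * (3/4) ^ n" for N n
    by (rule cyc_coeff_bound[OF trace_bound_half[OF b b \<delta>] _ _ c]) simp_all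
  show "cmod (cyc_sum \<alpha> N {..<n} (\<lambda>i. G (\<lambda>x. complex_of_real (cmod (\<psi> x)))) / fact n) \<le> growth (\<delta> * Tr) * (3/4) ^ n" for N n
    unfolding cyc_coeff_def[symmetric] by (rule cyc_coeff_bound[OF trace_bound_half[OF b' b' \<delta>] _ _ c]) simp_all
  show "bms \<delta> \<psi>" by (rule \<psi>)
  show "(\<lambda>n. tsum (\<lambda>_. \<psi>) n A / fact n) sums (\<Prod>a\<in>A. 1 + \<psi> a)" if "finite A" for A
    by (rule tsum_sums[OF that])
qed

text \<open>Meant for \<eta> = \<phi> (1 + \<psi>): the factor missing from the product is then
  restored, and the integrand becomes the statistic times its exponential.\<close>

lemma expectation_marked_prod:
  assumes \<psi>: "bms \<delta> \<psi>" and \<eta>: "bms c \<eta>" and \<delta>: "\<bar>\<alpha>\<bar> * \<kappa> * \<delta> \<le> 1/2"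
  shows "(\<lambda>N. \<Sum>n. mark_coeff \<alpha> N (G \<psi>) (G \<eta>) n) \<longlonglongrightarrow>
    (LINT \<omega>|M. (\<Sum>a\<in>X \<omega> \<inter> S. \<eta> a * (\<Prod>b\<in>X \<omega> \<inter> S - {a}. 1 + \<psi> b)))"
proof (rule expectation_series[where len="\<lambda>n. Suc n" and h="\<lambda>n. (\<lambda>_. \<psi>)(n := \<eta>)" and c="max \<delta> c" and D="3 * (c * Tr) * growth (\<delta> * Tr)"])
  have b: "bm \<delta> \<psi>" "bm \<delta> (\<lambda>x. complex_of_real (cmod (\<psi> x)))" 
    and e: "bm c \<eta>" "bm c (\<lambda>x. complex_of_real (cmod (\<eta> x)))" using \<psi> \<eta> by (auto simp: bms_def bm_def)
  have \<delta>0: "0 \<le> \<delta>" "0 \<le> c" using b e by (simp_all add: bm_def)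
  then show "0 \<le> max \<delta> c" by simp
  have c: "0 \<le> \<delta> * Tr" "0 \<le> c * Tr" using \<delta>0 Tr_nonneg by simp_all
  have eq: "(\<lambda>i. G (((\<lambda>_. \<psi>)(n := \<eta>)) i)) = (\<lambda>_. G \<psi>)(n := G \<eta>)" for \<psi> \<eta> and n :: nat by auto
  have eq': "(\<lambda>i. G (\<lambda>x. complex_of_real (cmod (((\<lambda>_. \<psi>)(n := \<eta>)) i x))))
      = (\<lambda>_. G (\<lambda>x. complex_of_real (cmod (\<psi> x))))(n := G (\<lambda>x. complex_of_real (cmod (\<eta> x))))" for n :: nat by auto
  show "cyc_sum \<alpha> N {..<Suc n} (\<lambda>i. G (((\<lambda>_. \<psi>)(n := \<eta>)) i)) / fact n = mark_coeff \<alpha> N (G \<psi>) (G \<eta>) n" for N n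
    unfolding eq by (rule cyc_sum_marked)
  show "cmod (mark_coeff \<alpha> N (G \<psi>) (G \<eta>) n) \<le> 3 * (c * Tr) * growth (\<delta> * Tr) * (3/4) ^ n" for N n
    by (rule mark_coeff_bound[OF trace_bound_half[OF b(1) b(1) \<delta>] _ _ c(1) trace_bound_half[OF b(1) e(1) \<delta>] c(2)]) simp_all
  show "cmod (cyc_sum \<alpha> N {..<Suc n} (\<lambda>i. G (\<lambda>x. complex_of_real (cmod (((\<lambda>_. \<psi>)(n := \<eta>)) i x)))) / fact n)
      \<le> 3 * (c * Tr) * growth (\<delta> * Tr) * (3/4) ^ n" for N n
    unfolding eq' cyc_sum_marked
    by (rule mark_coeff_bound[OF trace_bound_half[OF b(2) b(2) \<delta>] _ _ c(1) trace_bound_half[OF b(2) e(2) \<delta>] c(2)]) simp_all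
  show "bms (max \<delta> c) (((\<lambda>_. \<psi>)(n := \<eta>)) i)" for n i :: nat
    using \<psi> \<eta> by (auto simp: bms_def bm_def le_max_iff_disj)
  show "(\<lambda>n. tsum ((\<lambda>_. \<psi>)(n := \<eta>)) (Suc n) A / fact n) sums (\<Sum>a\<in>A. \<eta> a * (\<Prod>b\<in>A - {a}. 1 + \<psi> b))" if "finite A" for A
    by (rule tsum_marked_sums[OF that])
qed

context
  fixes \<phi> :: "'a \<Rightarrow> real" and b :: real
  assumes \<phi>: "\<phi> \<in> borel_measurable borel" "\<And>x. \<bar>\<phi> x\<bar> \<le> b" "\<And>x. x \<notin> S \<Longrightarrow> \<phi> x = 0" and b: "0 \<le> b"
begin

abbreviation c\<phi> :: "'a \<Rightarrow> complex" where "c\<phi> \<equiv> \<lambda>x. complex_of_real (\<phi> x)"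

definition Lam :: "'w \<Rightarrow> real" where "Lam \<omega> = (\<Sum>a\<in>X \<omega> \<inter> S. \<phi> a)"

lemma \<phi>_meas: "\<phi> \<in> borel_measurable \<mu>"
  using \<phi>(1) measurable_cong_sets[OF sets_mu refl] by auto

lemmas \<phi>b = \<phi>_meas \<phi>(2) b

lemma bms_\<phi>: "bms b c\<phi>"
  using bm_cphi[OF \<phi>b] \<phi>(3) by (simp add: bms_def)

lemma Lam_meas: "Lam \<in> borel_measurable M"
  unfolding Lam_def[abs_def] by (rule point_sum_measurable_real[OF pp S \<phi>(1)])

lemma mean_tendsto:
  "integrable M Lam" "(\<lambda>N. mtr N (G c\<phi>)) \<longlonglongrightarrow> complex_of_real (LINT \<omega>|M. Lam \<omega>)"
proof -
  have t: "tsum (\<lambda>_. c\<phi>) 1 (X \<omega> \<inter> S) = complex_of_real (Lam \<omega>)" if "\<omega> \<in> space M" for \<omega>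
    using tsum_Suc_first[OF fin[OF that], of "\<lambda>_. c\<phi>" 0] by (simp add: tsum_0 Lam_def)
  have "integrable M (\<lambda>\<omega>. tsum (\<lambda>_. c\<phi>) 1 (X \<omega> \<inter> S))"
    using expectation_tsum[of 1 b "\<lambda>_. c\<phi>"] bms_\<phi> b by simp
  then have "integrable M (\<lambda>\<omega>. complex_of_real (Lam \<omega>))"
    by (rule iffD1[OF Bochner_Integration.integrable_cong[OF refl], rotated]) (rule t)
  then show "integrable M Lam" by (simp add: complex_of_real_integrable_eq)
  have "cyc_sum \<alpha> N {..<1} (\<lambda>_. G c\<phi>) = mtr N (G c\<phi>)" for N
    using cyc_coeff_Suc[of 0 \<alpha> N "G c\<phi>"] by (simp add: mark_coeff_def cyc_coeff_0) (simp add: cyc_coeff_def)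
  then have "(\<lambda>N. mtr N (G c\<phi>)) \<longlonglongrightarrow> (LINT \<omega>|M. tsum (\<lambda>_. c\<phi>) 1 (X \<omega> \<inter> S))"
    using expectation_tsum_tendsto[of 1 b "\<lambda>_. c\<phi>"] bms_\<phi> b by simp
  also have "(LINT \<omega>|M. tsum (\<lambda>_. c\<phi>) 1 (X \<omega> \<inter> S)) = (LINT \<omega>|M. complex_of_real (Lam \<omega>))"
    by (rule Bochner_Integration.integral_cong[OF refl t])
  finally show "(\<lambda>N. mtr N (G c\<phi>)) \<longlonglongrightarrow> complex_of_real (LINT \<omega>|M. Lam \<omega>)" by simp
qed

text \<open>The square of the statistic is a sum over ordered pairs of distinct points plus the sum
  of \<phi>^2. In finite rank the squared mean cancels and the expression of
  \<open>nJ_sq_mtr\<close> remains.\<close>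

lemma variance_tendsto:
  "integrable M (\<lambda>\<omega>. (Lam \<omega>)\<^sup>2)" "(\<lambda>N. (nJ N c\<phi>)\<^sup>2) \<longlonglongrightarrow> P.variance Lam"
proof -
  define \<phi>2 where "\<phi>2 x = c\<phi> x * c\<phi> x" for x
  have b2: "bms (b * b) \<phi>2"
    using bm_mult[OF bm_cphi[OF \<phi>b] bm_cphi[OF \<phi>b]] \<phi>(3) by (simp add: bms_def \<phi>2_def[abs_def])
  have t1: "tsum (\<lambda>_. \<phi>2) 1 (X \<omega> \<inter> S) = (\<Sum>a\<in>X \<omega> \<inter> S. \<phi>2 a)" if "\<omega> \<in> space M" for \<omega>
    using tsum_Suc_first[OF fin[OF that], of "\<lambda>_. \<phi>2" 0] by (simp add: tsum_0)
  have t2: "tsum (\<lambda>_. c\<phi>) 2 (X \<omega> \<inter> S) + tsum (\<lambda>_. \<phi>2) 1 (X \<omega> \<inter> S) = complex_of_real ((Lam \<omega>)\<^sup>2)" if "\<omega> \<in> space M" for \<omega>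
  proof -
    let ?A = "X \<omega> \<inter> S"
    have A: "finite ?A" by (rule fin[OF that])
    have "tsum (\<lambda>_. c\<phi>) 1 ?A = complex_of_real (Lam \<omega>)"
      using tsum_Suc_first[OF A, of "\<lambda>_. c\<phi>" 0] by (simp add: tsum_0 Lam_def)
    moreover have "tsum ((\<lambda>_. c\<phi>)(0 := \<phi>2)) 1 ?A = tsum (\<lambda>_. \<phi>2) 1 ?A" by (rule tsum_cong) simp
    moreover have "tsum (\<lambda>_. c\<phi>) (Suc 1) ?A = tsum (\<lambda>_. c\<phi>) 1 ?A * (\<Sum>a\<in>?A. c\<phi> a) - tsum ((\<lambda>_. c\<phi>)(0 := \<phi>2)) 1 ?A"
      using tsum_Suc_last[OF A, of "\<lambda>_. c\<phi>" 1] by (simp add: \<phi>2_def[abs_def])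
    moreover have "Suc 1 = 2" by simp
    ultimately show ?thesis unfolding power2_eq_square by (simp add: Lam_def numeral_2_eq_2)
  qed
  have i: "integrable M (\<lambda>\<omega>. tsum (\<lambda>_. c\<phi>) 2 (X \<omega> \<inter> S))" "integrable M (\<lambda>\<omega>. tsum (\<lambda>_. \<phi>2) 1 (X \<omega> \<inter> S))"
    using expectation_tsum[of 2 b "\<lambda>_. c\<phi>"] expectation_tsum[of 1 "b * b" "\<lambda>_. \<phi>2"] bms_\<phi> b b2 by simp_all
  have "integrable M (\<lambda>\<omega>. complex_of_real ((Lam \<omega>)\<^sup>2))"
    by (rule iffD1[OF Bochner_Integration.integrable_cong[OF refl] Bochner_Integration.integrable_add[OF i]]) (rule t2)
  then show i2: "integrable M (\<lambda>\<omega>. (Lam \<omega>)\<^sup>2)" unfolding complex_of_real_integrable_eq .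
  have e2: "complex_of_real (LINT \<omega>|M. (Lam \<omega>)\<^sup>2) = (LINT \<omega>|M. tsum (\<lambda>_. c\<phi>) 2 (X \<omega> \<inter> S)) + (LINT \<omega>|M. tsum (\<lambda>_. \<phi>2) 1 (X \<omega> \<inter> S))"
  proof -
    have "complex_of_real (LINT \<omega>|M. (Lam \<omega>)\<^sup>2) = (LINT \<omega>|M. complex_of_real ((Lam \<omega>)\<^sup>2))" by (rule integral_complex_of_real[symmetric])
    also have "\<dots> = (LINT \<omega>|M. tsum (\<lambda>_. c\<phi>) 2 (X \<omega> \<inter> S) + tsum (\<lambda>_. \<phi>2) 1 (X \<omega> \<inter> S))"
      by (rule Bochner_Integration.integral_cong[OF refl t2[symmetric]])
    finally show ?thesis using i by simp
  qed
  have c1: "cyc_sum \<alpha> N {..<1} (\<lambda>_. G h) = mtr N (G h)" for N h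
    using cyc_coeff_Suc[of 0 \<alpha> N "G h"] by (simp add: mark_coeff_def cyc_coeff_0) (simp add: cyc_coeff_def)
  have c2: "cyc_sum \<alpha> N {..<2} (\<lambda>_. G c\<phi>) = (mtr N (G c\<phi>))\<^sup>2 + \<alpha> * mtr N (mm N (G c\<phi>) (G c\<phi>))" for N
  proof -
    have 1: "cyc_coeff \<alpha> N (G c\<phi>) 1 = mtr N (G c\<phi>)" using c1[of N c\<phi>] by (simp add: cyc_coeff_def)
    have "of_nat 2 * cyc_coeff \<alpha> N (G c\<phi>) 2 = mark_coeff \<alpha> N (G c\<phi>) (G c\<phi>) 1"
      using cyc_coeff_Suc[of 1 \<alpha> N "G c\<phi>"] by (simp add: numeral_2_eq_2)
    then show ?thesis using 1 unfolding mark_coeff_def cyc_coeff_0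
      by (simp add: cyc_coeff_0 power2_eq_square) (simp add: cyc_coeff_def)
  qed
  have "(\<lambda>N. cyc_sum \<alpha> N {..<1} (\<lambda>_. G \<phi>2) + cyc_sum \<alpha> N {..<2} (\<lambda>_. G c\<phi>) - (mtr N (G c\<phi>))\<^sup>2)
     \<longlonglongrightarrow> (LINT \<omega>|M. tsum (\<lambda>_. \<phi>2) 1 (X \<omega> \<inter> S)) + (LINT \<omega>|M. tsum (\<lambda>_. c\<phi>) 2 (X \<omega> \<inter> S)) - (complex_of_real (LINT \<omega>|M. Lam \<omega>))\<^sup>2"
    by (intro tendsto_add tendsto_diff tendsto_power mean_tendsto expectation_tsum_tendsto[where c="b*b"] expectation_tsum_tendsto[where c="b"] b2 bms_\<phi>)
       (use b in auto)
  also have "(\<lambda>N. cyc_sum \<alpha> N {..<1} (\<lambda>_. G \<phi>2) + cyc_sum \<alpha> N {..<2} (\<lambda>_. G c\<phi>) - (mtr N (G c\<phi>))\<^sup>2) = (\<lambda>N. complex_of_real ((nJ N c\<phi>)\<^sup>2))"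
    unfolding c1 c2 nJ_sq_mtr[OF \<phi>b] by (simp add: \<phi>2_def[abs_def])
  also have "(LINT \<omega>|M. tsum (\<lambda>_. \<phi>2) 1 (X \<omega> \<inter> S)) + (LINT \<omega>|M. tsum (\<lambda>_. c\<phi>) 2 (X \<omega> \<inter> S)) - (complex_of_real (LINT \<omega>|M. Lam \<omega>))\<^sup>2
      = complex_of_real (P.variance Lam)"
    unfolding P.variance_eq[OF mean_tendsto(1) i2] using e2 by simp
  finally show "(\<lambda>N. (nJ N c\<phi>)\<^sup>2) \<longlonglongrightarrow> P.variance Lam" unfolding tendsto_of_real_iff .
qed

text \<open>In finite rank the expectation weighted by the statistic is the trace series times the
  plain one, so \<open>log_deriv_bound\<close> becomes an inequality linear in the characteristic
  function. Without a quotient it passes to the limit even where that function vanishes.\<close>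

lemma char_fun_bound:
  assumes y: "\<bar>y\<bar> * (C0 * b) \<le> 1/2"
  shows "cmod ((LINT \<omega>|M. Lam \<omega> * iexp (y * Lam \<omega>)) - (P.expectation Lam + \<i> * y * P.variance Lam) * (LINT \<omega>|M. iexp (y * Lam \<omega>)))
     \<le> 8 * C0 * b * y\<^sup>2 * P.variance Lam * cmod (LINT \<omega>|M. iexp (y * Lam \<omega>))"
proof -
  let ?\<psi> = "psi \<phi> y" and ?\<eta> = "\<lambda>x. c\<phi> x * (1 + psi \<phi> y x)"
  have \<psi>: "bms (\<bar>y\<bar> * b) ?\<psi>"
    using bm_psi[OF \<phi>b, of y] \<phi>(3) by (simp add: bms_def psi_def[OF \<phi>b])
  have \<eta>: "bms b ?\<eta>"
    using bm_psi[OF \<phi>b, of y] \<phi>_meas \<phi>(2,3) b by (auto simp: bms_def bm_def psi_def[OF \<phi>b] norm_mult)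
  have \<delta>: "\<bar>\<alpha>\<bar> * \<kappa> * (\<bar>y\<bar> * b) \<le> 1/2"
  proof -
    have "(\<bar>\<alpha>\<bar> * \<kappa>) * (\<bar>y\<bar> * b) \<le> C0 * (\<bar>y\<bar> * b)" by (intro mult_right_mono C0) (use b in simp)
    also have "\<dots> \<le> 1/2" using y by (simp add: mult_ac)
    finally show ?thesis by simp
  qed
  have p: "(\<Prod>a\<in>A. 1 + ?\<psi> a) = iexp (y * (\<Sum>a\<in>A. \<phi> a))" if "finite A" for A
    using that by (simp add: psi_def[OF \<phi>b] exp_sum sum_distrib_left)
  have m: "(\<Sum>a\<in>A. ?\<eta> a * (\<Prod>b\<in>A - {a}. 1 + ?\<psi> b)) = (\<Sum>a\<in>A. \<phi> a) * iexp (y * (\<Sum>a\<in>A. \<phi> a))" if A: "finite A" for A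
  proof -
    have "?\<eta> a * (\<Prod>b\<in>A - {a}. 1 + ?\<psi> b) = \<phi> a * (\<Prod>b\<in>A. 1 + ?\<psi> b)" if "a \<in> A" for a
      using prod.remove[OF A that, of "\<lambda>b. 1 + ?\<psi> b"] by (simp add: mult.assoc)
    then have "(\<Sum>a\<in>A. ?\<eta> a * (\<Prod>b\<in>A - {a}. 1 + ?\<psi> b)) = (\<Sum>a\<in>A. \<phi> a * (\<Prod>b\<in>A. 1 + ?\<psi> b))"
      by (rule sum.cong[OF refl])
    then show ?thesis unfolding p[OF A] by (simp add: sum_distrib_right)
  qed
  define S1 where "S1 N = (\<Sum>n. mark_coeff \<alpha> N (G ?\<psi>) (G ?\<eta>) n)" for N
  define S0 where "S0 N = (\<Sum>n. cyc_coeff \<alpha> N (G ?\<psi>) n)" for N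
  have l0: "S0 \<longlonglongrightarrow> (LINT \<omega>|M. iexp (y * Lam \<omega>))"
  proof -
    have "(LINT \<omega>|M. iexp (y * Lam \<omega>)) = (LINT \<omega>|M. (\<Prod>a\<in>X \<omega> \<inter> S. 1 + ?\<psi> a))"
      by (rule Bochner_Integration.integral_cong[OF refl]) (simp only: p[OF fin] Lam_def)
    then show ?thesis using expectation_prod[OF \<psi> \<delta>] unfolding S0_def[abs_def] by simp
  qed
  have l1: "S1 \<longlonglongrightarrow> (LINT \<omega>|M. Lam \<omega> * iexp (y * Lam \<omega>))"
  proof -
    have "(LINT \<omega>|M. Lam \<omega> * iexp (y * Lam \<omega>)) = (LINT \<omega>|M. (\<Sum>a\<in>X \<omega> \<inter> S. ?\<eta> a * (\<Prod>b\<in>X \<omega> \<inter> S - {a}. 1 + ?\<psi> b)))"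
      by (rule Bochner_Integration.integral_cong[OF refl]) (simp only: m[OF fin] Lam_def)
    then show ?thesis using expectation_marked_prod[OF \<psi> \<eta> \<delta>] unfolding S1_def[abs_def] by simp
  qed
  have b1: "bm (\<bar>y\<bar> * b) ?\<psi>" "bm b ?\<eta>" using \<psi> \<eta> by (simp_all add: bms_def)
  have le: "cmod (S1 N - (mtr N (G c\<phi>) + \<i> * y * (nJ N c\<phi>)\<^sup>2) * S0 N) \<le> 8 * C0 * b * y\<^sup>2 * (nJ N c\<phi>)\<^sup>2 * cmod (S0 N)" for N
  proof -
    let ?t = "\<Sum>k. complex_of_real \<alpha> ^ k * mtr N (mpow N (G ?\<psi>) k (G ?\<eta>))"
    have "0 \<le> \<bar>y\<bar> * b * Tr" using b Tr_nonneg by simp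
    from mark_coeff_suminf[OF trace_bound_half[OF b1(1) b1(1) \<delta>] _ _ this trace_bound_half[OF b1 \<delta>]]
    have "S1 N = ?t * S0 N" unfolding S1_def S0_def by (simp add: sums_iff)
    then have "cmod (S1 N - (mtr N (G c\<phi>) + \<i> * y * (nJ N c\<phi>)\<^sup>2) * S0 N)
       = cmod (?t - mtr N (G c\<phi>) - \<i> * y * (nJ N c\<phi>)\<^sup>2) * cmod (S0 N)"
      by (simp add: norm_mult[symmetric] algebra_simps)
    also have "\<dots> \<le> 8 * C0 * b * y\<^sup>2 * (nJ N c\<phi>)\<^sup>2 * cmod (S0 N)"
      by (intro mult_right_mono log_deriv_bound[OF \<phi>b y]) simp
    finally show ?thesis .
  qed
  have v: "(\<lambda>N. complex_of_real ((nJ N c\<phi>)\<^sup>2)) \<longlonglongrightarrow> complex_of_real (P.variance Lam)"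
    by (intro tendsto_of_real variance_tendsto)
  show ?thesis
  proof (rule LIMSEQ_le)
    show "(\<lambda>N. cmod (S1 N - (mtr N (G c\<phi>) + \<i> * y * (nJ N c\<phi>)\<^sup>2) * S0 N)) \<longlonglongrightarrow>
       cmod ((LINT \<omega>|M. Lam \<omega> * iexp (y * Lam \<omega>)) - (P.expectation Lam + \<i> * y * P.variance Lam) * (LINT \<omega>|M. iexp (y * Lam \<omega>)))"
      by (intro tendsto_norm tendsto_diff tendsto_mult tendsto_add tendsto_const l0 l1 mean_tendsto v)
    show "(\<lambda>N. 8 * C0 * b * y\<^sup>2 * (nJ N c\<phi>)\<^sup>2 * cmod (S0 N)) \<longlonglongrightarrow>
       8 * C0 * b * y\<^sup>2 * P.variance Lam * cmod (LINT \<omega>|M. iexp (y * Lam \<omega>))"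
      by (intro tendsto_norm tendsto_mult tendsto_const l0 variance_tendsto)
  qed (use le in blast)
qed

end

end

section \<open>A smoothing inequality\<close>

lemma bounded_Fubini:
  fixes f :: "'a \<times> 'b \<Rightarrow> 'c::{banach, second_countable_topology}"
  assumes A: "finite_measure A" and B: "finite_measure B" and f: "f \<in> borel_measurable (A \<Otimes>\<^sub>M B)" and le: "\<And>x y. x \<in> space A \<Longrightarrow> y \<in> space B \<Longrightarrow> norm (f (x, y)) \<le> c"
  shows "(LINT x|A. (LINT y|B. f (x, y))) = (LINT y|B. (LINT x|A. f (x, y)))"
proof -
  interpret A: finite_measure A by fact
  interpret B: finite_measure B by fact
  interpret P: pair_sigma_finite A B ..
  interpret AB: finite_measure "A \<Otimes>\<^sub>M B" by (rule finite_measure_pair_measure[OF B A])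
  have "integrable (A \<Otimes>\<^sub>M B) f"
    by (rule AB.integrable_const_bound[where B=c]) (use f le in \<open>auto simp: space_pair_measure\<close>)
  then show ?thesis
    using P.Fubini_integral[of "\<lambda>x y. f (x, y)"] by simp
qed

lemma finite_measure_restrict_Icc: "finite_measure (restrict_space lborel {a..b::real})"
  by (rule finite_measureI) (simp add: emeasure_restrict_space emeasure_lborel_Icc_eq)

abbreviation lborel01 :: "real measure" where "lborel01 \<equiv> restrict_space lborel {0..1}"

lemma measurable_restrict_lborel: "f \<in> borel_measurable borel \<Longrightarrow> f \<in> borel_measurable (restrict_space lborel A)"
  by (intro measurable_restrict_space1) simp

text \<open>The Fourier transform of the triangle function on [-1, 1], equal to the square of
  sin(z/2) / (z/2): non-negative, integrable and band-limited.\<close>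

definition fejer :: "real \<Rightarrow> real" where
  "fejer z = 2 * (LINT t|lborel01. (1 - t) * cos (t * z))"

lemma integral_restrict_FTC:
  fixes f F :: "real \<Rightarrow> 'a::euclidean_space"
  assumes "a \<le> b" "\<And>x. (F has_vector_derivative f x) (at x)" "continuous_on UNIV f"
  shows "(LINT x|restrict_space lborel {a..b}. f x) = F b - F a"
proof -
  have "(LINT x|restrict_space lborel {a..b}. f x) = (LINT x|lborel. indicator {a..b} x *\<^sub>R f x)"
    by (rule integral_restrict_space) simp
  also have "\<dots> = F b - F a"
    by (rule integral_FTC_atLeastAtMost) (use assms in \<open>auto intro: has_vector_derivative_at_within continuous_on_subset\<close>)
  finally show ?thesis .
qed

lemma fejer_eq: "z \<noteq> 0 \<Longrightarrow> fejer z = 2 * (1 - cos z) / z\<^sup>2"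
proof -
  assume z: "z \<noteq> 0"
  have "(LINT t|lborel01. (1 - t) * cos (t * z)) = ((1 - 1) * sin (1 * z) / z - cos (1 * z) / z\<^sup>2) - ((1 - 0) * sin (0 * z) / z - cos (0 * z) / z\<^sup>2)"
  proof (rule integral_restrict_FTC[where F="\<lambda>t. (1 - t) * sin (t * z) / z - cos (t * z) / z\<^sup>2"])
    fix t :: real
    show "((\<lambda>t. (1 - t) * sin (t * z) / z - cos (t * z) / z\<^sup>2) has_vector_derivative (1 - t) * cos (t * z)) (at t)"
      unfolding has_real_derivative_iff_has_vector_derivative[symmetric]
      by (rule derivative_eq_intros refl | use z in \<open>simp add: field_simps power2_eq_square\<close>)+
  qed (auto intro!: continuous_intros)
  then show ?thesis using z by (simp add: fejer_def field_simps)
qed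

lemma fejer_0: "fejer 0 = 1"
proof -
  have "(LINT t|lborel01. (1 - t)) = (1 - 1\<^sup>2 / 2) - (0 - 0\<^sup>2 / 2)"
  proof (rule integral_restrict_FTC[where F="\<lambda>t. t - t\<^sup>2 / 2"])
    fix t :: real
    show "((\<lambda>t. t - t\<^sup>2 / 2) has_vector_derivative (1 - t)) (at t)"
      unfolding has_real_derivative_iff_has_vector_derivative[symmetric]
      by (auto intro!: derivative_eq_intros)
  qed (auto intro!: continuous_intros)
  then show ?thesis by (simp add: fejer_def)
qed

lemma fejer_if: "fejer = (\<lambda>z. if z = 0 then 1 else 2 * (1 - cos z) / z\<^sup>2)"
  by (auto simp: fejer_eq fejer_0)

lemma fejer_meas [measurable]: "fejer \<in> borel_measurable borel"
  unfolding fejer_if by measurable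

lemma fejer_nonneg: "0 \<le> fejer z"
  by (simp add: fejer_if)

lemma fejer_le_1: "fejer z \<le> 1"
proof (cases "z = 0")
  case False
  have "1 - cos z \<le> z\<^sup>2 / 2"
  proof -
    have "(sin (z/2))\<^sup>2 \<le> (z/2)\<^sup>2"
      using abs_sin_x_le_abs_x[of "z/2"] by (simp only: abs_le_square_iff)
    then show ?thesis using cos_double_sin[of "z/2"] by (simp add: power_divide)
  qed
  then show ?thesis using False by (simp add: fejer_eq field_simps)
qed (simp add: fejer_0)

lemma fejer_le: "fejer z \<le> 8 * inverse (1 + z\<^sup>2)"
proof (cases "\<bar>z\<bar> \<le> 1")
  case True
  then have "z\<^sup>2 \<le> 1" by (simp add: abs_square_le_1)
  moreover have "0 < 1 + z\<^sup>2" by (simp add: add_pos_nonneg)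
  ultimately have "1 \<le> 8 * inverse (1 + z\<^sup>2)" by (simp add: field_simps)
  then show ?thesis using fejer_le_1[of z] by simp
next
  case False
  then have z: "z \<noteq> 0" "1 \<le> z\<^sup>2" by (auto simp: abs_square_le_1 not_le dest: abs_square_less_1[THEN iffD2]) (metis False abs_square_le_1 linear)
  have "fejer z \<le> 4 / z\<^sup>2" unfolding fejer_eq[OF z(1)]
    by (intro divide_right_mono) (use cos_ge_minus_one[of z] in \<open>auto simp del: cos_ge_minus_one\<close>)
  also have "\<dots> \<le> 8 * inverse (1 + z\<^sup>2)" using z by (simp add: field_simps)
  finally show ?thesis .
qed

lemma integrable_fejer: "integrable lborel fejer"
proof (rule Bochner_Integration.integrable_bound)
  show "integrable lborel (\<lambda>z::real. 8 * inverse (1 + z\<^sup>2))"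
    using integrable_inverse_1_plus_square by (simp add: set_integrable_def einterval_def)
qed (use fejer_nonneg fejer_le in auto)

definition fejer_mass :: real where "fejer_mass = (LINT z|lborel. fejer z)"

lemma fejer_mass_pos: "0 < fejer_mass"
proof -
  have "fejer_mass \<noteq> 0"
  proof
    assume "fejer_mass = 0"
    then have "AE z in lborel. fejer z = 0"
      unfolding fejer_mass_def by (subst (asm) integral_nonneg_eq_0_iff_AE) (auto simp: integrable_fejer fejer_nonneg)
    then have "AE z::real in lborel. z \<notin> {1..2}"
    proof eventually_elim
      case (elim z)
      show ?case
      proof
        assume z: "z \<in> {1..2}"
        then have "cos z < cos 0" using pi_gt3 by (intro cos_monotone_0_pi) auto
        then show False using elim z by (simp add: fejer_eq)
      qed
    qed
    then have "emeasure lborel {1..2::real} = 0"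
      by (subst (asm) AE_iff_measurable[of "{1..2}"]) auto
    then show False by simp
  qed
  moreover have "0 \<le> fejer_mass" by (simp add: fejer_mass_def fejer_nonneg)
  ultimately show ?thesis by simp
qed

text \<open>A radius that leaves at most a quarter of the mass outside; it enters the constant of
  the smoothing inequality.\<close>

lemma fejer_tail: "\<exists>h>0. (LINT z|lborel. indicator (- {-h..h}) z * fejer z) \<le> fejer_mass / 4"
proof -
  have "(\<lambda>n. LINT z|lborel. indicator (- {-real n..real n}) z * fejer z) \<longlonglongrightarrow> (LINT z::real|lborel. (0::real))"
  proof (rule integral_dominated_convergence[where w=fejer])
    show "AE z in lborel. (\<lambda>n. indicator (- {-real n..real n}) z * fejer z) \<longlonglongrightarrow> 0"
    proof (rule AE_I2, rule tendsto_eventually)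
      fix z
      obtain m :: nat where "\<bar>z\<bar> \<le> real m" using real_arch_simple by blast
      then show "\<forall>\<^sub>F n in sequentially. indicator (- {-real n..real n}) z * fejer z = 0"
        by (intro eventually_sequentiallyI[of m]) (auto simp: indicator_def)
    qed
  qed (auto simp: integrable_fejer fejer_nonneg split: split_indicator)
  then have "(\<lambda>n. LINT z|lborel. indicator (- {-real n..real n}) z * fejer z) \<longlonglongrightarrow> 0" by simp
  from order_tendstoD(2)[OF this, of "fejer_mass / 4"]
  have "eventually (\<lambda>n. (LINT z|lborel. indicator (- {-real n..real n}) z * fejer z) < fejer_mass / 4) sequentially"
    using fejer_mass_pos by simp
  then have "eventually (\<lambda>n. 0 < n \<and> (LINT z|lborel. indicator (- {-real n..real n}) z * fejer z) < fejer_mass / 4) sequentially"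
    using eventually_gt_at_top[of 0] by eventually_elim simp
  then obtain n where "0 < n" "(LINT z|lborel. indicator (- {-real n..real n}) z * fejer z) < fejer_mass / 4"
    by (auto simp: eventually_sequentially)
  then show ?thesis by (intro exI[of _ "real n"]) simp
qed

text \<open>The value at a maximal deviation is recovered from the smoothed function, since most of the
  mass of the kernel sees a deviation that is almost as large.\<close>

lemma fejer_deconvolution:
  fixes f :: "real \<Rightarrow> real"
  assumes f: "f \<in> borel_measurable borel" "\<And>x. \<bar>f x\<bar> \<le> D" and h: "(LINT z|lborel. indicator (- {-h..h}) z * fejer z) \<le> fejer_mass / 4"
    and \<delta>: "\<And>z. \<bar>z\<bar> \<le> h \<Longrightarrow> \<delta> \<le> f (b - z)" "0 \<le> \<delta>" and le: "(LINT z|lborel. fejer z * f (b - z)) \<le> \<Delta>"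
  shows "3 * fejer_mass * \<delta> \<le> 4 * \<Delta> + fejer_mass * D"
proof -
  let ?i = "\<lambda>z. indicator (- {-h..h}) z :: real"
  have D: "0 \<le> D" using f(2)[of 0] by linarith
  have i1: "integrable lborel (\<lambda>z. ?i z * fejer z)"
    by (rule Bochner_Integration.integrable_bound[OF integrable_fejer]) (auto split: split_indicator)
  \<comment> \<open>Pointwise the integrand is at least \<delta> times the kernel inside the radius
    and at least -D times the kernel outside it.\<close>
  have "\<delta> * fejer_mass - \<delta> * (LINT z|lborel. ?i z * fejer z) - D * (LINT z|lborel. ?i z * fejer z)
     = (LINT z|lborel. \<delta> * fejer z - \<delta> * (?i z * fejer z) - D * (?i z * fejer z))"
    using i1 integrable_fejer by (simp add: fejer_mass_def)
  also have "\<dots> \<le> (LINT z|lborel. fejer z * f (b - z))"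
  proof (rule integral_mono)
    show "integrable lborel (\<lambda>z. \<delta> * fejer z - \<delta> * (?i z * fejer z) - D * (?i z * fejer z))"
      using i1 integrable_fejer by simp
    have [measurable]: "f \<in> borel_measurable borel" by (rule f(1))
    show "integrable lborel (\<lambda>z. fejer z * f (b - z))"
    proof (rule Bochner_Integration.integrable_bound)
      show "integrable lborel (\<lambda>z. fejer z * D)" using integrable_fejer by simp
      show "AE z in lborel. norm (fejer z * f (b - z)) \<le> norm (fejer z * D)"
        using f(2) D by (auto simp: abs_mult intro!: mult_left_mono)
    qed simp
    fix z
    show "\<delta> * fejer z - \<delta> * (?i z * fejer z) - D * (?i z * fejer z) \<le> fejer z * f (b - z)"
    proof (cases "\<bar>z\<bar> \<le> h")
      case True
      then have "?i z = 0" by (auto simp: indicator_def)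
      then show ?thesis using mult_right_mono[OF \<delta>(1)[OF True] fejer_nonneg[of z]] by (simp add: mult.commute)
    next
      case False
      then have "?i z = 1" by (auto simp: indicator_def)
      moreover have "- D \<le> f (b - z)" using f(2)[of "b - z"] by linarith
      ultimately show ?thesis using mult_right_mono[OF \<open>- D \<le> f (b - z)\<close> fejer_nonneg[of z]] by (simp add: mult.commute)
    qed
  qed
  also have "\<dots> \<le> \<Delta>" by (rule le)
  finally have "\<delta> * fejer_mass \<le> \<Delta> + (\<delta> + D) * (LINT z|lborel. ?i z * fejer z)" by (simp add: algebra_simps)
  also have "\<dots> \<le> \<Delta> + (\<delta> + D) * (fejer_mass / 4)" using \<delta>(2) D h by (intro add_left_mono mult_left_mono) auto
  finally have "4 * (\<delta> * fejer_mass) \<le> 4 * \<Delta> + (\<delta> + D) * fejer_mass" by linarith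
  then show ?thesis by (simp add: algebra_simps)
qed

text \<open>Up to the factor \<open>fejer_mass\<close>, the density of the convolution of
  \<open>N\<close> with the normalised kernel.\<close>

definition fejer_density :: "real measure \<Rightarrow> real \<Rightarrow> real" where
  "fejer_density N u = (LINT y|N. fejer (u - y))"

context real_distribution
begin

lemma fejer_density_meas: "fejer_density M \<in> borel_measurable borel"
  unfolding fejer_density_def[abs_def] by (rule borel_measurable_lebesgue_integral) measurable

lemma integrable_fejer_shift: "integrable M (\<lambda>y. fejer (u - y))"
  by (rule integrable_const_bound[where B=1]) (auto simp: fejer_nonneg fejer_le_1)

lemma fejer_density_nonneg: "0 \<le> fejer_density M u"
  by (simp add: fejer_density_def fejer_nonneg)

lemma cdf_meas: "cdf M \<in> borel_measurable borel"
  by (rule borel_measurable_mono) (simp add: monoI cdf_nondecreasing)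

lemma integrable_fejer_cdf: "integrable lborel (\<lambda>z. fejer z * cdf M (b - z))"
proof (rule Bochner_Integration.integrable_bound[OF integrable_fejer])
  show "AE z in lborel. norm (fejer z * cdf M (b - z)) \<le> norm (fejer z)"
    using cdf_bounded_prob cdf_nonneg by (auto simp: abs_mult fejer_nonneg intro!: mult_left_le)
  show "(\<lambda>z. fejer z * cdf M (b - z)) \<in> borel_measurable lborel"
    using measurable_compose[OF _ cdf_meas, of "\<lambda>z. b - z" lborel] by simp
qed

text \<open>Tonelli's theorem twice: integrating the smoothed density up to \<open>b\<close> is the
  same as smoothing the distribution function at \<open>b\<close>.\<close>

lemma fejer_density_cdf:
  "has_bochner_integral lborel (\<lambda>u. indicator {..b} u * fejer_density M u) (LINT z|lborel. fejer z * cdf M (b - z))"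
proof (rule has_bochner_integral_nn_integral)
  interpret P: pair_sigma_finite lborel M ..
  note [measurable] = fejer_density_meas
  show "(\<lambda>u. indicator {..b} u * fejer_density M u) \<in> borel_measurable lborel" by measurable
  show "AE u in lborel. 0 \<le> indicator {..b} u * fejer_density M u" by (simp add: fejer_density_nonneg)
  show "0 \<le> (LINT z|lborel. fejer z * cdf M (b - z))"
    by (intro integral_nonneg_AE) (auto simp: fejer_nonneg cdf_nonneg)
  have "(\<integral>\<^sup>+u. ennreal (indicator {..b} u * fejer_density M u) \<partial>lborel)
      = (\<integral>\<^sup>+u. (\<integral>\<^sup>+y. indicator {..b} u * ennreal (fejer (u - y)) \<partial>M) \<partial>lborel)"
  proof (rule nn_integral_cong)
    fix u
    have "ennreal (fejer_density M u) = (\<integral>\<^sup>+y. ennreal (fejer (u - y)) \<partial>M)"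
      unfolding fejer_density_def by (rule nn_integral_eq_integral[symmetric, OF integrable_fejer_shift]) (simp add: fejer_nonneg)
    then show "ennreal (indicator {..b} u * fejer_density M u) = (\<integral>\<^sup>+y. indicator {..b} u * ennreal (fejer (u - y)) \<partial>M)"
      by (simp add: nn_integral_cmult split: split_indicator)
  qed
  also have "\<dots> = (\<integral>\<^sup>+y. (\<integral>\<^sup>+u. indicator {..b} u * ennreal (fejer (u - y)) \<partial>lborel) \<partial>M)"
    by (rule P.Fubini'[symmetric]) measurable
  also have "\<dots> = (\<integral>\<^sup>+y. (\<integral>\<^sup>+z. indicator {..b} (y + z) * ennreal (fejer z) \<partial>lborel) \<partial>M)"
  proof (rule nn_integral_cong)
    fix y
    show "(\<integral>\<^sup>+u. indicator {..b} u * ennreal (fejer (u - y)) \<partial>lborel) = (\<integral>\<^sup>+z. indicator {..b} (y + z) * ennreal (fejer z) \<partial>lborel)"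
      using nn_integral_real_affine[of "\<lambda>u. indicator {..b} u * ennreal (fejer (u - y))" 1 y] by simp
  qed
  also have "\<dots> = (\<integral>\<^sup>+z. (\<integral>\<^sup>+y. indicator {..b} (y + z) * ennreal (fejer z) \<partial>M) \<partial>lborel)"
    by (rule P.Fubini') measurable
  also have "\<dots> = (\<integral>\<^sup>+z. ennreal (fejer z * cdf M (b - z)) \<partial>lborel)"
  proof (rule nn_integral_cong)
    fix z
    have "(\<integral>\<^sup>+y. indicator {..b} (y + z) * ennreal (fejer z) \<partial>M) = (\<integral>\<^sup>+y. ennreal (fejer z) * indicator {..b - z} y \<partial>M)"
      by (intro nn_integral_cong) (auto split: split_indicator)
    also have "\<dots> = ennreal (fejer z) * emeasure M {..b - z}"
      by (rule nn_integral_cmult_indicator) simp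
    finally show "(\<integral>\<^sup>+y. indicator {..b} (y + z) * ennreal (fejer z) \<partial>M) = ennreal (fejer z * cdf M (b - z))"
      by (simp add: cdf_def emeasure_eq_measure ennreal_mult fejer_nonneg)
  qed
  also have "\<dots> = ennreal (LINT z|lborel. fejer z * cdf M (b - z))"
    by (rule nn_integral_eq_integral[OF integrable_fejer_cdf]) (auto simp: fejer_nonneg cdf_nonneg)
  finally show "(\<integral>\<^sup>+u. ennreal (indicator {..b} u * fejer_density M u) \<partial>lborel) = ennreal (LINT z|lborel. fejer z * cdf M (b - z))" .
qed

text \<open>Fourier inversion with the triangle as weight; only frequencies up to 1 enter.\<close>

lemma fejer_density_char:
  "fejer_density M u = 2 * (LINT t|lborel01. (1 - t) * Re (iexp (- (t * u)) * char M t))"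
proof -
  have "fejer_density M u = 2 * (LINT y|M. (LINT t|lborel01. (1 - t) * cos (t * (u - y))))"
    by (simp add: fejer_density_def fejer_def)
  also have "(LINT y|M. (LINT t|lborel01. (1 - t) * cos (t * (u - y)))) = (LINT t|lborel01. (LINT y|M. (1 - t) * cos (t * (u - y))))"
  proof (rule bounded_Fubini[of M lborel01 "\<lambda>(y, t). (1 - t) * cos (t * (u - y))" 1, unfolded prod.case])
    show "finite_measure M" by (rule finite_measure_axioms)
    show "finite_measure lborel01" by (rule finite_measure_restrict_Icc)
    have 1: "(\<lambda>(y, t). (1 - t) * cos (t * (u - y))) \<in> borel_measurable (borel \<Otimes>\<^sub>M borel)"
      by measurable
    have 2: "(\<lambda>z. (fst z, snd z)) \<in> M \<Otimes>\<^sub>M lborel01 \<rightarrow>\<^sub>M borel \<Otimes>\<^sub>M borel"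
      by (intro measurable_Pair measurable_compose[OF measurable_snd measurable_restrict_lborel]) simp_all
    show "(\<lambda>(y, t). (1 - t) * cos (t * (u - y))) \<in> borel_measurable (M \<Otimes>\<^sub>M lborel01)"
      using measurable_compose[OF 2 1] by (simp add: case_prod_unfold)
    show "\<And>x y. y \<in> space lborel01 \<Longrightarrow> norm ((1 - y) * cos (y * (u - x))) \<le> 1"
      by (auto simp: space_restrict_space abs_mult intro!: mult_le_one)
  qed
  also have "\<dots> = (LINT t|lborel01. (1 - t) * Re (iexp (- (t * u)) * char M t))"
  proof (rule Bochner_Integration.integral_cong[OF refl])
    fix t
    have i: "integrable M (\<lambda>y. iexp (t * y))" by (rule integrable_iexp) auto
    have "Re (iexp (- (t * u)) * char M t) = Re (LINT y|M. iexp (- (t * u)) * iexp (t * y))"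
      unfolding char_def by simp
    also have "\<dots> = (LINT y|M. Re (iexp (- (t * u)) * iexp (t * y)))"
      by (rule integral_Re[symmetric]) (use i in simp)
    also have "\<dots> = (LINT y|M. cos (t * (u - y)))"
    proof (rule Bochner_Integration.integral_cong[OF refl])
      fix y
      have "iexp (- (t * u)) * iexp (t * y) = iexp (- (t * (u - y)))"
        by (simp add: exp_add[symmetric] algebra_simps)
      then show "Re (iexp (- (t * u)) * iexp (t * y)) = cos (t * (u - y))"
        by (simp only: Re_exp) (simp add: exp_of_real)
    qed
    finally show "(LINT y|M. (1 - t) * cos (t * (u - y))) = (1 - t) * Re (iexp (- (t * u)) * char M t)" by simp
  qed
  finally show ?thesis .
qed

end

text \<open>The bound is uniform in the interval, which permits a lower end tending to minus
  infinity. The singularity 1/t is met by the factor t in the hypothesis on the characteristic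
  functions.\<close>

lemma integral_iexp_bound:
  assumes ab: "a \<le> b" and t: "0 < t"
  shows "cmod (LINT u|restrict_space lborel {a..b}. iexp (- (t * u))) \<le> 2 / t"
proof -
  let ?c = "- (\<i> * complex_of_real t)"
  have "(LINT u|restrict_space lborel {a..b}. exp (?c * complex_of_real u)) = exp (?c * complex_of_real b) / ?c - exp (?c * complex_of_real a) / ?c"
  proof (rule integral_restrict_FTC[OF ab, where F="\<lambda>u. exp (?c * complex_of_real u) / ?c"])
    fix u :: real
    show "((\<lambda>u. exp (?c * complex_of_real u) / ?c) has_vector_derivative exp (?c * complex_of_real u)) (at u)"
    proof (rule has_vector_derivative_real_field)
      show "((\<lambda>z. exp (?c * z) / ?c) has_field_derivative exp (?c * complex_of_real u)) (at (complex_of_real u))"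
        by (rule derivative_eq_intros refl | use t in simp)+
    qed
  qed (intro continuous_intros)
  moreover have e: "?c * complex_of_real u = \<i> * complex_of_real (- (t * u))" for u by simp
  ultimately have "(LINT u|restrict_space lborel {a..b}. iexp (- (t * u))) = (iexp (- (t * b)) - iexp (- (t * a))) / ?c"
    unfolding e by (simp add: diff_divide_distrib)
  moreover have "cmod (iexp (- (t * b)) - iexp (- (t * a))) \<le> 1 + 1"
    by (rule order_trans[OF norm_triangle_ineq4]) (simp del: of_real_minus of_real_mult)
  ultimately show ?thesis using t by (simp add: norm_divide norm_mult divide_right_mono del: of_real_minus of_real_mult)
qed

context
  fixes M1 M2 :: "real measure" and g :: "real \<Rightarrow> real"
  assumes rd: "real_distribution M1" "real_distribution M2"
    and g: "integrable lborel01 g" "\<And>t. 0 < t \<Longrightarrow> t \<le> 1 \<Longrightarrow> cmod (char M1 t - char M2 t) \<le> t * g t"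
begin

interpretation M1: real_distribution M1 by (rule rd)
interpretation M2: real_distribution M2 by (rule rd)

text \<open>The factor 4 is 2 from the definition of the kernel times 2 from
  \<open>integral_iexp_bound\<close>.\<close>

lemma fejer_density_diff:
  assumes ab: "a \<le> b"
  shows "\<bar>LINT u|restrict_space lborel {a..b}. fejer_density M1 u - fejer_density M2 u\<bar> \<le> 4 * (LINT t|lborel01. g t)"
proof -
  let ?R = "restrict_space lborel {a..b}"
  define d where "d t = char M1 t - char M2 t" for t
  interpret I: finite_measure lborel01 by (rule finite_measure_restrict_Icc)
  have dm [measurable]: "d \<in> borel_measurable borel"
    unfolding d_def[abs_def] by (intro borel_measurable_diff M1.char_measurable M2.char_measurable)
  have d2: "cmod (d t) \<le> 2" for t
    unfolding d_def using norm_triangle_ineq4[of "char M1 t" "char M2 t"] M1.cmod_char_le_1[of t] M2.cmod_char_le_1[of t] by linarith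
  have int: "integrable lborel01 (\<lambda>t. (1 - t) * Re (iexp (- (t * u)) * f t))"
    if [measurable]: "f \<in> borel_measurable borel" and f: "\<And>t. cmod (f t) \<le> 2" for f u
  proof (rule I.integrable_const_bound[where B="1 * 2"])
    show "AE t in lborel01. norm ((1 - t) * Re (iexp (- (t * u)) * f t)) \<le> 1 * 2"
    proof (rule AE_I2)
      fix t assume "t \<in> space lborel01"
      moreover have "\<bar>Re (iexp (- (t * u)) * f t)\<bar> \<le> 2"
        by (rule order_trans[OF abs_Re_le_cmod]) (use f[of t] in \<open>simp add: norm_mult del: of_real_minus of_real_mult\<close>)
      ultimately show "norm ((1 - t) * Re (iexp (- (t * u)) * f t)) \<le> 1 * 2"
        unfolding real_norm_def abs_mult by (intro mult_mono) (auto simp: space_restrict_space)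
    qed
    show "(\<lambda>t. (1 - t) * Re (iexp (- (t * u)) * f t)) \<in> borel_measurable lborel01"
      by (rule measurable_restrict_lborel) measurable
  qed
  have "fejer_density M1 u - fejer_density M2 u = 2 * (LINT t|lborel01. (1 - t) * Re (iexp (- (t * u)) * d t))" for u
  proof -
    have "cmod (char M1 t) \<le> 2" "cmod (char M2 t) \<le> 2" for t
      using M1.cmod_char_le_1[of t] M2.cmod_char_le_1[of t] by linarith+
    then have i: "integrable lborel01 (\<lambda>t. (1 - t) * Re (iexp (- (t * u)) * char M1 t))"
       "integrable lborel01 (\<lambda>t. (1 - t) * Re (iexp (- (t * u)) * char M2 t))"
      by (intro int M1.char_measurable M2.char_measurable; simp)+
    show ?thesis unfolding M1.fejer_density_char M2.fejer_density_char right_diff_distrib[symmetric] Bochner_Integration.integral_diff[OF i, symmetric]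
      by (simp add: d_def algebra_simps)
  qed
  then have "(LINT u|?R. fejer_density M1 u - fejer_density M2 u) = 2 * (LINT u|?R. (LINT t|lborel01. (1 - t) * Re (iexp (- (t * u)) * d t)))"
    by simp
  also have "(LINT u|?R. (LINT t|lborel01. (1 - t) * Re (iexp (- (t * u)) * d t))) = (LINT t|lborel01. (LINT u|?R. (1 - t) * Re (iexp (- (t * u)) * d t)))"
  proof (rule bounded_Fubini[of ?R lborel01 "\<lambda>(u, t). (1 - t) * Re (iexp (- (t * u)) * d t)" "1 * 2", unfolded prod.case])
    show "finite_measure ?R" "finite_measure lborel01" by (rule finite_measure_restrict_Icc)+
    have 1: "(\<lambda>(u, t). (1 - t) * Re (iexp (- (t * u)) * d t)) \<in> borel_measurable (borel \<Otimes>\<^sub>M borel)"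
      by measurable
    have 2: "(\<lambda>z. (fst z, snd z)) \<in> ?R \<Otimes>\<^sub>M lborel01 \<rightarrow>\<^sub>M borel \<Otimes>\<^sub>M borel"
      by (intro measurable_Pair measurable_compose[OF measurable_fst measurable_restrict_lborel]
          measurable_compose[OF measurable_snd measurable_restrict_lborel]) simp_all
    show "(\<lambda>(u, t). (1 - t) * Re (iexp (- (t * u)) * d t)) \<in> borel_measurable (?R \<Otimes>\<^sub>M lborel01)"
      using measurable_compose[OF 2 1] by (simp add: case_prod_unfold)
    fix u t assume "t \<in> space lborel01"
    moreover have "\<bar>Re (iexp (- (t * u)) * d t)\<bar> \<le> 2"
      by (rule order_trans[OF abs_Re_le_cmod]) (use d2[of t] in \<open>simp add: norm_mult del: of_real_minus of_real_mult\<close>)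
    ultimately show "norm ((1 - t) * Re (iexp (- (t * u)) * d t)) \<le> 1 * 2"
      unfolding real_norm_def abs_mult by (intro mult_mono) (auto simp: space_restrict_space)
  qed
  also have "\<bar>2 * (LINT t|lborel01. (LINT u|?R. (1 - t) * Re (iexp (- (t * u)) * d t)))\<bar> \<le> 2 * (LINT t|lborel01. 2 * g t)"
  proof -
    define w where "w t = (LINT u|?R. (1 - t) * Re (iexp (- (t * u)) * d t))" for t
    have w: "\<bar>w t\<bar> \<le> 2 * g t" if t: "0 < t" "t \<le> 1" for t
    proof -
      interpret R: finite_measure ?R by (rule finite_measure_restrict_Icc)
      have i: "integrable ?R (\<lambda>u. iexp (- (t * u)))"
      proof (rule R.integrable_const_bound[where B=1])
        show "(\<lambda>u. iexp (- (t * u))) \<in> borel_measurable ?R" by (rule measurable_restrict_lborel) measurable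
      qed (simp del: of_real_minus of_real_mult)
      have "w t = (1 - t) * Re ((LINT u|?R. iexp (- (t * u))) * d t)"
        unfolding w_def using integral_Re[of ?R "\<lambda>u. iexp (- (t * u)) * d t"] i by simp
      also have "\<bar>\<dots>\<bar> \<le> 1 * cmod ((LINT u|?R. iexp (- (t * u))) * d t)"
        unfolding abs_mult by (intro mult_mono abs_Re_le_cmod) (use t in auto)
      also have "\<dots> \<le> (2 / t) * (t * g t)"
        unfolding mult_1 norm_mult by (intro mult_mono integral_iexp_bound ab t(1)) (use t g(2)[OF t] in \<open>auto simp: d_def\<close>)
      finally show ?thesis using t by simp
    qed
    have "AE t in lborel. t \<noteq> (0::real)" by (rule AE_lborel_singleton)
    then have ae: "AE t in lborel01. norm (w t) \<le> 2 * g t"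
      by (subst AE_restrict_space_iff) (auto elim!: eventually_mono intro: w)
    have "norm (LINT t|lborel01. w t) \<le> (LINT t|lborel01. 2 * g t)"
    proof (cases "integrable lborel01 w")
      case True
      have "norm (LINT t|lborel01. w t) \<le> (LINT t|lborel01. norm (w t))" by (rule integral_norm_bound)
      also have "\<dots> \<le> (LINT t|lborel01. 2 * g t)" by (intro integral_mono_AE ae integrable_norm True) (use g(1) in simp)
      finally show ?thesis .
    next
      \<comment> \<open>A non-integrable function has Bochner integral zero, and \<open>ae\<close>
        makes \<open>g\<close> non-negative almost everywhere.\<close>
      case False
      have "0 \<le> (LINT t|lborel01. 2 * g t)"
        by (rule integral_nonneg_AE) (use ae in \<open>eventually_elim, meson norm_ge_zero order_trans\<close>)
      then show ?thesis using False by (simp add: not_integrable_integral_eq)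
    qed
    then show ?thesis by (simp add: w_def abs_mult)
  qed
  finally show ?thesis using g(1) by simp
qed

text \<open>The lower end of the interval in \<open>fejer_density_diff\<close> is sent to minus
  infinity by dominated convergence.\<close>

lemma fejer_cdf_diff:
  "\<bar>(LINT z|lborel. fejer z * (cdf M1 (b - z) - cdf M2 (b - z)))\<bar> \<le> 4 * (LINT t|lborel01. g t)"
proof -
  let ?p = "\<lambda>u. fejer_density M1 u - fejer_density M2 u"
  note [measurable] = M1.fejer_density_meas M2.fejer_density_meas
  have i: "integrable lborel (\<lambda>u. indicator {..b} u * fejer_density M1 u)" "integrable lborel (\<lambda>u. indicator {..b} u * fejer_density M2 u)"
    using M1.fejer_density_cdf[of b] M2.fejer_density_cdf[of b] by (auto simp: has_bochner_integral_iff)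
  have "(LINT z|lborel. fejer z * (cdf M1 (b - z) - cdf M2 (b - z))) = (LINT u|lborel. indicator {..b} u * ?p u)"
    using M1.fejer_density_cdf[of b] M2.fejer_density_cdf[of b] M1.integrable_fejer_cdf[of b] M2.integrable_fejer_cdf[of b]
    by (simp add: has_bochner_integral_iff right_diff_distrib)
  moreover have "(\<lambda>n. LINT u|lborel. indicator {- real n..b} u * ?p u) \<longlonglongrightarrow> (LINT u|lborel. indicator {..b} u * ?p u)"
  proof (rule integral_dominated_convergence[where w="\<lambda>u. indicator {..b} u * fejer_density M1 u + indicator {..b} u * fejer_density M2 u"])
    show "integrable lborel (\<lambda>u. indicator {..b} u * fejer_density M1 u + indicator {..b} u * fejer_density M2 u)"
      using i by simp
    show "AE u in lborel. (\<lambda>n. indicator {- real n..b} u * ?p u) \<longlonglongrightarrow> indicator {..b} u * ?p u"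
    proof (rule AE_I2, rule tendsto_eventually)
      fix u
      obtain m :: nat where "\<bar>u\<bar> \<le> real m" using real_arch_simple by blast
      then show "\<forall>\<^sub>F n in sequentially. indicator {- real n..b} u * ?p u = indicator {..b} u * ?p u"
        by (intro eventually_sequentiallyI[of m]) (auto simp: indicator_def)
    qed
    show "AE u in lborel. norm (indicator {- real n..b} u * ?p u) \<le> indicator {..b} u * fejer_density M1 u + indicator {..b} u * fejer_density M2 u" for n
    proof (rule AE_I2)
      fix u
      show "norm (indicator {- real n..b} u * ?p u) \<le> indicator {..b} u * fejer_density M1 u + indicator {..b} u * fejer_density M2 u"
        using M1.fejer_density_nonneg[of u] M2.fejer_density_nonneg[of u] by (auto simp: indicator_def abs_le_iff)
    qed
  qed measurable
  ultimately have l: "(\<lambda>n. LINT u|lborel. indicator {- real n..b} u * ?p u) \<longlonglongrightarrow> (LINT z|lborel. fejer z * (cdf M1 (b - z) - cdf M2 (b - z)))"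
    by simp
  obtain m :: nat where m: "\<bar>b\<bar> \<le> real m" using real_arch_simple by blast
  have "\<bar>LINT u|lborel. indicator {- real n..b} u * ?p u\<bar> \<le> 4 * (LINT t|lborel01. g t)" if "m \<le> n" for n
    using fejer_density_diff[of "- real n" b] that m by (simp add: integral_restrict_space)
  then show ?thesis by (intro LIMSEQ_le_const2[OF tendsto_rabs[OF l]]) auto
qed

text \<open>Esseen's argument with unit bandwidth. Monotonicity of the first distribution function
  and the Lipschitz bound on the second keep a deviation at x alive on an interval of length 2h, to
  the right of x if it is positive and to the left if it is negative; hence the centres
  \<open>x + h\<close> and \<open>x - h\<close>.\<close>

lemma cdf_diff_le_unit:
  assumes lip: "\<And>x y. x \<le> y \<Longrightarrow> cdf M2 y - cdf M2 x \<le> lc * (y - x)" and h: "0 < h" "(LINT z|lborel. indicator (- {-h..h}) z * fejer z) \<le> fejer_mass / 4"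
  shows "\<bar>cdf M1 x - cdf M2 x\<bar> \<le> 3 * (lc * h) + 8 * (LINT t|lborel01. g t) / fejer_mass"
proof -
  define A where "A = (LINT t|lborel01. g t)"
  define D where "D = (SUP x. \<bar>cdf M1 x - cdf M2 x\<bar>)"
  have bdd: "bdd_above (range (\<lambda>x. \<bar>cdf M1 x - cdf M2 x\<bar>))"
  proof (rule bdd_aboveI2)
    show "\<bar>cdf M1 x - cdf M2 x\<bar> \<le> 1" for x
      using M1.cdf_bounded_prob[of x] M2.cdf_bounded_prob[of x] M1.cdf_nonneg[of x] M2.cdf_nonneg[of x] by linarith
  qed
  have D: "\<bar>cdf M1 x - cdf M2 x\<bar> \<le> D" for x unfolding D_def by (rule cSUP_upper[OF _ bdd]) simp
  have A0: "0 \<le> 4 * A" using fejer_cdf_diff[of 0] unfolding A_def by linarith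
  have l0: "0 \<le> lc" using lip[of 0 1] M2.cdf_nondecreasing[of 0 1] by simp
  note [measurable] = M1.cdf_meas M2.cdf_meas
  have key: "3 * fejer_mass * (\<bar>cdf M1 x - cdf M2 x\<bar> - 2 * lc * h) \<le> 4 * (4 * A) + fejer_mass * D" for x
  proof (cases "0 \<le> \<bar>cdf M1 x - cdf M2 x\<bar> - 2 * lc * h")
    case False
    then have "3 * fejer_mass * (\<bar>cdf M1 x - cdf M2 x\<bar> - 2 * lc * h) \<le> 0"
      using fejer_mass_pos by (simp add: mult_le_0_iff)
    moreover have "0 \<le> fejer_mass * D" using D[of 0] fejer_mass_pos by (intro mult_nonneg_nonneg) linarith+
    ultimately show ?thesis using A0 by linarith
  next
    case True
    show ?thesis
    proof (cases "cdf M2 x \<le> cdf M1 x")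
      case c: True
      show ?thesis
      proof (rule fejer_deconvolution[where f="\<lambda>y. cdf M1 y - cdf M2 y" and h=h and b="x + h"])
        fix z :: real assume z: "\<bar>z\<bar> \<le> h"
        have "cdf M2 (x + h - z) - cdf M2 x \<le> lc * (h - z)" using lip[of x "x + h - z"] z by (simp add: algebra_simps)
        also have "\<dots> \<le> lc * (2 * h)" using l0 z by (intro mult_left_mono) auto
        finally show "\<bar>cdf M1 x - cdf M2 x\<bar> - 2 * lc * h \<le> cdf M1 (x + h - z) - cdf M2 (x + h - z)"
          using M1.cdf_nondecreasing[of x "x + h - z"] z c by linarith
      next
        show "(LINT z|lborel. fejer z * (cdf M1 (x + h - z) - cdf M2 (x + h - z))) \<le> 4 * A"
          using fejer_cdf_diff[of "x + h"] by (simp add: A_def)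
      qed (use D True h in auto)
    next
      case c: False
      show ?thesis
      proof (rule fejer_deconvolution[where f="\<lambda>y. cdf M2 y - cdf M1 y" and h=h and b="x - h"])
        fix z :: real assume z: "\<bar>z\<bar> \<le> h"
        have "cdf M2 x - cdf M2 (x - h - z) \<le> lc * (h + z)" using lip[of "x - h - z" x] z by (simp add: algebra_simps)
        also have "\<dots> \<le> lc * (2 * h)" using l0 z by (intro mult_left_mono) auto
        finally show "\<bar>cdf M1 x - cdf M2 x\<bar> - 2 * lc * h \<le> cdf M2 (x - h - z) - cdf M1 (x - h - z)"
          using M1.cdf_nondecreasing[of "x - h - z" x] z c by linarith
      next
        have "(LINT z|lborel. fejer z * (cdf M2 (x - h - z) - cdf M1 (x - h - z))) = - (LINT z|lborel. fejer z * (cdf M1 (x - h - z) - cdf M2 (x - h - z)))"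
          unfolding Bochner_Integration.integral_minus[symmetric] by (simp add: algebra_simps)
        then show "(LINT z|lborel. fejer z * (cdf M2 (x - h - z) - cdf M1 (x - h - z))) \<le> 4 * A"
          using fejer_cdf_diff[of "x - h"] by (simp add: A_def)
      qed (use D True h in \<open>auto simp: abs_minus_commute\<close>)
    qed
  qed
  \<comment> \<open>The tail of the kernel brings \<open>D\<close> back with weight 1/3. Absorbing
    it on the left multiplies the rest by 3/2, which turns 2 into 3 and 16/3 into 8.\<close>
  have "D \<le> 2 * lc * h + (4 * (4 * A) + fejer_mass * D) / (3 * fejer_mass)"
    unfolding D_def
  proof (rule cSUP_least)
    fix x
    show "\<bar>cdf M1 x - cdf M2 x\<bar> \<le> 2 * lc * h + (4 * (4 * A) + fejer_mass * (SUP x. \<bar>cdf M1 x - cdf M2 x\<bar>)) / (3 * fejer_mass)"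
      using key[of x] fejer_mass_pos unfolding D_def[symmetric] by (simp add: field_simps)
  qed simp
  also have "(4 * (4 * A) + fejer_mass * D) / (3 * fejer_mass) = 16 / 3 * (A / fejer_mass) + D / 3"
    using fejer_mass_pos by (simp add: add_divide_distrib)
  finally have "D \<le> 3 * (lc * h) + 8 * A / fejer_mass" by simp
  then show ?thesis using D[of x] unfolding A_def by linarith
qed

end

theorem ks_dist_smoothing:
  "\<exists>C>0. \<forall>M1 M2 T g. real_distribution M1 \<longrightarrow> real_distribution M2 \<longrightarrow>
     (\<forall>x y. x \<le> y \<longrightarrow> cdf M2 y - cdf M2 x \<le> y - x) \<longrightarrow> 0 < T \<longrightarrow> integrable lborel g \<longrightarrow> (\<forall>t. 0 \<le> g t) \<longrightarrow>
     (\<forall>t. 0 < t \<longrightarrow> t \<le> T \<longrightarrow> cmod (char M1 t - char M2 t) \<le> t * g t) \<longrightarrow>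
     ks_dist M1 M2 \<le> C * (1 / T + (LINT t|lborel. g t))"
proof -
  obtain h where h: "0 < h" "(LINT z|lborel. indicator (- {-h..h}) z * fejer z) \<le> fejer_mass / 4"
    using fejer_tail by blast
  define C where "C = 3 * h + 8 / fejer_mass"
  have C: "0 < C" "3 * h \<le> C" "8 / fejer_mass \<le> C" using h(1) fejer_mass_pos by (auto simp: C_def add_pos_pos)
  show ?thesis
  proof (intro exI[of _ C] conjI allI impI C(1))
    fix M1 M2 :: "real measure" and T :: real and g :: "real \<Rightarrow> real"
    assume rd: "real_distribution M1" "real_distribution M2" and lip: "\<forall>x y. x \<le> y \<longrightarrow> cdf M2 y - cdf M2 x \<le> y - x"
      and T: "0 < T" and g: "integrable lborel g" "\<forall>t. 0 \<le> g t"
      and le: "\<forall>t. 0 < t \<longrightarrow> t \<le> T \<longrightarrow> cmod (char M1 t - char M2 t) \<le> t * g t"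
    \<comment> \<open>Rescaling by \<open>T\<close> reduces to unit bandwidth: the Lipschitz
      constant becomes 1 / T, and \<open>T * g (T * t)\<close> has the same integral as
      \<open>g\<close>.\<close>
    define sc where "sc N = distr N borel (\<lambda>x. T * x)" for N :: "real measure"
    have sc: "real_distribution (sc N)" "char (sc N) t = char N (T * t)" "cdf (sc N) x = cdf N (x / T)" if "real_distribution N" for N t x
    proof -
      interpret N: real_distribution N by fact
      show "real_distribution (sc N)" unfolding sc_def by (rule N.real_distribution_distr) simp
      show "char (sc N) t = char N (T * t)" unfolding char_def sc_def by (subst integral_distr) (auto simp: mult_ac)
      have "(\<lambda>x. T * x) -` {..x} = {..x / T}" using T by (auto simp: field_simps)
      then show "cdf (sc N) x = cdf N (x / T)" unfolding cdf_def sc_def by (subst measure_distr) auto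
    qed
    have gi: "integrable lborel (\<lambda>t. T * g (T * t))" "(LINT t|lborel. T * g (T * t)) = (LINT t|lborel. g t)"
      using T lborel_integrable_real_affine[OF g(1), of T 0] lborel_integral_real_affine[of T g 0] by auto
    have gr: "integrable lborel01 (\<lambda>t. T * g (T * t))"
      by (subst integrable_restrict_space) (simp, rule integrable_mult_indicator[OF _ gi(1)], simp)
    have gl: "(LINT t|lborel01. T * g (T * t)) \<le> (LINT t|lborel. g t)"
    proof -
      have "(LINT t|lborel01. T * g (T * t)) = (LINT t|lborel. indicator {0..1} t *\<^sub>R (T * g (T * t)))"
        by (rule integral_restrict_space) simp
      also have "\<dots> \<le> (LINT t|lborel. T * g (T * t))"
        by (intro integral_mono integrable_mult_indicator gi(1)) (use g(2) T in \<open>auto split: split_indicator\<close>)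
      finally show ?thesis unfolding gi(2) .
    qed
    have "\<bar>cdf M1 x - cdf M2 x\<bar> \<le> C * (1 / T + (LINT t|lborel. g t))" for x
    proof -
      have "\<bar>cdf (sc M1) (T * x) - cdf (sc M2) (T * x)\<bar> \<le> 3 * (1 / T * h) + 8 * (LINT t|lborel01. T * g (T * t)) / fejer_mass"
      proof (rule cdf_diff_le_unit[OF sc(1)[OF rd(1)] sc(1)[OF rd(2)] gr _ _ h])
        fix t :: real assume "0 < t" "t \<le> 1"
        then show "cmod (char (sc M1) t - char (sc M2) t) \<le> t * (T * g (T * t))"
          using le[rule_format, of "T * t"] T by (simp add: sc rd mult_ac)
      next
        fix x y :: real assume "x \<le> y"
        then show "cdf (sc M2) y - cdf (sc M2) x \<le> 1 / T * (y - x)"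
          using lip[rule_format, of "x / T" "y / T"] T by (simp add: sc rd diff_divide_distrib divide_right_mono)
      qed
      also have "\<dots> \<le> (3 * h) * (1 / T) + 8 / fejer_mass * (LINT t|lborel. g t)"
        using gl fejer_mass_pos by (simp add: divide_right_mono)
      also have "\<dots> \<le> C * (1 / T) + C * (LINT t|lborel. g t)"
        by (intro add_mono mult_right_mono C) (use T g(2) in \<open>auto intro: integral_nonneg_AE\<close>)
      finally show ?thesis using T by (simp add: sc rd distrib_left)
    qed
    then show "ks_dist M1 M2 \<le> C * (1 / T + (LINT t|lborel. g t))"
      unfolding ks_dist_def by (intro cSUP_least) auto
  qed
qed

section \<open>Normal approximation\<close>

lemma std_normal_cdf_lipschitz:
  assumes "x \<le> y" shows "cdf std_normal_distribution y - cdf std_normal_distribution x \<le> y - x"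
proof (cases "x < y")
  case True
  interpret N: real_distribution std_normal_distribution by (rule real_dist_normal_dist)
  have le1: "std_normal_density u \<le> 1" for u :: real
  proof -
    have "1 \<le> sqrt (2 * pi)" using pi_gt3 by simp
    then have "1 / sqrt (2 * pi) \<le> 1" by (simp add: divide_le_eq)
    moreover have "exp (- u\<^sup>2 / 2) \<le> 1" by simp
    ultimately show ?thesis unfolding std_normal_density_def by (intro mult_le_one) auto
  qed
  have "emeasure std_normal_distribution {x<..y} = (\<integral>\<^sup>+u. ennreal (std_normal_density u) * indicator {x<..y} u \<partial>lborel)"
    by (rule emeasure_density) auto
  also have "\<dots> \<le> (\<integral>\<^sup>+u. indicator {x<..y} u \<partial>lborel)"
    by (intro nn_integral_mono) (use le1 in \<open>auto split: split_indicator simp: ennreal_le_1\<close>)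
  also have "\<dots> = ennreal (y - x)" using assms by simp
  finally have "N.prob {x<..y} \<le> y - x"
    using assms by (simp add: N.emeasure_eq_measure)
  then show ?thesis using N.cdf_diff_eq[OF True] by simp
qed (use assms in simp)

text \<open>A direct estimate of the difference quotient: the second moment bounds the Taylor
  remainder by a multiple of h^2.\<close>

lemma (in prob_space) has_vector_derivative_char:
  assumes Y: "integrable M Y" "integrable M (\<lambda>\<omega>. (Y \<omega>)\<^sup>2)"
  shows "((\<lambda>t. LINT \<omega>|M. iexp (t * Y \<omega>)) has_vector_derivative \<i> * (LINT \<omega>|M. Y \<omega> * iexp (t * Y \<omega>))) (at t)"
proof -
  have [measurable]: "Y \<in> borel_measurable M" using Y(1) by (rule borel_measurable_integrable)
  have i1: "integrable M (\<lambda>\<omega>. iexp (s * Y \<omega>))" for s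
    by (rule integrable_const_bound[where B=1]) (simp_all del: of_real_mult)
  have i2: "integrable M (\<lambda>\<omega>. Y \<omega> * iexp (t * Y \<omega>))"
    by (rule Bochner_Integration.integrable_bound[OF Y(1)]) (simp_all add: norm_mult del: of_real_mult)
  define V where "V = (LINT \<omega>|M. (Y \<omega>)\<^sup>2) / 2"
  have bound: "cmod ((LINT \<omega>|M. iexp ((t + h) * Y \<omega>)) - (LINT \<omega>|M. iexp (t * Y \<omega>)) - h *\<^sub>R (\<i> * (LINT \<omega>|M. Y \<omega> * iexp (t * Y \<omega>)))) \<le> h\<^sup>2 * V" for h
  proof -
    have e: "(LINT \<omega>|M. iexp ((t + h) * Y \<omega>)) - (LINT \<omega>|M. iexp (t * Y \<omega>)) - h *\<^sub>R (\<i> * (LINT \<omega>|M. Y \<omega> * iexp (t * Y \<omega>)))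
      = (LINT \<omega>|M. iexp ((t + h) * Y \<omega>) - iexp (t * Y \<omega>) - (h * \<i>) * (Y \<omega> * iexp (t * Y \<omega>)))"
      using i1[of "t + h"] i1[of t] i2 by (simp add: scaleR_conv_of_real mult.assoc del: of_real_mult)
    have p: "cmod (iexp ((t + h) * y) - iexp (t * y) - (h * \<i>) * (y * iexp (t * y))) \<le> h\<^sup>2 * y\<^sup>2 / 2" for y
    proof -
      have "iexp ((t + h) * y) - iexp (t * y) - (h * \<i>) * (y * iexp (t * y)) = iexp (t * y) * (iexp (h * y) - (1 + \<i> * (h * y)))"
        by (simp add: algebra_simps exp_add)
      then have "cmod (iexp ((t + h) * y) - iexp (t * y) - (h * \<i>) * (y * iexp (t * y))) = cmod (iexp (h * y) - (1 + \<i> * (h * y)))"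
        by (simp add: norm_mult del: of_real_mult)
      also have "\<dots> \<le> \<bar>h * y\<bar>\<^sup>2 / 2"
        using iexp_approx1[of "h * y" 1] by (simp add: numeral_2_eq_2 add.commute)
      finally show ?thesis by (simp add: power_mult_distrib)
    qed
    have "cmod (LINT \<omega>|M. iexp ((t + h) * Y \<omega>) - iexp (t * Y \<omega>) - (h * \<i>) * (Y \<omega> * iexp (t * Y \<omega>)))
      \<le> (LINT \<omega>|M. h\<^sup>2 * (Y \<omega>)\<^sup>2 / 2)"
      by (rule order_trans[OF integral_norm_bound integral_mono])
         (use i1[of "t + h"] i1[of t] i2 Y p in \<open>auto simp del: of_real_mult of_real_add\<close>)
    then show ?thesis unfolding e V_def using Y by simp
  qed
  show ?thesis unfolding has_vector_derivative_def has_derivative_at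
  proof
    show "(\<lambda>h. norm ((LINT \<omega>|M. iexp ((t + h) * Y \<omega>)) - (LINT \<omega>|M. iexp (t * Y \<omega>)) - h *\<^sub>R (\<i> * (LINT \<omega>|M. Y \<omega> * iexp (t * Y \<omega>)))) / norm h) \<midarrow>0\<rightarrow> 0"
    proof (rule Lim_null_comparison)
      show "\<forall>\<^sub>F h in at 0. norm (norm ((LINT \<omega>|M. iexp ((t + h) * Y \<omega>)) - (LINT \<omega>|M. iexp (t * Y \<omega>)) - h *\<^sub>R (\<i> * (LINT \<omega>|M. Y \<omega> * iexp (t * Y \<omega>)))) / norm h) \<le> \<bar>h\<bar> * V"
      proof (rule always_eventually, rule allI)
        fix h :: real
        define n where "n = norm ((LINT \<omega>|M. iexp ((t + h) * Y \<omega>)) - (LINT \<omega>|M. iexp (t * Y \<omega>)) - h *\<^sub>R (\<i> * (LINT \<omega>|M. Y \<omega> * iexp (t * Y \<omega>))))"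
        have n: "0 \<le> n" "n \<le> h\<^sup>2 * V" using bound[of h] by (auto simp: n_def)
        have "norm (n / norm h) \<le> \<bar>h\<bar> * V"
        proof (cases "h = 0")
          case False
          have "h\<^sup>2 = \<bar>h\<bar> * \<bar>h\<bar>" by (simp add: power2_eq_square)
          then show ?thesis using n False by (simp add: field_simps)
        qed simp
        then show "norm (norm ((LINT \<omega>|M. iexp ((t + h) * Y \<omega>)) - (LINT \<omega>|M. iexp (t * Y \<omega>)) - h *\<^sub>R (\<i> * (LINT \<omega>|M. Y \<omega> * iexp (t * Y \<omega>)))) / norm h) \<le> \<bar>h\<bar> * V"
          unfolding n_def .
      qed
      have "((\<lambda>h. \<bar>h\<bar> * V) \<longlongrightarrow> \<bar>0\<bar> * V) (at 0)" by (intro tendsto_intros)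
      then show "((\<lambda>h. \<bar>h\<bar> * V) \<longlongrightarrow> 0) (at 0)" by simp
    qed
  qed (intro bounded_linear_scaleR_left)
qed

text \<open>The growth of \<open>f\<close> is bounded first; this makes exp(A s^3 / 3) a majorant
  for the increments, and e^x - 1 \<le> x e^x finishes.\<close>

lemma gronwall_cubic:
  fixes f f' :: "real \<Rightarrow> complex"
  assumes A: "0 \<le> A" and T: "0 < T" and f0: "f 0 = 1"
    and d: "\<And>s. 0 \<le> s \<Longrightarrow> s \<le> T \<Longrightarrow> (f has_vector_derivative f' s) (at s)"
    and le: "\<And>s. 0 \<le> s \<Longrightarrow> s \<le> T \<Longrightarrow> norm (f' s) \<le> A * s\<^sup>2 * norm (f s)"
  shows "norm (f T - 1) \<le> A * T ^ 3 * exp (A * T ^ 3 / 3)"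
proof -
  have n: "norm (f t) \<le> exp (A * t ^ 3 / 3)" if t: "0 \<le> t" "t \<le> T" for t
  proof -
    \<comment> \<open>The squared norm is used because the norm itself need not be differentiable
      where \<open>f\<close> vanishes.\<close>
    define r where "r s = (f s \<bullet> f s) * exp (- (2 * A * s ^ 3 / 3))" for s
    have "r t \<le> r 0"
    proof (rule DERIV_nonpos_imp_nonincreasing[OF t(1)])
      fix s assume s: "0 \<le> s" "s \<le> t"
      then have s': "0 \<le> s" "s \<le> T" using t by auto
      have "((\<lambda>s. f s \<bullet> f s) has_derivative (\<lambda>h. f s \<bullet> (h *\<^sub>R f' s) + (h *\<^sub>R f' s) \<bullet> f s)) (at s)"
        using d[OF s'] unfolding has_vector_derivative_def by (intro has_derivative_inner)
      moreover have "(\<lambda>h. f s \<bullet> (h *\<^sub>R f' s) + (h *\<^sub>R f' s) \<bullet> f s) = (*) (2 * (f s \<bullet> f' s))"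
        by (auto simp: fun_eq_iff inner_commute)
      ultimately have ff: "((\<lambda>s. f s \<bullet> f s) has_real_derivative 2 * (f s \<bullet> f' s)) (at s)"
        unfolding has_field_derivative_def by simp
      have ex: "((\<lambda>s. exp (- (2 * A * s ^ 3 / 3))) has_real_derivative exp (- (2 * A * s ^ 3 / 3)) * (- (2 * A * s\<^sup>2))) (at s)"
        by (auto intro!: derivative_eq_intros simp: power2_eq_square)
      have "f s \<bullet> f' s \<le> norm (f s) * norm (f' s)" using Cauchy_Schwarz_ineq2[of "f s" "f' s"] by linarith
      also have "\<dots> \<le> norm (f s) * (A * s\<^sup>2 * norm (f s))" by (intro mult_left_mono le s') simp
      also have "\<dots> = A * s\<^sup>2 * (f s \<bullet> f s)" by (simp add: power2_norm_eq_inner[symmetric] power2_eq_square)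
      finally have "2 * (f s \<bullet> f' s) - 2 * A * s\<^sup>2 * (f s \<bullet> f s) \<le> 0" by simp
      then have "(2 * (f s \<bullet> f' s) - 2 * A * s\<^sup>2 * (f s \<bullet> f s)) * exp (- (2 * A * s ^ 3 / 3)) \<le> 0"
        by (simp add: mult_le_0_iff)
      moreover have "(r has_real_derivative (f s \<bullet> f s) * (exp (- (2 * A * s ^ 3 / 3)) * (- (2 * A * s\<^sup>2))) + 2 * (f s \<bullet> f' s) * exp (- (2 * A * s ^ 3 / 3))) (at s)"
        unfolding r_def[abs_def] by (rule DERIV_mult'[OF ff ex])
      ultimately show "\<exists>y. (r has_real_derivative y) (at s) \<and> y \<le> 0"
        by (intro exI conjI) (assumption, simp add: algebra_simps)
    qed
    then have "(norm (f t))\<^sup>2 * exp (- (2 * A * t ^ 3 / 3)) \<le> 1" by (simp add: r_def f0 power2_norm_eq_inner)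
    then have "(norm (f t))\<^sup>2 \<le> exp (2 * A * t ^ 3 / 3)" by (simp add: exp_minus field_simps)
    also have "\<dots> = (exp (A * t ^ 3 / 3))\<^sup>2" by (simp add: exp_double[symmetric])
    finally show ?thesis by (rule power2_le_imp_le) simp
  qed
  have "norm (f T - f 0) \<le> exp (A * T ^ 3 / 3) - exp (A * 0 ^ 3 / 3)"
  proof (rule differentiable_bound_general[OF T, where f'=f' and \<phi>'="\<lambda>s. exp (A * s ^ 3 / 3) * (A * s\<^sup>2)"])
    show "continuous_on {0..T} f"
      by (intro continuous_at_imp_continuous_on ballI has_vector_derivative_continuous[OF d]) auto
    show "continuous_on {0..T} (\<lambda>s. exp (A * s ^ 3 / 3))" by (intro continuous_intros) simp_all
    fix s assume s: "0 < s" "s < T"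
    then show "(f has_vector_derivative f' s) (at s)" by (intro d) auto
    show "((\<lambda>s. exp (A * s ^ 3 / 3)) has_vector_derivative exp (A * s ^ 3 / 3) * (A * s\<^sup>2)) (at s)"
      unfolding has_real_derivative_iff_has_vector_derivative[symmetric]
      by (auto intro!: derivative_eq_intros simp: power2_eq_square)
    have "norm (f' s) \<le> A * s\<^sup>2 * norm (f s)" using s by (intro le) auto
    also have "\<dots> \<le> A * s\<^sup>2 * exp (A * s ^ 3 / 3)" using s A by (intro mult_left_mono n) auto
    finally show "norm (f' s) \<le> exp (A * s ^ 3 / 3) * (A * s\<^sup>2)" by (simp add: mult.commute)
  qed
  also have "\<dots> \<le> A * T ^ 3 / 3 * exp (A * T ^ 3 / 3)"
  proof -
    have "exp (A * T ^ 3 / 3) * (1 + - (A * T ^ 3 / 3)) \<le> exp (A * T ^ 3 / 3) * exp (- (A * T ^ 3 / 3))"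
      by (intro mult_left_mono exp_ge_add_one_self) simp
    then show ?thesis by (simp add: exp_minus field_simps)
  qed
  also have "\<dots> \<le> A * T ^ 3 * exp (A * T ^ 3 / 3)" using A T by (intro mult_right_mono) auto
  finally show ?thesis by (simp add: f0)
qed

text \<open>Up to a constant this is the second moment of the centred normal law with variance
  2.\<close>

lemma integrable_square_gauss: "integrable lborel (\<lambda>t::real. t\<^sup>2 * exp (- t\<^sup>2 / 4))"
proof -
  have "integrable lborel (\<lambda>t. sqrt (4 * pi) * (normal_density 0 (sqrt 2) t * (t - 0)\<^sup>2))"
    by (intro integrable_mult_right integrable_normal_moment) simp
  moreover have "sqrt (4 * pi) * (normal_density 0 (sqrt 2) t * (t - 0)\<^sup>2) = t\<^sup>2 * exp (- t\<^sup>2 / 4)" for t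
    by (simp add: normal_density_def)
  ultimately show ?thesis by (simp only:)
qed

text \<open>The constant is chosen before the space, the variable and \<open>B\<close>, so that one
  value serves all scales at once.\<close>

theorem ks_dist_standardized:
  "\<exists>c>0. \<forall>(M :: 'w measure) (Y :: 'w \<Rightarrow> real) (B :: real). prob_space M \<longrightarrow> integrable M Y \<longrightarrow> integrable M (\<lambda>\<omega>. (Y \<omega>)\<^sup>2) \<longrightarrow> 0 < B \<longrightarrow>
     0 < prob_space.variance M Y \<longrightarrow>
     (\<forall>y::real. \<bar>y\<bar> * B \<le> 1/2 \<longrightarrow>
        cmod ((LINT \<omega>|M. Y \<omega> * iexp (y * Y \<omega>)) - (prob_space.expectation M Y + \<i> * y * prob_space.variance M Y) * (LINT \<omega>|M. iexp (y * Y \<omega>)))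
          \<le> 8 * B * y\<^sup>2 * prob_space.variance M Y * cmod (LINT \<omega>|M. iexp (y * Y \<omega>))) \<longrightarrow>
     ks_dist (distr M borel (standardized M Y)) std_normal_distribution \<le> c * B / sqrt (prob_space.variance M Y)"
proof -
  obtain C where C: "0 < C" and smooth: "\<And>M1 M2 T g. real_distribution M1 \<Longrightarrow> real_distribution M2 \<Longrightarrow>
     (\<And>x y. x \<le> y \<Longrightarrow> cdf M2 y - cdf M2 x \<le> y - x) \<Longrightarrow> 0 < T \<Longrightarrow> integrable lborel g \<Longrightarrow> (\<And>t. 0 \<le> g t) \<Longrightarrow>
     (\<And>t. 0 < t \<Longrightarrow> t \<le> T \<Longrightarrow> cmod (char M1 t - char M2 t) \<le> t * g t) \<Longrightarrow>
     ks_dist M1 M2 \<le> C * (1 / T + (LINT t|lborel. g t))"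
    using ks_dist_smoothing by auto
  define I where "I = (LINT t::real|lborel. t\<^sup>2 * exp (- t\<^sup>2 / 4))"
  have I0: "0 \<le> I" unfolding I_def by (intro integral_nonneg_AE) simp
  show ?thesis
  proof (intro exI[of _ "8 * C * (4/3 + I)"] conjI allI impI)
    show "0 < 8 * C * (4/3 + I)" using C I0 by simp
    fix M :: "'w measure" and Y :: "'w \<Rightarrow> real" and B :: real
    assume "prob_space M" and Y: "integrable M Y" "integrable M (\<lambda>\<omega>. (Y \<omega>)\<^sup>2)" and B: "0 < B" and v0: "0 < prob_space.variance M Y"
      and bound: "\<forall>y::real. \<bar>y\<bar> * B \<le> 1/2 \<longrightarrow>
        cmod ((LINT \<omega>|M. Y \<omega> * iexp (y * Y \<omega>)) - (prob_space.expectation M Y + \<i> * y * prob_space.variance M Y) * (LINT \<omega>|M. iexp (y * Y \<omega>)))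
          \<le> 8 * B * y\<^sup>2 * prob_space.variance M Y * cmod (LINT \<omega>|M. iexp (y * Y \<omega>))"
    interpret P: prob_space M by fact
    define v where "v = P.variance Y"
    define m where "m = P.expectation Y"
    define \<sigma> where "\<sigma> = sqrt v"
    define X where "X y = (LINT \<omega>|M. iexp (y * Y \<omega>))" for y
    define D where "D y = (LINT \<omega>|M. Y \<omega> * iexp (y * Y \<omega>))" for y
    \<comment> \<open>The reciprocal of the characteristic function of the normal law with mean
      \<open>m\<close> and variance \<open>v\<close>. The product of \<open>X\<close> and
      \<open>E\<close> is 1 at 0, and its derivative is \<i> E times the quantity bounded in the
      hypothesis.\<close>
    define E where "E y = exp ((complex_of_real y)\<^sup>2 * complex_of_real v / 2 - \<i> * complex_of_real y * complex_of_real m)" for y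
    \<comment> \<open>The cubic coefficient after standardisation. With the cut-off 3 / (4 a) the
      smoothing inequality yields C (4 a / 3 + a I), and inserting a = 8 B / \<sigma> gives the
      constant claimed at the start.\<close>
    define a where "a = 8 * B / \<sigma>"
    have \<sigma>: "0 < \<sigma>" "\<sigma>\<^sup>2 = v" using v0 by (simp_all add: \<sigma>_def v_def)
    have a: "0 < a" using B \<sigma> by (simp add: a_def)
    have [measurable]: "Y \<in> borel_measurable M" using Y(1) by (rule borel_measurable_integrable)
    have b: "cmod (D y - (m + \<i> * y * v) * X y) \<le> 8 * B * v * y\<^sup>2 * cmod (X y)" if "\<bar>y\<bar> * B \<le> 1/2" for y
      using bound that by (simp add: D_def X_def m_def v_def mult_ac)
    have nE: "cmod (E y) = exp (y\<^sup>2 * v / 2)" for y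
      unfolding E_def norm_exp_eq_Re by (simp add: power2_eq_square)
    have G: "cmod (X y * E y - 1) \<le> 8 * B * v * y ^ 3 * exp (8 * B * v * y ^ 3 / 3)" if y: "0 < y" "y * B \<le> 1/2" for y
    proof (rule gronwall_cubic[where f'="\<lambda>s. \<i> * (D s - (m + \<i> * s * v) * X s) * E s", OF _ y(1)])
      show "0 \<le> 8 * B * v" using B v0 by (simp add: v_def)
      show "X 0 * E 0 = 1" by (simp add: X_def E_def P.prob_space)
      fix s assume s: "0 \<le> s" "s \<le> y"
      have "s * B \<le> y * B" using s B by (intro mult_right_mono) auto
      then have sB: "\<bar>s\<bar> * B \<le> 1/2" using s y(2) by simp
      have dE: "(E has_vector_derivative (complex_of_real s * v - \<i> * m) * E s) (at s)"
        unfolding E_def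
      proof (rule has_vector_derivative_real_field)
        show "((\<lambda>z. exp (z\<^sup>2 * complex_of_real v / 2 - \<i> * z * complex_of_real m)) has_field_derivative
          (complex_of_real s * complex_of_real v - \<i> * complex_of_real m) * exp ((complex_of_real s)\<^sup>2 * complex_of_real v / 2 - \<i> * complex_of_real s * complex_of_real m)) (at (complex_of_real s))"
          by (auto intro!: derivative_eq_intros simp: algebra_simps)
      qed
      have dX: "(X has_vector_derivative \<i> * D s) (at s)"
        unfolding X_def[abs_def] D_def by (rule P.has_vector_derivative_char[OF Y])
      have "((\<lambda>y. X y * E y) has_vector_derivative X s * ((complex_of_real s * v - \<i> * m) * E s) + \<i> * D s * E s) (at s)"
        by (rule has_vector_derivative_mult[OF dX dE])
      moreover have "X s * ((complex_of_real s * v - \<i> * m) * E s) + \<i> * D s * E s = \<i> * (D s - (m + \<i> * s * v) * X s) * E s"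
        by (simp add: algebra_simps)
      ultimately show "((\<lambda>y. X y * E y) has_vector_derivative \<i> * (D s - (m + \<i> * s * v) * X s) * E s) (at s)" by simp
      have "cmod (\<i> * (D s - (m + \<i> * s * v) * X s) * E s) = cmod (D s - (m + \<i> * s * v) * X s) * cmod (E s)"
        unfolding norm_mult by simp
      also have "\<dots> \<le> 8 * B * v * s\<^sup>2 * cmod (X s) * cmod (E s)"
        by (intro mult_right_mono b sB) simp
      finally show "cmod (\<i> * (D s - (m + \<i> * s * v) * X s) * E s) \<le> 8 * B * v * s\<^sup>2 * cmod (X s * E s)"
        by (simp add: norm_mult mult.assoc)
    qed
    have st: "standardized M Y = (\<lambda>\<omega>. (Y \<omega> - m) / \<sigma>)" by (simp add: standardized_def m_def \<sigma>_def v_def)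
    let ?N = "distr M borel (standardized M Y)"
    have rd: "real_distribution ?N" unfolding st by (rule P.real_distribution_distr) measurable
    have chN: "char ?N t = X (t / \<sigma>) * iexp (- (t * m / \<sigma>))" for t
    proof -
      have "char ?N t = (LINT \<omega>|M. iexp (t * ((Y \<omega> - m) / \<sigma>)))" unfolding char_def st by (rule integral_distr) measurable
      also have "\<dots> = (LINT \<omega>|M. iexp (t / \<sigma> * Y \<omega>) * iexp (- (t * m / \<sigma>)))"
        by (intro Bochner_Integration.integral_cong refl) (simp add: exp_add[symmetric] diff_divide_distrib algebra_simps)
      finally show ?thesis by (simp add: X_def)
    qed
    \<comment> \<open>Up to the cut-off a t \<le> 3/4, so the cubic exponent a t^3 / 3 is at most
      t^2 / 4 and half of the Gaussian decay survives. The same cut-off keeps t / \<sigma> within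
      the range where the hypothesis applies.\<close>
    have fin: "cmod (char ?N t - char std_normal_distribution t) \<le> t * (a * (t\<^sup>2 * exp (- t\<^sup>2 / 4)))"
      if t: "0 < t" "t \<le> 3 / (4 * a)" for t
    proof -
      let ?y = "t / \<sigma>"
      have y: "0 < ?y" using t \<sigma> by simp
      have "t * a \<le> 3 / 4" using t(2) a by (simp add: field_simps)
      then have ta: "t * (8 * B) \<le> 3 / 4 * \<sigma>" using \<sigma> by (simp add: a_def field_simps)
      then have "t * B \<le> \<sigma> / 2" using \<sigma>(1) by linarith
      then have yB: "?y * B \<le> 1/2" using \<sigma> by (simp add: field_simps)
      have Ey: "E ?y = exp (complex_of_real (t\<^sup>2 / 2)) * iexp (- (t * m / \<sigma>))"
      proof -
        have "(complex_of_real ?y)\<^sup>2 * complex_of_real v / 2 = complex_of_real (?y\<^sup>2 * v / 2)" by simp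
        also have "?y\<^sup>2 * v / 2 = t\<^sup>2 / 2" using \<sigma> by (simp add: power_divide \<sigma>(2)[symmetric])
        finally show ?thesis unfolding E_def exp_add[symmetric] by (simp add: mult.assoc)
      qed
      have "char ?N t - char std_normal_distribution t = exp (complex_of_real (- t\<^sup>2 / 2)) * (X ?y * E ?y - 1)"
        unfolding chN char_std_normal_distribution Ey
        by (simp add: exp_minus exp_of_real[symmetric] right_diff_distrib)
      then have "cmod (char ?N t - char std_normal_distribution t) = exp (- t\<^sup>2 / 2) * cmod (X ?y * E ?y - 1)"
        by (simp add: norm_mult norm_exp_eq_Re)
      also have "\<dots> \<le> exp (- t\<^sup>2 / 2) * (8 * B * v * ?y ^ 3 * exp (8 * B * v * ?y ^ 3 / 3))"
        by (intro mult_left_mono G y yB) simp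
      also have "8 * B * v * ?y ^ 3 = a * t ^ 3"
        unfolding a_def \<sigma>(2)[symmetric] using \<sigma>(1) by (simp add: power_divide power2_eq_square power3_eq_cube)
      also have "exp (- t\<^sup>2 / 2) * (a * t ^ 3 * exp (a * t ^ 3 / 3)) = a * t ^ 3 * exp (- t\<^sup>2 / 2 + a * t ^ 3 / 3)"
        by (simp only: exp_add mult_ac)
      also have "\<dots> \<le> a * t ^ 3 * exp (- t\<^sup>2 / 4)"
      proof -
        have "(t * a) * t\<^sup>2 \<le> 3 / 4 * t\<^sup>2" using \<open>t * a \<le> 3 / 4\<close> by (intro mult_right_mono) auto
        then have "a * t ^ 3 \<le> 3 / 4 * t\<^sup>2" by (simp add: power2_eq_square power3_eq_cube mult_ac)
        then show ?thesis using a t by (intro mult_left_mono) auto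
      qed
      finally show ?thesis by (simp add: power2_eq_square power3_eq_cube mult_ac)
    qed
    have "ks_dist ?N std_normal_distribution \<le> C * (1 / (3 / (4 * a)) + (LINT t|lborel. a * (t\<^sup>2 * exp (- t\<^sup>2 / 4))))"
    proof (rule smooth[OF rd real_dist_normal_dist])
      show "integrable lborel (\<lambda>t::real. a * (t\<^sup>2 * exp (- t\<^sup>2 / 4)))" by (intro integrable_mult_right integrable_square_gauss)
    qed (use a std_normal_cdf_lipschitz fin in auto)
    also have "(LINT t|lborel. a * (t\<^sup>2 * exp (- t\<^sup>2 / 4))) = a * I" unfolding I_def by (rule integral_mult_right_zero)
    finally have "ks_dist ?N std_normal_distribution \<le> C * (1 / (3 / (4 * a)) + a * I)" .
    also have "C * (1 / (3 / (4 * a)) + a * I) = 8 * C * (4/3 + I) * B / sqrt (P.variance Y)"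
      by (simp add: a_def \<sigma>_def v_def algebra_simps add_divide_distrib)
    finally show "ks_dist ?N std_normal_distribution \<le> 8 * C * (4/3 + I) * B / sqrt (P.variance Y)" .
  qed
qed

text \<open>For negative \<alpha> the hypothesis is tested on \<open>f\<close> cut off to
  \<open>S\<close>; the cut-off leaves Q unchanged and does not increase the norm.\<close>

lemma (in trace_kernel) q_add_Q_nonneg:
  assumes \<alpha>: "\<alpha> < 0 \<Longrightarrow> l2_psd \<mu> (\<lambda>f x. f x + complex_of_real \<alpha> * integral_op \<mu> K f x)" and f: "f \<in> L2 \<mu>"
  shows "0 \<le> l2.q \<mu> f + \<alpha> * Q.q f"
proof (cases "\<alpha> < 0")
  case False
  then show ?thesis using Q.q_nonneg[OF f] l2.q_nonneg[OF f] by simp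
next
  case True
  define h where "h = (\<lambda>x. indicator S x * f x)"
  have h: "h \<in> L2 \<mu>" unfolding h_def by (rule ind_L2[OF f S_sets(1)])
  have "0 \<le> Re (l2_inner \<mu> h (\<lambda>x. h x + complex_of_real \<alpha> * T h x))"
    using \<alpha>[OF True] h by (simp add: l2_psd_def complex_nonneg_Reals_iff)
  also have "l2_inner \<mu> h (\<lambda>x. h x + complex_of_real \<alpha> * T h x) = l2_inner \<mu> h h + \<alpha> * l2_inner \<mu> h (T h)"
    using l2.lin_right[OF h h T_L2[OF h], of 1 \<alpha>] by simp
  also have "l2_inner \<mu> h (T h) = Q f f" unfolding Q_eq h_def ..
  finally have "0 \<le> l2.q \<mu> h + \<alpha> * Q.q f" by (simp add: l2.q_def Q.q_def)
  moreover have "l2.q \<mu> h \<le> l2.q \<mu> f" unfolding h_def by (rule q_ind_le[OF f S_sets(1)])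
  ultimately show ?thesis by simp
qed

text \<open>The one-point correlation function is K(x, x); its almost everywhere non-negativity is
  carried from the product over a one-element index set to \<mu>.\<close>

lemma correlation_diagonal:
  assumes sets: "sets \<mu> = sets borel" and sf: "sigma_finite_measure \<mu>"
    and K: "case_prod K \<in> borel_measurable (borel \<Otimes>\<^sub>M borel)"
    and corr: "has_correlation_function M X \<mu> 1 (\<lambda>x. alpha_det \<alpha> 1 (\<lambda>i j. K (x i) (x j)))"
  shows "AE x in \<mu>. K x x \<in> \<real>\<^sub>\<ge>\<^sub>0"
proof -
  interpret sigma_finite_measure \<mu> by fact
  interpret PS: product_sigma_finite "\<lambda>_::nat. \<mu>" by standard
  have det: "alpha_det \<alpha> 1 A = A 0 0" for A
  proof -
    have "{\<sigma>. \<sigma> permutes {..<1::nat}} = {id}" by (auto simp: lessThan_Suc permutes_sing)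
    moreover have "num_cycles 1 id = 1" by (simp add: num_cycles_def lessThan_Suc)
    ultimately show ?thesis by (simp add: alpha_det_def)
  qed
  have s1: "{..<1} = {0::nat}" by auto
  have ae: "AE x in Pi\<^sub>M {0::nat} (\<lambda>_. \<mu>). K (x 0) (x 0) \<in> \<real>\<^sub>\<ge>\<^sub>0"
    using corr unfolding has_correlation_function_def det s1 by blast
  have "(\<lambda>x. K x x) \<in> borel_measurable borel"
    using measurable_compose[OF measurable_Pair[OF measurable_ident measurable_ident] K] by simp
  then have Km: "(\<lambda>x. K x x) \<in> borel_measurable \<mu>" using measurable_cong_sets[OF sets refl] by blast
  define N where "N = {x \<in> space \<mu>. K x x \<notin> \<real>\<^sub>\<ge>\<^sub>0}"
  have N: "N \<in> sets \<mu>"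
    unfolding N_def using measurable_sets[OF Km, of "- \<real>\<^sub>\<ge>\<^sub>0"] by (simp add: vimage_def Int_def conj_commute)
  have "emeasure \<mu> N = (\<integral>\<^sup>+x. indicator N x \<partial>\<mu>)" using N by simp
  also have "\<dots> = (\<integral>\<^sup>+x. indicator N (x 0) \<partial>Pi\<^sub>M {0::nat} (\<lambda>_. \<mu>))"
    by (rule PS.product_nn_integral_singleton[symmetric]) (use N in simp)
  also have "\<dots> = (\<integral>\<^sup>+x. 0 \<partial>Pi\<^sub>M {0::nat} (\<lambda>_. \<mu>))"
    by (rule nn_integral_cong_AE) (use ae in \<open>auto elim!: eventually_mono simp: N_def indicator_def\<close>)
  finally have "N \<in> null_sets \<mu>" using N by auto
  then show ?thesis by (rule AE_I') (auto simp: N_def)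
qed

lemma ks_dist_upper:
  assumes "real_distribution M1" "real_distribution M2"
  shows "\<bar>cdf M1 x - cdf M2 x\<bar> \<le> ks_dist M1 M2"
proof -
  interpret M1: real_distribution M1 by fact
  interpret M2: real_distribution M2 by fact
  have "bdd_above (range (\<lambda>x. \<bar>cdf M1 x - cdf M2 x\<bar>))"
  proof (rule bdd_aboveI2)
    show "\<bar>cdf M1 x - cdf M2 x\<bar> \<le> 1" for x
      using M1.cdf_bounded_prob[of x] M2.cdf_bounded_prob[of x] M1.cdf_nonneg[of x] M2.cdf_nonneg[of x] by linarith
  qed
  then show ?thesis unfolding ks_dist_def by (intro cSUP_upper) simp
qed

theorem theorem1p5:
  fixes M :: "'w measure"
    and X :: "'w \<Rightarrow> (real ^ 'd) set"
    and \<alpha> :: real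
    and K :: "real ^ 'd \<Rightarrow> real ^ 'd \<Rightarrow> complex"
    and \<mu> :: "(real ^ 'd) measure"
    and \<phi> :: "real ^ 'd \<Rightarrow> real"
    and C :: real
  assumes "prob_space M"
    and "sets \<mu> = sets borel" and "sigma_finite_measure \<mu>"
    and "case_prod K \<in> borel_measurable (borel \<Otimes>\<^sub>M borel)"
    and "\<And>x y. K x y = cnj (K y x)"
    and "alpha_determinantal_process M X \<alpha> K \<mu>"
    and "bounded_integral_operator \<mu> K"
    and "l2_symmetric \<mu> (integral_op \<mu> K)"
    and "locally_trace_class \<mu> K" and "diagonal_normalized \<mu> K"
    and "l2_psd \<mu> (integral_op \<mu> K)"
    and "\<alpha> \<in> {2 / real m |m. m \<ge> 1} \<union> {- 1 / real m |m. m \<ge> 1}"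
    and "\<alpha> < 0 \<Longrightarrow> l2_psd \<mu> (\<lambda>f x. f x + complex_of_real \<alpha> * integral_op \<mu> K f x)"
    and "C > 0"
    and "\<And>B. compact B \<Longrightarrow>
           (\<integral>\<^sup>+\<omega>. of_nat (card (X \<omega> \<inter> B)) \<partial>M) \<le> ennreal C * emeasure lborel B"
    and "\<phi> \<in> borel_measurable borel" and "bounded (range \<phi>)"
    and "\<exists>S. compact S \<and> (\<forall>x. x \<notin> S \<longrightarrow> \<phi> x = 0)"
    and "filterlim
           (\<lambda>L. sqrt (prob_space.variance M (linear_statistic X (rescale \<phi> L))) / ln L) at_top at_top"
  shows "converges_in_law
           (\<lambda>L. distr M borel (standardized M (linear_statistic X (rescale \<phi> L))))
           std_normal_distribution at_top
       \<and> (\<lambda>L. ks_dist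
                (distr M borel (standardized M (linear_statistic X (rescale \<phi> L))))
                std_normal_distribution)
         \<in> O[at_top](\<lambda>L. ln L / sqrt (prob_space.variance M (linear_statistic X (rescale \<phi> L))))"
proof -
  interpret P: prob_space M by fact
  obtain c where c: "0 < c" and ks: "\<And>(Y :: 'w \<Rightarrow> real) (B :: real). integrable M Y \<Longrightarrow> integrable M (\<lambda>\<omega>. (Y \<omega>)\<^sup>2) \<Longrightarrow> 0 < B \<Longrightarrow>
     0 < P.variance Y \<Longrightarrow>
     (\<And>y::real. \<bar>y\<bar> * B \<le> 1/2 \<Longrightarrow>
        cmod ((LINT \<omega>|M. Y \<omega> * iexp (y * Y \<omega>)) - (P.expectation Y + \<i> * y * P.variance Y) * (LINT \<omega>|M. iexp (y * Y \<omega>)))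
          \<le> 8 * B * y\<^sup>2 * P.variance Y * cmod (LINT \<omega>|M. iexp (y * Y \<omega>))) \<Longrightarrow>
     ks_dist (distr M borel (standardized M Y)) std_normal_distribution \<le> c * B / sqrt (P.variance Y)"
    using ks_dist_standardized[where 'w='w] P.prob_space_axioms by (elim exE conjE) blast
  obtain S0 where S0: "compact S0" "\<And>x. x \<notin> S0 \<Longrightarrow> \<phi> x = 0" using assms(18) by blast
  obtain b0 where b0: "\<And>x. \<bar>\<phi> x\<bar> \<le> b0" using assms(17) by (auto simp: bounded_iff)
  \<comment> \<open>Strictly positive even if \<phi> vanishes, because the parameter
    \<open>B\<close> of \<open>ks\<close> has to be.\<close>
  define b where "b = b0 + 1"
  have "0 \<le> b0" using b0[of 0] by linarith
  then have b: "0 < b" "\<And>x. \<bar>\<phi> x\<bar> \<le> b" by (auto simp: b_def intro: order_trans[OF b0])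
  obtain k where k: "\<And>f. f \<in> L2 \<mu> \<Longrightarrow> l2_norm \<mu> (integral_op \<mu> K f) \<le> k * l2_norm \<mu> f"
    using assms(7) unfolding bounded_integral_operator_def bounded_l2_operator_def by blast
  \<comment> \<open>The constant in the definition of a bounded operator carries no sign.\<close>
  define \<kappa> where "\<kappa> = max 0 k"
  have \<kappa>: "0 \<le> \<kappa>" "\<And>f. f \<in> L2 \<mu> \<Longrightarrow> l2_norm \<mu> (integral_op \<mu> K f) \<le> \<kappa> * l2_norm \<mu> f"
  proof -
    fix f assume "f \<in> L2 \<mu>"
    from k[OF this] show "l2_norm \<mu> (integral_op \<mu> K f) \<le> \<kappa> * l2_norm \<mu> f"
      by (rule order_trans) (simp add: \<kappa>_def mult_right_mono l2_norm_def)
  qed (simp add: \<kappa>_def)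
  have diag: "AE x in \<mu>. K x x \<in> \<real>\<^sub>\<ge>\<^sub>0"
    using assms(6) by (intro correlation_diagonal[OF assms(2,3,4), of M X \<alpha>]) (simp add: alpha_determinantal_process_def)
  \<comment> \<open>None of the factors depends on L: the compact set changes with the scale, but
    \<alpha>, \<open>\<kappa>\<close> and \<open>b\<close> do not.\<close>
  define D where "D = c * ((1 + \<bar>\<alpha>\<bar> * \<kappa>) * b)"
  have D: "0 \<le> D" using c b \<kappa>(1) by (simp add: D_def)
  define \<Lambda> where "\<Lambda> L = linear_statistic X (rescale \<phi> L)" for L
  define N where "N L = distr M borel (standardized M (\<Lambda> L))" for L
  have main: "real_distribution (N L) \<and> (0 < P.variance (\<Lambda> L) \<longrightarrow> ks_dist (N L) std_normal_distribution \<le> D / sqrt (P.variance (\<Lambda> L)))"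
    if L: "0 < L" for L
  proof -
    \<comment> \<open>The rescaled support; the locales are instantiated afresh for every L.\<close>
    define S where "S = (\<lambda>x. L *\<^sub>R x) ` S0"
    have S: "compact S" unfolding S_def by (rule compact_scaling[OF S0(1)])
    define f where "f = rescale \<phi> L"
    have f0: "f x = 0" if "x \<notin> S" for x
    proof -
      have "x /\<^sub>R L \<notin> S0"
      proof
        assume "x /\<^sub>R L \<in> S0"
        then have "L *\<^sub>R (x /\<^sub>R L) \<in> S" unfolding S_def by blast
        then show False using that L by simp
      qed
      then show ?thesis by (simp add: f_def rescale_def S0(2))
    qed
    have fm: "f \<in> borel_measurable borel"
      unfolding f_def rescale_def by (rule measurable_compose[OF _ assms(16)]) simp
    have fb: "\<bar>f x\<bar> \<le> b" for x unfolding f_def rescale_def by (rule b(2))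
    have tk: "trace_kernel \<mu> K S \<kappa>"
      by (intro trace_kernel.intro assms diag S \<kappa>)
    have ak: "alpha_kernel \<mu> K S \<kappa> \<alpha>"
      by (intro alpha_kernel.intro alpha_kernel_axioms.intro tk trace_kernel.q_add_Q_nonneg[OF tk] assms(13))
    interpret A: alpha_process \<mu> K S \<kappa> \<alpha> M X
      by (intro alpha_process.intro alpha_process_axioms.intro ak assms)
    define Y where "Y = A.Lam f"
    have Ym: "Y \<in> borel_measurable M" unfolding Y_def by (rule A.Lam_meas[OF fm fb f0 less_imp_le[OF b(1)]])
    \<comment> \<open>\<open>linear_statistic\<close> is an infinite sum over the configuration; its
      terms vanish outside \<open>S\<close>, and only finitely many points lie inside.\<close>
    have eq: "\<Lambda> L \<omega> = Y \<omega>" if "\<omega> \<in> space M" for \<omega>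
    proof -
      have "\<Lambda> L \<omega> = (\<Sum>\<^sub>\<infinity>x\<in>X \<omega> \<inter> S. f x)"
        unfolding \<Lambda>_def linear_statistic_def f_def[symmetric] by (rule infsum_cong_neutral) (auto simp: f0)
      also have "\<dots> = Y \<omega>"
        using A.Lam_def[OF fm fb f0 less_imp_le[OF b(1)], of \<omega>] infsum_finite[OF A.fin[OF that], of f] by (simp add: Y_def)
      finally show ?thesis .
    qed
    have ex: "P.expectation (\<Lambda> L) = P.expectation Y" by (rule Bochner_Integration.integral_cong[OF refl eq])
    have var: "P.variance (\<Lambda> L) = P.variance Y"
      unfolding ex by (rule Bochner_Integration.integral_cong) (simp_all add: eq)
    have Neq: "N L = distr M borel (standardized M Y)"
      unfolding N_def by (rule distr_cong) (auto simp: standardized_def ex var[unfolded ex] eq)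
    have sm: "standardized M Y \<in> borel_measurable M"
      unfolding standardized_def using Ym by measurable
    have "ks_dist (N L) std_normal_distribution \<le> D / sqrt (P.variance (\<Lambda> L))" if v: "0 < P.variance (\<Lambda> L)"
    proof -
      have C0b: "0 < A.C0 * b" using A.C0(1) b(1) by simp
      have "ks_dist (N L) std_normal_distribution \<le> c * (A.C0 * b) / sqrt (P.variance Y)"
        unfolding Neq
      proof (rule ks[OF _ _ C0b])
        note ctx = fm fb f0 less_imp_le[OF b(1)]
        show "integrable M Y" unfolding Y_def by (rule A.mean_tendsto(1)[OF ctx])
        show "integrable M (\<lambda>\<omega>. (Y \<omega>)\<^sup>2)" unfolding Y_def by (rule A.variance_tendsto(1)[OF ctx])
        show "0 < P.variance Y" using v unfolding var .
        fix y :: real assume y: "\<bar>y\<bar> * (A.C0 * b) \<le> 1/2"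
        have e: "8 * (A.C0 * b) = 8 * A.C0 * b" by simp
        show "cmod ((LINT \<omega>|M. Y \<omega> * iexp (y * Y \<omega>)) - (P.expectation Y + \<i> * y * P.variance Y) * (LINT \<omega>|M. iexp (y * Y \<omega>)))
          \<le> 8 * (A.C0 * b) * y\<^sup>2 * P.variance Y * cmod (LINT \<omega>|M. iexp (y * Y \<omega>))"
          unfolding Y_def e by (rule A.char_fun_bound[OF ctx y])
      qed
      then show ?thesis unfolding var by (simp add: D_def A.C0_def)
    qed
    moreover have "real_distribution (N L)" unfolding Neq by (rule P.real_distribution_distr[OF sm])
    ultimately show ?thesis by blast
  qed
  define \<sigma> where "\<sigma> L = sqrt (P.variance (\<Lambda> L))" for L
  have lim: "filterlim (\<lambda>L. \<sigma> L / ln L) at_top at_top" using assms(19) unfolding \<sigma>_def \<Lambda>_def .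
  \<comment> \<open>For L > e one has ln L \<ge> 1, so the rate D / \<sigma> is bounded by the rate
    with the logarithm. The divergence hypothesis also forces \<sigma> > 0 eventually, which rules
    out division by zero in the standardisation.\<close>
  have ev: "\<forall>\<^sub>F L in at_top. real_distribution (N L) \<and> ks_dist (N L) std_normal_distribution \<le> D * (ln L / \<sigma> L) \<and> 0 < ln L / \<sigma> L"
    using eventually_gt_at_top[of "exp 1"] filterlim_at_top[THEN iffD1, OF lim, rule_format, of 1]
  proof eventually_elim
    case (elim L)
    have L: "0 < L" using elim(1) by (rule less_trans[rotated]) simp
    have "ln (exp 1) \<le> ln L" using elim(1) L by (subst ln_le_cancel_iff) auto
    then have ln: "1 \<le> ln L" by simp
    have s: "0 < \<sigma> L"
    proof (rule ccontr)
      assume "\<not> 0 < \<sigma> L"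
      then have "\<sigma> L / ln L \<le> 0" using ln by (simp add: divide_nonpos_pos)
      then show False using elim(2) by linarith
    qed
    then have "0 < P.variance (\<Lambda> L)" unfolding \<sigma>_def by simp
    then have "ks_dist (N L) std_normal_distribution \<le> D / \<sigma> L" using main[OF L] unfolding \<sigma>_def by blast
    also have "\<dots> \<le> D * (ln L / \<sigma> L)"
      using mult_left_mono[OF ln D] s by (simp add: divide_right_mono)
    finally show ?case using main[OF L] ln s by simp
  qed
  have le: "\<bar>cdf (N L) x - cdf std_normal_distribution x\<bar> \<le> ks_dist (N L) std_normal_distribution" if "real_distribution (N L)" for L x
    by (rule ks_dist_upper[OF that real_dist_normal_dist])
  have "converges_in_law N std_normal_distribution at_top"
    unfolding converges_in_law_def
  proof (intro allI impI)
    fix x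
    have "((\<lambda>L. inverse (\<sigma> L / ln L)) \<longlongrightarrow> 0) at_top" by (rule tendsto_inverse_0_at_top[OF lim])
    then have "((\<lambda>L. D * (ln L / \<sigma> L)) \<longlongrightarrow> 0) at_top" using tendsto_mult_right_zero[of "\<lambda>L. inverse (\<sigma> L / ln L)" at_top D] by simp
    then have "((\<lambda>L. cdf (N L) x - cdf std_normal_distribution x) \<longlongrightarrow> 0) at_top"
    proof (rule Lim_null_comparison[rotated])
      show "\<forall>\<^sub>F L in at_top. norm (cdf (N L) x - cdf std_normal_distribution x) \<le> D * (ln L / \<sigma> L)"
        using ev by eventually_elim (use le[of _ x] in fastforce)
    qed
    then show "((\<lambda>L. cdf (N L) x) \<longlongrightarrow> cdf std_normal_distribution x) at_top" by (rule LIM_zero_cancel)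
  qed
  moreover have "(\<lambda>L. ks_dist (N L) std_normal_distribution) \<in> O[at_top](\<lambda>L. ln L / \<sigma> L)"
  proof (rule bigoI)
    show "\<forall>\<^sub>F L in at_top. norm (ks_dist (N L) std_normal_distribution) \<le> D * norm (ln L / \<sigma> L)"
      using ev
    proof eventually_elim
      case (elim L)
      then have "0 \<le> ks_dist (N L) std_normal_distribution" using le[of L 0] by linarith
      then show ?case using elim by (simp only: real_norm_def abs_of_nonneg abs_of_pos)
    qed
  qed
  ultimately show ?thesis unfolding N_def[abs_def] \<sigma>_def \<Lambda>_def by blast
qed

end
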